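(* For every $0\le n\le N-1$ and given data at time level $t^n$, there exists a unique solution $(\boldsymbol{u}_h^{n+1},\boldsymbol{p}_h^{n+1},z_h^{n+1},\boldsymbol{p}_h^{p,n+1})\in\boldsymbol{X}_h$ to the fully-discrete HDG method (F) described in the context.
   Context: **Domain and parameters.** $\Omega\subset\mathbb{R}^d$ ($d=2,3$) is a polygonal/polyhedral domain partitioned into two non-overlapping polygonal/polyhedral subdomains $\Omega^s$ and $\Omega^b$ with polygonal interface $\Gamma_I=\partial\Omega^s\cap\partial\Omega^b$. $n^j$ is the unit outward normal to $\Omega^j$ (also used for the outward normal on element boundaries of $\mathcal{T}^j$), and $n=n^s=-n^b$ on $\Gamma_I$. $\Gamma^b=\partial\Omega\cap\partial\Omega^b$ is partitioned both as $\Gamma_P^b\cup\Gamma_F^b$ (disjoint, $|\Gamma_P^b|>0$) and as $\Gamma_D^b\cup\Gamma_N^b$ (disjoint, both of positive measure); $\Gamma^s=\partial\Omega\cap\partial\Omega^s=\Gamma_D^s\cup\Gamma_N^s$ (disjoint, both of positive measure). Constants: $\mu^s,\mu^b,\lambda,\kappa,\gamma>0$, $0<\alpha<1$, $c_0\ge0$. Data: $f^j:\Omega^j\to\mathbb{R}^d$ ($j=s,b$; $f|_{\Omega^j}=f^j$), $g^b:\Omega^b\to\mathbb{R}$, depending on time. $(w)^t:=w-(w\cdot n)n$ and $\varepsilon(u)=\tfrac12(\nabla u+(\nabla u)^T)$. **Mesh.** $\mathcal{T}^j$ is a shape-regular simplicial triangulation of $\Omega^j$ ($j=s,b$), matching at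 $\Gamma_I$ and compatible with the boundary partitions; $\mathcal{T}=\mathcal{T}^s\cup\mathcal{T}^b$; $h_K$ is the diameter of $K$. $\mathcal{F}^j$ is the set of facets in $\overline{\Omega^j}$; $\Gamma_0^j=\cup_{F\in\mathcal{F}^j}F$. **Spaces** (polynomial degree $k\ge1$). $V_h^j$, $V_h$: functions in $[L^2]^d$ on $\Omega^j$, $\Omega$ that are in $[P_k(K)]^d$ on each element; $Q_h^j$, $Q_h$: functions in $L^2$ on $\Omega^j$, $\Omega$ that are in $P_{k-1}(K)$ on each element. $\bar V_h^j$: functions in $[L^2(\Gamma_0^j)]^d$ that are in $[P_k(F)]^d$ on each $F\in\mathcal{F}^j$ and vanish on $\Gamma_D^j$. $\bar Q_h^j$: functions in $L^2(\Gamma_0^j)$ that are in $P_k(F)$ on each $F\in\mathcal{F}^j$. $\bar Q_h^{b0}=\{\bar q\in\bar Q_h^b:\bar q=0\text{ on }\Gamma_P^b\}$. Put $\boldsymbol{v}_h=(v_h,\bar v_h^s,\bar v_h^b)\in\boldsymbol{V}_h=V_h\times\bar V_h^s\times\bar V_h^b$, $\boldsymbol{q}_h=(q_h,\bar q_h^s,\bar q_h^b)\in\boldsymbol{Q}_h=Q_h\times\bar Q_h^s\times\bar Q_h^b$, $\boldsymbol{q}_h^p=(q_h^p,\bar q_h^p)\in\boldsymbol{Q}_h^{b0}=Q_h^b\times\bar Q_h^{b0}$, $\boldsymbol{X}_h=\boldsymbol{V}_h\times\boldsymbol{Q}_h\times V_h^b\times\boldsymbol{Q}_h^{b0}$, and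 for $j=s,b$: $v_h^j=v_h|_{\Omega^j}$, $q_h^j=q_h|_{\Omega^j}$, $\boldsymbol{v}_h^j=(v_h^j,\bar v_h^j)\in\boldsymbol{V}_h^j=V_h^j\times\bar V_h^j$, $\boldsymbol{q}_h^j=(q_h^j,\bar q_h^j)$. **Forms** ($(\cdot,\cdot)_{\Omega^j}$ is the elementwise $L^2$ inner product, $\langle\cdot,\cdot\rangle_{\partial\mathcal{T}^j}=\sum_{K\in\mathcal{T}^j}\langle\cdot,\cdot\rangle_{\partial K}$, $\beta^j>0$ is a penalty parameter): $a_h^j(\boldsymbol{u}^j,\boldsymbol{v}^j)=(2\mu^j\varepsilon(u),\varepsilon(v))_{\Omega^j}+\sum_{K\in\mathcal{T}^j}\langle2\beta^j\mu^jh_K^{-1}(u-\bar u^j),v-\bar v^j\rangle_{\partial K}-\langle2\mu^j\varepsilon(u)n^j,v-\bar v^j\rangle_{\partial\mathcal{T}^j}-\langle2\mu^j\varepsilon(v)n^j,u-\bar u^j\rangle_{\partial\mathcal{T}^j}$; $a_h=a_h^s+a_h^b$; $b_h^j(\boldsymbol{q}^j,\boldsymbol{v}^j)=-(q,\nabla\cdot v)_{\Omega^j}+\langle\bar q^j,(v-\bar v^j)\cdot n^j\rangle_{\partial\mathcal{T}^j}$; $b_h=b_h^s+b_h^b$; $c_h((p,r),q)=(\lambda^{-1}(\alpha p-r),q)_{\Omega^b}$; $a_h^I((\bar u^s,\bar u^b),(\bar v^s,\bar v^b))=\langle\gamma(\mu^s/\kappa)^{1/2}(\bar u^s-\bar u^b)^t,(\bar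 v^s-\bar v^b)^t\rangle_{\Gamma_I}$; $b_h^I(\bar q^p,(\bar v^s,\bar v^b))=\langle\bar q^p,(\bar v^s-\bar v^b)\cdot n\rangle_{\Gamma_I}$. Standing assumption: the penalty parameters $\beta^j$ are large enough that, for some $C>0$ independent of the mesh size, $a_h^j(\boldsymbol{v}_h^j,\boldsymbol{v}_h^j)\ge C\mu^j\sum_{K\in\mathcal{T}^j}(\|\varepsilon(v_h^j)\|_K^2+h_K^{-1}\|v_h^j-\bar v_h^j\|_{\partial K}^2)$ for all $\boldsymbol{v}_h^j\in\boldsymbol{V}_h^j$, $j=s,b$. **Fully-discrete method (F).** With $t^n=n\Delta t$, $n=0,\dots,N$, $t^N=T$, $\Delta t>0$, $d_tg^{n+1}=(g^{n+1}-g^n)/\Delta t$, and a superscript $n$ denoting evaluation at $t^n$: given the level-$n$ quantities, find $(\boldsymbol{u}_h^{n+1},\boldsymbol{p}_h^{n+1},z_h^{n+1},\boldsymbol{p}_h^{p,n+1})\in\boldsymbol{X}_h$ such that for all $(\boldsymbol{v}_h,\boldsymbol{q}_h,w_h,\boldsymbol{q}_h^p)\in\boldsymbol{X}_h$ $a_h(\boldsymbol{u}_h^{n+1},\boldsymbol{v}_h)+a_h^I((\bar u_h^{s,n+1},d_t\bar u_h^{b,n+1}),(\bar v_h^s,\bar v_h^b))+b_h(\boldsymbol{p}_h^{n+1},\boldsymbol{v}_h)+b_h^I(\bar p_h^{p,n+1},(\bar v_h^s,\bar v_h^b))=(f^{n+1},v_h)_\Omega$, $b_h(\boldsymbol{q}_h,\boldsymbol{u}_h^{n+1})+c_h((p_h^{p,n+1},p_h^{b,n+1}),q_h^b)=0$,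 $(c_0d_tp_h^{p,n+1},q_h^p)_{\Omega^b}+c_h((d_tp_h^{p,n+1},d_tp_h^{b,n+1}),\alpha q_h^p)-b_h^b(\boldsymbol{q}_h^p,(z_h^{n+1},0))-b_h^I(\bar q_h^p,(\bar u_h^{s,n+1},d_t\bar u_h^{b,n+1}))=(g^{b,n+1},q_h^p)_{\Omega^b}$, $(\kappa^{-1}z_h^{n+1},w_h)_{\Omega^b}+b_h^b(\boldsymbol{p}_h^{p,n+1},(w_h,0))=0$. *)

theory Defs
  imports "HOL-Analysis.Analysis"
begin

text \<open>A polygonal (polyhedral) domain. The condition \<open>interior (closure \<Omega>) = \<Omega>\<close> excludes
  slits, so that a domain never lies on both sides of a piece of its boundary.\<close>

definition polytopal_domain :: "'a::euclidean_space set \<Rightarrow> bool" where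
  "polytopal_domain \<Omega> \<longleftrightarrow>
     open \<Omega> \<and> connected \<Omega> \<and> \<Omega> \<noteq> {} \<and> interior (closure \<Omega>) = \<Omega> \<and>
     (\<exists>\<P>. finite \<P> \<and> (\<forall>P\<in>\<P>. polytope P) \<and> closure \<Omega> = \<Union>\<P>)"

definition simplicial_mesh :: "'a::euclidean_space set \<Rightarrow> 'a set set \<Rightarrow> bool" where
  "simplicial_mesh \<Omega> \<T> \<longleftrightarrow>
     triangulation \<T> \<and> (\<forall>K\<in>\<T>. int DIM('a) simplex K) \<and> \<Union>\<T> = closure \<Omega>"

definition inradius :: "'a::euclidean_space set \<Rightarrow> real" where
  "inradius K = Sup {r. 0 \<le> r \<and> (\<exists>x. cball x r \<subseteq> K)}"

definition shape_regular :: "real \<Rightarrow> 'a::euclidean_space set set \<Rightarrow> bool" where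
  "shape_regular \<sigma> \<T> \<longleftrightarrow> (\<forall>K\<in>\<T>. diameter K \<le> \<sigma> * inradius K)"

definition facets :: "'a::euclidean_space set set \<Rightarrow> 'a set set" where
  "facets \<T> = {F. \<exists>K\<in>\<T>. F facet_of K}"

definition facets_in :: "'a::euclidean_space set set \<Rightarrow> 'a set \<Rightarrow> 'a set set" where
  "facets_in \<T> \<Gamma> = {F \<in> facets \<T>. F \<subseteq> \<Gamma>}"

text \<open>The \<open>(d-1)\<close>-dimensional Lebesgue (surface) measure on a hyperplane \<open>H\<close>: the measure of
  \<open>A \<subseteq> H\<close> is the volume of the right cylinder over \<open>A\<close> of height 1, that is, of the part of the
  slab of thickness 1 around \<open>H\<close> whose orthogonal projection onto \<open>H\<close> lies in \<open>A\<close>.\<close>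

definition hyperplane_measure :: "'a::euclidean_space set \<Rightarrow> 'a measure" where
  "hyperplane_measure H =
     distr (restrict_space lborel {x. infdist x H \<le> 1/2}) borel (closest_point H)"

definition facet_integral :: "'a::euclidean_space set \<Rightarrow> ('a \<Rightarrow> real) \<Rightarrow> real" where
  "facet_integral F g = (LINT x:F|hyperplane_measure (affine hull F). g x)"

text \<open>Summing over facets is legitimate because distinct facets of a mesh overlap
  in null sets only.\<close>

definition surface_area :: "'a::euclidean_space set set \<Rightarrow> 'a set \<Rightarrow> ennreal" where
  "surface_area \<T> A = (\<Sum>F\<in>facets \<T>. emeasure (hyperplane_measure (affine hull F)) (A \<inter> F))"

text \<open>A disjoint splitting of the boundary part \<open>\<Gamma>\<close> with which the mesh is compatible. The
  relative interior is used because the two disjoint parts cannot both contain the points in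
  which their closures meet.\<close>

definition boundary_partition ::
  "'a::euclidean_space set set \<Rightarrow> 'a set \<Rightarrow> 'a set \<Rightarrow> 'a set \<Rightarrow> bool" where
  "boundary_partition \<T> \<Gamma> A B \<longleftrightarrow>
     A \<union> B = \<Gamma> \<and> A \<inter> B = {} \<and>
     (\<forall>F\<in>facets_in \<T> \<Gamma>. rel_interior F \<subseteq> A \<or> rel_interior F \<subseteq> B)"

definition outward_normal :: "'a::euclidean_space set \<Rightarrow> 'a set \<Rightarrow> 'a" where
  "outward_normal K F =
     (THE n. norm n = 1 \<and> (\<exists>b. (\<forall>x\<in>F. n \<bullet> x = b) \<and> (\<forall>x\<in>K. n \<bullet> x \<le> b)))"

text \<open>The normal, outward to the meshed domain, on a facet that belongs to one element only.\<close>

definition mesh_normal :: "'a::euclidean_space set set \<Rightarrow> 'a set \<Rightarrow> 'a" where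
  "mesh_normal \<T> F = outward_normal (THE K. K \<in> \<T> \<and> F facet_of K) F"

text \<open>Integral over \<open>\<partial>K\<close> of an integrand depending on the outward normal and the point.\<close>

definition boundary_integral :: "'a::euclidean_space set \<Rightarrow> ('a \<Rightarrow> 'a \<Rightarrow> real) \<Rightarrow> real" where
  "boundary_integral K g = (\<Sum>F | F facet_of K. facet_integral F (g (outward_normal K F)))"

definition polys :: "nat \<Rightarrow> (real^'d \<Rightarrow> real) set" where
  "polys k = {p. \<exists>c::('d \<Rightarrow> nat) \<Rightarrow> real.
     p = (\<lambda>x. \<Sum>e | (\<Sum>i\<in>UNIV. e i) \<le> k. c e * (\<Prod>i\<in>UNIV. (x $ i) ^ e i))}"

definition vec_polys :: "nat \<Rightarrow> (real^'d \<Rightarrow> real^'d) set" where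
  "vec_polys k = {p. \<forall>i. (\<lambda>x. p x $ i) \<in> polys k}"

text \<open>Functions that are piecewise in \<open>P\<close> on the cells (elements or facets) \<open>\<C>\<close>. Elements of
  the \<open>L\<^sup>2\<close> spaces are classes modulo null sets; each such class has exactly one representative
  that is a function from \<open>P\<close> on the relative interior of every cell and vanishes at all other
  points, and this representative is used. Hence equality of functions is equality in \<open>L\<^sup>2\<close>, and
  vanishing pointwise on a part of the boundary resolved by the mesh is vanishing almost
  everywhere there.\<close>

definition piecewise ::
  "('a::euclidean_space \<Rightarrow> 'b::zero) set \<Rightarrow> 'a set set \<Rightarrow> ('a \<Rightarrow> 'b) set" where
  "piecewise P \<C> = {v. (\<forall>C\<in>\<C>. \<exists>p\<in>P. \<forall>x\<in>rel_interior C. v x = p x) \<and>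
                        (\<forall>x. x \<notin> \<Union>(rel_interior ` \<C>) \<longrightarrow> v x = 0)}"

definition V_space :: "nat \<Rightarrow> (real^'d) set set \<Rightarrow> (real^'d \<Rightarrow> real^'d) set" where
  "V_space k \<T> = piecewise (vec_polys k) \<T>"

definition Q_space :: "nat \<Rightarrow> (real^'d) set set \<Rightarrow> (real^'d \<Rightarrow> real) set" where
  "Q_space k \<T> = piecewise (polys (k - 1)) \<T>"

text \<open>The last argument is the part of the boundary on which the functions vanish.\<close>

definition Vbar_space ::
  "nat \<Rightarrow> (real^'d) set set \<Rightarrow> (real^'d) set \<Rightarrow> (real^'d \<Rightarrow> real^'d) set" where
  "Vbar_space k \<T> \<Gamma> = {v \<in> piecewise (vec_polys k) (facets \<T>). \<forall>x\<in>\<Gamma>. v x = 0}"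

definition Qbar_space ::
  "nat \<Rightarrow> (real^'d) set set \<Rightarrow> (real^'d) set \<Rightarrow> (real^'d \<Rightarrow> real) set" where
  "Qbar_space k \<T> \<Gamma> = {q \<in> piecewise (polys k) (facets \<T>). \<forall>x\<in>\<Gamma>. q x = 0}"

definition X_space ::
  "nat \<Rightarrow> (real^'d) set set \<Rightarrow> (real^'d) set set \<Rightarrow> (real^'d) set \<Rightarrow> (real^'d) set \<Rightarrow> (real^'d) set \<Rightarrow>
   (((real^'d \<Rightarrow> real^'d) \<times> (real^'d \<Rightarrow> real^'d) \<times> (real^'d \<Rightarrow> real^'d)) \<times>
    ((real^'d \<Rightarrow> real) \<times> (real^'d \<Rightarrow> real) \<times> (real^'d \<Rightarrow> real)) \<times>
    (real^'d \<Rightarrow> real^'d) \<times>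
    ((real^'d \<Rightarrow> real) \<times> (real^'d \<Rightarrow> real))) set" where
  "X_space k \<T>s \<T>b \<Gamma>Ds \<Gamma>Db \<Gamma>P =
     (V_space k (\<T>s \<union> \<T>b) \<times> Vbar_space k \<T>s \<Gamma>Ds \<times> Vbar_space k \<T>b \<Gamma>Db) \<times>
     (Q_space k (\<T>s \<union> \<T>b) \<times> Qbar_space k \<T>s {} \<times> Qbar_space k \<T>b {}) \<times>
     V_space k \<T>b \<times>
     (Q_space k \<T>b \<times> Qbar_space k \<T>b \<Gamma>P)"

definition square_integrable_on ::
  "('a::euclidean_space \<Rightarrow> 'b::euclidean_space) \<Rightarrow> 'a set \<Rightarrow> bool" (infix "square'_integrable'_on" 46)
  where
  "f square_integrable_on S \<longleftrightarrow>
     f \<in> borel_measurable (lebesgue_on S) \<and> integrable (lebesgue_on S) (\<lambda>x. (norm (f x))\<^sup>2)"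

definition L2_inner ::
  "'a::euclidean_space set \<Rightarrow> ('a \<Rightarrow> 'b::real_inner) \<Rightarrow> ('a \<Rightarrow> 'b) \<Rightarrow> real" where
  "L2_inner S f g = (LINT x|lebesgue_on S. f x \<bullet> g x)"

text \<open>The integral over \<open>K\<close> is taken over its interior, where
  piecewise polynomials are smooth.\<close>

definition mesh_inner ::
  "'a::euclidean_space set set \<Rightarrow> ('a \<Rightarrow> 'b::real_inner) \<Rightarrow> ('a \<Rightarrow> 'b) \<Rightarrow> real" where
  "mesh_inner \<T> f g = (\<Sum>K\<in>\<T>. L2_inner (interior K) f g)"

definition sym_grad :: "(real^'d \<Rightarrow> real^'d) \<Rightarrow> real^'d \<Rightarrow> real^'d^'d" where
  "sym_grad u x = (1/2) *\<^sub>R (jacobian u (at x) + transpose (jacobian u (at x)))"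

definition divergence :: "(real^'d \<Rightarrow> real^'d) \<Rightarrow> real^'d \<Rightarrow> real" where
  "divergence u x = trace (jacobian u (at x))"

definition inner_trace :: "'a::euclidean_space set \<Rightarrow> ('a \<Rightarrow> 'b::t2_space) \<Rightarrow> 'a \<Rightarrow> 'b" where
  "inner_trace K v x = Lim (at x within interior K) v"

text \<open>The forms of a subdomain depend on functions defined on the whole domain only through their
  values on the elements of the mesh of that subdomain, so no restriction operator is needed.\<close>

definition a_form ::
  "real \<Rightarrow> real \<Rightarrow> (real^'d) set set \<Rightarrow> (real^'d \<Rightarrow> real^'d) \<times> (real^'d \<Rightarrow> real^'d) \<Rightarrow>
   (real^'d \<Rightarrow> real^'d) \<times> (real^'d \<Rightarrow> real^'d) \<Rightarrow> real" where
  "a_form \<mu> \<beta> \<T> = (\<lambda>(u, u') (v, v').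
     mesh_inner \<T> (\<lambda>x. (2 * \<mu>) *\<^sub>R sym_grad u x) (sym_grad v)
     + (\<Sum>K\<in>\<T>. boundary_integral K (\<lambda>n x.
          ((2 * \<beta> * \<mu> / diameter K) *\<^sub>R (inner_trace K u x - u' x)) \<bullet> (inner_trace K v x - v' x)))
     - (\<Sum>K\<in>\<T>. boundary_integral K (\<lambda>n x.
          ((2 * \<mu>) *\<^sub>R (inner_trace K (sym_grad u) x *v n)) \<bullet> (inner_trace K v x - v' x)))
     - (\<Sum>K\<in>\<T>. boundary_integral K (\<lambda>n x.
          ((2 * \<mu>) *\<^sub>R (inner_trace K (sym_grad v) x *v n)) \<bullet> (inner_trace K u x - u' x))))"

definition b_form ::
  "(real^'d) set set \<Rightarrow> (real^'d \<Rightarrow> real) \<times> (real^'d \<Rightarrow> real) \<Rightarrow>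
   (real^'d \<Rightarrow> real^'d) \<times> (real^'d \<Rightarrow> real^'d) \<Rightarrow> real" where
  "b_form \<T> = (\<lambda>(q, q') (v, v').
     - mesh_inner \<T> q (divergence v)
     + (\<Sum>K\<in>\<T>. boundary_integral K (\<lambda>n x. q' x * ((inner_trace K v x - v' x) \<bullet> n))))"

definition c_form ::
  "real \<Rightarrow> real \<Rightarrow> (real^'d) set set \<Rightarrow> (real^'d \<Rightarrow> real) \<times> (real^'d \<Rightarrow> real) \<Rightarrow>
   (real^'d \<Rightarrow> real) \<Rightarrow> real" where
  "c_form lam \<alpha> \<T> = (\<lambda>(p, r) q. mesh_inner \<T> (\<lambda>x. inverse lam * (\<alpha> * p x - r x)) q)"

definition tangential :: "'a::real_inner \<Rightarrow> 'a \<Rightarrow> 'a" where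
  "tangential n w = w - (w \<bullet> n) *\<^sub>R n"

text \<open>In the interface forms \<open>\<T>\<close> is the mesh whose outward normal is used on the interface \<open>\<Gamma>\<close>.\<close>

definition aI_form ::
  "real \<Rightarrow> real \<Rightarrow> real \<Rightarrow> (real^'d) set set \<Rightarrow> (real^'d) set \<Rightarrow>
   (real^'d \<Rightarrow> real^'d) \<times> (real^'d \<Rightarrow> real^'d) \<Rightarrow>
   (real^'d \<Rightarrow> real^'d) \<times> (real^'d \<Rightarrow> real^'d) \<Rightarrow> real" where
  "aI_form \<gamma> \<mu> \<kappa> \<T> \<Gamma> = (\<lambda>(us, ub) (vs, vb).
     \<Sum>F\<in>facets_in \<T> \<Gamma>. facet_integral F (\<lambda>x.
       ((\<gamma> * sqrt (\<mu> / \<kappa>)) *\<^sub>R tangential (mesh_normal \<T> F) (us x - ub x))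
         \<bullet> tangential (mesh_normal \<T> F) (vs x - vb x)))"

definition bI_form ::
  "(real^'d) set set \<Rightarrow> (real^'d) set \<Rightarrow> (real^'d \<Rightarrow> real) \<Rightarrow>
   (real^'d \<Rightarrow> real^'d) \<times> (real^'d \<Rightarrow> real^'d) \<Rightarrow> real" where
  "bI_form \<T> \<Gamma> = (\<lambda>q (vs, vb).
     \<Sum>F\<in>facets_in \<T> \<Gamma>. facet_integral F (\<lambda>x. q x * ((vs x - vb x) \<bullet> mesh_normal \<T> F)))"

definition a_coercive ::
  "real \<Rightarrow> nat \<Rightarrow> real \<Rightarrow> real \<Rightarrow> (real^'d) set set \<Rightarrow> (real^'d) set \<Rightarrow> bool" where
  "a_coercive C k \<mu> \<beta> \<T> \<Gamma>D \<longleftrightarrow> (\<forall>v\<in>V_space k \<T>. \<forall>v'\<in>Vbar_space k \<T> \<Gamma>D.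
     a_form \<mu> \<beta> \<T> (v, v') (v, v') \<ge>
       C * \<mu> * (\<Sum>K\<in>\<T>. L2_inner (interior K) (sym_grad v) (sym_grad v)
         + inverse (diameter K) *
           boundary_integral K (\<lambda>n x. (norm (inner_trace K v x - v' x))\<^sup>2)))"

definition diff_quotient ::
  "real \<Rightarrow> ('a \<Rightarrow> 'b::real_vector) \<Rightarrow> ('a \<Rightarrow> 'b) \<Rightarrow> 'a \<Rightarrow> 'b" where
  "diff_quotient \<tau> g1 g0 x = (g1 x - g0 x) /\<^sub>R \<tau>"

end

theory Submission
  imports Defs "HOL-Library.Function_Algebras"
begin

text \<open>The step is a square linear system on a finite-dimensional space, so it suffices that the
  homogeneous system has only the zero solution. Testing with the solution itself, scaled by
  \<open>1 / \<tau>\<close> on the poroelastic side, gives an energy identity with nonnegative terms: the strain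
  vanishes on every element, the traces of the displacement agree with the facet unknowns, the
  velocity vanishes and the total pressure is \<open>\<alpha>\<close> times the pore pressure.

  A strain-free field that vanishes on a Dirichlet facet vanishes on its element; the facet unknowns
  carry this to neighbouring elements, and the elements of a mesh of a connected domain are connected
  through facets, because a generic segment avoids all faces of codimension two. The remaining
  equations say that each pressure pairs to zero with all fields of degree \<open>k\<close> on each element.
  Testing with fields along edges of the simplex, this makes the pressure and its trace equal to the
  same constant on the element, hence on the subdomain. The constant is zero by the boundary
  condition on \<open>\<Gamma>\<^sub>P\<close>, by the relation to the pore pressure, or by testing with the normal field of a
  single Neumann facet.\<close>

section \<open>Finite-dimensional linear algebra on function spaces\<close>

text \<open>The difference quotients in the interface terms divide the trial trace on the
  poroelastic side by the time step. Only when the tests there are divided by it as well do the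
  pressure terms of the four equations cancel and the interface friction become a square. Since
  \<open>c0\<close> may be zero, the storage term does not bound the pore pressure, so the pressures
  have to be recovered from the equations once displacement and velocity are gone. That recovery
  rests on a divergence theorem for facet integrals defined through right cylinders over a
  hyperplane. Integrating along edges of a simplex fits the tests in use, but edges are oblique to
  the facets; hence the work on replacing the orthogonal projection by an oblique one. A second
  obstacle is that representatives of facet functions are polynomial on relative interiors only:
  pointwise conclusions are drawn there, and relative boundaries are shown to be null sets.\<close>

instantiation "fun" :: (type, real_vector) real_vector
begin

definition scaleR_fun :: "real \<Rightarrow> ('a \<Rightarrow> 'b) \<Rightarrow> 'a \<Rightarrow> 'b" where
  "scaleR_fun c f = (\<lambda>x. c *\<^sub>R f x)"

instance
  by standard (auto simp: scaleR_fun_def fun_eq_iff algebra_simps)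

end

lemma scaleR_fun_apply [simp]: "(c *\<^sub>R f) x = c *\<^sub>R f x"
  by (simp add: scaleR_fun_def)

text \<open>Containment in a finite span, without asking for a subspace: this passes to subsets, so
  a space may be bounded by any larger set of sums of images.\<close>

definition fin_dim :: "'a::real_vector set \<Rightarrow> bool" where
  "fin_dim S \<longleftrightarrow> (\<exists>B. finite B \<and> S \<subseteq> span B)"

text \<open>The forms are linear only on fields whose integrands are bounded and measurable and
  whose derivatives exist; elsewhere the default values of integrals and derivatives break
  additivity. Hence linearity is relative to \<open>X\<close>.\<close>

definition lin_on :: "'a::real_vector set \<Rightarrow> ('a \<Rightarrow> 'b::real_vector) \<Rightarrow> bool" where
  "lin_on X f \<longleftrightarrow> (\<forall>x\<in>X. \<forall>y\<in>X. \<forall>c. f (x + c *\<^sub>R y) = f x + c *\<^sub>R f y)"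

lemma lin_onD: "lin_on X f \<Longrightarrow> x \<in> X \<Longrightarrow> y \<in> X \<Longrightarrow> f (x + c *\<^sub>R y) = f x + c *\<^sub>R f y"
  by (simp add: lin_on_def)

lemma lin_on_zero: "lin_on X f \<Longrightarrow> 0 \<in> X \<Longrightarrow> f 0 = 0"
  using lin_onD[of X f 0 0 1] by simp

lemma lin_on_diff: "lin_on X f \<Longrightarrow> x \<in> X \<Longrightarrow> y \<in> X \<Longrightarrow> f (x - y) = f x - f y"
  using lin_onD[of X f x y "-1"] by simp

lemma lin_on_scaleR: "lin_on X f \<Longrightarrow> 0 \<in> X \<Longrightarrow> x \<in> X \<Longrightarrow> f (c *\<^sub>R x) = c *\<^sub>R f x"
  using lin_onD[of X f 0 x c] lin_on_zero[of X f] by simp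

lemma lin_on_add: "lin_on X f \<Longrightarrow> lin_on X g \<Longrightarrow> lin_on X (\<lambda>x. f x + g x)"
  by (simp add: lin_on_def algebra_simps)

lemma lin_on_sub: "lin_on X f \<Longrightarrow> lin_on X g \<Longrightarrow> lin_on X (\<lambda>x. f x - g x)"
  by (simp add: lin_on_def algebra_simps)

lemma lin_on_sum: "(\<And>i. i \<in> I \<Longrightarrow> lin_on X (f i)) \<Longrightarrow> lin_on X (\<lambda>x. \<Sum>i\<in>I. f i x)"
  by (simp add: lin_on_def sum.distrib scaleR_right.sum)

lemma lin_on_linear: "linear h \<Longrightarrow> lin_on X f \<Longrightarrow> lin_on X (\<lambda>x. h (f x))"
  by (simp add: lin_on_def linear_add linear_scale)

lemma lin_on_comp: "linear h \<Longrightarrow> lin_on Y f \<Longrightarrow> h ` X \<subseteq> Y \<Longrightarrow> lin_on X (\<lambda>x. f (h x))"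
  by (simp add: lin_on_def linear_add linear_scale image_subset_iff)

lemma lin_on_eq_on_span:
  assumes "lin_on X f" "lin_on X g" "subspace X" "B \<subseteq> X" "\<And>b. b \<in> B \<Longrightarrow> f b = g b" "x \<in> span B"
  shows "f x = g x"
proof -
  have "x \<in> X \<and> f x = g x"
    using assms(6)
  proof (induction rule: span_induct_alt)
    case base
    then show ?case
      using assms(1-3) lin_on_zero subspace_0 by metis
  next
    case (step c x y)
    then have "x \<in> X"
      using assms(4) by auto
    then have "y + c *\<^sub>R x \<in> X" "f (y + c *\<^sub>R x) = g (y + c *\<^sub>R x)"
      using step assms by (auto simp: subspace_add subspace_scale lin_onD)
    then show ?case
      by (simp add: add.commute)
  qed
  then show ?thesis ..
qed

lemma fin_dim_subset: "fin_dim T \<Longrightarrow> S \<subseteq> T \<Longrightarrow> fin_dim S"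
  unfolding fin_dim_def by blast

lemma fin_dim_image: "linear h \<Longrightarrow> fin_dim S \<Longrightarrow> fin_dim (h ` S)"
proof -
  assume h: "linear h" and "fin_dim S"
  then obtain B where "finite B" "S \<subseteq> span B"
    unfolding fin_dim_def by blast
  then have "finite (h ` B)" "h ` S \<subseteq> span (h ` B)"
    by (auto simp: linear_span_image[OF h])
  then show ?thesis
    unfolding fin_dim_def by blast
qed

lemma fin_dim_plus:
  assumes "fin_dim S" "fin_dim T"
  shows "fin_dim {x + y |x y. x \<in> S \<and> y \<in> T}"
proof -
  obtain A B where AB: "finite A" "finite B" "S \<subseteq> span A" "T \<subseteq> span B"
    using assms unfolding fin_dim_def by blast
  have "{x + y |x y. x \<in> S \<and> y \<in> T} \<subseteq> span (A \<union> B)"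
    using AB span_mono[of A "A \<union> B"] span_mono[of B "A \<union> B"] by (auto intro!: span_add)
  then show ?thesis
    using AB unfolding fin_dim_def by blast
qed

lemma fin_dim_sum:
  assumes "finite I" "\<And>i. i \<in> I \<Longrightarrow> fin_dim (S i)"
  shows "fin_dim {\<Sum>i\<in>I. f i |f. \<forall>i\<in>I. f i \<in> S i}"
  using assms
proof (induction I rule: finite_induct)
  case empty
  have "{\<Sum>i\<in>{}. f i |f. \<forall>i\<in>{}. f i \<in> S i} \<subseteq> span {}"
    by auto
  then show ?case
    unfolding fin_dim_def by blast
next
  case (insert j I)
  have "{\<Sum>i\<in>insert j I. f i |f. \<forall>i\<in>insert j I. f i \<in> S i}
      \<subseteq> {x + y |x y. x \<in> S j \<and> y \<in> {\<Sum>i\<in>I. f i |f. \<forall>i\<in>I. f i \<in> S i}}"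
  proof safe
    fix f assume "\<forall>i\<in>insert j I. f i \<in> S i"
    then show "\<exists>x y. sum f (insert j I) = x + y \<and> x \<in> S j \<and> y \<in> {\<Sum>i\<in>I. f i |f. \<forall>i\<in>I. f i \<in> S i}"
      using insert.hyps by (intro exI[of _ "f j"] exI[of _ "sum f I"]) auto
  qed
  moreover have "fin_dim {x + y |x y. x \<in> S j \<and> y \<in> {\<Sum>i\<in>I. f i |f. \<forall>i\<in>I. f i \<in> S i}}"
    using insert by (intro fin_dim_plus) auto
  ultimately show ?case
    by (rule fin_dim_subset[rotated])
qed

lemma fin_dim_Times:
  assumes "fin_dim S" "fin_dim T"
  shows "fin_dim (S \<times> T)"
proof -
  have lin: "linear (\<lambda>x. (x, 0))" "linear (\<lambda>x. (0, x))"
    by (auto intro!: linearI)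
  have "fin_dim {x + y |x y. x \<in> (\<lambda>x. (x, 0)) ` S \<and> y \<in> (\<lambda>x. (0, x)) ` T}"
    using lin assms by (intro fin_dim_plus fin_dim_image)
  moreover have "S \<times> T \<subseteq> {x + y |x y. x \<in> (\<lambda>x. (x, 0)) ` S \<and> y \<in> (\<lambda>x. (0, x)) ` T}"
  proof safe
    fix a b assume "a \<in> S" "b \<in> T"
    then show "\<exists>x y. (a, b) = x + y \<and> x \<in> (\<lambda>x. (x, 0)) ` S \<and> y \<in> (\<lambda>x. (0, x)) ` T"
      by (intro exI[of _ "(a, 0)"] exI[of _ "(0, b)"]) auto
  qed
  ultimately show ?thesis
    by (rule fin_dim_subset)
qed

text \<open>The coordinate map \<open>x \<mapsto> (\<Phi> x b)\<^sub>b\<close> with respect to a basis is injective, so it maps the basis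
  to a maximal independent set and is onto.\<close>

lemma bilinear_unique_solution:
  fixes \<Phi> :: "'a::real_vector \<Rightarrow> 'a \<Rightarrow> real"
  assumes X: "subspace X" "fin_dim X"
    and lin: "\<And>y. y \<in> X \<Longrightarrow> lin_on X (\<lambda>x. \<Phi> x y)" "\<And>x. x \<in> X \<Longrightarrow> lin_on X (\<Phi> x)"
    and inj: "\<And>x. x \<in> X \<Longrightarrow> (\<And>y. y \<in> X \<Longrightarrow> \<Phi> x y = 0) \<Longrightarrow> x = 0"
    and L: "lin_on X L"
  shows "\<exists>!x. x \<in> X \<and> (\<forall>y\<in>X. \<Phi> x y = L y)"
proof -
  obtain B where B: "B \<subseteq> X" "independent B" "X \<subseteq> span B"
    by (rule basis_exists[of X])
  have finB: "finite B"
    using X(2) B independent_span_bound unfolding fin_dim_def by blast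
  have span_B: "span B = X"
    using B X(1) by (metis span_minimal subset_antisym)
  define e :: "'a \<Rightarrow> 'a \<Rightarrow> real" where "e b = (\<lambda>x. if x = b then 1 else 0)" for b
  define F where "F x = (\<lambda>b. if b \<in> B then \<Phi> x b else 0)" for x
  have F_e: "g \<in> span (e ` B)" if "\<And>b. b \<notin> B \<Longrightarrow> g b = 0" for g
  proof -
    have "g = (\<Sum>b\<in>B. g b *\<^sub>R e b)"
    proof
      fix x
      have "(\<Sum>b\<in>B. g b *\<^sub>R e b) x = (\<Sum>b\<in>B. g b * e b x)"
        using finB by (induction B rule: finite_induct) auto
      also have "\<dots> = (\<Sum>b\<in>B. if b = x then g b else 0)"
        by (intro sum.cong) (auto simp: e_def)
      also have "\<dots> = g x"
        using finB that by simp
      finally show "g x = (\<Sum>b\<in>B. g b *\<^sub>R e b) x" ..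
    qed
    also have "\<dots> \<in> span (e ` B)"
      by (intro span_sum span_scale span_base imageI)
    finally show ?thesis .
  qed
  have F_lin: "lin_on X F"
    using lin(1) B(1) by (auto simp: lin_on_def F_def fun_eq_iff)
  have F_inj: "x = 0" if x: "x \<in> X" "F x = 0" for x
  proof (rule inj[OF x(1)])
    fix y assume "y \<in> X"
    have "\<Phi> x b = 0" if "b \<in> B" for b
      using fun_cong[OF x(2), of b] that by (simp add: F_def)
    then show "\<Phi> x y = 0"
      using lin_on_eq_on_span[OF lin(2)[OF x(1)], of "\<lambda>_. 0" B y] X(1) B \<open>y \<in> X\<close>
      by (auto simp: lin_on_def)
  qed
  have inj_F: "inj_on F X"
    using F_inj lin_on_diff[OF F_lin] subspace_diff[OF X(1)]
    by (intro inj_onI) (metis right_minus_eq)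
  \<comment> \<open>\<open>F\<close> is linear only on \<open>X\<close>. A globally linear
    \<open>h\<close> that agrees with it on the basis, hence on \<open>X\<close>, carries the
    independence of \<open>B\<close> over to its image.\<close>
  obtain h where h: "linear h" "\<And>b. b \<in> B \<Longrightarrow> h b = F b"
    using linear_independent_extend[OF B(2)] by blast
  have h_F: "h x = F x" if "x \<in> X" for x
    using lin_on_eq_on_span[of X h F B x] h F_lin X(1) B that
    by (auto simp: lin_on_def linear_add linear_scale)
  have indep: "independent (F ` B)"
  proof -
    have "inj_on h (span B)"
      using inj_F h_F span_B by (metis inj_on_cong)
    then have "independent (h ` B)"
      using linear_independent_injective_image[OF h(1) B(2)] by blast
    then show ?thesis
      using h(2) by simp
  qed
  define g where "g = (\<lambda>b. if b \<in> B then L b else 0)"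
  \<comment> \<open>Otherwise \<open>g\<close> and the image of \<open>B\<close> would be
    independent with one element more than the functions \<open>e b\<close>, which span everything
    supported on \<open>B\<close>.\<close>
  have "g \<in> span (F ` B)"
  proof (rule ccontr)
    assume g: "g \<notin> span (F ` B)"
    then have "independent (insert g (F ` B))"
      using indep by (simp add: independent_insert)
    moreover have "insert g (F ` B) \<subseteq> span (e ` B)"
      by (auto intro!: F_e simp: g_def F_def)
    ultimately have "card (insert g (F ` B)) \<le> card (e ` B)"
      using independent_span_bound[of "e ` B"] finB by blast
    also have "\<dots> \<le> card B"
      using finB by (rule card_image_le)
    also have "card B = card (F ` B)"
      using inj_F B(1) by (metis card_image inj_on_subset)
    finally show False
      using g finB by (metis card_insert_disjoint finite_imageI lessI not_le span_base)
  qed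
  then obtain x where x: "x \<in> X" "F x = g"
    using linear_span_image[OF h(1), of B] h(2) h_F span_B by (auto simp: image_def)
  have "\<Phi> x y = L y" if "y \<in> X" for y
  proof (rule lin_on_eq_on_span[OF lin(2)[OF x(1)] L X(1) B(1)])
    show "\<Phi> x b = L b" if "b \<in> B" for b
      using fun_cong[OF x(2), of b] that by (simp add: F_def g_def)
  qed (use that B in auto)
  moreover have "x' = x" if x': "x' \<in> X" "\<forall>y\<in>X. \<Phi> x' y = L y" for x'
  proof -
    have "F x' = F x"
      using x' calculation B(1) by (auto simp: F_def fun_eq_iff subset_iff)
    then show ?thesis
      using inj_F x x' by (auto dest: inj_onD)
  qed
  ultimately show ?thesis
    using x(1) by blast
qed

section \<open>Surface measure on a hyperplane\<close>

text \<open>The explicit projection turns \<open>hyperplane_measure\<close> into an image of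
  Lebesgue measure under an affine map. By Cauchy-Schwarz with the unit normal, no point of the
  hyperplane is nearer.\<close>

lemma closest_point_hyperplane:
  fixes n :: "'a::euclidean_space"
  assumes "norm n = 1"
  shows "closest_point {x. n \<bullet> x = b} x = x - (n \<bullet> x - b) *\<^sub>R n"
proof (rule closest_point_unique[symmetric])
  have nn: "n \<bullet> n = 1"
    using assms by (simp add: norm_eq_1)
  then show "x - (n \<bullet> x - b) *\<^sub>R n \<in> {x. n \<bullet> x = b}"
    by (simp add: inner_diff_right)
  show "\<forall>z\<in>{x. n \<bullet> x = b}. dist x (x - (n \<bullet> x - b) *\<^sub>R n) \<le> dist x z"
  proof
    fix z assume "z \<in> {x. n \<bullet> x = b}"
    then have "\<bar>n \<bullet> x - b\<bar> = \<bar>n \<bullet> (x - z)\<bar>"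
      by (simp add: inner_diff_right)
    also have "\<dots> \<le> norm n * norm (x - z)"
      by (rule Cauchy_Schwarz_ineq2)
    finally show "dist x (x - (n \<bullet> x - b) *\<^sub>R n) \<le> dist x z"
      using assms by (simp add: dist_norm)
  qed
qed (simp_all add: convex_hyperplane closed_hyperplane)

lemma infdist_hyperplane:
  fixes n :: "'a::euclidean_space"
  assumes "norm n = 1"
  shows "infdist x {x. n \<bullet> x = b} = \<bar>n \<bullet> x - b\<bar>"
proof -
  have "b *\<^sub>R n \<in> {x. n \<bullet> x = b}"
    using assms by (simp add: norm_eq_1)
  then have "{x. n \<bullet> x = b} \<noteq> {}"
    by blast
  then have "infdist x {x. n \<bullet> x = b} = dist x (closest_point {x. n \<bullet> x = b} x)"
    by (simp add: infdist_eq_setdist setdist_closest_point closed_hyperplane)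
  then show ?thesis
    using assms by (simp add: closest_point_hyperplane dist_norm)
qed

lemma nn_integral_lborel_translate:
  fixes v :: "'a::euclidean_space"
  assumes "f \<in> borel_measurable borel"
  shows "(\<integral>\<^sup>+x. f (x + v) \<partial>lborel) = (\<integral>\<^sup>+x. f x \<partial>lborel)"
proof -
  have "(\<integral>\<^sup>+x. f x \<partial>lborel) = (\<integral>\<^sup>+x. f x \<partial>distr lborel borel ((+) v))"
    by (simp add: lborel_distr_plus)
  also have "\<dots> = (\<integral>\<^sup>+x. f (v + x) \<partial>lborel)"
    using assms by (intro nn_integral_distr) auto
  finally show ?thesis
    by (simp add: add.commute)
qed

definition slab :: "'a::euclidean_space \<Rightarrow> real \<Rightarrow> 'a set" where
  "slab n b = {x. \<bar>n \<bullet> x - b\<bar> \<le> 1/2}"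

lemma slab_borel [measurable]: "slab n b \<in> sets borel"
  unfolding slab_def by measurable

lemma indicator_slab_measurable [measurable (raw)]:
  "f \<in> borel_measurable M \<Longrightarrow> (\<lambda>x. indicator (slab n b) (f x) :: ennreal) \<in> borel_measurable M"
  by measurable

lemma emeasure_unit_interval_around: "(\<integral>\<^sup>+s. indicator {s::real. \<bar>c - s\<bar> \<le> 1/2} s \<partial>lborel) = 1"
proof -
  have "{s::real. \<bar>c - s\<bar> \<le> 1/2} = {c - 1/2 .. c + 1/2}"
    by (auto simp: abs_if split: if_splits)
  then show ?thesis
    by (simp add: nn_integral_indicator)
qed

text \<open>As \<open>n \<bullet> t = 1\<close>, every line in direction \<open>t\<close> meets the
  slab in a parameter set of length one; after Fubini and a translation of \<open>x\<close> the slab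
  contributes only this factor 1.\<close>

lemma nn_integral_slab_lines:
  fixes n t :: "'a::euclidean_space"
  assumes nt: "n \<bullet> t = 1" and G [measurable]: "G \<in> borel_measurable borel"
  shows "(\<integral>\<^sup>+x. G x \<partial>lborel)
    = (\<integral>\<^sup>+x. indicator (slab n b) x * (\<integral>\<^sup>+s. G (x + s *\<^sub>R t) \<partial>lborel) \<partial>lborel)"
proof -
  have "(\<integral>\<^sup>+x. indicator (slab n b) x * (\<integral>\<^sup>+s. G (x + s *\<^sub>R t) \<partial>lborel) \<partial>lborel)
      = (\<integral>\<^sup>+x. (\<integral>\<^sup>+s. indicator (slab n b) x * G (x + s *\<^sub>R t) \<partial>lborel) \<partial>lborel)"
    by (rule nn_integral_cong, rule nn_integral_cmult[symmetric]) measurable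
  also have "\<dots> = (\<integral>\<^sup>+s. (\<integral>\<^sup>+x. indicator (slab n b) x * G (x + s *\<^sub>R t) \<partial>lborel) \<partial>lborel)"
    by (intro lborel_pair.Fubini'[symmetric]) measurable
  also have "\<dots> = (\<integral>\<^sup>+s. (\<integral>\<^sup>+x. indicator (slab n b) (x - s *\<^sub>R t) * G x \<partial>lborel) \<partial>lborel)"
  proof (rule nn_integral_cong)
    fix s :: real
    show "(\<integral>\<^sup>+x. indicator (slab n b) x * G (x + s *\<^sub>R t) \<partial>lborel)
        = (\<integral>\<^sup>+x. indicator (slab n b) (x - s *\<^sub>R t) * G x \<partial>lborel)"
      by (subst nn_integral_lborel_translate[of _ "s *\<^sub>R t", symmetric]) auto
  qed
  also have "\<dots> = (\<integral>\<^sup>+x. (\<integral>\<^sup>+s. indicator (slab n b) (x - s *\<^sub>R t) * G x \<partial>lborel) \<partial>lborel)"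
    by (intro lborel_pair.Fubini') measurable
  also have "\<dots> = (\<integral>\<^sup>+x. G x \<partial>lborel)"
  proof (rule nn_integral_cong)
    fix x
    have "(\<integral>\<^sup>+s. indicator (slab n b) (x - s *\<^sub>R t) * G x \<partial>lborel)
        = (\<integral>\<^sup>+s. indicator (slab n b) (x - s *\<^sub>R t) \<partial>lborel) * G x"
      by (intro nn_integral_multc) measurable
    also have "(\<integral>\<^sup>+s. indicator (slab n b) (x - s *\<^sub>R t) \<partial>lborel)
        = (\<integral>\<^sup>+s. indicator {s. \<bar>(n \<bullet> x - b) - s\<bar> \<le> 1/2} s \<partial>(lborel::real measure))"
      using nt by (intro nn_integral_cong) (auto simp: slab_def inner_diff_right algebra_simps indicator_def)
    also have "\<dots> = 1"
      by (rule emeasure_unit_interval_around)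
    finally show "(\<integral>\<^sup>+s. indicator (slab n b) (x - s *\<^sub>R t) * G x \<partial>lborel) = G x"
      by simp
  qed
  finally show ?thesis ..
qed

text \<open>Averaging over lines parallel to \<open>n\<close> turns the projection along \<open>t\<close> into the orthogonal one
  followed by a shift by \<open>\<sigma> (n - t)\<close>, which translation invariance removes.\<close>

lemma nn_integral_oblique:
  fixes n t :: "'a::euclidean_space"
  assumes n: "norm n = 1" and nt: "n \<bullet> t = 1" and g [measurable]: "g \<in> borel_measurable borel"
  shows "(\<integral>\<^sup>+x. indicator (slab n b) x * g (x - (n \<bullet> x - b) *\<^sub>R t) \<partial>lborel)
    = (\<integral>\<^sup>+x. indicator (slab n b) x * g (x - (n \<bullet> x - b) *\<^sub>R n) \<partial>lborel)"
proof -
  have nn: "n \<bullet> n = 1"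
    using n by (simp add: norm_eq_1)
  define I :: "real \<Rightarrow> ennreal" where "I = indicator {\<sigma>. \<bar>0 - \<sigma>\<bar> \<le> 1/2}"
  have [measurable]: "I \<in> borel_measurable borel"
    unfolding I_def by measurable
  have "(\<integral>\<^sup>+x. indicator (slab n b) x * g (x - (n \<bullet> x - b) *\<^sub>R t) \<partial>lborel)
      = (\<integral>\<^sup>+x. indicator (slab n b) x * (\<integral>\<^sup>+s. indicator (slab n b) (x + s *\<^sub>R n) *
          g (x + s *\<^sub>R n - (n \<bullet> (x + s *\<^sub>R n) - b) *\<^sub>R t) \<partial>lborel) \<partial>lborel)"
    by (rule nn_integral_slab_lines[OF nn]) measurable
  also have "\<dots> = (\<integral>\<^sup>+x. indicator (slab n b) x * (\<integral>\<^sup>+\<sigma>. I \<sigma> *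
          g (x - (n \<bullet> x - b) *\<^sub>R n + \<sigma> *\<^sub>R (n - t)) \<partial>lborel) \<partial>lborel)"
  proof (rule nn_integral_cong, rule arg_cong2[of _ _ _ _ "(*)"], rule refl)
    \<comment> \<open>The substitution \<open>\<sigma> = s + (n \<bullet> x - b)\<close> measures
      the position on the line from the hyperplane, so that the base point becomes the orthogonal
      projection of \<open>x\<close>.\<close>
    fix x
    have "(\<integral>\<^sup>+\<sigma>. I \<sigma> * g (x - (n \<bullet> x - b) *\<^sub>R n + \<sigma> *\<^sub>R (n - t)) \<partial>lborel)
      = (\<integral>\<^sup>+s. I (s + (n \<bullet> x - b)) * g (x - (n \<bullet> x - b) *\<^sub>R n + (s + (n \<bullet> x - b)) *\<^sub>R (n - t)) \<partial>lborel)"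
      by (subst nn_integral_lborel_translate[of _ "n \<bullet> x - b"]) auto
    also have "\<dots> = (\<integral>\<^sup>+s. indicator (slab n b) (x + s *\<^sub>R n) *
          g (x + s *\<^sub>R n - (n \<bullet> (x + s *\<^sub>R n) - b) *\<^sub>R t) \<partial>lborel)"
    proof (rule nn_integral_cong, rule arg_cong2[of _ _ _ _ "(*)"])
      fix s
      show "I (s + (n \<bullet> x - b)) = indicator (slab n b) (x + s *\<^sub>R n)"
        by (auto simp: I_def slab_def indicator_def inner_add_right nn algebra_simps)
      show "g (x - (n \<bullet> x - b) *\<^sub>R n + (s + (n \<bullet> x - b)) *\<^sub>R (n - t))
          = g (x + s *\<^sub>R n - (n \<bullet> (x + s *\<^sub>R n) - b) *\<^sub>R t)"
        by (simp add: inner_add_right nn algebra_simps)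
    qed
    finally show "(\<integral>\<^sup>+s. indicator (slab n b) (x + s *\<^sub>R n) *
          g (x + s *\<^sub>R n - (n \<bullet> (x + s *\<^sub>R n) - b) *\<^sub>R t) \<partial>lborel)
        = (\<integral>\<^sup>+\<sigma>. I \<sigma> * g (x - (n \<bullet> x - b) *\<^sub>R n + \<sigma> *\<^sub>R (n - t)) \<partial>lborel)" ..
  qed
  also have "\<dots> = (\<integral>\<^sup>+x. (\<integral>\<^sup>+\<sigma>. indicator (slab n b) x * (I \<sigma> *
          g (x - (n \<bullet> x - b) *\<^sub>R n + \<sigma> *\<^sub>R (n - t))) \<partial>lborel) \<partial>lborel)"
    by (rule nn_integral_cong, rule nn_integral_cmult[symmetric]) measurable
  also have "\<dots> = (\<integral>\<^sup>+\<sigma>. (\<integral>\<^sup>+x. indicator (slab n b) x * (I \<sigma> *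
          g (x - (n \<bullet> x - b) *\<^sub>R n + \<sigma> *\<^sub>R (n - t))) \<partial>lborel) \<partial>lborel)"
    by (intro lborel_pair.Fubini'[symmetric]) measurable
  also have "\<dots> = (\<integral>\<^sup>+\<sigma>. I \<sigma> * (\<integral>\<^sup>+x. indicator (slab n b) x *
          g (x - (n \<bullet> x - b) *\<^sub>R n) \<partial>lborel) \<partial>lborel)"
  proof (rule nn_integral_cong)
    fix \<sigma>
    have "(\<integral>\<^sup>+x. indicator (slab n b) x * (I \<sigma> * g (x - (n \<bullet> x - b) *\<^sub>R n + \<sigma> *\<^sub>R (n - t))) \<partial>lborel)
        = (\<integral>\<^sup>+x. I \<sigma> * (indicator (slab n b) x * g (x - (n \<bullet> x - b) *\<^sub>R n + \<sigma> *\<^sub>R (n - t))) \<partial>lborel)"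
      by (simp add: mult_ac)
    also have "\<dots> = I \<sigma> * (\<integral>\<^sup>+x. indicator (slab n b) x * g (x - (n \<bullet> x - b) *\<^sub>R n + \<sigma> *\<^sub>R (n - t)) \<partial>lborel)"
      by (intro nn_integral_cmult) measurable
    also have "(\<integral>\<^sup>+x. indicator (slab n b) x * g (x - (n \<bullet> x - b) *\<^sub>R n + \<sigma> *\<^sub>R (n - t)) \<partial>lborel)
        = (\<integral>\<^sup>+x. indicator (slab n b) (x + \<sigma> *\<^sub>R (n - t)) *
            g (x + \<sigma> *\<^sub>R (n - t) - (n \<bullet> (x + \<sigma> *\<^sub>R (n - t)) - b) *\<^sub>R n) \<partial>lborel)"
      by (rule nn_integral_cong, rule arg_cong2[of _ _ _ _ "(*)"])
        (auto simp: slab_def indicator_def inner_add_right inner_diff_right nn nt algebra_simps)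
    also have "\<dots> = (\<integral>\<^sup>+x. indicator (slab n b) x * g (x - (n \<bullet> x - b) *\<^sub>R n) \<partial>lborel)"
      by (rule nn_integral_lborel_translate
          [where f = "\<lambda>x. indicator (slab n b) x * g (x - (n \<bullet> x - b) *\<^sub>R n)"]) measurable
    finally show "(\<integral>\<^sup>+x. indicator (slab n b) x * (I \<sigma> * g (x - (n \<bullet> x - b) *\<^sub>R n + \<sigma> *\<^sub>R (n - t))) \<partial>lborel)
        = I \<sigma> * (\<integral>\<^sup>+x. indicator (slab n b) x * g (x - (n \<bullet> x - b) *\<^sub>R n) \<partial>lborel)" .
  qed
  also have "\<dots> = (\<integral>\<^sup>+\<sigma>. I \<sigma> \<partial>lborel) * (\<integral>\<^sup>+x. indicator (slab n b) x *
          g (x - (n \<bullet> x - b) *\<^sub>R n) \<partial>lborel)"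
    by (intro nn_integral_multc) measurable
  also have "(\<integral>\<^sup>+\<sigma>. I \<sigma> \<partial>lborel) = 1"
    unfolding I_def by (rule emeasure_unit_interval_around)
  finally show ?thesis
    by simp
qed

section \<open>Integration over a hyperplane and over lines transversal to it\<close>

locale hyperplane =
  fixes n :: "'a::euclidean_space" and b :: real
  assumes unit: "norm n = 1"
begin

abbreviation H :: "'a set" where "H \<equiv> {x. n \<bullet> x = b}"

lemma nn: "n \<bullet> n = 1"
  using unit by (simp add: norm_eq_1)

lemma hyperplane_measure_eq:
  "hyperplane_measure H = distr (restrict_space lborel (slab n b)) borel (\<lambda>x. x - (n \<bullet> x - b) *\<^sub>R n)"
  unfolding hyperplane_measure_def infdist_hyperplane[OF unit] closest_point_hyperplane[OF unit]
    slab_def ..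

lemma space_hyperplane_measure [simp]: "space (hyperplane_measure H) = UNIV"
  and sets_hyperplane_measure [simp, measurable_cong]: "sets (hyperplane_measure H) = sets borel"
  by (simp_all add: hyperplane_measure_def)

text \<open>The cylinder over a set may be taken in any direction \<open>t\<close> of unit normal
  component instead of upright; suitable edges of a simplex become such directions after
  scaling.\<close>

lemma nn_integral_hyperplane_measure:
  assumes nt: "n \<bullet> t = 1" and g [measurable]: "g \<in> borel_measurable borel"
  shows "(\<integral>\<^sup>+y. g y \<partial>hyperplane_measure H)
    = (\<integral>\<^sup>+x. indicator (slab n b) x * g (x - (n \<bullet> x - b) *\<^sub>R t) \<partial>lborel)"
proof -
  have "(\<integral>\<^sup>+y. g y \<partial>hyperplane_measure H)
      = (\<integral>\<^sup>+x. g (x - (n \<bullet> x - b) *\<^sub>R n) \<partial>restrict_space lborel (slab n b))"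
    unfolding hyperplane_measure_eq
    by (intro nn_integral_distr) (auto intro!: measurable_restrict_space1)
  also have "\<dots> = (\<integral>\<^sup>+x. indicator (slab n b) x * g (x - (n \<bullet> x - b) *\<^sub>R n) \<partial>lborel)"
    by (subst nn_integral_restrict_space) (auto simp: mult.commute)
  also have "\<dots> = (\<integral>\<^sup>+x. indicator (slab n b) x * g (x - (n \<bullet> x - b) *\<^sub>R t) \<partial>lborel)"
    by (rule nn_integral_oblique[OF unit nt g, symmetric])
  finally show ?thesis .
qed

lemma cylinder_borel:
  assumes "A \<in> sets borel"
  shows "{x \<in> slab n b. x - (n \<bullet> x - b) *\<^sub>R n \<in> A} \<in> sets borel"
proof -
  have "(\<lambda>x. x - (n \<bullet> x - b) *\<^sub>R n) -` A \<in> sets borel"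
    by (rule measurable_sets_borel[OF _ assms]) measurable
  then have "slab n b \<inter> (\<lambda>x. x - (n \<bullet> x - b) *\<^sub>R n) -` A \<in> sets borel"
    by (intro sets.Int slab_borel)
  also have "slab n b \<inter> (\<lambda>x. x - (n \<bullet> x - b) *\<^sub>R n) -` A = {x \<in> slab n b. x - (n \<bullet> x - b) *\<^sub>R n \<in> A}"
    by auto
  finally show ?thesis .
qed

lemma H_borel: "H \<in> sets borel"
  by (intro borel_closed closed_hyperplane)

lemma emeasure_hyperplane_measure:
  assumes A [measurable]: "A \<in> sets borel"
  shows "emeasure (hyperplane_measure H) A
    = emeasure lborel {x \<in> slab n b. x - (n \<bullet> x - b) *\<^sub>R n \<in> A}"
proof -
  have "emeasure (hyperplane_measure H) A = (\<integral>\<^sup>+y. indicator A y \<partial>hyperplane_measure H)"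
    by (intro nn_integral_indicator[symmetric]) (simp add: A)
  also have "\<dots> = (\<integral>\<^sup>+x. indicator (slab n b) x * indicator A (x - (n \<bullet> x - b) *\<^sub>R n) \<partial>lborel)"
    by (rule nn_integral_hyperplane_measure[OF nn]) (rule borel_measurable_indicator[OF A])
  also have "\<dots> = (\<integral>\<^sup>+x. indicator {x \<in> slab n b. x - (n \<bullet> x - b) *\<^sub>R n \<in> A} x \<partial>lborel)"
    by (intro nn_integral_cong) (auto simp: indicator_def)
  also have "\<dots> = emeasure lborel {x \<in> slab n b. x - (n \<bullet> x - b) *\<^sub>R n \<in> A}"
    using cylinder_borel[OF A] by (intro nn_integral_indicator) simp
  finally show ?thesis .
qed

lemma emeasure_hyperplane_measure_bounded:
  assumes "bounded A"
  shows "emeasure (hyperplane_measure H) A < \<infinity>"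
proof -
  obtain r where r: "A \<subseteq> cball 0 r"
    using assms by (auto simp: bounded_iff subset_iff)
  have "emeasure (hyperplane_measure H) A \<le> emeasure (hyperplane_measure H) (cball 0 r)"
    using r by (intro emeasure_mono) auto
  also have "\<dots> = emeasure lborel {x \<in> slab n b. x - (n \<bullet> x - b) *\<^sub>R n \<in> cball 0 r}"
    by (intro emeasure_hyperplane_measure) auto
  also have "\<dots> \<le> emeasure lborel (cball (0::'a) (r + 1/2))"
  proof (intro emeasure_mono)
    show "{x \<in> slab n b. x - (n \<bullet> x - b) *\<^sub>R n \<in> cball 0 r} \<subseteq> cball 0 (r + 1/2)"
    proof
      fix x assume x: "x \<in> {x \<in> slab n b. x - (n \<bullet> x - b) *\<^sub>R n \<in> cball 0 r}"
      have "norm x \<le> norm (x - (n \<bullet> x - b) *\<^sub>R n) + norm ((n \<bullet> x - b) *\<^sub>R n)"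
        by (metis diff_add_cancel norm_triangle_ineq)
      also have "\<dots> \<le> r + 1/2"
        using x unit by (intro add_mono) (auto simp: slab_def)
      finally show "x \<in> cball 0 (r + 1/2)"
        by simp
    qed
  qed auto
  also have "\<dots> < \<infinity>"
    by (rule emeasure_bounded_finite) auto
  finally show ?thesis .
qed

lemma sigma_finite_hyperplane_measure: "sigma_finite_measure (hyperplane_measure H)"
proof
  have "(\<Union>k::nat. cball (0::'a) (real k)) = UNIV"
    using real_arch_simple by auto
  then show "\<exists>A. countable A \<and> A \<subseteq> sets (hyperplane_measure H) \<and>
      \<Union>A = space (hyperplane_measure H) \<and> (\<forall>a\<in>A. emeasure (hyperplane_measure H) a \<noteq> \<infinity>)"
    using emeasure_hyperplane_measure_bounded[OF bounded_cball]
    by (intro exI[of _ "range (\<lambda>k::nat. cball 0 (real k))"]) (auto simp: less_top)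
qed

text \<open>Fubini for a hyperplane and oblique lines. No Jacobian appears because \<open>t\<close>
  is normalised by its normal component rather than by its length. The parameter shift between a
  point and its foot on the hyperplane is absorbed by translation on the line.\<close>

lemma lborel_eq_distr_lines:
  assumes nt: "n \<bullet> t = 1"
  shows "lborel = distr (hyperplane_measure H \<Otimes>\<^sub>M lborel) borel (\<lambda>(y, s). y + s *\<^sub>R t)"
proof (rule measure_eqI)
  fix A :: "'a set" assume "A \<in> sets lborel"
  then have A [measurable]: "A \<in> sets borel"
    by simp
  have m: "(\<lambda>(y, s). y + s *\<^sub>R t) \<in> measurable (hyperplane_measure H \<Otimes>\<^sub>M (lborel :: real measure)) borel"
    by measurable
  have "emeasure (distr (hyperplane_measure H \<Otimes>\<^sub>M (lborel :: real measure)) borel (\<lambda>(y, s). y + s *\<^sub>R t)) A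
    = (\<integral>\<^sup>+z. indicator A z \<partial>distr (hyperplane_measure H \<Otimes>\<^sub>M (lborel :: real measure)) borel (\<lambda>(y, s). y + s *\<^sub>R t))"
    by simp
  also have "\<dots> = (\<integral>\<^sup>+p. indicator A (case p of (y, s) \<Rightarrow> y + s *\<^sub>R t) \<partial>(hyperplane_measure H \<Otimes>\<^sub>M (lborel :: real measure)))"
    by (intro nn_integral_distr m) simp
  also have "\<dots> = (\<integral>\<^sup>+y. (\<integral>\<^sup>+s. indicator A (y + s *\<^sub>R t) \<partial>lborel) \<partial>hyperplane_measure H)"
    by (subst lborel.nn_integral_fst[symmetric]) auto
  also have "\<dots> = (\<integral>\<^sup>+x. indicator (slab n b) x *
      (\<integral>\<^sup>+s. indicator A (x - (n \<bullet> x - b) *\<^sub>R t + s *\<^sub>R t) \<partial>lborel) \<partial>lborel)"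
    by (intro nn_integral_hyperplane_measure nt) measurable
  also have "\<dots> = (\<integral>\<^sup>+x. indicator (slab n b) x * (\<integral>\<^sup>+s. indicator A (x + s *\<^sub>R t) \<partial>lborel) \<partial>lborel)"
  proof (rule nn_integral_cong, rule arg_cong2[of _ _ _ _ "(*)"], rule refl)
    fix x
    show "(\<integral>\<^sup>+s. indicator A (x - (n \<bullet> x - b) *\<^sub>R t + s *\<^sub>R t) \<partial>lborel)
        = (\<integral>\<^sup>+s. (indicator A (x + s *\<^sub>R t) :: ennreal) \<partial>lborel)"
      by (subst nn_integral_lborel_translate[of _ "- (n \<bullet> x - b)", symmetric])
        (auto simp: algebra_simps)
  qed
  also have "\<dots> = (\<integral>\<^sup>+x. indicator A x \<partial>lborel)"
    by (intro nn_integral_slab_lines[OF nt, symmetric]) measurable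
  also have "\<dots> = emeasure lborel A"
    by simp
  finally show "emeasure lborel A
    = emeasure (distr (hyperplane_measure H \<Otimes>\<^sub>M (lborel :: real measure)) borel (\<lambda>(y, s). y + s *\<^sub>R t)) A" ..
qed simp

lemma integral_lborel_lines:
  fixes G :: "'a \<Rightarrow> real"
  assumes nt: "n \<bullet> t = 1" and G: "integrable lborel G"
  shows "(\<integral>x. G x \<partial>lborel) = (\<integral>y. (\<integral>s. G (y + s *\<^sub>R t) \<partial>lborel) \<partial>hyperplane_measure H)"
proof -
  interpret A: sigma_finite_measure "hyperplane_measure H"
    by (rule sigma_finite_hyperplane_measure)
  interpret P: pair_sigma_finite "hyperplane_measure H" "lborel :: real measure" ..
  have m: "(\<lambda>(y, s). y + s *\<^sub>R t) \<in> measurable (hyperplane_measure H \<Otimes>\<^sub>M (lborel :: real measure)) borel"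
    by measurable
  have [measurable]: "G \<in> borel_measurable borel"
    using G by auto
  have "(\<integral>x. G x \<partial>lborel)
      = (\<integral>p. G (case p of (y, s) \<Rightarrow> y + s *\<^sub>R t) \<partial>(hyperplane_measure H \<Otimes>\<^sub>M (lborel :: real measure)))"
    by (subst lborel_eq_distr_lines[OF nt]) (intro integral_distr m, simp)
  also have "\<dots> = (\<integral>y. (\<integral>s. G (case (y, s) of (y, s) \<Rightarrow> y + s *\<^sub>R t) \<partial>lborel) \<partial>hyperplane_measure H)"
  proof (rule P.integral_fst'[symmetric])
    have "integrable (distr (hyperplane_measure H \<Otimes>\<^sub>M (lborel :: real measure)) borel (\<lambda>(y, s). y + s *\<^sub>R t)) G"
      using G lborel_eq_distr_lines[OF nt] by metis
    then show "integrable (hyperplane_measure H \<Otimes>\<^sub>M (lborel :: real measure))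
        (\<lambda>p. G (case p of (y, s) \<Rightarrow> y + s *\<^sub>R t))"
      by (subst (asm) integrable_distr_eq[OF m]) auto
  qed
  finally show ?thesis
    by simp
qed

lemma emeasure_hyperplane_measure_ball_pos:
  assumes "x \<in> H" "r > 0"
  shows "emeasure (hyperplane_measure H) (ball x r \<inter> H) > 0"
proof -
  \<comment> \<open>The bound 1/2 keeps the ball inside the slab, the bound \<open>r\<close> keeps
    its projection near \<open>x\<close>: projecting onto \<open>H\<close> fixes \<open>x\<close>
    and does not increase distances.\<close>
  define \<rho> where "\<rho> = min r (1/2)"
  have "0 < emeasure lborel (ball x \<rho>)"
    using assms content_ball_pos[of \<rho> x] by (auto simp: \<rho>_def measure_def enn2real_positive_iff)
  also have "\<dots> \<le> emeasure lborel {y \<in> slab n b. y - (n \<bullet> y - b) *\<^sub>R n \<in> ball x r \<inter> H}"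
  proof (intro emeasure_mono subsetI CollectI conjI IntI)
    fix y assume y: "y \<in> ball x \<rho>"
    have ny: "n \<bullet> y - b = n \<bullet> (y - x)"
      using assms by (simp add: inner_diff_right)
    have "\<bar>n \<bullet> (y - x)\<bar> \<le> norm n * norm (y - x)"
      by (rule Cauchy_Schwarz_ineq2)
    then show "y \<in> slab n b"
      using y unit unfolding slab_def mem_Collect_eq ny by (auto simp: \<rho>_def dist_norm norm_minus_commute)
    show "n \<bullet> (y - (n \<bullet> y - b) *\<^sub>R n) = b"
      by (simp add: inner_diff_right nn)
    have "dist (closest_point H x) (closest_point H y) \<le> dist x y"
      using assms by (intro closest_point_lipschitz convex_hyperplane closed_hyperplane) auto
    then show "y - (n \<bullet> y - b) *\<^sub>R n \<in> ball x r"
      using y assms unfolding closest_point_hyperplane[OF unit] by (auto simp: \<rho>_def)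
  next
    show "{y \<in> slab n b. y - (n \<bullet> y - b) *\<^sub>R n \<in> ball x r \<inter> H} \<in> sets lborel"
      using cylinder_borel[of "ball x r \<inter> H"] H_borel by auto
  qed
  also have "\<dots> = emeasure (hyperplane_measure H) (ball x r \<inter> H)"
    by (intro emeasure_hyperplane_measure[symmetric] sets.Int H_borel) auto
  finally show ?thesis .
qed

text \<open>For nonempty \<open>A\<close> the cylinder lies in the affine hull of \<open>A\<close>
  and one more point in direction \<open>n\<close>. That adds at most one dimension, so the hull is
  still proper and a Lebesgue null set.\<close>

lemma emeasure_hyperplane_measure_lowdim:
  assumes "A \<subseteq> H" "aff_dim A + 1 < int DIM('a)"
  shows "emeasure (hyperplane_measure H) A = 0"
proof (cases "A = {}")
  case False
  then obtain a where a: "a \<in> A"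
    by blast
  define L where "L = affine hull (insert (a + n) A)"
  have aL: "a \<in> L" "a + n \<in> L" "affine hull A \<subseteq> L" "affine L"
    using a by (auto simp: L_def hull_inc intro: hull_mono[THEN subsetD])
  have "aff_dim L < int DIM('a)"
    using assms(2) by (auto simp: L_def aff_dim_insert)
  then have "interior L = {}"
    using aff_dim_nonempty_interior[of L] by auto
  then have "negligible L"
    using aL(4) by (simp add: negligible_convex_interior affine_imp_convex)
  then have null: "emeasure lborel L = 0"
    using aL(4) by (simp add: negligible_iff_null_sets null_sets_def affine_closed)
  have "emeasure (hyperplane_measure H) A \<le> emeasure (hyperplane_measure H) (affine hull A)"
    by (intro emeasure_mono) (auto simp: hull_inc)
  also have "\<dots> = emeasure lborel {x \<in> slab n b. x - (n \<bullet> x - b) *\<^sub>R n \<in> affine hull A}"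
    by (intro emeasure_hyperplane_measure) simp
  also have "\<dots> \<le> emeasure lborel L"
  proof (intro emeasure_mono subsetI)
    fix x assume "x \<in> {x \<in> slab n b. x - (n \<bullet> x - b) *\<^sub>R n \<in> affine hull A}"
    then have "x - (n \<bullet> x - b) *\<^sub>R n \<in> L"
      using aL(3) by auto
    then have "x - (n \<bullet> x - b) *\<^sub>R n + (n \<bullet> x - b) *\<^sub>R ((a + n) - a) \<in> L"
      using aL by (intro mem_affine_3_minus) auto
    then show "x \<in> L"
      by simp
  qed (use aL(4) in \<open>simp add: affine_closed\<close>)
  finally show ?thesis
    using null by simp
qed simp

end

section \<open>Barycentric coordinates of a simplex\<close>

text \<open>The edge vectors from another vertex \<open>b\<close> are independent, so some linear
  functional is 1 on the edge to \<open>c\<close> and 0 on the other edges. \<open>A\<close> is its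
  Riesz vector, obtained as an adjoint, and \<open>\<beta>\<close> shifts the value at
  \<open>b\<close> to 0.\<close>

lemma affine_independent_dual:
  fixes C :: "'a::euclidean_space set"
  assumes "\<not> affine_dependent C" "c \<in> C"
  shows "\<exists>A \<beta>. \<forall>c'\<in>C. A \<bullet> c' + \<beta> = (if c' = c then 1 else 0)"
proof (cases "C = {c}")
  case True
  then show ?thesis
    by (intro exI[of _ 0] exI[of _ 1]) simp
next
  case False
  then obtain b where b: "b \<in> C" "b \<noteq> c"
    using assms(2) by blast
  have "independent ((\<lambda>x. -b + x) ` (C - {b}))"
    using assms(1) b affine_dependent_iff_dependent2 by blast
  then obtain g :: "'a \<Rightarrow> real" where g: "linear g"
    "\<And>x. x \<in> (\<lambda>x. -b + x) ` (C - {b}) \<Longrightarrow> g x = (if x = -b + c then 1 else 0)"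
    using linear_independent_extend[of "(\<lambda>x. -b + x) ` (C - {b})" "\<lambda>x. if x = -b + c then 1 else (0::real)"]
    by blast
  have A: "adjoint g 1 \<bullet> x = g x" for x
    using adjoint_works[OF g(1), of x 1] by (simp add: inner_commute)
  have "adjoint g 1 \<bullet> c' - adjoint g 1 \<bullet> b = (if c' = c then 1 else 0)" if "c' \<in> C" for c'
  proof (cases "c' = b")
    case False
    then have "g (-b + c') = (if c' = c then 1 else 0)"
      using g(2)[of "-b + c'"] that by auto
    then show ?thesis
      using A[of "-b + c'"] by (simp only: inner_add_right inner_minus_right)
  qed (use b in auto)
  then show ?thesis
    by (intro exI[of _ "adjoint g 1"] exI[of _ "- (adjoint g 1 \<bullet> b)"]) auto
qed

locale full_simplex =
  fixes C :: "'a::euclidean_space set" and K :: "'a set"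
  assumes indep: "\<not> affine_dependent C" and card_C: "card C = Suc DIM('a)" and K_eq: "K = convex hull C"
begin

lemma finite_C: "finite C"
  using indep by (rule aff_independent_finite)

text \<open>Gradient and constant term of the barycentric coordinate of \<open>c\<close>. For
  \<open>c\<close> in \<open>C\<close> the values at the vertices determine them, since
  \<open>C\<close> spans the whole space affinely.\<close>

definition bary :: "'a \<Rightarrow> 'a \<times> real" where
  "bary c = (SOME p. \<forall>c'\<in>C. fst p \<bullet> c' + snd p = (if c' = c then 1 else 0))"

definition grd :: "'a \<Rightarrow> 'a" where "grd c = fst (bary c)"

definition lam :: "'a \<Rightarrow> 'a \<Rightarrow> real" where "lam c x = grd c \<bullet> x + snd (bary c)"

lemma lam_vertex: "c \<in> C \<Longrightarrow> c' \<in> C \<Longrightarrow> lam c c' = (if c' = c then 1 else 0)"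
proof -
  assume c: "c \<in> C" "c' \<in> C"
  obtain A \<beta> where "\<forall>c'\<in>C. A \<bullet> c' + \<beta> = (if c' = c then 1 else 0)"
    using affine_independent_dual[OF indep c(1)] by blast
  then have "\<forall>c'\<in>C. fst (A, \<beta>) \<bullet> c' + snd (A, \<beta>) = (if c' = c then 1 else 0)"
    by simp
  then have "\<forall>c'\<in>C. fst (bary c) \<bullet> c' + snd (bary c) = (if c' = c then 1 else 0)"
    unfolding bary_def by (rule someI)
  then show ?thesis
    using c(2) unfolding lam_def grd_def by blast
qed

lemma lam_sum:
  assumes "c \<in> C" "sum u C = 1"
  shows "lam c (\<Sum>c'\<in>C. u c' *\<^sub>R c') = u c"
proof -
  have "lam c (\<Sum>c'\<in>C. u c' *\<^sub>R c') = (\<Sum>c'\<in>C. u c' * (grd c \<bullet> c')) + (\<Sum>c'\<in>C. u c') * snd (bary c)"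
    using assms(2) by (simp add: lam_def inner_sum_right)
  also have "\<dots> = (\<Sum>c'\<in>C. u c' * lam c c')"
    by (simp add: lam_def sum_distrib_right sum.distrib algebra_simps)
  also have "\<dots> = (\<Sum>c'\<in>C. if c' = c then u c' else 0)"
    using assms(1) by (intro sum.cong) (auto simp: lam_vertex)
  also have "\<dots> = u c"
    using assms(1) finite_C by simp
  finally show ?thesis .
qed

lemma affine_combination:
  obtains u where "sum u C = 1" "x = (\<Sum>c\<in>C. u c *\<^sub>R c)"
proof -
  have "x \<in> affine hull C"
    using affine_independent_span_eq[OF indep card_C] by simp
  then show ?thesis
    using that unfolding affine_hull_finite[OF finite_C] by blast
qed

lemma sum_lam: "(\<Sum>c\<in>C. lam c x) = 1"
  and sum_lam_scaleR: "(\<Sum>c\<in>C. lam c x *\<^sub>R c) = x"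
proof -
  obtain u where u: "sum u C = 1" "x = (\<Sum>c\<in>C. u c *\<^sub>R c)"
    by (rule affine_combination)
  have "lam c x = u c" if "c \<in> C" for c
    using lam_sum[OF that u(1)] u(2) by simp
  then show "(\<Sum>c\<in>C. lam c x) = 1" "(\<Sum>c\<in>C. lam c x *\<^sub>R c) = x"
    using u by (metis (mono_tags, lifting) sum.cong)+
qed

lemma lam_add: "lam c (x + s *\<^sub>R v) = lam c x + s * (grd c \<bullet> v)"
  by (simp add: lam_def inner_add_right)

lemma grd_edge:
  "c \<in> C \<Longrightarrow> a \<in> C \<Longrightarrow> b \<in> C \<Longrightarrow> a \<noteq> b \<Longrightarrow>
    grd c \<bullet> (a - b) = (if c = a then 1 else if c = b then -1 else 0)"
  using lam_vertex[of c a] lam_vertex[of c b] by (auto simp: lam_def inner_diff_right)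

lemma continuous_lam: "continuous_on S (lam c)"
  unfolding lam_def by (intro continuous_intros)

lemma convex_hull_vertices:
  assumes "D \<subseteq> C"
  shows "convex hull D = {x. (\<forall>c\<in>D. lam c x \<ge> 0) \<and> (\<forall>c\<in>C - D. lam c x = 0)}"
proof -
  have finD: "finite D"
    using assms finite_C finite_subset by blast
  have split: "(\<Sum>c\<in>C. f c) = (\<Sum>c\<in>D. f c) + (\<Sum>c\<in>C - D. f c)" for f :: "'a \<Rightarrow> 'b::comm_monoid_add"
    using sum.subset_diff[OF assms finite_C, of f] by (simp add: add.commute)
  show ?thesis
  proof (intro set_eqI iffI)
    fix x assume "x \<in> convex hull D"
    then obtain u where u: "\<forall>x\<in>D. 0 \<le> u x" "sum u D = 1" "(\<Sum>c\<in>D. u c *\<^sub>R c) = x"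
      unfolding convex_hull_finite[OF finD] by blast
    define w where "w c = (if c \<in> D then u c else 0)" for c
    have "sum w C = 1" "(\<Sum>c\<in>C. w c *\<^sub>R c) = x"
      unfolding split using u by (auto simp: w_def)
    then have "lam c x = w c" if "c \<in> C" for c
      using lam_sum[OF that] by metis
    then show "x \<in> {x. (\<forall>c\<in>D. lam c x \<ge> 0) \<and> (\<forall>c\<in>C - D. lam c x = 0)}"
      using assms u by (auto simp: w_def)
  next
    fix x assume x: "x \<in> {x. (\<forall>c\<in>D. lam c x \<ge> 0) \<and> (\<forall>c\<in>C - D. lam c x = 0)}"
    then have "(\<Sum>c\<in>D. lam c x) = 1" "(\<Sum>c\<in>D. lam c x *\<^sub>R c) = x"
      using sum_lam[of x] sum_lam_scaleR[of x] unfolding split by auto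
    then show "x \<in> convex hull D"
      using x unfolding convex_hull_finite[OF finD]
      by (intro CollectI exI[of _ "\<lambda>c. lam c x"]) auto
  qed
qed

lemma rel_interior_convex_hull_vertices:
  assumes "D \<subseteq> C"
  shows "rel_interior (convex hull D) = {x. (\<forall>c\<in>D. lam c x > 0) \<and> (\<forall>c\<in>C - D. lam c x = 0)}"
proof -
  have split: "(\<Sum>c\<in>C. f c) = (\<Sum>c\<in>D. f c) + (\<Sum>c\<in>C - D. f c)" for f :: "'a \<Rightarrow> 'b::comm_monoid_add"
    using sum.subset_diff[OF assms finite_C, of f] by (simp add: add.commute)
  have ind: "\<not> affine_dependent D"
    using affine_independent_subset[OF indep assms] .
  show ?thesis
  proof (intro set_eqI iffI)
    fix x assume "x \<in> rel_interior (convex hull D)"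
    then obtain u where u: "\<forall>x\<in>D. 0 < u x" "sum u D = 1" "(\<Sum>c\<in>D. u c *\<^sub>R c) = x"
      unfolding rel_interior_convex_hull_explicit[OF ind] by blast
    define w where "w c = (if c \<in> D then u c else 0)" for c
    have "sum w C = 1" "(\<Sum>c\<in>C. w c *\<^sub>R c) = x"
      unfolding split using u by (auto simp: w_def)
    then have "lam c x = w c" if "c \<in> C" for c
      using lam_sum[OF that] by metis
    then show "x \<in> {x. (\<forall>c\<in>D. lam c x > 0) \<and> (\<forall>c\<in>C - D. lam c x = 0)}"
      using assms u by (auto simp: w_def)
  next
    fix x assume x: "x \<in> {x. (\<forall>c\<in>D. lam c x > 0) \<and> (\<forall>c\<in>C - D. lam c x = 0)}"
    then have "(\<Sum>c\<in>D. lam c x) = 1" "(\<Sum>c\<in>D. lam c x *\<^sub>R c) = x"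
      using sum_lam[of x] sum_lam_scaleR[of x] unfolding split by auto
    then show "x \<in> rel_interior (convex hull D)"
      using x unfolding rel_interior_convex_hull_explicit[OF ind]
      by (intro CollectI exI[of _ "\<lambda>c. lam c x"]) auto
  qed
qed

lemma mem_K: "x \<in> K \<longleftrightarrow> (\<forall>c\<in>C. lam c x \<ge> 0)"
  using convex_hull_vertices[of C] by (simp add: K_eq)

lemma mem_interior_K: "x \<in> interior K \<longleftrightarrow> (\<forall>c\<in>C. lam c x > 0)"
proof -
  have "affine hull K = UNIV"
    using affine_independent_span_eq[OF indep card_C] by (simp add: K_eq)
  then have "interior K = rel_interior K"
    by (simp add: rel_interior_interior)
  then show ?thesis
    using rel_interior_convex_hull_vertices[of C] by (simp add: K_eq)
qed

lemma rel_interior_K: "rel_interior K = interior K"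
  using affine_independent_span_eq[OF indep card_C] by (simp add: K_eq rel_interior_interior)

lemma compact_K: "compact K" and convex_K: "convex K"
  by (simp_all add: K_eq finite_imp_compact_convex_hull finite_C)

lemma C_subset_K: "C \<subseteq> K"
  by (simp add: K_eq hull_subset)

lemma interior_K_nonempty: "interior K \<noteq> {}"
proof -
  have "rel_interior K \<noteq> {}"
    using card_C by (auto simp: K_eq rel_interior_eq_empty)
  then show ?thesis
    by (simp add: rel_interior_K)
qed

lemma closure_interior_K: "closure (interior K) = K"
  using convex_closure_interior[OF convex_K interior_K_nonempty] compact_K
  by (simp add: compact_imp_closed)

lemma aff_dim_K: "aff_dim K = int DIM('a)"
  using aff_dim_nonempty_interior interior_K_nonempty by blast

lemma ex_other_vertex:
  assumes "c \<in> C"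
  obtains c' where "c' \<in> C" "c' \<noteq> c"
proof -
  have "C \<noteq> {c}"
    using card_C DIM_positive[where 'a='a] by auto
  then show ?thesis
    using assms that by blast
qed

lemma diameter_K_pos: "diameter K > 0"
proof -
  obtain c where c: "c \<in> C"
    using card_C by fastforce
  then obtain c' where c': "c' \<in> C" "c' \<noteq> c"
    by (rule ex_other_vertex)
  have "0 < dist c c'"
    using c' by simp
  also have "\<dots> \<le> diameter K"
    using c c' C_subset_K compact_K by (intro diameter_bounded_bound) (auto simp: compact_imp_bounded)
  finally show ?thesis .
qed

text \<open>Facets are indexed by the opposite vertex, so that \<open>fac c\<close> is the zero set
  of \<open>lam c\<close> in \<open>K\<close>.\<close>

definition fac :: "'a \<Rightarrow> 'a set" where "fac c = convex hull (C - {c})"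

lemma facet_of_K: "F facet_of K \<longleftrightarrow> (\<exists>c\<in>C. F = fac c)"
  using facet_of_convex_hull_affine_independent_alt[OF indep, of F] card_C DIM_positive[where 'a='a]
  by (auto simp: K_eq fac_def Suc_le_eq)

lemma mem_fac: "c \<in> C \<Longrightarrow> x \<in> fac c \<longleftrightarrow> x \<in> K \<and> lam c x = 0"
  using convex_hull_vertices[of "C - {c}"] by (auto simp: fac_def mem_K double_diff)

lemma mem_rel_interior_fac:
  "c \<in> C \<Longrightarrow> x \<in> rel_interior (fac c) \<longleftrightarrow> lam c x = 0 \<and> (\<forall>c'\<in>C - {c}. lam c' x > 0)"
  using rel_interior_convex_hull_vertices[of "C - {c}"] by (auto simp: fac_def double_diff)

lemma fac_subset: "c \<in> C \<Longrightarrow> fac c \<subseteq> K"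
  using mem_fac by blast

lemma fac_inj: "inj_on fac C"
proof (rule inj_onI, rule ccontr)
  fix c c' assume c: "c \<in> C" "c' \<in> C" "fac c = fac c'" "c \<noteq> c'"
  have "c' \<in> fac c"
    using c(1,2,4) C_subset_K mem_fac[OF c(1), of c'] lam_vertex[OF c(1,2)] by auto
  then have "lam c' c' = 0"
    using c(2,3) mem_fac[of c' c'] by simp
  then show False
    using lam_vertex[OF c(2,2)] by simp
qed

lemma facets_K: "{F. F facet_of K} = fac ` C"
  by (auto simp: facet_of_K)

lemma grd_nz: "c \<in> C \<Longrightarrow> grd c \<noteq> 0"
proof
  assume c: "c \<in> C" "grd c = 0"
  obtain c' where "c' \<in> C" "c' \<noteq> c"
    using ex_other_vertex[OF c(1)] by blast
  then show False
    using grd_edge[of c c c'] c by auto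
qed

text \<open>\<open>lam c\<close> grows from the facet opposite to \<open>c\<close> into the simplex,
  so the normalised negative gradient points outward.\<close>

definition nrm :: "'a \<Rightarrow> 'a" where "nrm c = - (grd c /\<^sub>R norm (grd c))"

definition lev :: "'a \<Rightarrow> real" where "lev c = snd (bary c) / norm (grd c)"

lemma norm_nrm: "c \<in> C \<Longrightarrow> norm (nrm c) = 1"
  using grd_nz by (simp add: nrm_def)

lemma lam_nrm: "c \<in> C \<Longrightarrow> lam c x = norm (grd c) * (lev c - nrm c \<bullet> x)"
  using grd_nz[of c] by (simp add: lam_def nrm_def lev_def field_simps)

lemma lam_zero_iff: "c \<in> C \<Longrightarrow> lam c x = 0 \<longleftrightarrow> nrm c \<bullet> x = lev c"
  using lam_nrm[of c x] grd_nz[of c] by auto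

lemma nrm_edge:
  "c \<in> C \<Longrightarrow> a \<in> C \<Longrightarrow> b \<in> C \<Longrightarrow> a \<noteq> b \<Longrightarrow>
    nrm c \<bullet> (a - b) = (if c = a then -1 else if c = b then 1 else 0) / norm (grd c)"
  using grd_edge[of c a b] by (simp add: nrm_def divide_inverse)

lemma affine_hull_fac:
  assumes "c \<in> C"
  shows "affine hull (fac c) = {x. nrm c \<bullet> x = lev c}"
proof -
  have finD: "finite (C - {c})"
    using finite_C by simp
  have "affine hull (fac c) = affine hull (C - {c})"
    by (simp add: fac_def)
  also have "\<dots> = {x. lam c x = 0}"
  proof (intro set_eqI iffI)
    fix x assume "x \<in> affine hull (C - {c})"
    moreover have "affine {x. lam c x = 0}"
      using affine_hyperplane[of "nrm c" "lev c"] by (simp add: lam_zero_iff[OF assms])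
    moreover have "C - {c} \<subseteq> {x. lam c x = 0}"
      using assms by (auto simp: lam_vertex)
    ultimately show "x \<in> {x. lam c x = 0}"
      by (metis hull_minimal subsetD)
  next
    fix x assume "x \<in> {x. lam c x = 0}"
    then have "(\<Sum>c\<in>C - {c}. lam c x) = 1" "(\<Sum>c\<in>C - {c}. lam c x *\<^sub>R c) = x"
      using sum_lam[of x] sum_lam_scaleR[of x] assms finite_C by (auto simp: sum.remove)
    then show "x \<in> affine hull (C - {c})"
      unfolding affine_hull_finite[OF finD] by (intro CollectI exI[of _ "\<lambda>c. lam c x"]) auto
  qed
  finally show ?thesis
    by (simp add: lam_zero_iff[OF assms])
qed

lemma hyperplane_nrm: "c \<in> C \<Longrightarrow> hyperplane (nrm c)"
  by unfold_locales (rule norm_nrm)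

lemma aff_dim_fac: "c \<in> C \<Longrightarrow> aff_dim (fac c) = int DIM('a) - 1"
  using facet_of_K[of "fac c"] aff_dim_K by (auto simp: facet_of_def)

text \<open>Uniqueness: an admissible \<open>n\<close> takes the value \<open>b\<close> at every
  vertex but \<open>c\<close>, hence \<open>n \<bullet> x = b + r * lam c x\<close> for all
  \<open>x\<close> and \<open>n\<close> is \<open>r\<close> times \<open>grd c\<close>. The
  half-space condition at \<open>c\<close> gives the sign of \<open>r\<close>, the norm its
  size.\<close>

lemma outward_normal_fac:
  assumes c: "c \<in> C"
  shows "outward_normal K (fac c) = nrm c"
  unfolding outward_normal_def
proof (rule the_equality)
  have "nrm c \<bullet> x = lev c" if "x \<in> fac c" for x
    using that c by (simp add: mem_fac lam_zero_iff)
  moreover have "nrm c \<bullet> x \<le> lev c" if "x \<in> K" for x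
    using that c lam_nrm[OF c, of x] grd_nz[OF c] by (auto simp: mem_K zero_le_mult_iff)
  ultimately show "norm (nrm c) = 1 \<and> (\<exists>b. (\<forall>x\<in>fac c. nrm c \<bullet> x = b) \<and> (\<forall>x\<in>K. nrm c \<bullet> x \<le> b))"
    using norm_nrm[OF c] by blast
next
  fix n assume "norm n = 1 \<and> (\<exists>b. (\<forall>x\<in>fac c. n \<bullet> x = b) \<and> (\<forall>x\<in>K. n \<bullet> x \<le> b))"
  then obtain b where n: "norm n = 1" "\<And>x. x \<in> fac c \<Longrightarrow> n \<bullet> x = b" "\<And>x. x \<in> K \<Longrightarrow> n \<bullet> x \<le> b"
    by blast
  define r where "r = n \<bullet> c - b"
  have nx: "n \<bullet> x = b + r * lam c x" for x
  proof -
    have "n \<bullet> x = (\<Sum>c'\<in>C. lam c' x * (n \<bullet> c'))"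
      by (subst sum_lam_scaleR[of x, symmetric]) (simp add: inner_sum_right)
    also have "\<dots> = (\<Sum>c'\<in>C. b * lam c' x + (if c' = c then r * lam c x else 0))"
    proof (rule sum.cong)
      fix c' assume c': "c' \<in> C"
      have "n \<bullet> c' = b" if "c' \<noteq> c"
        using that c c' C_subset_K by (intro n(2)) (auto simp: mem_fac lam_vertex)
      then show "lam c' x * (n \<bullet> c') = b * lam c' x + (if c' = c then r * lam c x else 0)"
        by (auto simp: r_def algebra_simps)
    qed simp
    also have "\<dots> = b + r * lam c x"
      using c finite_C by (simp add: sum.distrib sum_distrib_left[symmetric] sum_lam)
    finally show ?thesis .
  qed
  have "n \<bullet> y = (r *\<^sub>R grd c) \<bullet> y" for y
    using nx[of y] nx[of 0] by (simp add: lam_def algebra_simps)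
  then have n_eq: "n = r *\<^sub>R grd c"
    by (metis inner_commute vector_eq_ldot)
  have "r \<le> 0"
    using n(3)[of c] c C_subset_K by (auto simp: r_def)
  moreover have "\<bar>r\<bar> * norm (grd c) = 1"
    using n(1) by (simp add: n_eq)
  ultimately have "r = - inverse (norm (grd c))"
    using grd_nz[OF c] by (simp add: field_simps)
  then show "n = nrm c"
    by (simp add: n_eq nrm_def)
qed

lemma boundary_integral_K: "boundary_integral K g = (\<Sum>c\<in>C. facet_integral (fac c) (g (nrm c)))"
proof -
  have "boundary_integral K g = (\<Sum>F\<in>fac ` C. facet_integral F (g (outward_normal K F)))"
    by (simp add: boundary_integral_def facets_K)
  also have "\<dots> = (\<Sum>c\<in>C. facet_integral (fac c) (g (outward_normal K (fac c))))"
    using fac_inj by (rule sum.reindex_cong) auto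
  also have "\<dots> = (\<Sum>c\<in>C. facet_integral (fac c) (g (nrm c)))"
    by (intro sum.cong) (auto simp: outward_normal_fac)
  finally show ?thesis .
qed

text \<open>At a relative interior point of the facet all other coordinates are positive and remain
  so nearby; only the sign of \<open>lam c\<close> then decides membership.\<close>

lemma half_ball:
  assumes c: "c \<in> C" and x: "x \<in> rel_interior (fac c)"
  obtains r where "r > 0" "\<And>y. y \<in> ball x r \<Longrightarrow> nrm c \<bullet> y \<le> lev c \<Longrightarrow> y \<in> K"
    "\<And>y. y \<in> ball x r \<Longrightarrow> nrm c \<bullet> y < lev c \<Longrightarrow> y \<in> interior K"
proof -
  define U where "U = (\<Inter>c'\<in>C - {c}. {y. lam c' y > 0})"
  have "open U"
    unfolding U_def using finite_C
    by (intro open_INT ballI) (auto intro!: open_Collect_less continuous_lam)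
  moreover have "x \<in> U"
    using x c by (auto simp: U_def mem_rel_interior_fac)
  ultimately obtain r where r: "r > 0" "ball x r \<subseteq> U"
    using open_contains_ball by blast
  have g: "norm (grd c) > 0"
    using grd_nz[OF c] by simp
  have U: "lam c' y > 0" if "y \<in> ball x r" "c' \<in> C" "c' \<noteq> c" for y c'
    using that r(2) unfolding U_def by blast
  show ?thesis
  proof (rule that[OF r(1)])
    fix y assume y: "y \<in> ball x r" "nrm c \<bullet> y \<le> lev c"
    then have "lam c y \<ge> 0"
      using g by (simp add: lam_nrm[OF c])
    then show "y \<in> K"
      using U[OF y(1)] unfolding mem_K by (metis less_imp_le)
  next
    fix y assume y: "y \<in> ball x r" "nrm c \<bullet> y < lev c"
    then have "lam c y > 0"
      using g by (simp add: lam_nrm[OF c])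
    then show "y \<in> interior K"
      using U[OF y(1)] unfolding mem_interior_K by metis
  qed
qed

text \<open>A point of the facet off its relative interior has a second vanishing coordinate, so it
  lies in the hull of the vertices without \<open>c\<close> and \<open>c'\<close>, of dimension
  \<open>DIM('a) - 2\<close>.\<close>

lemma rel_frontier_fac_null:
  assumes c: "c \<in> C"
  shows "emeasure (hyperplane_measure (affine hull (fac c))) (fac c - rel_interior (fac c)) = 0"
proof -
  interpret hyperplane "nrm c" "lev c"
    by (rule hyperplane_nrm[OF c])
  let ?E = "\<lambda>c'. {x. lam c x = 0 \<and> lam c' x = 0} \<inter> K"
  have sub: "fac c - rel_interior (fac c) \<subseteq> (\<Union>c'\<in>C - {c}. ?E c')"
    using c by (force simp: mem_fac mem_rel_interior_fac mem_K)
  have "emeasure (hyperplane_measure H) (?E c') = 0" if c': "c' \<in> C - {c}" for c'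
  proof (rule emeasure_hyperplane_measure_lowdim)
    show "?E c' \<subseteq> H"
      using lam_zero_iff[OF c] by auto
    have "C - (C - {c, c'}) = {c, c'}"
      using c c' by auto
    then have "convex hull (C - {c, c'}) = {x. (\<forall>a\<in>C - {c, c'}. 0 \<le> lam a x) \<and> lam c x = 0 \<and> lam c' x = 0}"
      using convex_hull_vertices[of "C - {c, c'}"] by auto
    also have "\<dots> = ?E c'"
      unfolding set_eq_iff mem_Collect_eq Int_iff mem_K by (metis DiffE DiffI insertCI insertE empty_iff order_refl)
    finally have "?E c' = convex hull (C - {c, c'})" ..
    moreover have "int (card (C - {c, c'})) = aff_dim (C - {c, c'}) + 1"
      by (intro aff_dim_affine_independent affine_independent_Diff indep)
    moreover have "card (C - {c, c'}) = DIM('a) - 1"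
      using c c' card_C finite_C by (auto simp: card_Diff_subset card_insert_if)
    ultimately show "aff_dim (?E c') + 1 < int DIM('a)"
      by (simp add: aff_dim_convex_hull of_nat_diff DIM_positive Suc_leI)
  qed
  moreover have "?E c' \<in> sets borel" for c'
    using compact_K
    by (intro borel_closed closed_Int closed_Collect_conj closed_Collect_eq)
      (auto intro: continuous_lam simp: compact_imp_closed)
  ultimately have null: "(\<Union>c'\<in>C - {c}. ?E c') \<in> null_sets (hyperplane_measure H)"
    using finite_C by (intro null_sets_UN' countable_finite null_setsI) auto
  have "emeasure (hyperplane_measure H) (fac c - rel_interior (fac c))
      \<le> emeasure (hyperplane_measure H) (\<Union>c'\<in>C - {c}. ?E c')"
    by (rule emeasure_mono[OF sub null_setsD2[OF null]])
  then show ?thesis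
    unfolding affine_hull_fac[OF c] null_setsD1[OF null] by simp
qed

end

lemma full_simplexI:
  fixes K :: "'a::euclidean_space set"
  assumes "int DIM('a) simplex K"
  obtains C where "full_simplex C K"
proof -
  obtain C where "\<not> affine_dependent C" "int (card C) = int DIM('a) + 1" "K = convex hull C"
    using assms unfolding simplex_def by auto
  then have "full_simplex C K"
    by unfold_locales auto
  then show ?thesis
    by (rule that)
qed

section \<open>Integrals of bounded measurable functions over elements and facets\<close>

text \<open>Bounded Borel rather than continuous: representatives of facet functions drop to 0 on
  relative boundaries. The class is closed under the pointwise operations in the forms and
  integrable over elements and facets alike.\<close>

definition bmeas :: "'a::euclidean_space set \<Rightarrow> ('a \<Rightarrow> 'b::euclidean_space) \<Rightarrow> bool" where
  "bmeas S f \<longleftrightarrow> f \<in> borel_measurable (restrict_space borel S) \<and> (\<exists>B. \<forall>x\<in>S. norm (f x) \<le> B)"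

lemma bmeas_cong: "(\<And>x. x \<in> S \<Longrightarrow> f x = g x) \<Longrightarrow> bmeas S f = bmeas S g"
  unfolding bmeas_def by (intro arg_cong2[of _ _ _ _ "(\<and>)"] measurable_cong) (auto simp: space_restrict_space)

lemma bmeas_subset: "bmeas T f \<Longrightarrow> S \<subseteq> T \<Longrightarrow> bmeas S f"
  using measurable_restrict_space2_iff
  unfolding bmeas_def by (meson measurable_restrict_mono subsetD)

lemma bmeas_const: "bmeas S (\<lambda>_. c)"
  unfolding bmeas_def by auto

lemma bmeas_continuous:
  assumes "continuous_on T f" "compact T" "S \<subseteq> T"
  shows "bmeas S f"
proof -
  have "bounded (f ` T)"
    using assms compact_continuous_image compact_imp_bounded by blast
  then obtain B where "\<forall>x\<in>T. norm (f x) \<le> B"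
    by (auto simp: bounded_iff)
  moreover have "f \<in> borel_measurable (restrict_space borel S)"
    using assms continuous_on_subset by (intro borel_measurable_continuous_on_restrict) blast
  ultimately show ?thesis
    using assms(3) unfolding bmeas_def by blast
qed

lemma bmeas_add: "bmeas S f \<Longrightarrow> bmeas S g \<Longrightarrow> bmeas S (\<lambda>x. f x + g x)"
  unfolding bmeas_def by (auto intro: norm_add_rule_thm intro!: exI)

lemma bmeas_bounded_linear:
  assumes h: "bounded_linear h" and f: "bmeas S f"
  shows "bmeas S (\<lambda>x. h (f x))"
proof -
  obtain B where B: "\<forall>x\<in>S. norm (f x) \<le> B"
    using f unfolding bmeas_def by blast
  obtain M where M: "\<And>x. norm (h x) \<le> norm x * M" "M > 0"
    using bounded_linear.pos_bounded[OF h] by auto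
  have "norm (h (f x)) \<le> B * M" if "x \<in> S" for x
    using order_trans[OF M(1)[of "f x"] mult_right_mono[of "norm (f x)" B M]] B M(2) that by simp
  moreover have "(\<lambda>x. h (f x)) \<in> borel_measurable (restrict_space borel S)"
    using f linear_continuous_on[OF h, of UNIV] unfolding bmeas_def
    by (intro borel_measurable_continuous_on[of h]) auto
  ultimately show ?thesis
    unfolding bmeas_def by blast
qed

lemma bmeas_bilinear:
  assumes p: "bounded_bilinear p" and f: "bmeas S f" and g: "bmeas S g"
  shows "bmeas S (\<lambda>x. p (f x) (g x))"
proof -
  obtain A where A: "\<forall>x\<in>S. norm (f x) \<le> A"
    using f unfolding bmeas_def by blast
  obtain B where B: "\<forall>x\<in>S. norm (g x) \<le> B"
    using g unfolding bmeas_def by blast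
  obtain M where M: "\<And>x y. norm (p x y) \<le> norm x * norm y * M" "M > 0"
    using bounded_bilinear.pos_bounded[OF p] by auto
  have "norm (p (f x) (g x)) \<le> A * B * M" if x: "x \<in> S" for x
  proof -
    have "norm (f x) * norm (g x) \<le> A * B"
      using A B x by (intro mult_mono) (auto intro: order_trans[OF norm_ge_zero])
    then have "norm (f x) * norm (g x) * M \<le> A * B * M"
      using M(2) by simp
    then show ?thesis
      using M(1)[of "f x" "g x"] by simp
  qed
  moreover have "(\<lambda>x. p (f x) (g x)) \<in> borel_measurable (restrict_space borel S)"
  proof (rule borel_measurable_continuous_Pair[where H = p])
    show "f \<in> borel_measurable (restrict_space borel S)" "g \<in> borel_measurable (restrict_space borel S)"
      using f g by (simp_all add: bmeas_def)
    show "continuous_on UNIV (\<lambda>x. p (fst x) (snd x))"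
      by (intro bounded_bilinear.continuous_on[OF p] continuous_on_fst continuous_on_snd continuous_on_id)
  qed
  ultimately show ?thesis
    unfolding bmeas_def by blast
qed

lemmas bmeas_inner = bmeas_bilinear[OF bounded_bilinear_inner]
lemmas bmeas_mult = bmeas_bilinear[OF bounded_bilinear_mult]
lemmas bmeas_scaleR = bmeas_bilinear[OF bounded_bilinear_scaleR]
lemmas bmeas_scaleR_const = bmeas_bounded_linear[OF bounded_linear_scaleR_right]

lemma bmeas_diff: "bmeas S f \<Longrightarrow> bmeas S g \<Longrightarrow> bmeas S (\<lambda>x. f x - g x)"
  using bmeas_add[of S f "\<lambda>x. (-1) *\<^sub>R g x"] bmeas_scaleR_const[of S g "-1"] by simp

lemma bmeas_sum:
  "(\<And>i. i \<in> I \<Longrightarrow> bmeas S (f i)) \<Longrightarrow> bmeas S (\<lambda>x. \<Sum>i\<in>I. f i x)"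
  by (induction I rule: infinite_finite_induct) (auto intro: bmeas_const bmeas_add)

abbreviation cell_integral :: "'a::euclidean_space set \<Rightarrow> ('a \<Rightarrow> real) \<Rightarrow> real" where
  "cell_integral S f \<equiv> (LINT x|lebesgue_on S. f x)"

lemma cell_integral_integrable:
  assumes "open S" "bounded S" "bmeas S f"
  shows "integrable (lebesgue_on S) f"
proof -
  have S: "S \<in> lmeasurable"
    using assms by (simp add: lmeasurable_open)
  then interpret finite_measure "lebesgue_on S"
    by (rule finite_measure_lebesgue_on)
  have "f \<in> borel_measurable (lebesgue_on S)"
  proof (rule borel_measurable_subalgebra)
    show "f \<in> borel_measurable (restrict_space borel S)"
      using assms(3) by (simp add: bmeas_def)
    show "sets (restrict_space borel S) \<subseteq> sets (lebesgue_on S)"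
      by (auto simp: sets_restrict_space)
  qed (simp add: space_restrict_space)
  moreover obtain B where "\<forall>x\<in>S. norm (f x) \<le> B"
    using assms(3) unfolding bmeas_def by blast
  ultimately show ?thesis
    by (intro integrable_const_bound[of _ B]) (auto intro!: AE_I2)
qed

lemma cell_integral_cong: "(\<And>x. x \<in> S \<Longrightarrow> f x = g x) \<Longrightarrow> cell_integral S f = cell_integral S g"
  by (intro Bochner_Integration.integral_cong) auto

lemma cell_integral_lin:
  assumes "open S" "bounded S" "bmeas S f" "bmeas S g"
  shows "cell_integral S (\<lambda>x. f x + c * g x) = cell_integral S f + c * cell_integral S g"
  using cell_integral_integrable[OF assms(1,2,3)] cell_integral_integrable[OF assms(1,2,4)] by simp

lemma cell_integral_nonneg: "(\<And>x. x \<in> S \<Longrightarrow> f x \<ge> 0) \<Longrightarrow> cell_integral S f \<ge> 0"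
  by (intro integral_nonneg_AE AE_I2) auto

text \<open>The set where \<open>f\<close> is nonzero is open and Lebesgue null, hence
  empty.\<close>

lemma cell_integral_eq_0_imp:
  assumes S: "open S" "bounded S" and f: "bmeas S f" "continuous_on S f" "\<And>x. x \<in> S \<Longrightarrow> f x \<ge> 0"
    and 0: "cell_integral S f = 0" and x: "x \<in> S"
  shows "f x = 0"
proof -
  define V where "V = {x \<in> S. f x \<noteq> 0}"
  have "V = S \<inter> f -` (- {0})"
    by (auto simp: V_def)
  then have "open V"
    using continuous_open_preimage[OF f(2) S(1), of "- {0}"] by auto
  have "AE x in lebesgue_on S. f x = 0"
    using 0 f(3) by (subst (asm) integral_nonneg_eq_0_iff_AE[OF cell_integral_integrable[OF S f(1)]]) (auto intro!: AE_I2)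
  then have "AE x in lebesgue. x \<notin> V"
    using S(1) by (subst (asm) AE_restrict_space_iff) (auto simp: V_def elim: eventually_mono)
  moreover have "V \<in> sets lebesgue"
    using \<open>open V\<close> by simp
  ultimately have "V \<in> null_sets lebesgue"
    by (simp add: AE_iff_null_sets)
  then have "negligible V"
    by (simp add: negligible_iff_null_sets)
  then have "V = {}"
    using \<open>open V\<close> open_not_negligible by blast
  then show ?thesis
    using x by (auto simp: V_def)
qed

text \<open>The simplex serves as a witness of the hyperplane, the compactness and the null relative
  boundary, so facet integrals can be treated without a mesh.\<close>

definition good_facet :: "'a::euclidean_space set \<Rightarrow> bool" where
  "good_facet F \<longleftrightarrow> (\<exists>K. int DIM('a) simplex K \<and> F facet_of K)"

lemma good_facetE:
  fixes F :: "'a::euclidean_space set"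
  assumes "good_facet F"
  obtains n b where "hyperplane n" "affine hull F = {x. n \<bullet> x = b}" "compact F" "convex F" "F \<noteq> {}"
    "aff_dim F = int DIM('a) - 1"
    "emeasure (hyperplane_measure {x. n \<bullet> x = b}) (F - rel_interior F) = 0"
proof -
  obtain K where K: "int DIM('a) simplex K" "F facet_of K"
    using assms unfolding good_facet_def by blast
  obtain C where "full_simplex C K"
    using full_simplexI[OF K(1)] .
  then interpret full_simplex C K .
  obtain c where c: "c \<in> C" "F = fac c"
    using K(2) facet_of_K by blast
  show ?thesis
  proof (rule that[of "nrm c" "lev c"])
    show "emeasure (hyperplane_measure {x. nrm c \<bullet> x = lev c}) (F - rel_interior F) = 0"
      using rel_frontier_fac_null[OF c(1)] unfolding c(2) affine_hull_fac[OF c(1)] .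
    show "F \<noteq> {}"
      using K(2) by (simp add: facet_of_def)
    show "compact F" "convex F"
      by (simp_all add: c(2) fac_def finite_imp_compact_convex_hull finite_C)
  qed (use c in \<open>simp_all add: hyperplane_nrm affine_hull_fac aff_dim_fac\<close>)
qed

lemma good_facet_borel: "good_facet F \<Longrightarrow> F \<in> sets borel" "good_facet F \<Longrightarrow> rel_interior F \<in> sets borel"
proof -
  assume F: "good_facet F"
  obtain n b where "affine hull F = {x. n \<bullet> x = b}" "compact F"
    using F by (rule good_facetE)
  then show "F \<in> sets borel"
    by (simp add: borel_compact)
  obtain T where "open T" "rel_interior F = affine hull F \<inter> T"
    using openin_rel_interior[of F] by (auto simp: openin_open)
  then show "rel_interior F \<in> sets borel"
    by (simp add: borel_open borel_closed sets.Int)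
qed

lemma facet_set_integrable:
  assumes F: "good_facet F" and f: "bmeas F f"
  shows "set_integrable (hyperplane_measure (affine hull F)) F f"
proof -
  obtain n b where nb: "hyperplane n" "affine hull F = {x. n \<bullet> x = b}" "compact F"
    using F by (rule good_facetE)
  interpret hyperplane n b
    by (rule nb(1))
  obtain B where B: "\<forall>x\<in>F. norm (f x) \<le> B"
    using f unfolding bmeas_def by blast
  have FB: "F \<in> sets borel"
    using F by (rule good_facet_borel)
  have m: "(\<lambda>x. indicator F x *\<^sub>R f x) \<in> borel_measurable borel"
    using f FB unfolding bmeas_def by (subst (asm) borel_measurable_restrict_space_iff) auto
  show ?thesis
    unfolding set_integrable_def nb(2)
  proof (rule integrableI_bounded_set[where A = F and B = B])
    show "(\<lambda>x. indicator F x *\<^sub>R f x) \<in> borel_measurable (hyperplane_measure H)"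
      using m by (simp cong: measurable_cong_sets)
    show "emeasure (hyperplane_measure H) F < \<infinity>"
      using nb(3) by (intro emeasure_hyperplane_measure_bounded compact_imp_bounded)
  qed (use B FB in \<open>auto intro!: AE_I2 simp: indicator_def\<close>)
qed

lemma facet_integral_cong: "(\<And>x. x \<in> F \<Longrightarrow> f x = g x) \<Longrightarrow> facet_integral F f = facet_integral F g"
  by (auto simp: facet_integral_def set_lebesgue_integral_def indicator_def
      intro!: Bochner_Integration.integral_cong)

lemma facet_integral_lin:
  assumes "good_facet F" "bmeas F f" "bmeas F g"
  shows "facet_integral F (\<lambda>x. f x + c * g x) = facet_integral F f + c * facet_integral F g"
  using facet_set_integrable[OF assms(1,2)] facet_set_integrable[OF assms(1,3)]
  unfolding facet_integral_def by (subst set_integral_add) (auto intro: set_integrable_mult_right)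

lemma facet_integral_nonneg: "(\<And>x. x \<in> F \<Longrightarrow> f x \<ge> 0) \<Longrightarrow> facet_integral F f \<ge> 0"
  unfolding facet_integral_def set_lebesgue_integral_def
  by (intro integral_nonneg_AE AE_I2) (auto simp: indicator_def)

text \<open>This is how integrands known only on the relative interior are evaluated: the rest of
  the facet is a null set.\<close>

lemma facet_integral_cong_rel_interior:
  assumes F: "good_facet F" and f: "bmeas F f" and g: "bmeas F g"
    and eq: "\<And>x. x \<in> rel_interior F \<Longrightarrow> f x = g x"
  shows "facet_integral F f = facet_integral F g"
proof -
  obtain n b where nb: "hyperplane n" "affine hull F = {x. n \<bullet> x = b}"
     and null: "emeasure (hyperplane_measure {x. n \<bullet> x = b}) (F - rel_interior F) = 0"
    using F by (rule good_facetE)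
  interpret hyperplane n b
    by (rule nb(1))
  have "F - rel_interior F \<in> null_sets (hyperplane_measure H)"
    using null good_facet_borel[OF F] by (intro null_setsI) auto
  then have "AE x in hyperplane_measure H. x \<notin> F - rel_interior F"
    by (rule AE_not_in)
  then have "AE x in hyperplane_measure H. indicator F x *\<^sub>R f x = indicator F x *\<^sub>R g x"
    by eventually_elim (use eq in \<open>auto simp: indicator_def\<close>)
  moreover have "(\<lambda>x. indicator F x *\<^sub>R f x) \<in> borel_measurable (hyperplane_measure H)"
    "(\<lambda>x. indicator F x *\<^sub>R g x) \<in> borel_measurable (hyperplane_measure H)"
    using facet_set_integrable[OF F f] facet_set_integrable[OF F g] nb(2)
    by (simp_all add: set_integrable_def borel_measurable_integrable)
  ultimately show ?thesis
    unfolding facet_integral_def set_lebesgue_integral_def nb(2) by (intro integral_cong_AE)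
qed

text \<open>By continuity a nonzero value at a relative interior point persists on a relative ball,
  and such a ball has positive surface measure, so no null set contains it.\<close>

lemma facet_integral_eq_0_imp:
  assumes F: "good_facet F" and f: "bmeas F f" "continuous_on (rel_interior F) f" "\<And>x. x \<in> F \<Longrightarrow> f x \<ge> 0"
    and 0: "facet_integral F f = 0" and x: "x \<in> rel_interior F"
  shows "f x = 0"
proof (rule ccontr)
  assume fx: "f x \<noteq> 0"
  obtain n b where nb: "hyperplane n" "affine hull F = {x. n \<bullet> x = b}"
    using F by (rule good_facetE)
  interpret hyperplane n b
    by (rule nb(1))
  have int: "integrable (hyperplane_measure H) (\<lambda>x. indicator F x *\<^sub>R f x)"
    using facet_set_integrable[OF F f(1)] unfolding set_integrable_def nb(2) .
  have "AE x in hyperplane_measure H. indicator F x *\<^sub>R f x = 0"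
  proof (subst integral_nonneg_eq_0_iff_AE[OF int, symmetric])
    show "AE x in hyperplane_measure H. 0 \<le> indicator F x *\<^sub>R f x"
      using f(3) by (intro AE_I2) (auto simp: indicator_def)
    show "(\<integral>x. indicator F x *\<^sub>R f x \<partial>hyperplane_measure H) = 0"
      using 0 unfolding facet_integral_def set_lebesgue_integral_def nb(2) .
  qed
  then obtain N where N: "N \<in> null_sets (hyperplane_measure H)" "{x. indicator F x *\<^sub>R f x \<noteq> 0} \<subseteq> N"
    by (auto elim!: AE_E simp: null_sets_def)
  obtain T where T: "open T" "rel_interior F = affine hull F \<inter> T"
    using openin_rel_interior[of F] by (auto simp: openin_open)
  obtain r where r: "r > 0" "ball x r \<subseteq> T"
    using T x open_contains_ball by blast
  obtain d where d: "d > 0" "\<And>y. y \<in> rel_interior F \<Longrightarrow> dist y x < d \<Longrightarrow> dist (f y) (f x) < \<bar>f x\<bar>"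
    using f(2) x fx unfolding continuous_on_iff by (metis zero_less_abs_iff)
  have "ball x (min r d) \<inter> H \<subseteq> N"
  proof
    fix y assume y: "y \<in> ball x (min r d) \<inter> H"
    then have yr: "y \<in> rel_interior F"
      using T(2) r(2) nb(2) by auto
    moreover have "f y \<noteq> 0"
      using d(2)[OF yr] y by (auto simp: dist_commute dist_real_def)
    ultimately have "indicator F y *\<^sub>R f y \<noteq> 0"
      using rel_interior_subset[of F] by auto
    then show "y \<in> N"
      using N(2) by blast
  qed
  then have "emeasure (hyperplane_measure H) (ball x (min r d) \<inter> H) \<le> emeasure (hyperplane_measure H) N"
    using N(1) by (intro emeasure_mono) auto
  moreover have "0 < emeasure (hyperplane_measure H) (ball x (min r d) \<inter> H)"
    using x T(2) nb(2) r(1) d(1) by (intro emeasure_hyperplane_measure_ball_pos) auto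
  ultimately show False
    using N(1) by auto
qed

lemma facet_integral_one_pos:
  assumes F: "good_facet F"
  shows "facet_integral F (\<lambda>_. 1) > 0"
proof (rule ccontr)
  assume "\<not> ?thesis"
  then have 0: "facet_integral F (\<lambda>_. 1) = 0"
    using facet_integral_nonneg[of F "\<lambda>_. 1"] by simp
  have "rel_interior F \<noteq> {}"
    using F by (rule good_facetE) (simp add: rel_interior_eq_empty)
  then show False
    using facet_integral_eq_0_imp[OF F bmeas_const continuous_on_const _ 0] by auto
qed

text \<open>A smaller dimension would make the affine hull of the intersection a null set, and
  together with the relative boundary it covers \<open>A \<inter> F\<close>. The affine dimension is
  the form in which the argument for strain-free fields uses positive area.\<close>

lemma facet_positive_area_aff_dim:
  fixes F :: "'a::euclidean_space set"
  assumes F: "good_facet F" and A: "emeasure (hyperplane_measure (affine hull F)) (A \<inter> F) > 0"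
  shows "aff_dim (A \<inter> rel_interior F) = int DIM('a) - 1"
proof (rule ccontr)
  assume neq: "aff_dim (A \<inter> rel_interior F) \<noteq> int DIM('a) - 1"
  obtain n b where nb: "hyperplane n" "affine hull F = {x. n \<bullet> x = b}" "aff_dim F = int DIM('a) - 1"
     and null: "emeasure (hyperplane_measure {x. n \<bullet> x = b}) (F - rel_interior F) = 0"
    using F by (rule good_facetE)
  interpret hyperplane n b
    by (rule nb(1))
  have sub: "A \<inter> rel_interior F \<subseteq> F"
    using rel_interior_subset by blast
  have "aff_dim (A \<inter> rel_interior F) \<le> aff_dim F"
    by (rule aff_dim_subset[OF sub])
  then have "aff_dim (affine hull (A \<inter> rel_interior F)) + 1 < int DIM('a)"
    using neq nb(3) by simp
  moreover have "affine hull (A \<inter> rel_interior F) \<subseteq> H"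
    using hull_mono[OF sub] nb(2) by metis
  ultimately have "emeasure (hyperplane_measure H) (affine hull (A \<inter> rel_interior F)) = 0"
    by (intro emeasure_hyperplane_measure_lowdim)
  then have n1: "affine hull (A \<inter> rel_interior F) \<in> null_sets (hyperplane_measure H)"
    by (intro null_setsI) auto
  moreover have "F - rel_interior F \<in> null_sets (hyperplane_measure H)"
    using null good_facet_borel[OF F] by (intro null_setsI) auto
  ultimately have n2: "affine hull (A \<inter> rel_interior F) \<union> (F - rel_interior F) \<in> null_sets (hyperplane_measure H)"
    by (rule null_sets.Un)
  have "A \<inter> F \<subseteq> affine hull (A \<inter> rel_interior F) \<union> (F - rel_interior F)"
    by (auto intro: hull_inc)
  then have "emeasure (hyperplane_measure H) (A \<inter> F) \<le> 0"
    using emeasure_mono[OF _ null_setsD2[OF n2]] null_setsD1[OF n2] by metis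
  then show False
    using A nb(2) by simp
qed

section \<open>The divergence theorem along an edge of a simplex\<close>

lemma (in hyperplane) AE_hyperplane: "AE y in hyperplane_measure H. y \<in> H"
proof (rule AE_I)
  have "{x \<in> slab n b. x - (n \<bullet> x - b) *\<^sub>R n \<in> - H} = {}"
    by (auto simp: inner_diff_right nn)
  then show "emeasure (hyperplane_measure H) (- H) = 0"
    using emeasure_hyperplane_measure[OF borel_comp[OF H_borel]] by (simp only: emeasure_empty)
qed (use H_borel in \<open>auto intro: borel_comp\<close>)

lemma cell_integral_eq_lborel:
  fixes f :: "'a::euclidean_space \<Rightarrow> real"
  assumes "open S" "f \<in> borel_measurable borel"
  shows "cell_integral S f = (\<integral>x. indicator S x * f x \<partial>lborel)"
proof -
  have "cell_integral S f = (\<integral>x. indicator S x *\<^sub>R f x \<partial>lebesgue)"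
    using assms(1) by (intro integral_restrict_space) auto
  also have "\<dots> = (\<integral>x. indicator S x *\<^sub>R f x \<partial>lborel)"
    using assms by (intro integral_completion) (auto intro: borel_open)
  finally show ?thesis
    by simp
qed

lemma integral_derivative_open_interval:
  fixes F f :: "real \<Rightarrow> real"
  assumes "0 \<le> l" "\<And>s. (F has_real_derivative f s) (at s)" "continuous_on UNIV f"
  shows "(\<integral>s. indicator {0<..<l} s * f s \<partial>lborel) = F l - F 0"
proof -
  have [measurable]: "f \<in> borel_measurable borel"
    using assms(3) by (rule borel_measurable_continuous_onI)
  have "(\<integral>s. indicator {0<..<l} s * f s \<partial>lborel) = (\<integral>s. indicator {0..l} s *\<^sub>R f s \<partial>lborel)"
  proof (intro integral_cong_AE)
    show "AE s in lborel. indicator {0<..<l} s * f s = indicator {0..l} s *\<^sub>R f s"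
      using AE_lborel_singleton[of 0] AE_lborel_singleton[of l]
      by eventually_elim (auto simp: indicator_def)
  qed measurable
  also have "\<dots> = F l - F 0"
    using assms
    by (intro integral_FTC_atLeastAtMost)
      (auto simp: has_real_derivative_iff_has_vector_derivative[symmetric]
        intro: continuous_on_subset has_field_derivative_at_within)
  finally show ?thesis .
qed

context full_simplex
begin

text \<open>Moving along \<open>a - b\<close> trades the coordinate of \<open>b\<close> for that of
  \<open>a\<close> and leaves all others fixed. A line starting on the facet opposite to
  \<open>a\<close> therefore leaves \<open>K\<close> exactly when the coordinate of \<open>b\<close>
  is used up.\<close>

lemma edge_line_interior:
  assumes ab: "a \<in> C" "b \<in> C" "a \<noteq> b" and y: "lam a y = 0"
  shows "y + s *\<^sub>R (a - b) \<in> interior K \<longleftrightarrow> 0 < s \<and> s < lam b y \<and> y \<in> rel_interior (fac a)"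
proof -
  have l: "lam c (y + s *\<^sub>R (a - b)) = (if c = a then s else if c = b then lam b y - s else lam c y)" if "c \<in> C" for c
    using grd_edge[OF that ab] y by (auto simp: lam_add)
  have "y + s *\<^sub>R (a - b) \<in> interior K \<longleftrightarrow>
      (\<forall>c\<in>C. 0 < (if c = a then s else if c = b then lam b y - s else lam c y))"
    unfolding mem_interior_K using l by auto
  also have "\<dots> \<longleftrightarrow> 0 < s \<and> s < lam b y \<and> (\<forall>c\<in>C - {a, b}. 0 < lam c y)"
    using ab by (auto split: if_splits)
  also have "\<dots> \<longleftrightarrow> 0 < s \<and> s < lam b y \<and> y \<in> rel_interior (fac a)"
    unfolding mem_rel_interior_fac[OF ab(1)] using ab y by fastforce
  finally show ?thesis .
qed

lemma good_facet_fac: "c \<in> C \<Longrightarrow> good_facet (fac c)"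
proof -
  assume "c \<in> C"
  moreover have "int DIM('a) simplex K"
    using indep card_C K_eq unfolding simplex_def by auto
  ultimately show ?thesis
    unfolding good_facet_def using facet_of_K by blast
qed

text \<open>Divergence theorem for the field \<open>h\<close> times \<open>a - b\<close>: lines in
  this direction enter \<open>K\<close> through the facet opposite to \<open>a\<close> and leave
  through the one opposite to \<open>b\<close>, where \<open>h\<close> vanishes; they are parallel
  to all other facets. So a single facet integral remains.\<close>

lemma cell_integral_edge_derivative:
  fixes h D :: "'a \<Rightarrow> real"
  assumes ab: "a \<in> C" "b \<in> C" "a \<noteq> b"
    and D: "\<And>x s. ((\<lambda>s. h (x + s *\<^sub>R (a - b))) has_real_derivative D (x + s *\<^sub>R (a - b))) (at s)"
    and cont: "continuous_on UNIV D" "continuous_on UNIV h"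
    and h0: "\<And>x. lam b x = 0 \<Longrightarrow> h x = 0"
  shows "cell_integral (interior K) D = (nrm a \<bullet> (a - b)) * facet_integral (fac a) h"
proof -
  interpret hyperplane "nrm a" "lev a"
    by (rule hyperplane_nrm[OF ab(1)])
  define \<tau> where "\<tau> = nrm a \<bullet> (a - b)"
  have \<tau>: "\<tau> < 0"
    using nrm_edge[OF ab(1) ab] grd_nz[OF ab(1)] by (simp add: \<tau>_def)
  \<comment> \<open>\<open>\<tau>\<close> is negative because \<open>a - b\<close> points into
    \<open>K\<close> from the facet opposite to \<open>a\<close>; dividing by it gives the unit
    normal component required for integration over lines.\<close>
  define t where "t = (a - b) /\<^sub>R \<tau>"
  have nt: "nrm a \<bullet> t = 1"
    using \<tau> by (simp add: t_def \<tau>_def)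
  define G where "G x = indicator (interior K) x * D x" for x
  have [measurable]: "D \<in> borel_measurable borel" "h \<in> borel_measurable borel"
    using cont by (auto intro: borel_measurable_continuous_onI)
  have [measurable]: "G \<in> borel_measurable borel"
    unfolding G_def by (intro borel_measurable_times borel_measurable_indicator) auto
  have "integrable lborel G"
  proof -
    have "bounded (D ` K)"
      using cont(1) compact_K by (intro compact_imp_bounded compact_continuous_image continuous_on_subset[OF cont(1)]) auto
    then obtain B where "\<forall>x\<in>K. norm (D x) \<le> B"
      by (auto simp: bounded_iff)
    then show ?thesis
      using emeasure_bounded_finite[OF compact_imp_bounded[OF compact_K]] compact_K interior_subset[of K]
      by (intro integrableI_bounded_set[where A = K and B = B])
        (auto intro!: AE_I2 simp: G_def indicator_def borel_compact)
  qed
  have inner: "(\<integral>s. G (y + s *\<^sub>R t) \<partial>lborel) = \<tau> * (indicator (fac a) y *\<^sub>R h y)"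
    if y: "y \<in> H" "y \<notin> fac a - rel_interior (fac a)" for y
  proof -
    have ly: "lam a y = 0"
      using y(1) lam_zero_iff[OF ab(1)] by simp
    \<comment> \<open>The substitution by the factor \<open>\<tau> < 0\<close> contributes
      \<open>\<bar>\<tau>\<bar> = - \<tau>\<close>, which cancels the minus sign of the value at the
      lower end of the line.\<close>
    have "(\<integral>s. G (y + s *\<^sub>R t) \<partial>lborel) = \<bar>\<tau>\<bar> *\<^sub>R (\<integral>s. G (y + (0 + \<tau> * s) *\<^sub>R t) \<partial>lborel)"
      using \<tau> by (intro lborel_integral_real_affine) simp
    also have "(\<lambda>s. G (y + (0 + \<tau> * s) *\<^sub>R t)) = (\<lambda>s. G (y + s *\<^sub>R (a - b)))"
    proof (rule ext, rule arg_cong[of _ _ G])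
      fix s
      have "\<tau> * s * inverse \<tau> = s"
        using \<tau> by (simp add: field_simps)
      then show "y + (0 + \<tau> * s) *\<^sub>R t = y + s *\<^sub>R (a - b)"
        by (simp add: t_def)
    qed
    also have "(\<integral>s. G (y + s *\<^sub>R (a - b)) \<partial>lborel) = - (indicator (fac a) y *\<^sub>R h y)"
    proof (cases "y \<in> rel_interior (fac a)")
      case True
      then have yF: "y \<in> fac a" and lb: "lam b y > 0"
        using ab rel_interior_subset mem_rel_interior_fac[OF ab(1)] by blast+
      have "(\<integral>s. G (y + s *\<^sub>R (a - b)) \<partial>lborel)
          = (\<integral>s. indicator {0<..<lam b y} s * D (y + s *\<^sub>R (a - b)) \<partial>lborel)"
        using edge_line_interior[OF ab ly] True
        by (intro Bochner_Integration.integral_cong) (auto simp: G_def indicator_def)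
      also have "\<dots> = h (y + lam b y *\<^sub>R (a - b)) - h (y + 0 *\<^sub>R (a - b))"
        using lb D
        by (intro integral_derivative_open_interval[where F = "\<lambda>s. h (y + s *\<^sub>R (a - b))"])
          (auto intro!: continuous_on_compose2[OF cont(1)] continuous_intros)
      also have "h (y + lam b y *\<^sub>R (a - b)) = 0"
        using grd_edge[OF ab(2) ab] ab(3) by (intro h0) (simp add: lam_add)
      finally show ?thesis
        using yF by simp
    next
      case False
      then have "y \<notin> fac a"
        using y(2) by blast
      moreover have "G (y + s *\<^sub>R (a - b)) = 0" for s
        using edge_line_interior[OF ab ly, of s] False by (simp add: G_def)
      ultimately show ?thesis
        by simp
    qed
    finally show ?thesis
      using \<tau> by simp
  qed
  have F: "good_facet (fac a)"
    using ab(1) by (rule good_facet_fac)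
  have "fac a - rel_interior (fac a) \<in> null_sets (hyperplane_measure H)"
    using rel_frontier_fac_null[OF ab(1)] good_facet_borel[OF F] affine_hull_fac[OF ab(1)]
    by (intro null_setsI) auto
  then have "AE y in hyperplane_measure H. y \<notin> fac a - rel_interior (fac a)"
    by (rule AE_not_in)
  then have AE: "AE y in hyperplane_measure H. (\<integral>s. G (y + s *\<^sub>R t) \<partial>lborel) = \<tau> * (indicator (fac a) y *\<^sub>R h y)"
    using AE_hyperplane by eventually_elim (rule inner)
  have "cell_integral (interior K) D = (\<integral>x. G x \<partial>lborel)"
    unfolding G_def by (rule cell_integral_eq_lborel) auto
  also have "\<dots> = (\<integral>y. (\<integral>s. G (y + s *\<^sub>R t) \<partial>lborel) \<partial>hyperplane_measure H)"
    by (rule integral_lborel_lines[OF nt \<open>integrable lborel G\<close>])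
  also have "\<dots> = (\<integral>y. \<tau> * (indicator (fac a) y *\<^sub>R h y) \<partial>hyperplane_measure H)"
  proof (rule integral_cong_AE[OF _ _ AE])
    show "(\<lambda>y. \<integral>s. G (y + s *\<^sub>R t) \<partial>lborel) \<in> borel_measurable (hyperplane_measure H)"
      by measurable
    show "(\<lambda>y. \<tau> * (indicator (fac a) y *\<^sub>R h y)) \<in> borel_measurable (hyperplane_measure H)"
      using good_facet_borel[OF F] by measurable
  qed
  also have "\<dots> = \<tau> * facet_integral (fac a) h"
    unfolding facet_integral_def set_lebesgue_integral_def affine_hull_fac[OF ab(1)] by simp
  finally show ?thesis
    by (simp add: \<tau>_def)
qed

end

section \<open>Polynomials\<close>

definition mpow :: "('d::finite \<Rightarrow> nat) \<Rightarrow> real^'d \<Rightarrow> real" where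
  "mpow e = (\<lambda>x. \<Prod>i\<in>UNIV. (x $ i) ^ e i)"

lemma sum_fun_apply: "(\<Sum>i\<in>I. f i) x = (\<Sum>i\<in>I. f i x)"
  by (induction I rule: infinite_finite_induct) auto

lemma finite_exponents: "finite {e :: 'd::finite \<Rightarrow> nat. (\<Sum>i\<in>UNIV. e i) \<le> k}"
proof (rule finite_subset)
  show "{e :: 'd \<Rightarrow> nat. (\<Sum>i\<in>UNIV. e i) \<le> k} \<subseteq> UNIV \<rightarrow>\<^sub>E {..k}"
  proof safe
    fix e :: "'d \<Rightarrow> nat" and i assume "(\<Sum>i\<in>UNIV. e i) \<le> k"
    moreover have "e i \<le> (\<Sum>i\<in>UNIV. e i)"
      by (rule member_le_sum) auto
    ultimately show "e i \<le> k"
      by linarith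
  qed auto
  show "finite ((UNIV :: 'd set) \<rightarrow>\<^sub>E {..k})"
    by (rule finite_PiE) auto
qed

lemma polys_eq:
  "polys k = {p. \<exists>c. p = (\<Sum>e | (\<Sum>i\<in>UNIV. e i) \<le> k. c e *\<^sub>R mpow (e :: 'd::finite \<Rightarrow> nat))}"
proof -
  have "(\<lambda>x. \<Sum>e | (\<Sum>i\<in>UNIV. e i) \<le> k. c e * (\<Prod>i\<in>UNIV. (x $ i) ^ e i))
      = (\<Sum>e | (\<Sum>i\<in>UNIV. e i) \<le> k. c e *\<^sub>R mpow (e :: 'd \<Rightarrow> nat))" for c
    by (simp add: fun_eq_iff sum_fun_apply mpow_def)
  then show ?thesis
    unfolding polys_def by simp
qed

lemma mpow_in_polys:
  fixes e :: "'d::finite \<Rightarrow> nat"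
  assumes "(\<Sum>i\<in>UNIV. e i) \<le> k"
  shows "mpow e \<in> polys k"
proof -
  have "mpow e = (\<Sum>e' | (\<Sum>i\<in>UNIV. e' i) \<le> k. (if e' = e then 1 else 0) *\<^sub>R mpow e')"
    using assms finite_exponents[where 'd = 'd, of k]
    by (simp add: if_distrib[of "\<lambda>c. c *\<^sub>R _"] cong: if_cong)
  then show ?thesis
    unfolding polys_eq by (intro CollectI exI[of _ "\<lambda>e'. if e' = e then 1 else 0"])
qed

lemma subspace_polys: "subspace (polys k)"
proof (rule subspaceI)
  show "0 \<in> polys k"
    unfolding polys_eq by (auto intro!: exI[of _ "\<lambda>_. 0"])
next
  fix p q :: "real^'a \<Rightarrow> real" assume "p \<in> polys k" "q \<in> polys k"
  then obtain c d where "p = (\<Sum>e | sum e UNIV \<le> k. c e *\<^sub>R mpow e)" "q = (\<Sum>e | sum e UNIV \<le> k. d e *\<^sub>R mpow e)"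
    unfolding polys_eq by auto
  then have "p + q = (\<Sum>e | sum e UNIV \<le> k. (c e + d e) *\<^sub>R mpow e)"
    by (simp add: sum.distrib scaleR_add_left)
  then show "p + q \<in> polys k"
    unfolding polys_eq by (intro CollectI exI[of _ "\<lambda>e. c e + d e"]) simp
next
  fix r and p :: "real^'a \<Rightarrow> real" assume "p \<in> polys k"
  then obtain c where "p = (\<Sum>e | sum e UNIV \<le> k. c e *\<^sub>R mpow e)"
    unfolding polys_eq by auto
  then have "r *\<^sub>R p = (\<Sum>e | sum e UNIV \<le> k. (r * c e) *\<^sub>R mpow e)"
    by (simp add: scaleR_sum_right)
  then show "r *\<^sub>R p \<in> polys k"
    unfolding polys_eq by (intro CollectI exI[of _ "\<lambda>e. r * c e"]) simp
qed

text \<open>Serves as an induction principle: a property of polynomials that defines a subspace need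
  only be checked on monomials.\<close>

lemma polys_subset_subspace:
  assumes "subspace S" "\<And>e. (\<Sum>i\<in>UNIV. e i) \<le> k \<Longrightarrow> mpow e \<in> S"
  shows "polys k \<subseteq> S"
  using assms unfolding polys_eq by (auto intro!: subspace_sum subspace_scale)

lemma fin_dim_polys: "fin_dim (polys k)"
  unfolding fin_dim_def
proof (intro exI conjI)
  show "finite (mpow ` {e :: 'a \<Rightarrow> nat. (\<Sum>i\<in>UNIV. e i) \<le> k})"
    by (intro finite_imageI finite_exponents)
  show "polys k \<subseteq> span (mpow ` {e :: 'a \<Rightarrow> nat. (\<Sum>i\<in>UNIV. e i) \<le> k})"
    by (intro polys_subset_subspace subspace_span span_base) auto
qed

lemma polys_mono: "k \<le> m \<Longrightarrow> polys k \<subseteq> polys m"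
  by (intro polys_subset_subspace subspace_polys mpow_in_polys) auto

lemma polys_const: "(\<lambda>_. c) \<in> polys k"
proof -
  have "c *\<^sub>R mpow (\<lambda>_. 0) \<in> polys k"
    by (intro subspace_scale subspace_polys mpow_in_polys) simp
  then show ?thesis
    by (simp add: mpow_def scaleR_fun_def)
qed

lemma polys_add: "p \<in> polys k \<Longrightarrow> q \<in> polys k \<Longrightarrow> (\<lambda>x. p x + q x) \<in> polys k"
  using subspace_add[OF subspace_polys, of p k q] by (simp add: plus_fun_def)

lemma polys_scale: "p \<in> polys k \<Longrightarrow> (\<lambda>x. c * p x) \<in> polys k"
  using subspace_scale[OF subspace_polys, of p k c] by (simp add: scaleR_fun_def)

lemma polys_diff: "p \<in> polys k \<Longrightarrow> q \<in> polys k \<Longrightarrow> (\<lambda>x. p x - q x) \<in> polys k"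
  using polys_add[of p k "\<lambda>x. -1 * q x"] polys_scale[of q k "-1"] by simp

lemma polys_sum: "(\<And>i. i \<in> I \<Longrightarrow> p i \<in> polys k) \<Longrightarrow> (\<lambda>x. \<Sum>i\<in>I. p i x) \<in> polys k"
  by (induction I rule: infinite_finite_induct) (auto intro: polys_add polys_const)

lemma mpow_coord_mult: "x $ i * mpow e x = mpow (e(i := Suc (e i))) x"
proof -
  have "mpow e x = (x $ i) ^ e i * (\<Prod>j\<in>UNIV - {i}. (x $ j) ^ e j)" for e
    unfolding mpow_def by (subst prod.remove[of UNIV i]) auto
  note split = this
  have "(\<Prod>j\<in>UNIV - {i}. (x $ j) ^ (e(i := Suc (e i))) j) = (\<Prod>j\<in>UNIV - {i}. (x $ j) ^ e j)"
    by (intro prod.cong) auto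
  then show ?thesis
    unfolding split[of e] split[of "e(i := Suc (e i))"] by simp
qed

lemma polys_coord_mult:
  assumes "p \<in> polys k"
  shows "(\<lambda>x. x $ i * p x) \<in> polys (Suc k)"
proof -
  have "polys k \<subseteq> {p. (\<lambda>x. x $ i * p x) \<in> polys (Suc k)}"
  proof (rule polys_subset_subspace)
    show "subspace {p. (\<lambda>x. x $ i * p x) \<in> polys (Suc k)}"
      by (auto simp: subspace_def distrib_left polys_const mult.left_commute intro: polys_add polys_scale)
    fix e :: "'a \<Rightarrow> nat" assume e: "(\<Sum>i\<in>UNIV. e i) \<le> k"
    have "(\<Sum>j\<in>UNIV. (e(i := Suc (e i))) j) = Suc (\<Sum>j\<in>UNIV. e j)"
      by (simp add: sum.remove[of UNIV i])
    then have "mpow (e(i := Suc (e i))) \<in> polys (Suc k)"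
      using e by (intro mpow_in_polys) simp
    then show "mpow e \<in> {p. (\<lambda>x. x $ i * p x) \<in> polys (Suc k)}"
      by (simp add: mpow_coord_mult)
  qed
  then show ?thesis
    using assms by blast
qed

lemma polys_affine_mult:
  assumes "p \<in> polys k"
  shows "(\<lambda>x. (A \<bullet> x + \<beta>) * p x) \<in> polys (Suc k)"
proof -
  have "(\<lambda>x. (\<Sum>i\<in>UNIV. A $ i * (x $ i * p x)) + \<beta> * p x) \<in> polys (Suc k)"
    using assms polys_mono[of k "Suc k"]
    by (intro polys_add polys_sum polys_scale polys_coord_mult) auto
  then show ?thesis
    by (simp add: inner_vec_def distrib_right sum_distrib_right mult.assoc)
qed

text \<open>One coordinate is split off every nonconstant monomial. This is the induction step on
  the degree for derivatives and, later, the source of the barycentric factors on a facet.\<close>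

lemma polys_decompose:
  fixes p :: "real^'d \<Rightarrow> real"
  assumes "p \<in> polys (Suc k)"
  obtains c \<phi> where "\<And>i. \<phi> i \<in> polys k" "\<And>x. p x = c + (\<Sum>i\<in>UNIV. x $ i * \<phi> i x)"
proof -
  define S where "S = {p. \<exists>c \<phi>. (\<forall>i. \<phi> i \<in> polys k) \<and> p = (\<lambda>x::real^'d. c + (\<Sum>i\<in>UNIV. x $ i * \<phi> i x))}"
  have "polys (Suc k) \<subseteq> S"
  proof (rule polys_subset_subspace)
    show "subspace S"
    proof (rule subspaceI)
      show "0 \<in> S"
        unfolding S_def by (intro CollectI exI[of _ "0::real"] exI[of _ "\<lambda>_ _. 0"]) (auto simp: polys_const fun_eq_iff)
    next
      fix p q assume "p \<in> S" "q \<in> S"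
      then obtain c \<phi> d \<psi> where *: "\<And>i. \<phi> i \<in> polys k" "p = (\<lambda>x. c + (\<Sum>i\<in>UNIV. x $ i * \<phi> i x))"
        "\<And>i. \<psi> i \<in> polys k" "q = (\<lambda>x. d + (\<Sum>i\<in>UNIV. x $ i * \<psi> i x))"
        unfolding S_def by auto
      then show "p + q \<in> S"
        unfolding S_def
        by (intro CollectI exI[of _ "c + d"] exI[of _ "\<lambda>i x. \<phi> i x + \<psi> i x"])
          (auto simp: fun_eq_iff distrib_left sum.distrib intro: polys_add)
    next
      fix r p assume "p \<in> S"
      then obtain c \<phi> where *: "\<And>i. \<phi> i \<in> polys k" "p = (\<lambda>x. c + (\<Sum>i\<in>UNIV. x $ i * \<phi> i x))"
        unfolding S_def by auto
      then show "r *\<^sub>R p \<in> S"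
        unfolding S_def
        by (intro CollectI exI[of _ "r * c"] exI[of _ "\<lambda>i x. r * \<phi> i x"])
          (auto simp: fun_eq_iff distrib_left sum_distrib_left mult.left_commute intro: polys_scale)
    qed
  next
    fix e :: "'d \<Rightarrow> nat" assume e: "(\<Sum>i\<in>UNIV. e i) \<le> Suc k"
    show "mpow e \<in> S"
    proof (cases "\<exists>i. e i > 0")
      case False
      then have "e = (\<lambda>_. 0)"
        by auto
      then show ?thesis
        unfolding S_def by (intro CollectI exI[of _ "1::real"] exI[of _ "\<lambda>_ _. 0"]) (auto simp: polys_const mpow_def)
    next
      case True
      then obtain i where i: "e i > 0" ..
      define e' where "e' = e(i := e i - 1)"
      have e': "e = e'(i := Suc (e' i))"
        using i by (auto simp: e'_def)
      have "(\<Sum>j\<in>UNIV. e j) = Suc (\<Sum>j\<in>UNIV. e' j)"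
        by (subst e') (simp add: sum.remove[of UNIV i])
      then have "mpow e' \<in> polys k"
        using e by (intro mpow_in_polys) simp
      then have "(\<lambda>x. if j = i then mpow e' x else 0) \<in> polys k" for j
        by (cases "j = i") (auto simp: polys_const)
      moreover have "mpow e = (\<lambda>x. 0 + (\<Sum>j\<in>UNIV. x $ j * (if j = i then mpow e' x else 0)))"
      proof
        fix x
        have "mpow e x = x $ i * mpow e' x"
          by (subst e') (simp add: mpow_coord_mult)
        then show "mpow e x = 0 + (\<Sum>j\<in>UNIV. x $ j * (if j = i then mpow e' x else 0))"
          by (simp add: if_distrib[of "\<lambda>y. _ * y"] cong: if_cong)
      qed
      ultimately show ?thesis
        unfolding S_def
        by (intro CollectI exI[of _ "0::real"] exI[of _ "\<lambda>j x. if j = i then mpow e' x else 0"])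
          (auto simp: polys_const)
    qed
  qed
  then have "p \<in> S"
    using assms by blast
  then show ?thesis
    using that unfolding S_def by auto
qed

lemma polys_0: "p \<in> polys 0 \<Longrightarrow> \<exists>c. \<forall>x. p x = c"
proof -
  assume "p \<in> polys 0"
  moreover have "{e :: 'a \<Rightarrow> nat. (\<Sum>i\<in>UNIV. e i) \<le> 0} = {\<lambda>_. 0}"
    by auto
  ultimately show ?thesis
    unfolding polys_def by auto
qed

text \<open>Product rule on the decomposition by coordinates. The clause for \<open>k = 0\<close> is
  carried along because \<open>k - 1\<close> is truncated: with the degree bound alone,
  \<open>x $ i * D i j x\<close> could have degree 1 where degree 0 is needed.\<close>

lemma polys_has_derivative:
  "p \<in> polys k \<Longrightarrow> \<exists>D. (\<forall>i. D i \<in> polys (k - 1)) \<and> (k = 0 \<longrightarrow> (\<forall>i x. D i x = 0)) \<and>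
     (\<forall>x. (p has_derivative (\<lambda>v. \<Sum>i\<in>UNIV. v $ i * D i x)) (at x))"
proof (induction k arbitrary: p)
  case 0
  obtain c where "\<forall>x. p x = c"
    using polys_0[OF 0] by blast
  then have "p = (\<lambda>_. c)"
    by auto
  then show ?case
    by (intro exI[of _ "\<lambda>_ _. 0"]) (auto simp: polys_const)
next
  case (Suc k)
  obtain c \<phi> where \<phi>: "\<And>i. \<phi> i \<in> polys k" "\<And>x. p x = c + (\<Sum>i\<in>UNIV. x $ i * \<phi> i x)"
    by (rule polys_decompose[OF Suc.prems]) (rule that)
  have "\<forall>i. \<exists>D. (\<forall>j. D j \<in> polys (k - 1)) \<and> (k = 0 \<longrightarrow> (\<forall>j x. D j x = 0)) \<and>
     (\<forall>x. (\<phi> i has_derivative (\<lambda>v. \<Sum>j\<in>UNIV. v $ j * D j x)) (at x))"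
    using Suc.IH \<phi>(1) by blast
  from choice[OF this] obtain D where D': "\<forall>i. (\<forall>j. D i j \<in> polys (k - 1)) \<and>
     (k = 0 \<longrightarrow> (\<forall>j x. D i j x = 0)) \<and>
     (\<forall>x. (\<phi> i has_derivative (\<lambda>v. \<Sum>j\<in>UNIV. v $ j * D i j x)) (at x))"
    by (rule exE)
  then have D: "\<And>i j. D i j \<in> polys (k - 1)" "\<And>i j x. k = 0 \<Longrightarrow> D i j x = 0"
    "\<And>i x. (\<phi> i has_derivative (\<lambda>v. \<Sum>j\<in>UNIV. v $ j * D i j x)) (at x)"
    by simp_all
  define E where "E j x = \<phi> j x + (\<Sum>i\<in>UNIV. x $ i * D i j x)" for j x
  have "(\<lambda>x. x $ i * D i j x) \<in> polys k" for i j
  proof (cases k)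
    case 0
    then show ?thesis
      using D(2) by (simp add: polys_const)
  next
    case (Suc l)
    then show ?thesis
      using polys_coord_mult[OF D(1)[of i j], of i] by simp
  qed
  then have E: "E j \<in> polys k" for j
    unfolding E_def using \<phi>(1) by (intro polys_add polys_sum) auto
  have p: "p = (\<lambda>x. c + (\<Sum>i\<in>UNIV. x $ i * \<phi> i x))"
    using \<phi>(2) by auto
  have "(p has_derivative (\<lambda>v. \<Sum>j\<in>UNIV. v $ j * E j x)) (at x)" for x
  proof -
    have "(p has_derivative (\<lambda>v. 0 + (\<Sum>i\<in>UNIV. x $ i * (\<Sum>j\<in>UNIV. v $ j * D i j x) + v $ i * \<phi> i x))) (at x)"
      unfolding p
      by (intro has_derivative_add has_derivative_const has_derivative_sum has_derivative_mult D(3)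
          bounded_linear.has_derivative[OF bounded_linear_vec_nth] has_derivative_ident)
    moreover have "0 + (\<Sum>i\<in>UNIV. x $ i * (\<Sum>j\<in>UNIV. v $ j * D i j x) + v $ i * \<phi> i x)
        = (\<Sum>j\<in>UNIV. v $ j * E j x)" for v
    proof -
      have "(\<Sum>i\<in>UNIV. x $ i * (\<Sum>j\<in>UNIV. v $ j * D i j x)) = (\<Sum>j\<in>UNIV. v $ j * (\<Sum>i\<in>UNIV. x $ i * D i j x))"
        unfolding sum_distrib_left by (subst sum.swap) (simp add: mult_ac)
      then show ?thesis
        by (simp add: E_def sum.distrib distrib_left)
    qed
    ultimately show ?thesis
      by simp
  qed
  then show ?case
    using E by (intro exI[of _ E]) auto
qed

lemma polys_continuous:
  assumes "p \<in> polys k"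
  shows "continuous_on S p"
proof (rule continuous_at_imp_continuous_on, rule ballI)
  fix x
  obtain D where "\<forall>x. (p has_derivative (\<lambda>v. \<Sum>i\<in>UNIV. v $ i * D i x)) (at x)"
    using polys_has_derivative[OF assms] by auto
  then show "isCont p x"
    using has_derivative_continuous by blast
qed

section \<open>Traces and differential operators of piecewise smooth fields\<close>

text \<open>Smoothness on the whole space, not on a cell: values and strains then extend
  continuously to the boundary of every cell, where the traces are taken.\<close>

definition C1 :: "(real^'d \<Rightarrow> real^'d) \<Rightarrow> bool" where
  "C1 p \<longleftrightarrow> (\<forall>x. p differentiable (at x)) \<and> continuous_on UNIV (\<lambda>x. jacobian p (at x))"

lemma jacobian_unique:
  fixes p :: "real^'d \<Rightarrow> real^'d"
  shows "(p has_derivative (*v) A) (at x) \<Longrightarrow> jacobian p (at x) = A"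
  unfolding jacobian_def by (metis frechet_derivative_at matrix_of_matrix_vector_mul)

lemma C1_has_derivative: "C1 p \<Longrightarrow> (p has_derivative (*v) (jacobian p (at x))) (at x)"
  unfolding C1_def using jacobian_works by blast

lemma C1_continuous: "C1 p \<Longrightarrow> continuous_on S p"
  by (intro continuous_at_imp_continuous_on ballI)
    (auto simp: C1_def intro: differentiable_imp_continuous_within)

lemma jacobian_lin:
  assumes "C1 p" "C1 q"
  shows "jacobian (p + c *\<^sub>R q) (at x) = jacobian p (at x) + c *\<^sub>R jacobian q (at x)"
proof (rule jacobian_unique)
  have "((\<lambda>y. p y + c *\<^sub>R q y) has_derivative (\<lambda>h. jacobian p (at x) *v h + c *\<^sub>R (jacobian q (at x) *v h))) (at x)"
    by (intro has_derivative_add has_derivative_scaleR_right C1_has_derivative assms)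
  moreover have "p + c *\<^sub>R q = (\<lambda>y. p y + c *\<^sub>R q y)"
    by auto
  moreover have "(*v) (jacobian p (at x) + c *\<^sub>R jacobian q (at x))
      = (\<lambda>h. jacobian p (at x) *v h + c *\<^sub>R (jacobian q (at x) *v h))"
    by (simp add: fun_eq_iff matrix_vector_mult_add_rdistrib scaleR_matrix_vector_assoc)
  ultimately show "(p + c *\<^sub>R q has_derivative (*v) (jacobian p (at x) + c *\<^sub>R jacobian q (at x))) (at x)"
    by simp
qed

lemma C1_lin:
  assumes "C1 p" "C1 q"
  shows "C1 (p + c *\<^sub>R q)"
  unfolding C1_def jacobian_lin[OF assms]
proof (intro conjI allI)
  fix x
  have "(\<lambda>y. p y + c *\<^sub>R q y) differentiable (at x)"
    using assms by (auto simp: C1_def)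
  then show "(p + c *\<^sub>R q) differentiable (at x)"
    by (simp add: plus_fun_def)
next
  show "continuous_on UNIV (\<lambda>x. jacobian p (at x) + c *\<^sub>R jacobian q (at x))"
    using assms by (auto simp: C1_def intro!: continuous_intros)
qed

lemma vec_polys_has_derivative:
  fixes p :: "real^'d \<Rightarrow> real^'d"
  assumes "p \<in> vec_polys k"
  obtains D where "\<And>i j. D i j \<in> polys (k - 1)"
    "\<And>x. (p has_derivative (*v) (\<chi> i j. D i j x)) (at x)"
proof -
  have "\<forall>i. \<exists>D. (\<forall>j. D j \<in> polys (k - 1)) \<and> (k = 0 \<longrightarrow> (\<forall>j x. D j x = 0)) \<and>
     (\<forall>x. ((\<lambda>x. p x $ i) has_derivative (\<lambda>v. \<Sum>j\<in>UNIV. v $ j * D j x)) (at x))"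
    using assms polys_has_derivative unfolding vec_polys_def by blast
  from choice[OF this] obtain D where D: "\<forall>i. (\<forall>j. D i j \<in> polys (k - 1)) \<and> (k = 0 \<longrightarrow> (\<forall>j x. D i j x = 0)) \<and>
     (\<forall>x. ((\<lambda>x. p x $ i) has_derivative (\<lambda>v. \<Sum>j\<in>UNIV. v $ j * D i j x)) (at x))"
    by (rule exE)
  show ?thesis
  proof (rule that)
    show "D i j \<in> polys (k - 1)" for i j
      using D by simp
    fix x
    have "((\<lambda>x. p x $ i) has_derivative (\<lambda>v. ((\<chi> i j. D i j x) *v v) $ i)) (at x)" for i
      using D by (simp add: matrix_vector_mult_def mult.commute)
    then show "(p has_derivative (*v) (\<chi> i j. D i j x)) (at x)"
      by (subst has_derivative_componentwise_within) (auto simp: Basis_vec_def inner_axis)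
  qed
qed

lemma vec_polys_C1: "p \<in> vec_polys k \<Longrightarrow> C1 p"
proof -
  assume "p \<in> vec_polys k"
  then obtain D where D: "\<And>i j. D i j \<in> polys (k - 1)" "\<And>x. (p has_derivative (*v) (\<chi> i j. D i j x)) (at x)"
    by (rule vec_polys_has_derivative) (rule that)
  have "continuous_on UNIV (\<lambda>x. \<chi> i j. D i j x)"
    using polys_continuous[OF D(1)] by (intro continuous_on_vec_lambda)
  then show ?thesis
    unfolding C1_def jacobian_unique[OF D(2)] using D(2) by (auto simp: differentiable_def)
qed

definition symm :: "real^'d^'d \<Rightarrow> real^'d^'d" where
  "symm A = (1/2) *\<^sub>R (A + transpose A)"

lemma linear_symm: "linear symm"
  by (rule linearI) (auto simp: symm_def transpose_def vec_eq_iff algebra_simps)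

lemma linear_trace: "linear (trace :: real^'d^'d \<Rightarrow> real)"
  by (rule linearI) (auto simp: trace_def sum.distrib sum_distrib_left)

lemma sym_grad_symm: "sym_grad u x = symm (jacobian u (at x))"
  by (simp add: sym_grad_def symm_def)

lemma continuous_sym_grad:
  assumes "C1 p"
  shows "continuous_on S (sym_grad p)"
proof -
  have "continuous_on S (\<lambda>x. jacobian p (at x))"
    using assms continuous_on_subset unfolding C1_def by blast
  then have "continuous_on S (\<lambda>x. symm (jacobian p (at x)))"
    by (rule bounded_linear.continuous_on[OF linear_symm[unfolded linear_conv_bounded_linear]])
  then show ?thesis
    by (simp add: sym_grad_symm[abs_def])
qed

lemma continuous_divergence:
  assumes "C1 p"
  shows "continuous_on S (divergence p)"
proof -
  have "continuous_on S (\<lambda>x. jacobian p (at x))"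
    using assms continuous_on_subset unfolding C1_def by blast
  then have "continuous_on S (\<lambda>x. trace (jacobian p (at x)))"
    by (rule bounded_linear.continuous_on[OF linear_trace[unfolded linear_conv_bounded_linear]])
  then show ?thesis
    by (simp add: divergence_def[abs_def])
qed

definition smooth_on_cell :: "(real^'d) set \<Rightarrow> (real^'d \<Rightarrow> real^'d) \<Rightarrow> bool" where
  "smooth_on_cell K u \<longleftrightarrow> (\<exists>p. C1 p \<and> (\<forall>x\<in>interior K. u x = p x))"

lemma inner_trace_eq:
  fixes p :: "'a::euclidean_space \<Rightarrow> 'b::t2_space"
  assumes K: "x \<in> closure (interior K)" and p: "continuous_on UNIV p"
    and eq: "\<And>y. y \<in> interior K \<Longrightarrow> u y = p y"
  shows "inner_trace K u x = p x"
  unfolding inner_trace_def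
proof (rule tendsto_Lim)
  have "x islimpt interior K"
    using K interior_limit_point[of x "interior K"] by (auto simp: closure_def)
  then show "\<not> trivial_limit (at x within interior K)"
    by (simp add: trivial_limit_within)
  have "(p \<longlongrightarrow> p x) (at x within interior K)"
    using p by (meson continuous_on_def continuous_on_subset UNIV_I at_le subset_UNIV tendsto_mono)
  moreover have "\<forall>\<^sub>F y in at x within interior K. p y = u y"
    using eq by (auto simp: eventually_at_filter)
  ultimately show "(u \<longlongrightarrow> p x) (at x within interior K)"
    by (rule Lim_transform_eventually)
qed

text \<open>Derivatives are local on the open interior and traces are limits from the interior, so
  both may be computed from the smooth extension \<open>p\<close>; the values of \<open>u\<close> on
  the boundary of the cell never enter.\<close>

lemma smooth_on_cell_operators:
  assumes p: "C1 p" and eq: "\<And>y. y \<in> interior K \<Longrightarrow> u y = p y"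
  shows "x \<in> interior K \<Longrightarrow> sym_grad u x = sym_grad p x"
    and "x \<in> interior K \<Longrightarrow> divergence u x = divergence p x"
    and "x \<in> closure (interior K) \<Longrightarrow> inner_trace K u x = p x"
    and "x \<in> closure (interior K) \<Longrightarrow> inner_trace K (sym_grad u) x = sym_grad p x"
proof -
  have J: "jacobian u (at x) = jacobian p (at x)" if "x \<in> interior K" for x
    by (rule jacobian_unique, rule has_derivative_transform_within_open[OF C1_has_derivative[OF p] open_interior that])
      (use eq in auto)
  show S: "sym_grad u x = sym_grad p x" if "x \<in> interior K" for x
    using J[OF that] by (simp add: sym_grad_def)
  show "divergence u x = divergence p x" if "x \<in> interior K"
    using J[OF that] by (simp add: divergence_def)
  show "inner_trace K u x = p x" if "x \<in> closure (interior K)"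
    using inner_trace_eq[OF that C1_continuous[OF p] eq] .
  show "inner_trace K (sym_grad u) x = sym_grad p x" if "x \<in> closure (interior K)"
    using inner_trace_eq[OF that continuous_sym_grad[OF p] S] .
qed

lemma smooth_on_cell_lin:
  assumes "smooth_on_cell K u" "smooth_on_cell K v"
  shows "smooth_on_cell K (u + c *\<^sub>R v)"
    and "x \<in> interior K \<Longrightarrow> sym_grad (u + c *\<^sub>R v) x = sym_grad u x + c *\<^sub>R sym_grad v x"
    and "x \<in> interior K \<Longrightarrow> divergence (u + c *\<^sub>R v) x = divergence u x + c *\<^sub>R divergence v x"
    and "x \<in> closure (interior K) \<Longrightarrow>
      inner_trace K (u + c *\<^sub>R v) x = inner_trace K u x + c *\<^sub>R inner_trace K v x"
    and "x \<in> closure (interior K) \<Longrightarrow> inner_trace K (sym_grad (u + c *\<^sub>R v)) x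
      = inner_trace K (sym_grad u) x + c *\<^sub>R inner_trace K (sym_grad v) x"
proof -
  obtain p q where pq: "C1 p" "C1 q" "\<And>x. x \<in> interior K \<Longrightarrow> u x = p x" "\<And>x. x \<in> interior K \<Longrightarrow> v x = q x"
    using assms unfolding smooth_on_cell_def by blast
  have r: "C1 (p + c *\<^sub>R q)" "\<And>x. x \<in> interior K \<Longrightarrow> (u + c *\<^sub>R v) x = (p + c *\<^sub>R q) x"
    using pq C1_lin by auto
  then show "smooth_on_cell K (u + c *\<^sub>R v)"
    unfolding smooth_on_cell_def by blast
  have S: "sym_grad (p + c *\<^sub>R q) x = sym_grad p x + c *\<^sub>R sym_grad q x" for x
    by (simp add: sym_grad_symm jacobian_lin pq linear_add[OF linear_symm] linear_scale[OF linear_symm])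
  have D: "divergence (p + c *\<^sub>R q) x = divergence p x + c *\<^sub>R divergence q x" for x
    by (simp add: divergence_def jacobian_lin pq linear_add[OF linear_trace] linear_scale[OF linear_trace])
  note ops = smooth_on_cell_operators[where K = K and u = u and p = p, OF pq(1,3)]
    smooth_on_cell_operators[where K = K and u = v and p = q, OF pq(2,4)]
    smooth_on_cell_operators[where K = K and u = "u + c *\<^sub>R v" and p = "p + c *\<^sub>R q", OF r]
  show "sym_grad (u + c *\<^sub>R v) x = sym_grad u x + c *\<^sub>R sym_grad v x" if "x \<in> interior K"
    using ops(1)[OF _ that] ops(5)[OF _ that] ops(9)[OF _ that] S that by simp
  show "divergence (u + c *\<^sub>R v) x = divergence u x + c *\<^sub>R divergence v x" if "x \<in> interior K"
    using ops(2)[OF _ that] ops(6)[OF _ that] ops(10)[OF _ that] D that by simp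
  show "inner_trace K (u + c *\<^sub>R v) x = inner_trace K u x + c *\<^sub>R inner_trace K v x"
    if "x \<in> closure (interior K)"
    using ops(3)[OF _ that] ops(7)[OF _ that] ops(11)[OF _ that] that by simp
  show "inner_trace K (sym_grad (u + c *\<^sub>R v)) x
      = inner_trace K (sym_grad u) x + c *\<^sub>R inner_trace K (sym_grad v) x"
    if "x \<in> closure (interior K)"
    using ops(4)[OF _ that] ops(8)[OF _ that] ops(12)[OF _ that] S that by simp
qed

lemma smooth_on_cell_bmeas:
  assumes u: "smooth_on_cell K u" and K: "compact K"
  shows "bmeas (interior K) (sym_grad u)" "bmeas (interior K) (divergence u)"
    and "F \<subseteq> closure (interior K) \<Longrightarrow> bmeas F (inner_trace K u)"
    and "F \<subseteq> closure (interior K) \<Longrightarrow> bmeas F (inner_trace K (sym_grad u))"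
proof -
  obtain p where p: "C1 p" "\<And>x. x \<in> interior K \<Longrightarrow> u x = p x"
    using u unfolding smooth_on_cell_def by blast
  note ops = smooth_on_cell_operators[where K = K and u = u and p = p, OF p]
  have b: "bmeas S f" if "continuous_on UNIV f" "S \<subseteq> K" for S and f :: "real^'a \<Rightarrow> 'c::euclidean_space"
    using that K by (intro bmeas_continuous[of K f S]) (auto intro: continuous_on_subset)
  have sub: "closure (interior K) \<subseteq> K"
    using K by (intro closure_minimal interior_subset compact_imp_closed)
  have "bmeas (interior K) (sym_grad p)" "bmeas (interior K) (divergence p)"
    using p(1) interior_subset by (auto intro!: b continuous_sym_grad continuous_divergence)
  then show "bmeas (interior K) (sym_grad u)" "bmeas (interior K) (divergence u)"
    using ops(1,2) by (simp_all cong: bmeas_cong)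
  assume F: "F \<subseteq> closure (interior K)"
  then have "bmeas F p" "bmeas F (sym_grad p)"
    using p(1) sub by (auto intro!: b continuous_sym_grad C1_continuous)
  then show "bmeas F (inner_trace K u)" "bmeas F (inner_trace K (sym_grad u))"
    using bmeas_cong[of F "inner_trace K u" p] bmeas_cong[of F "inner_trace K (sym_grad u)" "sym_grad p"]
      ops(3)[OF _ subsetD[OF F]] ops(4)[OF _ subsetD[OF F]] by simp_all
qed

section \<open>Topology of simplicial meshes\<close>

locale mesh =
  fixes T :: "'a::euclidean_space set set"
  assumes tri: "triangulation T" and full: "K \<in> T \<Longrightarrow> int DIM('a) simplex K"
begin

lemma finite_T: "finite T"
  using tri by (simp add: triangulation_def)

lemma face_Int: "K \<in> T \<Longrightarrow> K' \<in> T \<Longrightarrow> K \<inter> K' face_of K"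
  using tri by (simp add: triangulation_def)

lemma simplexE:
  assumes "K \<in> T"
  obtains C where "full_simplex C K"
  using full[OF assms] by (rule full_simplexI)

lemma elem:
  assumes "K \<in> T"
  shows "compact K" "convex K" "closure (interior K) = K" "interior K \<noteq> {}" "rel_interior K = interior K"
    "aff_dim K = int DIM('a)" "diameter K > 0" "finite {F. F facet_of K}"
proof -
  obtain C where "full_simplex C K"
    using assms by (rule simplexE)
  then interpret full_simplex C K .
  show "compact K" "convex K" "closure (interior K) = K" "interior K \<noteq> {}" "rel_interior K = interior K"
    "aff_dim K = int DIM('a)" "diameter K > 0"
    by (fact compact_K convex_K closure_interior_K interior_K_nonempty rel_interior_K aff_dim_K diameter_K_pos)+
  show "finite {F. F facet_of K}"
    using finite_C by (simp add: facets_K)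
qed

lemma finite_facets: "finite (facets T)"
proof -
  have "facets T = (\<Union>K\<in>T. {F. F facet_of K})"
    by (auto simp: facets_def)
  then show ?thesis
    using finite_T elem(8) by auto
qed

lemma facets_good: "F \<in> facets T \<Longrightarrow> good_facet F"
  using full unfolding facets_def good_facet_def by blast

lemma face_subset_eq:
  assumes "K \<in> T" "K' \<in> T" "K \<subseteq> K'"
  shows "K = K'"
proof (rule ccontr)
  assume "K \<noteq> K'"
  have "K face_of K'"
    using face_Int[OF assms(2,1)] assms(3) by (simp add: Int_absorb1)
  then have "aff_dim K < aff_dim K'"
    using face_of_aff_dim_lt elem(2)[OF assms(2)] \<open>K \<noteq> K'\<close> by blast
  then show False
    using elem(6) assms by simp
qed

lemma interior_disjoint:
  assumes "K \<in> T" "K' \<in> T" "x \<in> interior K" "x \<in> K'"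
  shows "K = K'"
proof -
  have "x \<in> (K \<inter> K') \<inter> rel_interior K"
    using assms interior_subset elem(5) by auto
  then have "K \<subseteq> K \<inter> K'"
    by (intro subset_of_face_of[OF face_Int[OF assms(1,2)] subset_refl]) auto
  then show ?thesis
    using assms by (intro face_subset_eq) auto
qed

text \<open>A face that contains a relative interior point of \<open>F\<close> contains all of
  \<open>F\<close>. Thus \<open>F\<close> lies in the common face of \<open>K\<close> and
  \<open>K'\<close> and is a face of both, of the right dimension.\<close>

lemma facet_transfer:
  assumes "K \<in> T" "K' \<in> T" "F facet_of K" "x \<in> rel_interior F" "x \<in> K'"
  shows "F facet_of K'"
proof -
  have F: "F face_of K" "F \<noteq> {}" "aff_dim F = aff_dim K - 1" "F \<subseteq> K"
    using assms(3) by (auto simp: facet_of_def face_of_imp_subset)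
  have "F \<subseteq> K \<inter> K'"
    using F(4) assms(4,5) rel_interior_subset[of F]
    by (intro subset_of_face_of[OF face_Int[OF assms(1,2)]]) auto
  then have "F face_of K \<inter> K'"
    using F(1) by (intro face_of_subset[OF F(1)]) auto
  moreover have "K \<inter> K' face_of K'"
    using face_Int[OF assms(2,1)] by (simp add: Int_commute)
  ultimately have "F face_of K'"
    by (rule face_of_trans)
  then show ?thesis
    using F assms elem(6) by (simp add: facet_of_def)
qed

text \<open>By transfer \<open>F\<close> is also a facet of the element to which \<open>F'\<close>
  belongs; a facet contained in another of equal dimension equals it.\<close>

lemma facet_disjoint:
  assumes "F \<in> facets T" "F' \<in> facets T" "x \<in> rel_interior F" "x \<in> F'"
  shows "F = F'"
proof -
  obtain K K' where K: "K \<in> T" "F facet_of K" "K' \<in> T" "F' facet_of K'"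
    using assms(1,2) unfolding facets_def by blast
  have F': "F' face_of K'" "aff_dim F' = aff_dim K' - 1"
    using K(4) by (auto simp: facet_of_def)
  have F: "F facet_of K'"
    by (rule facet_transfer[OF K(1,3,2) assms(3) subsetD[OF face_of_imp_subset[OF F'(1)] assms(4)]])
  then have FK: "F face_of K'" "F \<subseteq> K'" "aff_dim F = aff_dim K' - 1"
    by (auto simp: facet_of_def face_of_imp_subset)
  have sub: "F \<subseteq> F'"
    using assms(3,4) by (intro subset_of_face_of[OF F'(1) FK(2)]) auto
  then have "F face_of F'"
    by (rule face_of_subset[OF FK(1) _ face_of_imp_subset[OF F'(1)]])
  moreover have "convex F'"
    using F'(1) face_of_imp_convex by blast
  ultimately show ?thesis
    using face_of_aff_dim_lt[of F' F] FK(3) F'(2) by auto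
qed

lemma finite_faces: "K \<in> T \<Longrightarrow> finite {F. F face_of K}"
  using full simplex_imp_polytope by (intro finite_polytope_faces) blast

lemma facet_connected:
  assumes \<Omega>: "open \<Omega>" "connected \<Omega>" "interior (closure \<Omega>) = \<Omega>" "\<Union>T = closure \<Omega>"
    and K0: "K0 \<in> T" "Z K0"
    and step: "\<And>K K' F. K \<in> T \<Longrightarrow> K' \<in> T \<Longrightarrow> F facet_of K \<Longrightarrow> F facet_of K' \<Longrightarrow> Z K \<Longrightarrow> Z K'"
    and K: "K \<in> T"
  shows "Z K"
proof (rule ccontr)
  assume notZ: "\<not> Z K"
  define G where "G = {K \<in> T. Z K}"
  define N where "N = {K \<in> T. \<not> Z K}"
  have fin: "finite G" "finite N"
    using finite_T by (auto simp: G_def N_def)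
  have cl: "closed (\<Union>G)" "closed (\<Union>N)"
    using fin elem(1) by (auto intro!: closed_Union simp: G_def N_def compact_imp_closed)
  have cover: "closure \<Omega> = \<Union>G \<union> \<Union>N"
    using \<Omega>(4) by (auto simp: G_def N_def)
  have int_sub: "interior K \<subseteq> \<Omega>" if "K \<in> T" for K
    using that \<Omega>(3,4) interior_mono[of K "closure \<Omega>"] by auto
  have ne: "K \<inter> \<Omega> \<noteq> {}" if "K \<in> T" for K
    using int_sub[OF that] elem(4)[OF that] interior_subset[of K] by blast
  \<comment> \<open>Otherwise the closed unions of the two classes of elements would disconnect
    \<Omega>.\<close>
  have "\<Union>G \<inter> \<Union>N \<inter> \<Omega> \<noteq> {}"
  proof
    assume "\<Union>G \<inter> \<Union>N \<inter> \<Omega> = {}"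
    moreover have "\<Union>G \<inter> \<Omega> \<noteq> {}"
      using ne[OF K0(1)] K0 by (auto simp: G_def)
    moreover have "\<Union>N \<inter> \<Omega> \<noteq> {}"
      using ne[OF K] K notZ by (auto simp: N_def)
    moreover have "\<Omega> \<subseteq> \<Union>G \<union> \<Union>N"
      using cover closure_subset by blast
    ultimately show False
      using \<Omega>(2) cl unfolding connected_closed by blast
  qed
  then obtain x K1 K2 where x: "x \<in> \<Omega>" "K1 \<in> G" "x \<in> K1" "K2 \<in> N" "x \<in> K2"
    by blast
  have T12: "K1 \<in> T" "K2 \<in> T"
    using x by (auto simp: G_def N_def)
  \<comment> \<open>\<Omega> need not be convex, but a ball around a common point of both classes
    is: segments inside it stay in the meshed region.\<close>
  obtain r where r: "r > 0" "ball x r \<subseteq> \<Omega>"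
    using \<Omega>(1) x(1) open_contains_ball by blast
  have meet: "interior K \<inter> ball x r \<noteq> {}" if "K \<in> T" "x \<in> K" for K
  proof -
    have "x \<in> closure (interior K)"
      using that elem(3) by simp
    then obtain y where "y \<in> interior K" "dist y x < r"
      using r(1) unfolding closure_approachable by blast
    then show ?thesis
      by (auto simp: dist_commute)
  qed
  obtain y where y: "y \<in> interior K1" "y \<in> ball x r"
    using meet[OF T12(1) x(3)] by blast
  \<comment> \<open>Faces of codimension at least two. The affine hull of such a face and
    \<open>y\<close> is still a proper subspace, so finitely many of these hulls cannot cover an
    open part of \<open>K2\<close>.\<close>
  define L where "L = {F. (\<exists>K\<in>T. F face_of K) \<and> aff_dim F + 1 < int DIM('a)}"
  have "finite (\<Union>K\<in>T. {F. F face_of K})"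
    using finite_T finite_faces by blast
  then have "finite L"
    by (rule rev_finite_subset) (auto simp: L_def)
  have "negligible (affine hull (insert y F))" if "F \<in> L" for F
  proof -
    have "aff_dim (affine hull (insert y F)) < int DIM('a)"
      using that by (auto simp: L_def aff_dim_insert)
    then have "interior (affine hull (insert y F)) = {}"
      using aff_dim_nonempty_interior[of "affine hull (insert y F)"] by auto
    then show ?thesis
      by (simp add: negligible_convex_interior convex_affine_hull)
  qed
  then have "negligible (\<Union>F\<in>L. affine hull (insert y F))"
    using \<open>finite L\<close> by (intro negligible_Union) auto
  moreover have "\<not> negligible (interior K2 \<inter> ball x r)"
    using meet[OF T12(2) x(5)] by (intro open_not_negligible open_Int) auto
  ultimately have "\<not> interior K2 \<inter> ball x r \<subseteq> (\<Union>F\<in>L. affine hull (insert y F))"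
    using negligible_subset by blast
  then obtain y' where y': "y' \<in> interior K2" "y' \<in> ball x r" "\<And>F. F \<in> L \<Longrightarrow> y' \<notin> affine hull (insert y F)"
    by blast
  have "closed_segment y y' \<subseteq> ball x r"
    using y(2) y'(2) by (intro closed_segment_subset convex_ball)
  then have "closed_segment y y' \<subseteq> \<Union>G \<union> \<Union>N"
    using r(2) cover closure_subset[of \<Omega>] by blast
  moreover have "\<Union>G \<inter> closed_segment y y' \<noteq> {}"
    using y(1) x(2) interior_subset[of K1] by (auto intro!: exI[of _ y])
  moreover have "\<Union>N \<inter> closed_segment y y' \<noteq> {}"
    using y'(1) x(4) interior_subset[of K2] by (auto intro!: exI[of _ y'])
  ultimately have "\<Union>G \<inter> \<Union>N \<inter> closed_segment y y' \<noteq> {}"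
    using connected_segment(1)[of y y'] cl unfolding connected_closed by blast
  then obtain w L1 L2 where w: "w \<in> closed_segment y y'" "L1 \<in> G" "w \<in> L1" "L2 \<in> N" "w \<in> L2"
    by blast
  have TL: "L1 \<in> T" "L2 \<in> T" "Z L1" "\<not> Z L2"
    using w by (auto simp: G_def N_def)
  \<comment> \<open>\<open>y\<close> is interior to \<open>K1\<close>, so no element of
    \<open>N\<close> contains it. As \<open>w\<close> differs from \<open>y\<close>, the line
    through both is determined and reaches \<open>y'\<close>.\<close>
  have wy: "w \<noteq> y"
    using interior_disjoint[OF T12(1) TL(2) y(1)] w(5) TL(4) x(2) by (auto simp: G_def)
  \<comment> \<open>If the common face were in \<open>L\<close>, the line from \<open>y\<close>
    through \<open>w\<close> would put \<open>y'\<close> into one of the excluded hulls.\<close>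
  have notL: "L1 \<inter> L2 \<notin> L"
  proof
    assume IL: "L1 \<inter> L2 \<in> L"
    obtain u where u: "0 \<le> u" "w = (1 - u) *\<^sub>R y + u *\<^sub>R y'"
      using w(1) by (auto simp: closed_segment_def)
    have "u \<noteq> 0"
      using u wy by auto
    have "w - y = u *\<^sub>R (y' - y)"
      using u(2) by (simp add: algebra_simps)
    then have "y' = y + (1/u) *\<^sub>R (w - y)"
      using \<open>u \<noteq> 0\<close> by simp
    moreover have "y + (1/u) *\<^sub>R (w - y) \<in> affine hull (insert y (L1 \<inter> L2))"
      using w by (intro mem_affine_3_minus affine_affine_hull) (auto intro: hull_inc)
    ultimately show False
      using y'(3)[OF IL] by simp
  qed
  have I: "L1 \<inter> L2 face_of L1" "L1 \<inter> L2 face_of L2"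
    using face_Int[OF TL(1,2)] face_Int[OF TL(2,1)] by (simp_all add: Int_commute)
  then have "int DIM('a) \<le> aff_dim (L1 \<inter> L2) + 1"
    using notL TL(1) unfolding L_def by auto
  moreover have "L1 \<inter> L2 \<noteq> L1" "L1 \<inter> L2 \<noteq> L2"
    using face_subset_eq TL by (metis Int_lower2, metis Int_lower1)
  then have "aff_dim (L1 \<inter> L2) < aff_dim L1" "aff_dim (L1 \<inter> L2) < aff_dim L2"
    using I elem(2) TL by (auto intro!: face_of_aff_dim_lt)
  ultimately have "L1 \<inter> L2 facet_of L1" "L1 \<inter> L2 facet_of L2"
    using I w elem(6) TL by (auto simp: facet_of_def)
  then show False
    using step TL by blast
qed

text \<open>Two elements sharing \<open>F\<close> would lie on the same side of it, with overlapping
  interiors, or on opposite sides, covering a ball around \<open>x\<close>; then \<open>x\<close>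
  would be interior to the closure of \<Omega>, which is \<Omega> itself. Uniqueness of the element
  carries the frontier property from \<open>x\<close> to all of \<open>F\<close>.\<close>

lemma boundary_facet:
  assumes \<Omega>: "open \<Omega>" "interior (closure \<Omega>) = \<Omega>" "\<Union>T = closure \<Omega>"
    and F: "F \<in> facets T" "x \<in> rel_interior F" "x \<in> frontier \<Omega>"
  shows "F \<subseteq> frontier \<Omega>" "\<exists>!K. K \<in> T \<and> F facet_of K"
proof -
  have uniq: "K1 = K2" if K: "K1 \<in> T" "F facet_of K1" "K2 \<in> T" "F facet_of K2" for K1 K2
  proof (rule ccontr)
    assume neq: "K1 \<noteq> K2"
    obtain C1 where "full_simplex C1 K1"
      using K(1) by (rule simplexE)
    then interpret S1: full_simplex C1 K1 .
    obtain C2 where "full_simplex C2 K2"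
      using K(3) by (rule simplexE)
    then interpret S2: full_simplex C2 K2 .
    obtain c1 where c1: "c1 \<in> C1" "F = S1.fac c1"
      using K(2) S1.facet_of_K by blast
    obtain c2 where c2: "c2 \<in> C2" "F = S2.fac c2"
      using K(4) S2.facet_of_K by blast
    define n b m d where "n = S1.nrm c1" and "b = S1.lev c1" and "m = S2.nrm c2" and "d = S2.lev c2"
    have H: "affine hull F = {x. n \<bullet> x = b}" "affine hull F = {x. m \<bullet> x = d}"
      using S1.affine_hull_fac[OF c1(1)] S2.affine_hull_fac[OF c2(1)] c1 c2
      by (simp_all add: n_def m_def b_def d_def)
    have nm: "n \<bullet> n = 1" "m \<bullet> m = 1"
      using S1.norm_nrm[OF c1(1)] S2.norm_nrm[OF c2(1)] by (simp_all add: n_def m_def norm_eq_1)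
    have "x \<in> affine hull F"
      using F(2) rel_interior_subset[of F] by (auto intro: hull_inc)
    then have xb: "n \<bullet> x = b" "m \<bullet> x = d"
      using H by auto
    \<comment> \<open>Component of \<open>m\<close> orthogonal to \<open>n\<close>: translating
      \<open>x\<close> by it stays in the hyperplane of \<open>n\<close>, hence in that of
      \<open>m\<close>, which forces \<open>v = 0\<close>.\<close>
    define v where "v = m - (m \<bullet> n) *\<^sub>R n"
    have nv: "n \<bullet> v = 0"
      using nm by (simp add: v_def inner_diff_right inner_commute)
    then have "x + v \<in> {x. n \<bullet> x = b}"
      using xb by (simp add: inner_add_right)
    then have "x + v \<in> {x. m \<bullet> x = d}"
      using H by simp
    then have mv: "m \<bullet> v = 0"
      using xb by (simp add: inner_add_right)
    have "v \<bullet> v = m \<bullet> v - (m \<bullet> n) * (n \<bullet> v)"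
      by (subst (1) v_def) (simp add: inner_diff_left)
    then have "v = 0"
      using nv mv by simp
    then have m: "m = (m \<bullet> n) *\<^sub>R n"
      by (simp add: v_def)
    then have "(m \<bullet> n) * (m \<bullet> n) = 1"
      using nm by (metis inner_scaleR_right mult.commute inner_commute)
    then have s: "m \<bullet> n = 1 \<or> m \<bullet> n = -1"
      by (simp add: square_eq_1_iff)
    obtain r1 where r1: "r1 > 0" "\<And>y. y \<in> ball x r1 \<Longrightarrow> n \<bullet> y \<le> b \<Longrightarrow> y \<in> K1"
      "\<And>y. y \<in> ball x r1 \<Longrightarrow> n \<bullet> y < b \<Longrightarrow> y \<in> interior K1"
      using S1.half_ball[OF c1(1)] F(2) c1(2) unfolding n_def b_def by metis
    obtain r2 where r2: "r2 > 0" "\<And>y. y \<in> ball x r2 \<Longrightarrow> m \<bullet> y \<le> d \<Longrightarrow> y \<in> K2"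
      "\<And>y. y \<in> ball x r2 \<Longrightarrow> m \<bullet> y < d \<Longrightarrow> y \<in> interior K2"
      using S2.half_ball[OF c2(1)] F(2) c2(2) unfolding m_def d_def by metis
    define r where "r = min r1 r2"
    have r: "r > 0" "ball x r \<subseteq> ball x r1" "ball x r \<subseteq> ball x r2"
      using r1 r2 by (auto simp: r_def)
    from s show False
    proof
      assume "m \<bullet> n = 1"
      then have "m = n"
        using m by simp
      then have bd: "b = d"
        using xb by simp
      define y where "y = x - (r/2) *\<^sub>R n"
      have "norm n = 1"
        using nm by (simp add: norm_eq_1)
      then have "y \<in> ball x r"
        using r(1) by (simp add: y_def dist_norm)
      moreover have "n \<bullet> y < b"
        using r(1) xb nm by (simp add: y_def inner_diff_right)
      ultimately have "y \<in> interior K1" "y \<in> interior K2"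
        using r1(3) r2(3) r \<open>m = n\<close> bd by auto
      then show False
        using interior_disjoint[OF K(1,3), of y] neq interior_subset by blast
    next
      assume "m \<bullet> n = -1"
      then have mn: "m = - n"
        using m by simp
      then have bd: "d = - b"
        using xb by simp
      have "ball x r \<subseteq> K1 \<union> K2"
      proof
        fix y assume y: "y \<in> ball x r"
        show "y \<in> K1 \<union> K2"
        proof (cases "n \<bullet> y \<le> b")
          case True
          then show ?thesis
            using r1(2) r y by blast
        next
          case False
          then have "m \<bullet> y \<le> d"
            by (simp add: mn bd)
          then show ?thesis
            using r2(2) r y by blast
        qed
      qed
      also have "K1 \<union> K2 \<subseteq> closure \<Omega>"
        using K \<Omega>(3) by blast
      finally have "x \<in> interior (closure \<Omega>)"
        using r(1) by (meson centre_in_ball open_ball interior_maximal subsetD)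
      then show False
        using F(3) \<Omega>(1,2) by (simp add: frontier_def interior_open)
    qed
  qed
  obtain K where K: "K \<in> T" "F facet_of K"
    using F(1) unfolding facets_def by blast
  then show "\<exists>!K. K \<in> T \<and> F facet_of K"
    using uniq by blast
  obtain C where "full_simplex C K"
    using K(1) by (rule simplexE)
  then interpret S: full_simplex C K .
  obtain c where c: "c \<in> C" "F = S.fac c"
    using K(2) S.facet_of_K by blast
  have "rel_interior F \<subseteq> frontier \<Omega>"
  proof
    fix z assume z: "z \<in> rel_interior F"
    have zF: "z \<in> F" "z \<in> K"
      using z rel_interior_subset[of F] S.fac_subset[OF c(1)] c(2) by auto
    have "z \<notin> \<Omega>"
    proof
      assume "z \<in> \<Omega>"
      \<comment> \<open>Near \<open>z\<close> the mesh consists of \<open>K\<close> alone, since any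
        element containing \<open>z\<close> has \<open>F\<close> as a facet; yet a small step along
        the outward normal leaves \<open>K\<close> while staying in \<Omega>.\<close>
      define U where "U = \<Omega> - \<Union>(T - {K})"
      have "closed (\<Union>(T - {K}))"
        using finite_T elem(1) by (auto intro!: closed_Union simp: compact_imp_closed)
      then have "open U"
        using \<Omega>(1) by (simp add: U_def open_Diff)
      moreover have "z \<in> U"
        using \<open>z \<in> \<Omega>\<close> facet_transfer[OF K(1) _ K(2) z] uniq[OF K] by (auto simp: U_def)
      ultimately obtain r where r: "r > 0" "ball z r \<subseteq> U"
        using open_contains_ball by blast
      have "U \<subseteq> K"
        using \<Omega>(3) closure_subset[of \<Omega>] by (auto simp: U_def)
      define y where "y = z + (r/2) *\<^sub>R S.nrm c"
      have n1: "norm (S.nrm c) = 1"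
        by (rule S.norm_nrm[OF c(1)])
      then have "y \<in> ball z r"
        using r(1) by (simp add: y_def dist_norm)
      then have "y \<in> K"
        using r(2) \<open>U \<subseteq> K\<close> by blast
      then have "S.lam c y \<ge> 0"
        using S.mem_K c(1) by blast
      then have "S.nrm c \<bullet> y \<le> S.lev c"
        using S.grd_nz[OF c(1)] by (simp add: S.lam_nrm[OF c(1)] zero_le_mult_iff)
      moreover have "S.nrm c \<bullet> z = S.lev c"
        using zF(1) c S.mem_fac S.lam_zero_iff by blast
      ultimately show False
        using r(1) n1 by (simp add: y_def inner_add_right norm_eq_1)
    qed
    moreover have "z \<in> closure \<Omega>"
      using zF(2) K(1) \<Omega>(3) by blast
    ultimately show "z \<in> frontier \<Omega>"
      using \<Omega>(1) by (simp add: frontier_def interior_open)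
  qed
  then have "closure (rel_interior F) \<subseteq> frontier \<Omega>"
    by (intro closure_minimal frontier_closed)
  moreover have "convex F" "closed F"
    using c by (simp_all add: S.fac_def finite_imp_compact_convex_hull S.finite_C compact_imp_closed)
  ultimately show "F \<subseteq> frontier \<Omega>"
    by (simp add: convex_closure_rel_interior)
qed

end

section \<open>Local unisolvence of the pressure pairing\<close>

lemma has_derivative_along_line:
  fixes p :: "'a::real_normed_vector \<Rightarrow> real"
  assumes "(p has_derivative L) (at (x + s *\<^sub>R e))"
  shows "((\<lambda>s. p (x + s *\<^sub>R e)) has_real_derivative L e) (at s)"
proof -
  have "((\<lambda>s. x + s *\<^sub>R e) has_derivative (\<lambda>t. t *\<^sub>R e)) (at s)"
    by (auto intro!: derivative_eq_intros)
  then have "((\<lambda>s. p (x + s *\<^sub>R e)) has_derivative (\<lambda>t. L (t *\<^sub>R e))) (at s)"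
    using assms by (rule has_derivative_compose)
  moreover have "(\<lambda>t. L (t *\<^sub>R e)) = (*) (L e)"
    using has_derivative_bounded_linear[OF assms] by (auto simp: bounded_linear.linear linear_scale)
  ultimately show ?thesis
    by (simp add: has_field_derivative_def)
qed

lemma divergence_direction:
  fixes h :: "real^'d \<Rightarrow> real" and e :: "real^'d"
  assumes "(h has_derivative (\<lambda>v. \<Sum>i\<in>UNIV. v $ i * D i x)) (at x)"
  shows "divergence (\<lambda>x. h x *\<^sub>R e) x = (\<Sum>i\<in>UNIV. e $ i * D i x)"
proof -
  have "((\<lambda>x. h x *\<^sub>R e) has_derivative (\<lambda>v. (\<Sum>i\<in>UNIV. v $ i * D i x) *\<^sub>R e)) (at x)"
    using assms by (rule has_derivative_scaleR_left)
  moreover have "(\<lambda>v. (\<Sum>i\<in>UNIV. v $ i * D i x) *\<^sub>R e) = (*v) (\<chi> i j. e $ i * D j x)"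
    by (auto simp: fun_eq_iff vec_eq_iff matrix_vector_mult_def sum_distrib_left sum_distrib_right mult_ac)
  ultimately have "jacobian (\<lambda>x. h x *\<^sub>R e) (at x) = (\<chi> i j. e $ i * D j x)"
    by (intro jacobian_unique) simp
  then show ?thesis
    by (simp add: divergence_def trace_def)
qed

lemma direction_vec_polys: "h \<in> polys k \<Longrightarrow> (\<lambda>x. h x *\<^sub>R e) \<in> vec_polys k"
  using polys_scale[of h k "e $ _"] by (auto simp: vec_polys_def mult.commute)

lemma facet_integral_scale:
  "good_facet F \<Longrightarrow> bmeas F f \<Longrightarrow> facet_integral F (\<lambda>x. c * f x) = c * facet_integral F f"
  using facet_integral_lin[of F "\<lambda>_. 0" f c] by (simp add: bmeas_const facet_integral_def)

lemma facet_integral_sum: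
  assumes "good_facet F" "finite I" "\<And>i. i \<in> I \<Longrightarrow> bmeas F (f i)"
  shows "facet_integral F (\<lambda>x. \<Sum>i\<in>I. f i x) = (\<Sum>i\<in>I. facet_integral F (f i))"
  using assms(2,3)
proof (induction I rule: finite_induct)
  case (insert j I)
  then show ?case
    using facet_integral_lin[OF assms(1), of "f j" "\<lambda>x. \<Sum>i\<in>I. f i x" 1] by (simp add: bmeas_sum)
qed (simp add: facet_integral_def)

context full_simplex
begin

text \<open>Difference of the barycentric identities at \<open>v\<close> and at 0. As the weights
  sum to 0, every vector is a combination of edge vectors.\<close>

lemma vector_eq_sum_grd: "(\<Sum>c\<in>C. (grd c \<bullet> v) *\<^sub>R c) = v" "(\<Sum>c\<in>C. grd c \<bullet> v) = 0"
proof -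
  have "(\<Sum>c\<in>C. lam c (0 + 1 *\<^sub>R v) *\<^sub>R c) = 0 + 1 *\<^sub>R v" "(\<Sum>c\<in>C. lam c (0 + 1 *\<^sub>R v)) = 1"
    by (rule sum_lam_scaleR sum_lam)+
  then show "(\<Sum>c\<in>C. (grd c \<bullet> v) *\<^sub>R c) = v" "(\<Sum>c\<in>C. grd c \<bullet> v) = 0"
    unfolding lam_add by (simp_all add: scaleR_add_left sum.distrib sum_lam sum_lam_scaleR)
qed

end

text \<open>On the facet opposite to \<open>a\<close> the remaining coordinates sum to 1, so
  constants and Cartesian coordinates are combinations of \<open>lam b\<close> with \<open>b\<close>
  different from \<open>a\<close>. Each product of \<open>lam b\<close> and \<open>\<psi> b\<close>
  vanishes on the facet opposite to \<open>b\<close>, as a test along the edge requires.\<close>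

lemma polys_facet_decompose:
  fixes C K :: "(real^'d) set"
  assumes S: "full_simplex C K" and a: "a \<in> C" and g: "g \<in> polys (Suc k)"
  obtains \<psi> where "\<And>b. \<psi> b \<in> polys k"
    "\<And>x. full_simplex.lam C a x = 0 \<Longrightarrow> g x = (\<Sum>b\<in>C - {a}. full_simplex.lam C b x * \<psi> b x)"
proof -
  interpret full_simplex C K by (rule S)
  obtain c \<phi> where \<phi>: "\<And>i. \<phi> i \<in> polys k" "\<And>x. g x = c + (\<Sum>i\<in>UNIV. x $ i * \<phi> i x)"
    by (rule polys_decompose[OF g]) (rule that)
  define \<psi> where "\<psi> b x = c + (\<Sum>i\<in>UNIV. b $ i * \<phi> i x)" for b x
  show ?thesis
  proof (rule that)
    show "\<psi> b \<in> polys k" for b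
      unfolding \<psi>_def using \<phi>(1) by (intro polys_add polys_const polys_sum polys_scale)
    fix x assume la: "lam a x = 0"
    have s: "(\<Sum>b\<in>C - {a}. lam b x) = 1" "(\<Sum>b\<in>C - {a}. lam b x *\<^sub>R b) = x"
      using sum_lam[of x] sum_lam_scaleR[of x] la a finite_C by (auto simp: sum.remove)
    have "x $ i = (\<Sum>b\<in>C - {a}. lam b x * b $ i)" for i
      by (subst s(2)[symmetric]) (simp add: sum_component)
    then have "g x = (\<Sum>b\<in>C - {a}. lam b x) * c + (\<Sum>i\<in>UNIV. (\<Sum>b\<in>C - {a}. lam b x * b $ i) * \<phi> i x)"
      unfolding \<phi>(2) s(1) by simp
    also have "(\<Sum>i\<in>UNIV. (\<Sum>b\<in>C - {a}. lam b x * b $ i) * \<phi> i x)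
        = (\<Sum>b\<in>C - {a}. lam b x * (\<Sum>i\<in>UNIV. b $ i * \<phi> i x))"
      unfolding sum_distrib_right sum_distrib_left by (subst sum.swap) (simp add: mult_ac)
    also have "(\<Sum>b\<in>C - {a}. lam b x) * c + (\<Sum>b\<in>C - {a}. lam b x * (\<Sum>i\<in>UNIV. b $ i * \<phi> i x))
        = (\<Sum>b\<in>C - {a}. lam b x * \<psi> b x)"
      by (simp add: \<psi>_def distrib_left sum.distrib sum_distrib_right)
    finally show "g x = (\<Sum>b\<in>C - {a}. lam b x * \<psi> b x)" .
  qed
qed

text \<open>The degrees of freedom tested are those of the Brezzi--Douglas--Marini element, but only
  fields \<open>h \<cdot> (a - b)\<close> along an edge from \<open>b\<close> to \<open>a\<close> with \<open>h = 0\<close> on the facet opposite to \<open>b\<close>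
  are needed: their normal trace lives on the facet opposite to \<open>a\<close>.\<close>

lemma pressure_pairing_constant:
  fixes C K :: "(real^'d) set"
  assumes S: "full_simplex C K" and k: "k \<ge> 1" and p: "p \<in> polys (k - 1)"
    and m: "\<And>F. F facet_of K \<Longrightarrow> bmeas F m"
    and mp: "\<And>F. F facet_of K \<Longrightarrow> \<exists>m'\<in>polys k. \<forall>x\<in>rel_interior F. m x = m' x"
    and eq: "\<And>w. w \<in> vec_polys k \<Longrightarrow> cell_integral (interior K) (\<lambda>x. p x * divergence w x)
        = boundary_integral K (\<lambda>n x. m x * (w x \<bullet> n))"
  shows "\<exists>r. (\<forall>x\<in>K. p x = r) \<and> (\<forall>F. F facet_of K \<longrightarrow> (\<forall>x\<in>rel_interior F. m x = r))"
proof -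
  interpret full_simplex C K by (rule S)
  obtain l where l: "k = Suc l"
    using k by (cases k) auto
  have pl: "p \<in> polys l"
    using p l by simp
  from polys_has_derivative[OF pl] obtain P where P': "(\<forall>i. P i \<in> polys (l - 1)) \<and>
      (l = 0 \<longrightarrow> (\<forall>i x. P i x = 0)) \<and> (\<forall>x. (p has_derivative (\<lambda>v. \<Sum>i\<in>UNIV. v $ i * P i x)) (at x))"
    by (rule exE)
  then have P: "\<And>i. P i \<in> polys (l - 1)" "\<And>i x. l = 0 \<Longrightarrow> P i x = 0"
    "\<And>x. (p has_derivative (\<lambda>v. \<Sum>i\<in>UNIV. v $ i * P i x)) (at x)"
    by blast+
  define dP where "dP e x = (\<Sum>i\<in>UNIV. e $ i * P i x)" for e x
  have dP: "dP e \<in> polys (l - 1)" for e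
    unfolding dP_def using P(1) by (intro polys_sum polys_scale)
  have cont: "continuous_on UNIV q" if "q \<in> polys j" for q j
    using polys_continuous[OF that] .
  have fF: "fac c facet_of K" "good_facet (fac c)" "fac c \<subseteq> K" "bmeas (fac c) m" if "c \<in> C" for c
  proof -
    show F: "fac c facet_of K"
      using that by (auto simp: facet_of_K)
    show "good_facet (fac c)" "fac c \<subseteq> K" "bmeas (fac c) m"
      by (rule good_facet_fac[OF that] fac_subset[OF that] m[OF F])+
  qed
  have bF: "bmeas (fac c) q" if "c \<in> C" "continuous_on UNIV q" for c and q :: "real^'d \<Rightarrow> real"
    using fF(3)[OF that(1)] compact_K continuous_on_subset[OF that(2)] by (intro bmeas_continuous[of K q]) auto
  have bK: "bmeas (interior K) q" if "continuous_on UNIV q" for q :: "real^'d \<Rightarrow> real"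
    using interior_subset compact_K continuous_on_subset[OF that] by (intro bmeas_continuous[of K q]) auto
  have intK: "open (interior K)" "bounded (interior K)"
    using compact_K bounded_subset[OF compact_imp_bounded interior_subset] by auto
  \<comment> \<open>The hypothesis evaluates the integral of \<open>p\<close> against the edge
    derivative of \<open>h\<close>, the divergence theorem that of the derivative of the product.
    The difference isolates the derivative of \<open>p\<close> and, on the facet opposite to
    \<open>a\<close>, the jump \<open>p - m\<close>.\<close>
  have key: "cell_integral (interior K) (\<lambda>x. h x * dP (a - b) x)
      = (nrm a \<bullet> (a - b)) * facet_integral (fac a) (\<lambda>x. (p x - m x) * h x)"
    if ab: "a \<in> C" "b \<in> C" "a \<noteq> b" and h: "h \<in> polys k" and h0: "\<And>x. lam b x = 0 \<Longrightarrow> h x = 0" for a b h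
  proof -
    obtain D where D: "\<And>i. D i \<in> polys (k - 1)"
      "\<And>x. (h has_derivative (\<lambda>v. \<Sum>i\<in>UNIV. v $ i * D i x)) (at x)"
      using polys_has_derivative[OF h] by auto
    define e where "e = a - b"
    define dh where "dh x = (\<Sum>i\<in>UNIV. e $ i * D i x)" for x
    have "dh \<in> polys (k - 1)"
      unfolding dh_def using D(1) by (intro polys_sum polys_scale)
    note c = cont[OF this] cont[OF h] cont[OF pl] cont[OF dP[of e]]
    have "cell_integral (interior K) (\<lambda>x. p x * dh x) = cell_integral (interior K) (\<lambda>x. p x * divergence (\<lambda>x. h x *\<^sub>R e) x)"
      unfolding dh_def divergence_direction[where D = D, OF D(2)] ..
    also have "\<dots> = boundary_integral K (\<lambda>n x. m x * ((h x *\<^sub>R e) \<bullet> n))"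
      by (intro eq direction_vec_polys h)
    also have "\<dots> = (\<Sum>c\<in>C. facet_integral (fac c) (\<lambda>x. m x * ((h x *\<^sub>R e) \<bullet> nrm c)))"
      by (rule boundary_integral_K)
    \<comment> \<open>The facet opposite to \<open>b\<close> drops out since \<open>h\<close>
      vanishes there, every further facet since the edge is tangential to it.\<close>
    also have "\<dots> = (\<Sum>c\<in>C. if c = a then (nrm a \<bullet> e) * facet_integral (fac a) (\<lambda>x. m x * h x) else 0)"
    proof (rule sum.cong)
      fix c assume c': "c \<in> C"
      show "facet_integral (fac c) (\<lambda>x. m x * ((h x *\<^sub>R e) \<bullet> nrm c))
          = (if c = a then (nrm a \<bullet> e) * facet_integral (fac a) (\<lambda>x. m x * h x) else 0)"
      proof (cases "c = a")
        case True
        have "facet_integral (fac a) (\<lambda>x. m x * ((h x *\<^sub>R e) \<bullet> nrm a))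
            = facet_integral (fac a) (\<lambda>x. (nrm a \<bullet> e) * (m x * h x))"
          by (intro facet_integral_cong) (simp add: inner_commute)
        also have "\<dots> = (nrm a \<bullet> e) * facet_integral (fac a) (\<lambda>x. m x * h x)"
          using fF ab(1) bF[OF ab(1) c(2)] by (intro facet_integral_scale bmeas_mult) auto
        finally show ?thesis
          using True by simp
      next
        case False
        have "m x * ((h x *\<^sub>R e) \<bullet> nrm c) = 0" if "x \<in> fac c" for x
        proof (cases "c = b")
          case True
          then show ?thesis
            using that h0 ab(2) by (simp add: mem_fac)
        next
          case False
          then have "nrm c \<bullet> e = 0"
            using nrm_edge[OF c' ab] \<open>c \<noteq> a\<close> by (simp add: e_def)
          then show ?thesis
            by (simp add: inner_commute)
        qed
        then have "facet_integral (fac c) (\<lambda>x. m x * ((h x *\<^sub>R e) \<bullet> nrm c)) = facet_integral (fac c) (\<lambda>x. 0)"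
          by (rule facet_integral_cong)
        then show ?thesis
          using False by (simp add: facet_integral_def)
      qed
    qed simp
    also have "\<dots> = (nrm a \<bullet> e) * facet_integral (fac a) (\<lambda>x. m x * h x)"
      using ab(1) finite_C by simp
    finally have 1: "cell_integral (interior K) (\<lambda>x. p x * dh x) = (nrm a \<bullet> e) * facet_integral (fac a) (\<lambda>x. m x * h x)" .
    have 2: "cell_integral (interior K) (\<lambda>x. p x * dh x + h x * dP e x) = (nrm a \<bullet> e) * facet_integral (fac a) (\<lambda>x. p x * h x)"
      unfolding e_def
    proof (rule cell_integral_edge_derivative[OF ab])
      fix x s
      have "((\<lambda>s. h (x + s *\<^sub>R (a - b))) has_real_derivative dh (x + s *\<^sub>R (a - b))) (at s)"
        unfolding dh_def e_def by (rule has_derivative_along_line[OF D(2)])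
      moreover have "((\<lambda>s. p (x + s *\<^sub>R (a - b))) has_real_derivative dP (a - b) (x + s *\<^sub>R (a - b))) (at s)"
        unfolding dP_def by (rule has_derivative_along_line[OF P(3)])
      ultimately show "((\<lambda>s. p (x + s *\<^sub>R (a - b)) * h (x + s *\<^sub>R (a - b))) has_real_derivative
          p (x + s *\<^sub>R (a - b)) * dh (x + s *\<^sub>R (a - b)) + h (x + s *\<^sub>R (a - b)) * dP (a - b) (x + s *\<^sub>R (a - b))) (at s)"
        by (auto intro!: derivative_eq_intros)
    qed (use c h0 in \<open>auto simp: e_def intro!: continuous_intros\<close>)
    have "cell_integral (interior K) (\<lambda>x. p x * dh x + 1 * (h x * dP e x))
        = cell_integral (interior K) (\<lambda>x. p x * dh x) + 1 * cell_integral (interior K) (\<lambda>x. h x * dP e x)"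
      using c by (intro cell_integral_lin intK bK continuous_on_mult)
    then have 3: "cell_integral (interior K) (\<lambda>x. p x * dh x + h x * dP e x)
        = cell_integral (interior K) (\<lambda>x. p x * dh x) + cell_integral (interior K) (\<lambda>x. h x * dP e x)"
      by simp
    have "facet_integral (fac a) (\<lambda>x. p x * h x + (-1) * (m x * h x))
        = facet_integral (fac a) (\<lambda>x. p x * h x) + (-1) * facet_integral (fac a) (\<lambda>x. m x * h x)"
      using fF[OF ab(1)] bF[OF ab(1) c(2)] bF[OF ab(1) c(3)] by (intro facet_integral_lin bmeas_mult)
    then have 4: "facet_integral (fac a) (\<lambda>x. (p x - m x) * h x)
        = facet_integral (fac a) (\<lambda>x. p x * h x) - facet_integral (fac a) (\<lambda>x. m x * h x)"
      by (simp add: left_diff_distrib)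
    show ?thesis
      unfolding 4 e_def[symmetric] right_diff_distrib using 1 2 3 by linarith
  qed
  have lam_polys: "(\<lambda>x. lam b x * q x) \<in> polys (Suc j)" if "q \<in> polys j" for b q j
    unfolding lam_def by (rule polys_affine_mult[OF that])
  \<comment> \<open>The test is \<open>lam a * lam b\<close> times the derivative itself: the two
    factors vanish on the facets concerned and are positive inside, and the degree
    \<open>l - 1 + 2\<close> equals \<open>k\<close>. For \<open>l = 0\<close> the truncated
    \<open>l - 1\<close> would give too high a degree, but then the derivative is zero
    anyway.\<close>
  have dP0: "dP (a - b) x = 0" if ab: "a \<in> C" "b \<in> C" "a \<noteq> b" and x: "x \<in> interior K" for a b x
  proof (cases "l = 0")
    case True
    then show ?thesis
      using P(2) by (simp add: dP_def)
  next
    case False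
    then have k2: "k = Suc (Suc (l - 1))"
      using l by simp
    define h where "h x = lam a x * (lam b x * dP (a - b) x)" for x
    have h: "h \<in> polys k"
      unfolding h_def k2 by (intro lam_polys dP)
    have "facet_integral (fac a) (\<lambda>x. (p x - m x) * h x) = facet_integral (fac a) (\<lambda>x. 0)"
      by (rule facet_integral_cong) (use ab mem_fac in \<open>auto simp: h_def\<close>)
    then have 0: "cell_integral (interior K) (\<lambda>x. h x * dP (a - b) x) = 0"
      using key[OF ab h] by (simp add: h_def facet_integral_def)
    have C: "continuous_on UNIV (\<lambda>x. h x * dP (a - b) x)"
      by (intro continuous_on_mult cont[OF h] cont[OF dP])
    have nn: "h y * dP (a - b) y \<ge> 0" if "y \<in> interior K" for y
    proof -
      have "h y * dP (a - b) y = lam a y * lam b y * (dP (a - b) y * dP (a - b) y)"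
        by (simp add: h_def)
      also have "\<dots> \<ge> 0"
        using that ab(1,2) by (intro mult_nonneg_nonneg zero_le_square) (simp_all add: mem_interior_K less_imp_le)
      finally show ?thesis .
    qed
    have "h x * dP (a - b) x = 0"
      by (rule cell_integral_eq_0_imp[OF intK bK[OF C] continuous_on_subset[OF C subset_UNIV] nn 0 x])
    moreover have "lam a x > 0" "lam b x > 0"
      using x ab by (auto simp: mem_interior_K)
    ultimately show ?thesis
      by (auto simp: h_def)
  qed
  have grad0: "dP v x = 0" if x: "x \<in> interior K" for v x
  proof -
    obtain c0 where c0: "c0 \<in> C"
      using card_C by fastforce
    have lin: "linear (\<lambda>v. dP v x)"
      by (rule linearI) (auto simp: dP_def sum.distrib distrib_right sum_distrib_left mult.assoc)
    \<comment> \<open>The weights sum to 0, so subtracting \<open>c0\<close> in every term changes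
      nothing and leaves edge vectors only.\<close>
    have "v = (\<Sum>c\<in>C. (grd c \<bullet> v) *\<^sub>R c) - (\<Sum>c\<in>C. grd c \<bullet> v) *\<^sub>R c0"
      using vector_eq_sum_grd[of v] by simp
    also have "\<dots> = (\<Sum>c\<in>C. (grd c \<bullet> v) *\<^sub>R (c - c0))"
      by (simp add: scaleR_diff_right sum_subtractf scaleR_sum_left)
    finally have "dP v x = dP (\<Sum>c\<in>C. (grd c \<bullet> v) *\<^sub>R (c - c0)) x"
      by (rule arg_cong[where f = "\<lambda>v. dP v x"])
    also have "\<dots> = (\<Sum>c\<in>C. (grd c \<bullet> v) *\<^sub>R dP (c - c0) x)"
      by (simp only: linear_sum[OF lin] linear_scale[OF lin])
    also have "\<dots> = 0"
    proof (rule sum.neutral, rule ballI)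
      fix c assume "c \<in> C"
      then show "(grd c \<bullet> v) *\<^sub>R dP (c - c0) x = 0"
        using dP0[OF _ c0 _ x, of c] linear_0[OF lin] by (cases "c = c0") auto
    qed
    finally show ?thesis .
  qed
  obtain x0 where x0: "x0 \<in> interior K"
    using interior_K_nonempty by blast
  define r where "r = p x0"
  have "p x = r" if "x \<in> interior K" for x
    unfolding r_def
  proof (rule has_derivative_zero_unique[of "interior K" p])
    show "(p has_derivative (\<lambda>h. 0)) (at x within interior K)" if "x \<in> interior K" for x
      using P(3)[of x] grad0[OF that] unfolding dP_def by (auto intro: has_derivative_at_withinI)
  qed (use that x0 convex_K in \<open>auto simp: convex_interior\<close>)
  then have pr: "p x = r" if "x \<in> K" for x
    using continuous_constant_on_closure[of "interior K" p r x] that cont[OF pl]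
    by (auto simp: closure_interior_K intro: continuous_on_subset)
  have "m x = r" if F: "F facet_of K" and x: "x \<in> rel_interior F" for F x
  proof -
    obtain a where a: "a \<in> C" "F = fac a"
      using F facet_of_K by blast
    obtain m' where m': "m' \<in> polys k" "\<And>x. x \<in> rel_interior F \<Longrightarrow> m x = m' x"
      using mp[OF F] by blast
    have "(\<lambda>x. r - m' x) \<in> polys (Suc l)"
      using m'(1) l by (intro polys_diff polys_const) simp
    then obtain \<psi> where \<psi>: "\<And>b. \<psi> b \<in> polys l"
      "\<And>x. lam a x = 0 \<Longrightarrow> r - m' x = (\<Sum>b\<in>C - {a}. lam b x * \<psi> b x)"
      by (rule polys_facet_decompose[OF S a(1)]) (rule that)
    have lp: "(\<lambda>x. lam b x * \<psi> b x) \<in> polys k" for b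
      unfolding l by (rule lam_polys[OF \<psi>(1)])
    have bm: "bmeas F (\<lambda>x. r - m x)"
      using m[OF F] by (intro bmeas_diff bmeas_const)
    have blp: "bmeas F (\<lambda>x. lam b x * \<psi> b x)" for b
      unfolding a(2) by (intro bF a cont[OF lp])
    have zero: "facet_integral F (\<lambda>x. (r - m x) * (lam b x * \<psi> b x)) = 0" if b: "b \<in> C - {a}" for b
    proof -
      have ab: "a \<in> C" "b \<in> C" "a \<noteq> b"
        using a b by auto
      have "cell_integral (interior K) (\<lambda>x. (lam b x * \<psi> b x) * dP (a - b) x) = cell_integral (interior K) (\<lambda>x. 0)"
        using dP0[OF ab] by (intro cell_integral_cong) simp
      moreover have "nrm a \<bullet> (a - b) \<noteq> 0"
        using nrm_edge[OF a(1) ab] grd_nz[OF a(1)] by simp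
      ultimately have "facet_integral F (\<lambda>x. (p x - m x) * (lam b x * \<psi> b x)) = 0"
        using key[OF ab lp[of b]] a(2) by simp
      also have "facet_integral F (\<lambda>x. (p x - m x) * (lam b x * \<psi> b x))
          = facet_integral F (\<lambda>x. (r - m x) * (lam b x * \<psi> b x))"
        using fac_subset[OF a(1)] a(2) pr by (intro facet_integral_cong) auto
      finally show ?thesis .
    qed
    \<comment> \<open>One factor \<open>r - m x\<close> is replaced by its decomposition into
      admissible tests, each of which gives zero; thus the square integrates to zero.\<close>
    have "facet_integral F (\<lambda>x. (r - m x) * (r - m x))
        = facet_integral F (\<lambda>x. \<Sum>b\<in>C - {a}. (r - m x) * (lam b x * \<psi> b x))"
    proof (rule facet_integral_cong_rel_interior)
      fix x assume x: "x \<in> rel_interior F"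
      then have "lam a x = 0"
        using mem_rel_interior_fac[OF a(1)] a(2) by simp
      then have "r - m x = (\<Sum>b\<in>C - {a}. lam b x * \<psi> b x)"
        using \<psi>(2) m'(2)[OF x] by simp
      then show "(r - m x) * (r - m x) = (\<Sum>b\<in>C - {a}. (r - m x) * (lam b x * \<psi> b x))"
        by (simp only: sum_distrib_left[symmetric])
    next
      show "good_facet F" "bmeas F (\<lambda>x. (r - m x) * (r - m x))"
        "bmeas F (\<lambda>x. \<Sum>b\<in>C - {a}. (r - m x) * (lam b x * \<psi> b x))"
        unfolding a(2) by (rule fF(2)[OF a(1)] bmeas_mult[OF bm bm, unfolded a(2)]
            bmeas_sum[OF bmeas_mult[OF bm blp], unfolded a(2)])+
    qed
    also have "\<dots> = (\<Sum>b\<in>C - {a}. facet_integral F (\<lambda>x. (r - m x) * (lam b x * \<psi> b x)))"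
      using fF(2)[OF a(1)] a(2) finite_C by (intro facet_integral_sum bmeas_mult[OF bm blp]) auto
    also have "\<dots> = 0"
      using zero by simp
    finally have 0: "facet_integral F (\<lambda>x. (r - m x) * (r - m x)) = 0" .
    have "continuous_on (rel_interior F) (\<lambda>x. (r - m' x) * (r - m' x))"
      by (intro continuous_intros polys_continuous[OF m'(1)])
    then have "continuous_on (rel_interior F) (\<lambda>x. (r - m x) * (r - m x))"
      using m'(2) by (simp cong: continuous_on_cong)
    then have "(r - m x) * (r - m x) = 0"
      using fF(2)[OF a(1)] a(2) x 0 by (intro facet_integral_eq_0_imp[OF _ bmeas_mult[OF bm bm]]) auto
    then show ?thesis
      by simp
  qed
  then show ?thesis
    using pr by (intro exI[of _ r]) auto
qed

section \<open>Bilinearity of the forms\<close>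

text \<open>This and the two sets below are domains of linearity of the forms. They refer to the
  cells of \<open>T\<close> only, so a field on the whole domain qualifies for the mesh of either
  subdomain.\<close>

definition cell_smooth :: "(real^'d) set set \<Rightarrow> (real^'d \<Rightarrow> real^'d) set" where
  "cell_smooth T = {u. \<forall>K\<in>T. smooth_on_cell K u}"

definition cell_bmeas :: "'a::euclidean_space set set \<Rightarrow> ('a \<Rightarrow> 'b::euclidean_space) set" where
  "cell_bmeas T = {q. \<forall>K\<in>T. bmeas (interior K) q}"

definition facet_bmeas :: "'a::euclidean_space set set \<Rightarrow> ('a \<Rightarrow> 'b::euclidean_space) set" where
  "facet_bmeas T = {q. \<forall>F\<in>facets T. bmeas F q}"

lemma bmeas_lin: "bmeas S f \<Longrightarrow> bmeas S g \<Longrightarrow> bmeas S (f + c *\<^sub>R g)"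
  unfolding plus_fun_def scaleR_fun_def by (intro bmeas_add bmeas_scaleR_const)

lemma subspace_if_lin:
  "0 \<in> S \<Longrightarrow> (\<And>x y c. x \<in> S \<Longrightarrow> y \<in> S \<Longrightarrow> x + c *\<^sub>R y \<in> S) \<Longrightarrow> subspace S"
  unfolding subspace_def by (metis add_0 scaleR_one)

lemma bmeas_0: "bmeas S 0"
  using bmeas_const[of S 0] by (simp add: zero_fun_def)

lemma subspace_cell_bmeas: "subspace (cell_bmeas T)"
  by (rule subspace_if_lin) (auto simp: cell_bmeas_def bmeas_lin bmeas_0)

lemma subspace_facet_bmeas: "subspace (facet_bmeas T)"
  by (rule subspace_if_lin) (auto simp: facet_bmeas_def bmeas_lin bmeas_0)

lemma smooth_on_cell_0: "smooth_on_cell K 0"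
proof -
  have "(\<lambda>_. 0) \<in> (vec_polys 0 :: (real^'a \<Rightarrow> real^'a) set)"
    by (simp add: vec_polys_def polys_const)
  then show ?thesis
    unfolding smooth_on_cell_def using vec_polys_C1 by fastforce
qed

lemma subspace_cell_smooth: "subspace (cell_smooth T)"
  by (rule subspace_if_lin) (auto simp: cell_smooth_def smooth_on_cell_lin(1) smooth_on_cell_0)

lemma cell_integral_lin_on:
  assumes "open S" "bounded S" "\<And>u. u \<in> A \<Longrightarrow> bmeas S (L u)" "bmeas S g"
    and lin: "\<And>y. y \<in> S \<Longrightarrow> lin_on A (\<lambda>u. L u y)"
  shows "lin_on A (\<lambda>u. cell_integral S (\<lambda>y. L u y \<bullet> g y))"
  unfolding lin_on_def
proof (intro ballI allI)
  fix u v c assume uv: "u \<in> A" "v \<in> A"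
  have "cell_integral S (\<lambda>y. L (u + c *\<^sub>R v) y \<bullet> g y) = cell_integral S (\<lambda>y. L u y \<bullet> g y + c * (L v y \<bullet> g y))"
    using lin_onD[OF lin uv] by (intro cell_integral_cong) (simp add: inner_add_left)
  also have "\<dots> = cell_integral S (\<lambda>y. L u y \<bullet> g y) + c * cell_integral S (\<lambda>y. L v y \<bullet> g y)"
    using assms uv by (intro cell_integral_lin bmeas_inner) auto
  finally show "cell_integral S (\<lambda>y. L (u + c *\<^sub>R v) y \<bullet> g y) = cell_integral S (\<lambda>y. L u y \<bullet> g y) + c *\<^sub>R cell_integral S (\<lambda>y. L v y \<bullet> g y)"
    by simp
qed

lemma facet_integral_lin_on:
  assumes "good_facet F" "\<And>u. u \<in> A \<Longrightarrow> bmeas F (L u)" "bmeas F g"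
    and lin: "\<And>y. y \<in> F \<Longrightarrow> lin_on A (\<lambda>u. L u y)"
  shows "lin_on A (\<lambda>u. facet_integral F (\<lambda>y. L u y \<bullet> g y))"
  unfolding lin_on_def
proof (intro ballI allI)
  fix u v c assume uv: "u \<in> A" "v \<in> A"
  have "facet_integral F (\<lambda>y. L (u + c *\<^sub>R v) y \<bullet> g y)
      = facet_integral F (\<lambda>y. L u y \<bullet> g y + c * (L v y \<bullet> g y))"
    using lin_onD[OF lin uv] by (intro facet_integral_cong) (simp add: inner_add_left)
  also have "\<dots> = facet_integral F (\<lambda>y. L u y \<bullet> g y) + c * facet_integral F (\<lambda>y. L v y \<bullet> g y)"
    using assms uv by (intro facet_integral_lin bmeas_inner) auto
  finally show "facet_integral F (\<lambda>y. L (u + c *\<^sub>R v) y \<bullet> g y)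
      = facet_integral F (\<lambda>y. L u y \<bullet> g y) + c *\<^sub>R facet_integral F (\<lambda>y. L v y \<bullet> g y)"
    by simp
qed

lemma lin_on_neg: "lin_on X f \<Longrightarrow> lin_on X (\<lambda>x. - f x)"
  by (simp add: lin_on_def algebra_simps)

lemma lin_on_scale: "lin_on X f \<Longrightarrow> lin_on X (\<lambda>x. c *\<^sub>R f x)"
  by (simp add: lin_on_def algebra_simps)

lemma linear_tangential: "linear (tangential n)"
  by (rule linearI) (auto simp: tangential_def inner_add_left algebra_simps)

lemma bmeas_tangential: "bmeas S f \<Longrightarrow> bmeas S (\<lambda>x. tangential n (f x))"
  using bmeas_bounded_linear linear_tangential linear_conv_bounded_linear by blast

lemma bmeas_matrix_vector: "bmeas S f \<Longrightarrow> bmeas S (\<lambda>x. (f x :: real^'d^'d) *v n)"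
proof -
  have "linear (\<lambda>A. (A :: real^'d^'d) *v n)"
    by (rule linearI) (simp_all add: matrix_vector_mult_add_rdistrib scaleR_matrix_vector_assoc)
  then show "bmeas S f \<Longrightarrow> bmeas S (\<lambda>x. (f x :: real^'d^'d) *v n)"
    using bmeas_bounded_linear linear_conv_bounded_linear by blast
qed

lemma a_form_sym: "a_form \<mu> \<beta> T x y = a_form \<mu> \<beta> T y x"
  by (cases x; cases y) (simp add: a_form_def mesh_inner_def L2_inner_def inner_commute)

locale vec_mesh = mesh T for T :: "(real^'d) set set"
begin

lemma facet_sub: "K \<in> T \<Longrightarrow> F facet_of K \<Longrightarrow> F \<subseteq> K \<and> F \<in> facets T \<and> good_facet F"
  using facets_good by (auto simp: facets_def facet_of_def face_of_imp_subset)

lemma cell_smoothD: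
  assumes "u \<in> cell_smooth T" "K \<in> T"
  shows "smooth_on_cell K u" "bmeas (interior K) (sym_grad u)" "bmeas (interior K) (divergence u)"
    "F facet_of K \<Longrightarrow> bmeas F (inner_trace K u)" "F facet_of K \<Longrightarrow> bmeas F (inner_trace K (sym_grad u))"
proof -
  show s: "smooth_on_cell K u"
    using assms by (simp add: cell_smooth_def)
  show "bmeas (interior K) (sym_grad u)" "bmeas (interior K) (divergence u)"
    using smooth_on_cell_bmeas(1,2)[OF s elem(1)[OF assms(2)]] .
  assume "F facet_of K"
  then have "F \<subseteq> closure (interior K)"
    using facet_sub assms(2) elem(3) by simp
  then show "bmeas F (inner_trace K u)" "bmeas F (inner_trace K (sym_grad u))"
    using smooth_on_cell_bmeas(3,4)[OF s elem(1)[OF assms(2)]] by auto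
qed

lemma facet_bmeasD: "v \<in> facet_bmeas T \<Longrightarrow> K \<in> T \<Longrightarrow> F facet_of K \<Longrightarrow> bmeas F v"
  using facet_sub by (auto simp: facet_bmeas_def)

lemma cell_bmeasD: "q \<in> cell_bmeas T \<Longrightarrow> K \<in> T \<Longrightarrow> bmeas (interior K) q"
  by (auto simp: cell_bmeas_def)

lemma int_elem: "K \<in> T \<Longrightarrow> open (interior K) \<and> bounded (interior K)"
  using elem(1) bounded_subset[OF compact_imp_bounded interior_subset] by auto

lemma trace_lin:
  assumes "K \<in> T"
  shows "x \<in> K \<Longrightarrow> lin_on (cell_smooth T) (\<lambda>u. inner_trace K u x)"
    and "x \<in> K \<Longrightarrow> lin_on (cell_smooth T) (\<lambda>u. inner_trace K (sym_grad u) x)"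
    and "x \<in> interior K \<Longrightarrow> lin_on (cell_smooth T) (\<lambda>u. sym_grad u x)"
    and "x \<in> interior K \<Longrightarrow> lin_on (cell_smooth T) (\<lambda>u. divergence u x)"
proof -
  have s: "smooth_on_cell K u" if "u \<in> cell_smooth T" for u
    using that assms by (simp add: cell_smooth_def)
  show "lin_on (cell_smooth T) (\<lambda>u. inner_trace K u x)" "lin_on (cell_smooth T) (\<lambda>u. inner_trace K (sym_grad u) x)" if "x \<in> K"
    using smooth_on_cell_lin(4,5)[OF s s, of _ _ x] that elem(3)[OF assms] by (auto simp: lin_on_def)
  show "lin_on (cell_smooth T) (\<lambda>u. sym_grad u x)" "lin_on (cell_smooth T) (\<lambda>u. divergence u x)" if "x \<in> interior K"
    using smooth_on_cell_lin(2,3)[OF s s, of _ _ x] that by (auto simp: lin_on_def)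
qed

lemma jump_lin:
  assumes "K \<in> T" "x \<in> K"
  shows "lin_on (cell_smooth T \<times> facet_bmeas T) (\<lambda>p. inner_trace K (fst p) x - snd p x)"
  using trace_lin(1)[OF assms] by (auto simp: lin_on_def algebra_simps)

lemma jump_bmeas:
  assumes "K \<in> T" "F facet_of K" "p \<in> cell_smooth T \<times> facet_bmeas T"
  shows "bmeas F (\<lambda>x. inner_trace K (fst p) x - snd p x)"
  using assms cell_smoothD(4) facet_bmeasD by (intro bmeas_diff) auto

lemma boundary_lin_on:
  assumes "\<And>F n. F facet_of K \<Longrightarrow> lin_on A (\<lambda>u. facet_integral F (\<lambda>x. g u n x))"
  shows "lin_on A (\<lambda>u. boundary_integral K (\<lambda>n x. g u n x))"
  unfolding boundary_integral_def by (intro lin_on_sum assms) auto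

lemma a_form_lin:
  assumes y: "y \<in> cell_smooth T \<times> facet_bmeas T"
  shows "lin_on (cell_smooth T \<times> facet_bmeas T) (\<lambda>x. a_form \<mu> \<beta> T x y)"
proof -
  \<comment> \<open>The last term is commuted so that in each term the factor depending on
    \<open>x\<close> stands on the left, as the linearity lemmas for cell and facet integrals
    expect.\<close>
  have eq: "(\<lambda>x. a_form \<mu> \<beta> T x y) = (\<lambda>x.
     (\<Sum>K\<in>T. cell_integral (interior K) (\<lambda>t. ((2 * \<mu>) *\<^sub>R sym_grad (fst x) t) \<bullet> sym_grad (fst y) t))
     + (\<Sum>K\<in>T. boundary_integral K (\<lambda>n t.
          ((2 * \<beta> * \<mu> / diameter K) *\<^sub>R (inner_trace K (fst x) t - snd x t)) \<bullet> (inner_trace K (fst y) t - snd y t)))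
     - (\<Sum>K\<in>T. boundary_integral K (\<lambda>n t.
          ((2 * \<mu>) *\<^sub>R (inner_trace K (sym_grad (fst x)) t *v n)) \<bullet> (inner_trace K (fst y) t - snd y t)))
     - (\<Sum>K\<in>T. boundary_integral K (\<lambda>n t.
          (inner_trace K (fst x) t - snd x t) \<bullet> ((2 * \<mu>) *\<^sub>R (inner_trace K (sym_grad (fst y)) t *v n)))))"
    by (simp add: fun_eq_iff a_form_def mesh_inner_def L2_inner_def case_prod_beta inner_commute)
  show ?thesis
    unfolding eq
  proof (intro lin_on_add lin_on_sub lin_on_sum boundary_lin_on)
    fix K assume K: "K \<in> T"
    show "lin_on (cell_smooth T \<times> facet_bmeas T) (\<lambda>x. cell_integral (interior K) (\<lambda>t. ((2 * \<mu>) *\<^sub>R sym_grad (fst x) t) \<bullet> sym_grad (fst y) t))"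
    proof (rule cell_integral_lin_on)
      show "lin_on (cell_smooth T \<times> facet_bmeas T) (\<lambda>x. (2 * \<mu>) *\<^sub>R sym_grad (fst x) t)" if "t \<in> interior K" for t
        using trace_lin(3)[OF K that] by (auto simp: lin_on_def algebra_simps)
    qed (use int_elem[OF K] cell_smoothD(2)[OF _ K] y in \<open>auto intro!: bmeas_scaleR_const\<close>)
    fix F n assume F: "F facet_of K"
    have FK: "good_facet F" "\<And>t. t \<in> F \<Longrightarrow> t \<in> K"
      using facet_sub[OF K F] by auto
    show "lin_on (cell_smooth T \<times> facet_bmeas T) (\<lambda>x. facet_integral F (\<lambda>t. ((2 * \<beta> * \<mu> / diameter K) *\<^sub>R (inner_trace K (fst x) t - snd x t)) \<bullet> (inner_trace K (fst y) t - snd y t)))"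
      by (intro facet_integral_lin_on FK lin_on_scale jump_lin[OF K] bmeas_scaleR_const jump_bmeas[OF K F] y)
    show "lin_on (cell_smooth T \<times> facet_bmeas T) (\<lambda>x. facet_integral F (\<lambda>t. ((2 * \<mu>) *\<^sub>R (inner_trace K (sym_grad (fst x)) t *v n)) \<bullet> (inner_trace K (fst y) t - snd y t)))"
    proof (rule facet_integral_lin_on)
      show "lin_on (cell_smooth T \<times> facet_bmeas T) (\<lambda>x. (2 * \<mu>) *\<^sub>R (inner_trace K (sym_grad (fst x)) t *v n))" if "t \<in> F" for t
        using trace_lin(2)[OF K FK(2)[OF that]]
        by (auto simp: lin_on_def algebra_simps scaleR_matrix_vector_assoc[symmetric])
    qed (use FK jump_bmeas[OF K F y] cell_smoothD(5)[OF _ K F] in \<open>auto intro!: bmeas_scaleR_const bmeas_matrix_vector\<close>)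
    show "lin_on (cell_smooth T \<times> facet_bmeas T) (\<lambda>x. facet_integral F (\<lambda>t. (inner_trace K (fst x) t - snd x t) \<bullet> ((2 * \<mu>) *\<^sub>R (inner_trace K (sym_grad (fst y)) t *v n))))"
      by (intro facet_integral_lin_on FK jump_lin[OF K] jump_bmeas[OF K F] bmeas_scaleR_const bmeas_matrix_vector)
        (use cell_smoothD(5)[OF _ K F] y in auto)
  qed
qed

lemma a_form_lin2: "x \<in> cell_smooth T \<times> facet_bmeas T \<Longrightarrow> lin_on (cell_smooth T \<times> facet_bmeas T) (\<lambda>y. a_form \<mu> \<beta> T x y)"
  using a_form_lin by (subst a_form_sym)

lemma b_form_eq: "b_form T x y = - (\<Sum>K\<in>T. cell_integral (interior K) (\<lambda>t. fst x t * divergence (fst y) t))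
   + (\<Sum>K\<in>T. boundary_integral K (\<lambda>n t. snd x t * ((inner_trace K (fst y) t - snd y t) \<bullet> n)))"
  by (simp add: b_form_def mesh_inner_def L2_inner_def case_prod_beta)

lemma b_form_lin1:
  assumes y: "y \<in> cell_smooth T \<times> facet_bmeas T"
  shows "lin_on (cell_bmeas T \<times> facet_bmeas T) (\<lambda>x. b_form T x y)"
  unfolding b_form_eq
proof (intro lin_on_add lin_on_neg lin_on_sum boundary_lin_on)
  fix K assume K: "K \<in> T"
  have "lin_on (cell_bmeas T \<times> facet_bmeas T) (\<lambda>x. cell_integral (interior K) (\<lambda>t. fst x t \<bullet> divergence (fst y) t))"
    using int_elem[OF K] cell_smoothD(3)[OF _ K] cell_bmeasD[OF _ K] y by (intro cell_integral_lin_on) (auto simp: lin_on_def)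
  then show "lin_on (cell_bmeas T \<times> facet_bmeas T) (\<lambda>x. cell_integral (interior K) (\<lambda>t. fst x t * divergence (fst y) t))"
    by simp
  fix F n assume F: "F facet_of K"
  have "lin_on (cell_bmeas T \<times> facet_bmeas T) (\<lambda>x. facet_integral F (\<lambda>t. snd x t \<bullet> ((inner_trace K (fst y) t - snd y t) \<bullet> n)))"
    using facet_sub[OF K F] facet_bmeasD[OF _ K F] jump_bmeas[OF K F y]
    by (intro facet_integral_lin_on bmeas_inner bmeas_const) (auto simp: lin_on_def)
  then show "lin_on (cell_bmeas T \<times> facet_bmeas T) (\<lambda>x. facet_integral F (\<lambda>t. snd x t * ((inner_trace K (fst y) t - snd y t) \<bullet> n)))"
    by simp
qed

lemma b_form_lin2:
  assumes x: "x \<in> cell_bmeas T \<times> facet_bmeas T"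
  shows "lin_on (cell_smooth T \<times> facet_bmeas T) (\<lambda>y. b_form T x y)"
  unfolding b_form_eq
proof (intro lin_on_add lin_on_neg lin_on_sum boundary_lin_on)
  fix K assume K: "K \<in> T"
  have "lin_on (cell_smooth T \<times> facet_bmeas T) (\<lambda>y. cell_integral (interior K) (\<lambda>t. divergence (fst y) t \<bullet> fst x t))"
    using int_elem[OF K] cell_smoothD(3)[OF _ K] cell_bmeasD[OF _ K] x trace_lin(4)[OF K]
    by (intro cell_integral_lin_on) (auto simp: lin_on_def)
  then show "lin_on (cell_smooth T \<times> facet_bmeas T) (\<lambda>y. cell_integral (interior K) (\<lambda>t. fst x t * divergence (fst y) t))"
    by (simp add: mult.commute)
  fix F n assume F: "F facet_of K"
  have "lin_on (cell_smooth T \<times> facet_bmeas T) (\<lambda>y. facet_integral F (\<lambda>t. (inner_trace K (fst y) t - snd y t) \<bullet> (snd x t *\<^sub>R n)))"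
    using facet_sub[OF K F] facet_bmeasD[OF _ K F] jump_bmeas[OF K F] jump_lin[OF K] x
    by (intro facet_integral_lin_on bmeas_scaleR bmeas_const) auto
  then show "lin_on (cell_smooth T \<times> facet_bmeas T) (\<lambda>y. facet_integral F (\<lambda>t. snd x t * ((inner_trace K (fst y) t - snd y t) \<bullet> n)))"
    by simp
qed

lemma mesh_inner_lin1: "g \<in> cell_bmeas T \<Longrightarrow> lin_on (cell_bmeas T) (\<lambda>f. mesh_inner T f g)"
  unfolding mesh_inner_def L2_inner_def
  using int_elem cell_bmeasD by (intro lin_on_sum cell_integral_lin_on) (auto simp: lin_on_def)

lemma mesh_inner_lin2: "f \<in> cell_bmeas T \<Longrightarrow> lin_on (cell_bmeas T) (\<lambda>g. mesh_inner T f g)"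
  using mesh_inner_lin1[of f] by (simp add: mesh_inner_def L2_inner_def inner_commute)

lemma facets_inD: "F \<in> facets_in T \<Gamma> \<Longrightarrow> F \<in> facets T \<and> good_facet F"
  using facets_good by (auto simp: facets_in_def)

lemma aI_form_lin:
  assumes y: "fst y \<in> facet_bmeas T" "snd y \<in> facet_bmeas T"
  shows "lin_on (facet_bmeas T \<times> facet_bmeas T) (\<lambda>x. aI_form \<gamma> \<mu> \<kappa> T \<Gamma> x y)"
proof -
  have eq: "(\<lambda>x. aI_form \<gamma> \<mu> \<kappa> T \<Gamma> x y) = (\<lambda>x. \<Sum>F\<in>facets_in T \<Gamma>. facet_integral F (\<lambda>t.
       ((\<gamma> * sqrt (\<mu> / \<kappa>)) *\<^sub>R tangential (mesh_normal T F) (fst x t - snd x t))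
         \<bullet> tangential (mesh_normal T F) (fst y t - snd y t)))"
    by (simp add: fun_eq_iff aI_form_def case_prod_beta)
  show ?thesis
    unfolding eq
  proof (rule lin_on_sum)
    fix F assume F: "F \<in> facets_in T \<Gamma>"
    show "lin_on (facet_bmeas T \<times> facet_bmeas T) (\<lambda>x. facet_integral F (\<lambda>t.
       ((\<gamma> * sqrt (\<mu> / \<kappa>)) *\<^sub>R tangential (mesh_normal T F) (fst x t - snd x t))
         \<bullet> tangential (mesh_normal T F) (fst y t - snd y t)))"
    proof (rule facet_integral_lin_on)
      show "lin_on (facet_bmeas T \<times> facet_bmeas T) (\<lambda>x. (\<gamma> * sqrt (\<mu> / \<kappa>)) *\<^sub>R tangential (mesh_normal T F) (fst x t - snd x t))" for t
        by (intro lin_on_scale lin_on_linear[OF linear_tangential]) (auto simp: lin_on_def algebra_simps)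
    qed (use facets_inD[OF F] y in \<open>auto simp: facet_bmeas_def intro!: bmeas_scaleR_const bmeas_tangential bmeas_diff\<close>)
  qed
qed

lemma aI_form_sym: "aI_form \<gamma> \<mu> \<kappa> T \<Gamma> x y = aI_form \<gamma> \<mu> \<kappa> T \<Gamma> y x"
  by (cases x; cases y) (simp add: aI_form_def inner_commute)

lemma aI_form_lin2:
  "fst x \<in> facet_bmeas T \<Longrightarrow> snd x \<in> facet_bmeas T \<Longrightarrow> lin_on (facet_bmeas T \<times> facet_bmeas T) (\<lambda>y. aI_form \<gamma> \<mu> \<kappa> T \<Gamma> x y)"
  using aI_form_lin by (subst aI_form_sym)

lemma bI_form_lin1:
  assumes y: "fst y \<in> facet_bmeas T" "snd y \<in> facet_bmeas T"
  shows "lin_on (facet_bmeas T) (\<lambda>q. bI_form T \<Gamma> q y)"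
proof -
  have eq: "(\<lambda>q. bI_form T \<Gamma> q y) = (\<lambda>q. \<Sum>F\<in>facets_in T \<Gamma>. facet_integral F (\<lambda>t.
       q t \<bullet> ((fst y t - snd y t) \<bullet> mesh_normal T F)))"
    by (simp add: fun_eq_iff bI_form_def case_prod_beta)
  show ?thesis
    unfolding eq
    by (intro lin_on_sum facet_integral_lin_on)
      (use facets_inD y in \<open>auto simp: facet_bmeas_def lin_on_def intro!: bmeas_inner bmeas_diff bmeas_const\<close>)
qed

lemma bI_form_lin2:
  assumes q: "q \<in> facet_bmeas T"
  shows "lin_on (facet_bmeas T \<times> facet_bmeas T) (\<lambda>y. bI_form T \<Gamma> q y)"
proof -
  have eq: "(\<lambda>y. bI_form T \<Gamma> q y) = (\<lambda>y. \<Sum>F\<in>facets_in T \<Gamma>. facet_integral F (\<lambda>t.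
       (fst y t - snd y t) \<bullet> (q t *\<^sub>R mesh_normal T F)))"
    by (simp add: fun_eq_iff bI_form_def case_prod_beta)
  show ?thesis
    unfolding eq
    by (intro lin_on_sum facet_integral_lin_on)
      (use facets_inD q in \<open>auto simp: facet_bmeas_def lin_on_def algebra_simps intro!: bmeas_scaleR bmeas_diff bmeas_const\<close>)
qed

lemma c_form_lin1:
  assumes q: "q \<in> cell_bmeas T"
  shows "lin_on (cell_bmeas T \<times> cell_bmeas T) (\<lambda>x. c_form lam \<alpha> T x q)"
proof -
  have eq: "(\<lambda>x. c_form lam \<alpha> T x q) = (\<lambda>x. mesh_inner T (inverse lam *\<^sub>R (\<alpha> *\<^sub>R fst x - snd x)) q)"
    by (auto simp: fun_eq_iff c_form_def case_prod_beta intro!: arg_cong2[of _ _ _ _ "mesh_inner T"])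
  show ?thesis
    unfolding eq
  proof (rule lin_on_comp[OF _ mesh_inner_lin1[OF q]])
    show "linear (\<lambda>x. inverse lam *\<^sub>R (\<alpha> *\<^sub>R fst x - snd x))"
      by (rule linearI) (auto simp: algebra_simps)
    show "(\<lambda>x. inverse lam *\<^sub>R (\<alpha> *\<^sub>R fst x - snd x)) ` (cell_bmeas T \<times> cell_bmeas T) \<subseteq> cell_bmeas T"
      by (auto intro!: subspace_scale subspace_diff subspace_cell_bmeas)
  qed
qed

lemma c_form_lin2:
  assumes x: "x \<in> cell_bmeas T \<times> cell_bmeas T"
  shows "lin_on (cell_bmeas T) (\<lambda>q. c_form lam \<alpha> T x q)"
proof -
  have eq: "(\<lambda>q. c_form lam \<alpha> T x q) = (\<lambda>q. mesh_inner T (inverse lam *\<^sub>R (\<alpha> *\<^sub>R fst x - snd x)) q)"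
    by (auto simp: fun_eq_iff c_form_def case_prod_beta intro!: arg_cong2[of _ _ _ _ "mesh_inner T"])
  show ?thesis
    unfolding eq using x
    by (intro mesh_inner_lin2) (auto intro!: subspace_scale subspace_diff subspace_cell_bmeas)
qed

end

section \<open>The finite element spaces\<close>

text \<open>The property shared by elements and facets that makes a piecewise function a sum of
  functions on single cells.\<close>

definition ri_disjoint :: "'a::euclidean_space set set \<Rightarrow> bool" where
  "ri_disjoint \<C> \<longleftrightarrow> (\<forall>C\<in>\<C>. \<forall>C'\<in>\<C>. \<forall>x. x \<in> rel_interior C \<longrightarrow> x \<in> rel_interior C' \<longrightarrow> C = C')"

lemma subspace_vec_polys: "subspace (vec_polys k)"
proof (rule subspace_if_lin)
  show "0 \<in> vec_polys k"
    by (simp add: vec_polys_def polys_const)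
  show "p + c *\<^sub>R q \<in> vec_polys k" if "p \<in> vec_polys k" "q \<in> vec_polys k" for p q :: "real^'a \<Rightarrow> real^'a" and c
    using that by (auto simp: vec_polys_def intro!: polys_add polys_scale)
qed

lemma fin_dim_vec_polys: "fin_dim (vec_polys k :: (real^'d \<Rightarrow> real^'d) set)"
proof -
  define E :: "'d \<Rightarrow> (real^'d \<Rightarrow> real) \<Rightarrow> real^'d \<Rightarrow> real^'d" where "E i q = (\<lambda>x. q x *\<^sub>R axis i 1)" for i q
  have "linear (E i)" for i
    by (rule linearI) (auto simp: E_def fun_eq_iff scaleR_add_left)
  then have "fin_dim {\<Sum>i\<in>UNIV. f i |f. \<forall>i\<in>UNIV. f i \<in> E i ` polys k}"
    by (intro fin_dim_sum fin_dim_image fin_dim_polys) auto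
  moreover have "vec_polys k \<subseteq> {\<Sum>i\<in>UNIV. f i |f. \<forall>i\<in>UNIV. f i \<in> E i ` polys k}"
  proof
    fix p :: "real^'d \<Rightarrow> real^'d" assume p: "p \<in> vec_polys k"
    have "p = (\<Sum>i\<in>UNIV. E i (\<lambda>x. p x $ i))"
    proof
      fix x
      show "p x = (\<Sum>i\<in>UNIV. E i (\<lambda>x. p x $ i)) x"
        using basis_expansion[of "p x"] by (simp add: sum_fun_apply E_def scalar_mult_eq_scaleR)
    qed
    moreover have "\<forall>i\<in>UNIV. E i (\<lambda>x. p x $ i) \<in> E i ` polys k"
      using p by (auto simp: vec_polys_def)
    ultimately show "p \<in> {\<Sum>i\<in>UNIV. f i |f. \<forall>i\<in>UNIV. f i \<in> E i ` polys k}"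
      by (intro CollectI exI[of _ "\<lambda>i. E i (\<lambda>x. p x $ i)"] conjI)
  qed
  ultimately show ?thesis
    by (rule fin_dim_subset)
qed

lemma subspace_piecewise:
  assumes "subspace P"
  shows "subspace (piecewise P \<C>)"
proof (rule subspace_if_lin)
  show "0 \<in> piecewise P \<C>"
    unfolding piecewise_def using subspace_0[OF assms] by (auto intro!: bexI[of _ 0])
  fix u v c assume uv: "u \<in> piecewise P \<C>" "v \<in> piecewise P \<C>"
  show "u + c *\<^sub>R v \<in> piecewise P \<C>"
    unfolding piecewise_def
  proof (intro CollectI conjI ballI)
    fix C assume "C \<in> \<C>"
    then obtain p q where "p \<in> P" "\<forall>x\<in>rel_interior C. u x = p x" "q \<in> P" "\<forall>x\<in>rel_interior C. v x = q x"
      using uv unfolding piecewise_def by blast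
    then show "\<exists>p\<in>P. \<forall>x\<in>rel_interior C. (u + c *\<^sub>R v) x = p x"
      using assms by (intro bexI[of _ "p + c *\<^sub>R q"]) (auto intro: subspace_add subspace_scale)
  qed (use uv in \<open>auto simp: piecewise_def\<close>)
qed

lemma piecewise_sum:
  assumes C: "finite \<C>" "ri_disjoint \<C>" and v: "v \<in> piecewise P \<C>"
  obtains p where "\<And>c. c \<in> \<C> \<Longrightarrow> p c \<in> P"
    "v = (\<Sum>c\<in>\<C>. (\<lambda>x. if x \<in> rel_interior c then p c x else 0))"
proof -
  have "\<forall>c\<in>\<C>. \<exists>p. p \<in> P \<and> (\<forall>x\<in>rel_interior c. v x = p x)"
    using v by (auto simp: piecewise_def)
  then obtain p where p: "\<forall>c\<in>\<C>. p c \<in> P \<and> (\<forall>x\<in>rel_interior c. v x = p c x)"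
    by (rule bchoice[THEN exE])
  have "v x = (\<Sum>c\<in>\<C>. (\<lambda>x. if x \<in> rel_interior c then p c x else 0)) x" for x
  proof (cases "\<exists>c\<in>\<C>. x \<in> rel_interior c")
    case True
    then obtain c where c: "c \<in> \<C>" "x \<in> rel_interior c"
      by blast
    have "(\<Sum>c\<in>\<C>. (\<lambda>x. if x \<in> rel_interior c then p c x else 0)) x = (\<Sum>c'\<in>\<C>. if c' = c then v x else 0)"
      unfolding sum_fun_apply
    proof (rule sum.cong)
      fix c' assume "c' \<in> \<C>"
      then show "(if x \<in> rel_interior c' then p c' x else 0) = (if c' = c then v x else 0)"
        using c C(2) p unfolding ri_disjoint_def by auto
    qed simp
    then show ?thesis
      using c C(1) by simp
  next
    case False
    then have "v x = 0"
      using v by (auto simp: piecewise_def)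
    then show ?thesis
      using False by (simp add: sum_fun_apply)
  qed
  then show ?thesis
    using p by (intro that[of p] ext) auto
qed

lemma fin_dim_piecewise:
  assumes P: "fin_dim P" and C: "finite \<C>" "ri_disjoint \<C>"
  shows "fin_dim (piecewise P \<C>)"
proof -
  define E :: "'a set \<Rightarrow> ('a \<Rightarrow> 'b) \<Rightarrow> 'a \<Rightarrow> 'b" where "E c p = (\<lambda>x. if x \<in> rel_interior c then p x else 0)" for c p
  have "linear (E c)" for c
    by (rule linearI) (auto simp: E_def fun_eq_iff)
  then have "fin_dim {\<Sum>c\<in>\<C>. f c |f. \<forall>c\<in>\<C>. f c \<in> E c ` P}"
    using C by (intro fin_dim_sum fin_dim_image P) auto
  moreover have "piecewise P \<C> \<subseteq> {\<Sum>c\<in>\<C>. f c |f. \<forall>c\<in>\<C>. f c \<in> E c ` P}"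
  proof
    fix v assume v: "v \<in> piecewise P \<C>"
    obtain p where p: "\<And>c. c \<in> \<C> \<Longrightarrow> p c \<in> P" "v = (\<Sum>c\<in>\<C>. E c (p c))"
      by (rule piecewise_sum[OF C v]) (rule that, simp_all only: E_def)
    then show "v \<in> {\<Sum>c\<in>\<C>. f c |f. \<forall>c\<in>\<C>. f c \<in> E c ` P}"
      by (intro CollectI exI[of _ "\<lambda>c. E c (p c)"]) auto
  qed
  ultimately show ?thesis
    by (rule fin_dim_subset)
qed

text \<open>Relative interiors are Borel, being relatively open in an affine hull, and continuous
  pieces are bounded on compact cells. The conclusion is on \<open>UNIV\<close> so that facet
  functions of one mesh can be integrated over facets of another, as on the interface.\<close>

lemma piecewise_bmeas:
  fixes v :: "'a::euclidean_space \<Rightarrow> 'b::euclidean_space"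
  assumes C: "finite \<C>" "ri_disjoint \<C>" "\<And>c. c \<in> \<C> \<Longrightarrow> compact c"
    and v: "v \<in> piecewise P \<C>" and P: "\<And>p. p \<in> P \<Longrightarrow> continuous_on UNIV p"
  shows "bmeas UNIV v"
proof -
  obtain p where p: "\<And>c. c \<in> \<C> \<Longrightarrow> p c \<in> P"
    "v = (\<Sum>c\<in>\<C>. (\<lambda>x. if x \<in> rel_interior c then p c x else 0))"
    by (rule piecewise_sum[OF C(1,2) v]) (rule that)
  have "bmeas UNIV (\<lambda>x. if x \<in> rel_interior c then p c x else 0)" if c: "c \<in> \<C>" for c
    unfolding bmeas_def
  proof
    obtain U where "open U" "rel_interior c = affine hull c \<inter> U"
      using openin_rel_interior[of c] by (auto simp: openin_open)
    then have "rel_interior c \<in> sets borel"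
      by (simp add: borel_open borel_closed sets.Int)
    moreover have "p c \<in> borel_measurable borel"
      by (rule borel_measurable_continuous_onI[OF P[OF p(1)[OF c]]])
    ultimately show "(\<lambda>x. if x \<in> rel_interior c then p c x else 0) \<in> borel_measurable (restrict_space borel UNIV)"
      by (auto intro!: measurable_If_set)
    have "bmeas c (p c)"
      by (rule bmeas_continuous[OF continuous_on_subset[OF P[OF p(1)[OF c]] subset_UNIV] C(3)[OF c] subset_refl])
    then obtain B where "\<forall>x\<in>c. norm (p c x) \<le> B"
      unfolding bmeas_def by blast
    then have "norm (if x \<in> rel_interior c then p c x else 0) \<le> max B 0" for x
      using rel_interior_subset[of c] by (auto simp: le_max_iff_disj)
    then show "\<exists>B. \<forall>x\<in>UNIV. norm (if x \<in> rel_interior c then p c x else 0) \<le> B"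
      by blast
  qed
  then have "bmeas UNIV (\<lambda>x. \<Sum>c\<in>\<C>. if x \<in> rel_interior c then p c x else 0)"
    by (rule bmeas_sum)
  moreover have "v = (\<lambda>x. \<Sum>c\<in>\<C>. if x \<in> rel_interior c then p c x else 0)"
    unfolding p(2) by (simp add: fun_eq_iff sum_fun_apply)
  ultimately show ?thesis
    by simp
qed

lemma bmeas_UNIV_facet_bmeas: "bmeas UNIV v \<Longrightarrow> v \<in> facet_bmeas T"
  and bmeas_UNIV_cell_bmeas: "bmeas UNIV v \<Longrightarrow> v \<in> cell_bmeas T"
  unfolding facet_bmeas_def cell_bmeas_def using bmeas_subset by blast+

text \<open>Supplies test functions supported on chosen cells; disjointness ensures that they vanish
  on all others.\<close>

lemma piecewise_glue:
  assumes C: "ri_disjoint \<C>" and 0: "0 \<in> P" and sub: "\<D> \<subseteq> \<C>"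
    and f: "\<And>c. c \<in> \<D> \<Longrightarrow> \<exists>p\<in>P. \<forall>x\<in>rel_interior c. f x = p x"
  shows "(\<lambda>x. if x \<in> \<Union>(rel_interior ` \<D>) then f x else 0) \<in> piecewise P \<C>"
  unfolding piecewise_def
proof (intro CollectI conjI ballI allI impI)
  fix c assume c: "c \<in> \<C>"
  show "\<exists>p\<in>P. \<forall>x\<in>rel_interior c. (if x \<in> \<Union>(rel_interior ` \<D>) then f x else 0) = p x"
  proof (cases "c \<in> \<D>")
    case True
    obtain p where p: "p \<in> P" "\<forall>x\<in>rel_interior c. f x = p x"
      using f[OF True] by (rule bexE)
    show ?thesis
      by (rule bexI[OF _ p(1)]) (use p(2) True in auto)
  next
    case False
    have "x \<notin> \<Union>(rel_interior ` \<D>)" if "x \<in> rel_interior c" for x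
      using C that False c sub unfolding ri_disjoint_def by blast
    then show ?thesis
      by (intro bexI[OF _ 0]) simp
  qed
next
  fix x assume "x \<notin> \<Union>(rel_interior ` \<C>)"
  then show "(if x \<in> \<Union>(rel_interior ` \<D>) then f x else 0) = 0"
    using sub by auto
qed

lemma (in mesh) ri_disjoint_T: "ri_disjoint T"
  unfolding ri_disjoint_def
proof (intro ballI allI impI)
  fix C C' x assume "C \<in> T" "C' \<in> T" "x \<in> rel_interior C" "x \<in> rel_interior C'"
  then show "C = C'"
    using rel_interior_subset[of C'] elem(5)[of C] by (intro interior_disjoint[of C C' x]) auto
qed

lemma (in mesh) ri_disjoint_facets: "ri_disjoint (facets T)"
  unfolding ri_disjoint_def
proof (intro ballI allI impI)
  fix C C' x assume "C \<in> facets T" "C' \<in> facets T" "x \<in> rel_interior C" "x \<in> rel_interior C'"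
  then show "C = C'"
    using rel_interior_subset[of C'] by (intro facet_disjoint[of C C' x]) auto
qed

context vec_mesh
begin

lemma V_space_cell_smooth:
  assumes "v \<in> V_space k T'" "T \<subseteq> T'"
  shows "v \<in> cell_smooth T"
  unfolding cell_smooth_def smooth_on_cell_def
proof (intro CollectI ballI)
  fix K assume K: "K \<in> T"
  then obtain p where "p \<in> vec_polys k" "\<forall>x\<in>rel_interior K. v x = p x"
    using assms unfolding V_space_def piecewise_def by blast
  then show "\<exists>p. C1 p \<and> (\<forall>x\<in>interior K. v x = p x)"
    using vec_polys_C1 elem(5)[OF K] by (intro exI[of _ p]) auto
qed

lemma spaces_bmeas:
  "v \<in> V_space k T \<Longrightarrow> bmeas UNIV v" "q \<in> Q_space k T \<Longrightarrow> bmeas UNIV q"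
  "v' \<in> Vbar_space k T \<Gamma> \<Longrightarrow> bmeas UNIV v'" "q' \<in> Qbar_space k T \<Gamma> \<Longrightarrow> bmeas UNIV q'"
proof -
  have cont: "continuous_on UNIV p" if "p \<in> vec_polys k" for p :: "real^'d \<Rightarrow> real^'d"
    by (rule C1_continuous[OF vec_polys_C1[OF that]])
  have comp: "compact F" if "F \<in> facets T" for F
    using facets_good[OF that] by (rule good_facetE)
  show "bmeas UNIV v" if "v \<in> V_space k T"
  proof (rule piecewise_bmeas)
    show "v \<in> piecewise (vec_polys k) T"
      using that by (simp add: V_space_def Q_space_def Vbar_space_def Qbar_space_def)
  qed (rule finite_T ri_disjoint_T elem(1) cont | assumption)+
  show "bmeas UNIV q" if "q \<in> Q_space k T"
  proof (rule piecewise_bmeas)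
    show "q \<in> piecewise (polys (k - 1)) T"
      using that by (simp add: V_space_def Q_space_def Vbar_space_def Qbar_space_def)
  qed (rule finite_T ri_disjoint_T elem(1) polys_continuous | assumption)+
  show "bmeas UNIV v'" if "v' \<in> Vbar_space k T \<Gamma>"
  proof (rule piecewise_bmeas)
    show "v' \<in> piecewise (vec_polys k) (facets T)"
      using that by (simp add: V_space_def Q_space_def Vbar_space_def Qbar_space_def)
  qed (rule finite_facets ri_disjoint_facets comp cont | assumption)+
  show "bmeas UNIV q'" if "q' \<in> Qbar_space k T \<Gamma>"
  proof (rule piecewise_bmeas)
    show "q' \<in> piecewise (polys k) (facets T)"
      using that by (simp add: V_space_def Q_space_def Vbar_space_def Qbar_space_def)
  qed (rule finite_facets ri_disjoint_facets comp polys_continuous | assumption)+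
qed

lemma Vbar_space_facet_bmeas: "v \<in> Vbar_space k T \<Gamma> \<Longrightarrow> v \<in> facet_bmeas T'"
  by (intro bmeas_UNIV_facet_bmeas spaces_bmeas(3))

lemma Qbar_space_facet_bmeas: "v \<in> Qbar_space k T \<Gamma> \<Longrightarrow> v \<in> facet_bmeas T'"
  by (intro bmeas_UNIV_facet_bmeas spaces_bmeas(4))

lemma subspace_spaces:
  "subspace (V_space k T)" "subspace (Q_space k T)"
  "subspace (Vbar_space k T \<Gamma>)" "subspace (Qbar_space k T \<Gamma>)"
proof -
  show V: "subspace (V_space k T)" "subspace (Q_space k T)"
    unfolding V_space_def Q_space_def by (intro subspace_piecewise subspace_vec_polys subspace_polys)+
  have z: "subspace {v :: real^'d \<Rightarrow> 'b::real_vector. \<forall>x\<in>\<Gamma>. v x = 0}"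
    by (auto simp: subspace_def)
  have "Vbar_space k T \<Gamma> = piecewise (vec_polys k) (facets T) \<inter> {v. \<forall>x\<in>\<Gamma>. v x = 0}"
    "Qbar_space k T \<Gamma> = piecewise (polys k) (facets T) \<inter> {v. \<forall>x\<in>\<Gamma>. v x = 0}"
    by (auto simp: Vbar_space_def Qbar_space_def)
  then show "subspace (Vbar_space k T \<Gamma>)" "subspace (Qbar_space k T \<Gamma>)"
    by (auto intro!: subspace_inter z subspace_piecewise subspace_vec_polys subspace_polys)
qed

lemma fin_dim_spaces:
  "fin_dim (V_space k T)" "fin_dim (Q_space k T)"
  "fin_dim (Vbar_space k T \<Gamma>)" "fin_dim (Qbar_space k T \<Gamma>)"
proof -
  show "fin_dim (V_space k T)" "fin_dim (Q_space k T)"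
    unfolding V_space_def Q_space_def
    by (intro fin_dim_piecewise fin_dim_vec_polys fin_dim_polys finite_T ri_disjoint_T)+
  have "fin_dim (piecewise (vec_polys k) (facets T) :: (real^'d \<Rightarrow> real^'d) set)"
    "fin_dim (piecewise (polys k) (facets T) :: (real^'d \<Rightarrow> real) set)"
    by (intro fin_dim_piecewise fin_dim_vec_polys fin_dim_polys finite_facets ri_disjoint_facets)+
  then show "fin_dim (Vbar_space k T \<Gamma>)" "fin_dim (Qbar_space k T \<Gamma>)"
    by (auto intro: fin_dim_subset simp: Vbar_space_def Qbar_space_def)
qed

end

section \<open>Uniqueness on one mesh\<close>

lemma C1_0: "C1 0"
  by (rule vec_polys_C1[OF subspace_0[OF subspace_vec_polys]])

lemma divergence_0: "divergence (0 :: real^'d \<Rightarrow> real^'d) x = 0"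
proof -
  have "((\<lambda>_. 0 :: real^'d) has_derivative (*v) (0::real^'d^'d)) (at x)"
    by (simp add: matrix_vector_mult_0[abs_def])
  then have "jacobian (0 :: real^'d \<Rightarrow> real^'d) (at x) = 0"
    by (intro jacobian_unique) (simp add: zero_fun_def)
  then show ?thesis
    by (simp add: divergence_def trace_def)
qed

text \<open>Along the segment the derivative of \<open>p \<bullet> e\<close> is the quadratic form
  of the Jacobian at \<open>e\<close>, which sees only the symmetric part and hence
  vanishes.\<close>

lemma zero_strain_orthogonal:
  fixes p :: "real^'d \<Rightarrow> real^'d"
  assumes p: "C1 p" and S: "convex S" and strain: "\<And>x. x \<in> S \<Longrightarrow> sym_grad p x = 0"
    and xy: "x \<in> S" "y \<in> S"
  shows "(p x - p y) \<bullet> (x - y) = 0"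
proof -
  define e where "e = x - y"
  define f where "f t = p (y + t *\<^sub>R e) \<bullet> e" for t
  have skew: "(jacobian p (at z) *v e) \<bullet> e = 0" if "z \<in> S" for z
  proof -
    let ?A = "jacobian p (at z)"
    have "(transpose ?A *v e) \<bullet> e = (?A *v e) \<bullet> e"
      by (simp only: transpose_matrix_vector dot_lmul_matrix) (rule inner_commute)
    then have "(sym_grad p z *v e) \<bullet> e = (?A *v e) \<bullet> e"
      by (simp add: sym_grad_def scaleR_matrix_vector_assoc[symmetric] matrix_vector_mult_add_rdistrib inner_add_left)
    then show ?thesis
      using strain[OF that] by simp
  qed
  have D: "(f has_real_derivative 0) (at t)" if t: "0 \<le> t" "t \<le> 1" for t
  proof -
    have "y + t *\<^sub>R e = (1 - t) *\<^sub>R y + t *\<^sub>R x"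
      by (simp add: e_def algebra_simps)
    then have z: "y + t *\<^sub>R e \<in> S"
      using S xy t by (simp add: convex_alt)
    have "((\<lambda>x. p x \<bullet> e) has_derivative (\<lambda>h. (jacobian p (at (y + t *\<^sub>R e)) *v h) \<bullet> e)) (at (y + t *\<^sub>R e))"
      by (intro has_derivative_inner_left C1_has_derivative p)
    from has_derivative_along_line[OF this] show ?thesis
      using skew[OF z] by (simp add: f_def[abs_def])
  qed
  have cont: "continuous_on {0..1} f"
    using D by (intro continuous_at_imp_continuous_on ballI) (auto intro: DERIV_isCont)
  have "f 1 = f 0"
    by (rule DERIV_isconst_end[OF _ cont]) (use D in auto)
  then show ?thesis
    by (simp add: f_def e_def inner_diff_left)
qed

text \<open>A field with vanishing strain moves points orthogonally to their connecting lines, so its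
  value off a hyperplane piece on which it vanishes is orthogonal to a spanning set.\<close>

lemma zero_strain_zero:
  fixes p :: "real^'d \<Rightarrow> real^'d"
  assumes p: "C1 p" and K: "convex K" "closure (interior K) = K"
    and strain: "\<And>x. x \<in> interior K \<Longrightarrow> sym_grad p x = 0"
    and M: "M \<subseteq> K" "aff_dim M = int CARD('d) - 1" "\<And>x. x \<in> M \<Longrightarrow> p x = 0"
    and x: "x \<in> K"
  shows "p x = 0"
proof -
  have cont: "continuous_on S p" for S
    by (rule C1_continuous[OF p])
  have orth: "(p x - p y) \<bullet> (x - y) = 0" if x: "x \<in> interior K" and y: "y \<in> K" for x y
  proof (rule continuous_constant_on_closure[of "interior K" "\<lambda>y. (p x - p y) \<bullet> (x - y)" 0 y])
    show "(p x - p y) \<bullet> (x - y) = 0" if "y \<in> interior K" for y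
      using zero_strain_orthogonal[OF p convex_interior[OF K(1)] strain x that] .
  qed (use y K(2) in \<open>auto intro!: continuous_intros cont\<close>)
  \<comment> \<open>\<open>p x\<close> is orthogonal to \<open>x - y\<close> for all
    \<open>y\<close> in \<open>M\<close>, so the inner product with \<open>p x\<close> is constant
    on the affine hull of \<open>x\<close> and \<open>M\<close>, which is the whole space.
    Evaluating at \<open>x + p x\<close> gives \<open>p x = 0\<close>.\<close>
  have off: "p x = 0" if x: "x \<in> interior K" "x \<notin> affine hull M" for x
  proof -
    have "M \<subseteq> {y. p x \<bullet> y = p x \<bullet> x}"
      using orth[OF x(1)] M(1,3) by (force simp: inner_diff_right)
    then have "insert x M \<subseteq> {y. p x \<bullet> y = p x \<bullet> x}"
      by auto
    then have "affine hull (insert x M) \<subseteq> {y. p x \<bullet> y = p x \<bullet> x}"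
      by (intro hull_minimal affine_hyperplane)
    moreover have "affine hull (insert x M) = UNIV"
      using aff_dim_lt_full[of "insert x M"] x(2) M(2) by (auto simp: aff_dim_insert)
    ultimately have "x + p x \<in> {y. p x \<bullet> y = p x \<bullet> x}"
      by auto
    then show ?thesis
      by (simp add: inner_add_right)
  qed
  have "p x = 0" if x: "x \<in> interior K" for x
  proof (rule ccontr)
    assume nz: "p x \<noteq> 0"
    \<comment> \<open>The set of interior points with nonzero value is open and lies in a
      hyperplane, so it is empty.\<close>
    define V where "V = interior K \<inter> p -` (- {0})"
    have "open V"
      unfolding V_def by (intro continuous_open_preimage cont) auto
    moreover have "V \<subseteq> affine hull M"
      using off by (auto simp: V_def)
    ultimately have "V \<subseteq> interior (affine hull M)"
      by (simp add: interior_maximal)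
    moreover have "interior (affine hull M) = {}"
      using M(2) aff_dim_nonempty_interior[of "affine hull M"] by auto
    ultimately show False
      using x nz by (auto simp: V_def)
  qed
  then show ?thesis
    using continuous_constant_on_closure[of "interior K" p 0 x] x K(2) cont by auto
qed

section \<open>Coercivity, strain-free fields and piecewise constant pressures on one mesh\<close>

context vec_mesh
begin

lemma ri_subset: "F facet_of K \<Longrightarrow> K \<in> T \<Longrightarrow> rel_interior F \<subseteq> K \<and> rel_interior F \<subseteq> F \<and> rel_interior F \<noteq> {}"
  using rel_interior_subset[of F] facet_sub[of K F]
  by (auto simp: facet_of_def rel_interior_eq_empty face_of_imp_convex)

lemma V_space_operators:
  assumes v: "v \<in> V_space k T" and K: "K \<in> T"
  obtains p where "C1 p" "\<And>x. x \<in> interior K \<Longrightarrow> v x = p x"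
    "\<And>x. x \<in> interior K \<Longrightarrow> sym_grad v x = sym_grad p x"
    "\<And>x. x \<in> K \<Longrightarrow> inner_trace K v x = p x"
proof -
  have "v \<in> cell_smooth T"
    using V_space_cell_smooth[OF v] by simp
  then obtain p where p: "C1 p" "\<And>x. x \<in> interior K \<Longrightarrow> v x = p x"
    using K unfolding cell_smooth_def smooth_on_cell_def by blast
  show ?thesis
    using that[of p] p smooth_on_cell_operators(1,3)[where u = v and p = p and K = K] elem(3)[OF K] by simp
qed

lemma coercive_terms_nonneg:
  assumes K: "K \<in> T"
  shows "L2_inner (interior K) (sym_grad v) (sym_grad v) \<ge> 0"
    "facet_integral F (\<lambda>x. (norm (inner_trace K v x - v' x))\<^sup>2) \<ge> 0"
    "inverse (diameter K) * boundary_integral K (\<lambda>n x. (norm (inner_trace K v x - v' x))\<^sup>2) \<ge> 0"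
proof -
  show "L2_inner (interior K) (sym_grad v) (sym_grad v) \<ge> 0"
    unfolding L2_inner_def by (intro cell_integral_nonneg) auto
  show F: "facet_integral F (\<lambda>x. (norm (inner_trace K v x - v' x))\<^sup>2) \<ge> 0" for F
    by (intro facet_integral_nonneg) auto
  show "inverse (diameter K) * boundary_integral K (\<lambda>n x. (norm (inner_trace K v x - v' x))\<^sup>2) \<ge> 0"
    unfolding boundary_integral_def using elem(7)[OF K] F by (intro mult_nonneg_nonneg sum_nonneg) auto
qed

lemma a_form_nonneg:
  assumes "a_coercive c k \<mu> \<beta> T \<Gamma>" "c > 0" "\<mu> > 0" "v \<in> V_space k T" "v' \<in> Vbar_space k T \<Gamma>"
  shows "a_form \<mu> \<beta> T (v, v') (v, v') \<ge> 0"
proof -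
  have "0 \<le> (\<Sum>K\<in>T. L2_inner (interior K) (sym_grad v) (sym_grad v)
         + inverse (diameter K) * boundary_integral K (\<lambda>n x. (norm (inner_trace K v x - v' x))\<^sup>2))"
    by (intro sum_nonneg add_nonneg_nonneg coercive_terms_nonneg)
  then have "0 \<le> c * \<mu> * (\<Sum>K\<in>T. L2_inner (interior K) (sym_grad v) (sym_grad v)
         + inverse (diameter K) * boundary_integral K (\<lambda>n x. (norm (inner_trace K v x - v' x))\<^sup>2))"
    using assms(2,3) by simp
  also have "\<dots> \<le> a_form \<mu> \<beta> T (v, v') (v, v')"
    using assms(1,4,5) unfolding a_coercive_def by blast
  finally show ?thesis .
qed

lemma Vbar_continuous:
  assumes "v' \<in> Vbar_space k T \<Gamma>" "F \<in> facets T"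
  shows "continuous_on (rel_interior F) v'"
proof -
  obtain p where p: "p \<in> vec_polys k" "\<forall>x\<in>rel_interior F. v' x = p x"
    using assms unfolding Vbar_space_def piecewise_def by blast
  have "continuous_on (rel_interior F) p"
    by (rule C1_continuous[OF vec_polys_C1[OF p(1)]])
  then show ?thesis
    using p(2) by (simp cong: continuous_on_cong)
qed

text \<open>Coercivity bounds a sum of nonnegative integrals by zero, so each vanishes. Strain and
  jump are continuous on interiors and relative interiors, hence zero there pointwise.\<close>

lemma a_form_zero:
  assumes co: "a_coercive c k \<mu> \<beta> T \<Gamma>" "c > 0" "\<mu> > 0" and v: "v \<in> V_space k T" "v' \<in> Vbar_space k T \<Gamma>"
    and 0: "a_form \<mu> \<beta> T (v, v') (v, v') = 0" and K: "K \<in> T"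
  shows "x \<in> interior K \<Longrightarrow> sym_grad v x = 0"
    and "F facet_of K \<Longrightarrow> y \<in> rel_interior F \<Longrightarrow> inner_trace K v y = v' y"
proof -
  let ?S = "\<lambda>K. L2_inner (interior K) (sym_grad v) (sym_grad v)"
  let ?B = "\<lambda>K. inverse (diameter K) * boundary_integral K (\<lambda>n x. (norm (inner_trace K v x - v' x))\<^sup>2)"
  have "c * \<mu> * (\<Sum>K\<in>T. ?S K + ?B K) \<le> a_form \<mu> \<beta> T (v, v') (v, v')"
    using co(1) v unfolding a_coercive_def by blast
  then have "(c * \<mu>) * (\<Sum>K\<in>T. ?S K + ?B K) \<le> 0"
    using 0 by simp
  then have "(\<Sum>K\<in>T. ?S K + ?B K) \<le> 0"
    using co(2,3) unfolding mult_le_0_iff by linarith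
  moreover have nn: "?S K \<ge> 0" "?B K \<ge> 0" if "K \<in> T" for K
    using coercive_terms_nonneg[OF that] by blast+
  ultimately have "(\<Sum>K\<in>T. ?S K + ?B K) = 0"
    by (intro antisym sum_nonneg) auto
  then have "?S K + ?B K = 0"
    using nn K finite_T by (subst (asm) sum_nonneg_eq_0_iff) auto
  then have SB: "?S K = 0" "?B K = 0"
    using nn[OF K] by linarith+
  obtain p where p: "C1 p" "\<And>x. x \<in> interior K \<Longrightarrow> sym_grad v x = sym_grad p x"
    "\<And>x. x \<in> K \<Longrightarrow> inner_trace K v x = p x"
    by (rule V_space_operators[OF v(1) K]) (rule that)
  have vE: "v \<in> cell_smooth T"
    using V_space_cell_smooth[OF v(1)] by simp
  note intK = int_elem[OF K, THEN conjunct1] int_elem[OF K, THEN conjunct2]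
  show "sym_grad v x = 0" if x: "x \<in> interior K"
  proof -
    have "continuous_on (interior K) (\<lambda>x. sym_grad p x \<bullet> sym_grad p x)"
      by (intro continuous_on_inner continuous_sym_grad p(1))
    then have "continuous_on (interior K) (\<lambda>x. sym_grad v x \<bullet> sym_grad v x)"
      using p(2) by (simp cong: continuous_on_cong)
    moreover have "bmeas (interior K) (\<lambda>x. sym_grad v x \<bullet> sym_grad v x)"
      by (intro bmeas_inner cell_smoothD(2)[OF vE K])
    ultimately have "sym_grad v x \<bullet> sym_grad v x = 0"
      using SB(1) x unfolding L2_inner_def
      by (intro cell_integral_eq_0_imp[OF intK, of "\<lambda>x. sym_grad v x \<bullet> sym_grad v x"]) auto
    then show ?thesis
      by simp
  qed
  assume F: "F facet_of K" and y: "y \<in> rel_interior F"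
  note FK = facet_sub[OF K F]
  have "boundary_integral K (\<lambda>n x. (norm (inner_trace K v x - v' x))\<^sup>2) = 0"
    using SB(2) elem(7)[OF K] by simp
  then have "facet_integral F (\<lambda>x. (norm (inner_trace K v x - v' x))\<^sup>2) = 0"
    unfolding boundary_integral_def using F elem(8)[OF K] coercive_terms_nonneg(2)[OF K]
    by (subst (asm) sum_nonneg_eq_0_iff) auto
  then have I0: "facet_integral F (\<lambda>x. (inner_trace K v x - v' x) \<bullet> (inner_trace K v x - v' x)) = 0"
    by (simp add: power2_norm_eq_inner)
  have "continuous_on (rel_interior F) (inner_trace K v)"
  proof -
    have "continuous_on (rel_interior F) p"
      by (rule C1_continuous[OF p(1)])
    then show ?thesis
      using p(3) ri_subset[OF F K] by (subst continuous_on_cong[OF refl, of _ _ p]) auto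
  qed
  then have "continuous_on (rel_interior F) (\<lambda>x. (inner_trace K v x - v' x) \<bullet> (inner_trace K v x - v' x))"
    using Vbar_continuous[OF v(2)] FK by (intro continuous_on_inner continuous_on_diff) auto
  moreover have "(v, v') \<in> cell_smooth T \<times> facet_bmeas T"
    using vE Vbar_space_facet_bmeas[OF v(2)] by simp
  then have "bmeas F (\<lambda>x. inner_trace K (fst (v, v')) x - snd (v, v') x)"
    by (rule jump_bmeas[OF K F])
  then have bj: "bmeas F (\<lambda>x. inner_trace K v x - v' x)"
    by simp
  have "bmeas F (\<lambda>x. (inner_trace K v x - v' x) \<bullet> (inner_trace K v x - v' x))"
    by (rule bmeas_inner[OF bj bj])
  ultimately have "(inner_trace K v y - v' y) \<bullet> (inner_trace K v y - v' y) = 0"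
    using FK I0 y by (intro facet_integral_eq_0_imp[of F "\<lambda>x. (inner_trace K v x - v' x) \<bullet> (inner_trace K v x - v' x)"]) auto
  then show "inner_trace K v y = v' y"
    by simp
qed

lemma positive_area_facet:
  assumes "surface_area T A > 0"
  obtains F where "F \<in> facets T" "aff_dim (A \<inter> rel_interior F) = int CARD('d) - 1"
proof -
  obtain F where F: "F \<in> facets T" "emeasure (hyperplane_measure (affine hull F)) (A \<inter> F) \<noteq> 0"
    using assms unfolding surface_area_def by (metis (no_types, lifting) less_irrefl sum.neutral)
  then have "aff_dim (A \<inter> rel_interior F) = int DIM(real^'d) - 1"
    by (intro facet_positive_area_aff_dim facets_good) (auto simp: zero_less_iff_neq_zero)
  then show ?thesis
    using that F(1) by simp
qed

lemma displacement_zero: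
  assumes \<Omega>: "open \<Omega>" "connected \<Omega>" "interior (closure \<Omega>) = \<Omega>" "\<Union>T = closure \<Omega>"
    and v: "v \<in> V_space k T" "v' \<in> Vbar_space k T \<Gamma>" and \<Gamma>: "surface_area T \<Gamma> > 0"
    and strain: "\<And>K x. K \<in> T \<Longrightarrow> x \<in> interior K \<Longrightarrow> sym_grad v x = 0"
    and trace: "\<And>K F x. K \<in> T \<Longrightarrow> F facet_of K \<Longrightarrow> x \<in> rel_interior F \<Longrightarrow> inner_trace K v x = v' x"
  shows "v = 0" "v' = 0"
proof -
  \<comment> \<open>\<open>M\<close> will be the Dirichlet part of a facet at the start and the
    relative interior of a shared facet when passing to a neighbour.\<close>
  have zero: "\<forall>x\<in>K. inner_trace K v x = 0"
    if K: "K \<in> T" and M: "M \<subseteq> K" "aff_dim M = int CARD('d) - 1" "\<And>x. x \<in> M \<Longrightarrow> inner_trace K v x = 0" for K M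
  proof -
    obtain p where p: "C1 p" "\<And>x. x \<in> interior K \<Longrightarrow> sym_grad v x = sym_grad p x"
      "\<And>x. x \<in> K \<Longrightarrow> inner_trace K v x = p x"
      by (rule V_space_operators[OF v(1) K]) (rule that)
    have "p x = 0" if "x \<in> K" for x
    proof (rule zero_strain_zero[OF p(1) elem(2,3)[OF K] _ M(1,2) _ that])
      show "sym_grad p x = 0" if "x \<in> interior K" for x
        using p(2)[OF that] strain[OF K that] by simp
      show "p x = 0" if "x \<in> M" for x
        using p(3)[of x] M(1,3) that by auto
    qed
    then show ?thesis
      using p(3) by simp
  qed
  obtain F0 where F0: "F0 \<in> facets T" "aff_dim (\<Gamma> \<inter> rel_interior F0) = int CARD('d) - 1"
    using \<Gamma> by (rule positive_area_facet)
  obtain K0 where K0: "K0 \<in> T" "F0 facet_of K0"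
    using F0(1) unfolding facets_def by blast
  have Z0: "\<forall>x\<in>K0. inner_trace K0 v x = 0"
  proof (rule zero[OF K0(1) _ F0(2)])
    show "inner_trace K0 v x = 0" if "x \<in> \<Gamma> \<inter> rel_interior F0" for x
      using trace[OF K0] that v(2) by (simp add: Vbar_space_def)
  qed (use ri_subset[OF K0(2,1)] in auto)
  have Z: "\<forall>x\<in>K. inner_trace K v x = 0" if "K \<in> T" for K
  proof (rule facet_connected[OF \<Omega>, where Z = "\<lambda>K. \<forall>x\<in>K. inner_trace K v x = 0", OF K0(1) Z0 _ that])
    fix K K' F assume K: "K \<in> T" "K' \<in> T" "F facet_of K" "F facet_of K'" "\<forall>x\<in>K. inner_trace K v x = 0"
    have "aff_dim (rel_interior F) = aff_dim F"
      using facet_sub[OF K(1,3)] K(3) by (auto simp: facet_of_def face_of_imp_convex rel_interior_aff_dim)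
    also have "\<dots> = int CARD('d) - 1"
      using K(3) elem(6)[OF K(1)] by (simp add: facet_of_def)
    finally have "aff_dim (rel_interior F) = int CARD('d) - 1" .
    moreover have "inner_trace K' v x = 0" if "x \<in> rel_interior F" for x
      using trace[OF K(1,3) that] trace[OF K(2,4) that] K(5) ri_subset[OF K(3,1)] that by auto
    ultimately show "\<forall>x\<in>K'. inner_trace K' v x = 0"
      using zero[OF K(2), of "rel_interior F"] ri_subset[OF K(4,2)] by auto
  qed
  show "v = 0"
  proof
    fix x
    show "v x = 0 x"
    proof (cases "\<exists>K\<in>T. x \<in> interior K")
      case True
      then obtain K where K: "K \<in> T" "x \<in> interior K"
        by blast
      obtain p where p: "\<And>x. x \<in> interior K \<Longrightarrow> v x = p x" "\<And>x. x \<in> K \<Longrightarrow> inner_trace K v x = p x"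
        by (rule V_space_operators[OF v(1) K(1)]) (rule that)
      show ?thesis
        using p[of x] Z[OF K(1)] K(2) interior_subset[of K] by auto
    next
      case False
      then have "x \<notin> \<Union>(rel_interior ` T)"
        using elem(5) by auto
      then show ?thesis
        using v(1) by (simp add: V_space_def piecewise_def)
    qed
  qed
  show "v' = 0"
  proof
    fix x
    show "v' x = 0 x"
    proof (cases "\<exists>F\<in>facets T. x \<in> rel_interior F")
      case True
      then obtain K F where "K \<in> T" "F facet_of K" "x \<in> rel_interior F"
        unfolding facets_def by blast
      then show ?thesis
        using trace[of K F x] Z[of K] ri_subset[of F K] by auto
    next
      case False
      then have "x \<notin> \<Union>(rel_interior ` facets T)"
        by auto
      then show ?thesis
        using v(2) by (simp add: Vbar_space_def piecewise_def)
    qed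
  qed
qed

text \<open>Extension by zero localises the pairing: divergence and traces are taken from inside
  each element, so neighbours see zero even on shared facets.\<close>

lemma element_test_field:
  assumes K: "K \<in> T" and w: "w \<in> vec_polys k"
  defines "v \<equiv> \<lambda>x. if x \<in> interior K then w x else 0"
  shows "v \<in> V_space k T"
    and "b_form T (q, q') (v, 0) = - cell_integral (interior K) (\<lambda>x. q x * divergence w x)
      + boundary_integral K (\<lambda>n x. q' x * (w x \<bullet> n))"
proof -
  have "(\<lambda>x. if x \<in> \<Union>(rel_interior ` {K}) then w x else 0) \<in> piecewise (vec_polys k) T"
    using K w subspace_0[OF subspace_vec_polys] by (intro piecewise_glue ri_disjoint_T) auto
  then show "v \<in> V_space k T"
    using elem(5)[OF K] by (simp add: v_def V_space_def)
  have in_K: "v x = w x" if "x \<in> interior K" for x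
    using that by (simp add: v_def)
  have out_K: "v x = 0 x" if "x \<in> interior K'" "K' \<in> T" "K' \<noteq> K" for x K'
    using that interior_disjoint[OF that(2) K that(1)] interior_subset[of K] by (auto simp: v_def)
  note opK = smooth_on_cell_operators[where K = K and u = v and p = w, OF vec_polys_C1[OF w] in_K]
  note op0 = smooth_on_cell_operators[where u = v and p = "0 :: real^'d \<Rightarrow> real^'d", OF C1_0 out_K]
  have "(\<Sum>K'\<in>T. cell_integral (interior K') (\<lambda>t. q t * divergence v t))
      = (\<Sum>K'\<in>T. if K' = K then cell_integral (interior K) (\<lambda>x. q x * divergence w x) else 0)"
  proof (rule sum.cong)
    fix K' assume K': "K' \<in> T"
    show "cell_integral (interior K') (\<lambda>t. q t * divergence v t)
        = (if K' = K then cell_integral (interior K) (\<lambda>x. q x * divergence w x) else 0)"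
    proof (cases "K' = K")
      case True
      then show ?thesis
        using opK(2) by (auto intro!: cell_integral_cong)
    next
      case False
      have "cell_integral (interior K') (\<lambda>t. q t * divergence v t) = cell_integral (interior K') (\<lambda>t. 0)"
        using op0(2)[OF _ K' False] by (intro cell_integral_cong) (auto simp: divergence_0)
      then show ?thesis
        using False by simp
    qed
  qed simp
  then have s1: "(\<Sum>K'\<in>T. cell_integral (interior K') (\<lambda>t. q t * divergence v t)) = cell_integral (interior K) (\<lambda>x. q x * divergence w x)"
    using K finite_T by simp
  have "(\<Sum>K'\<in>T. boundary_integral K' (\<lambda>n t. q' t * ((inner_trace K' v t - 0 t) \<bullet> n)))
      = (\<Sum>K'\<in>T. if K' = K then boundary_integral K (\<lambda>n x. q' x * (w x \<bullet> n)) else 0)"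
  proof (rule sum.cong)
    fix K' assume K': "K' \<in> T"
    show "boundary_integral K' (\<lambda>n t. q' t * ((inner_trace K' v t - 0 t) \<bullet> n))
        = (if K' = K then boundary_integral K (\<lambda>n x. q' x * (w x \<bullet> n)) else 0)"
    proof (cases "K' = K")
      case True
      have "boundary_integral K (\<lambda>n t. q' t * ((inner_trace K v t - 0 t) \<bullet> n))
          = boundary_integral K (\<lambda>n x. q' x * (w x \<bullet> n))"
        unfolding boundary_integral_def
      proof (intro sum.cong refl facet_integral_cong)
        fix F x assume "F \<in> {F. F facet_of K}" "x \<in> F"
        then have "x \<in> closure (interior K)"
          using facet_sub[OF K] elem(3)[OF K] by auto
        then show "q' x * ((inner_trace K v x - 0 x) \<bullet> outward_normal K F) = q' x * (w x \<bullet> outward_normal K F)"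
          using opK(3) by simp
      qed
      then show ?thesis
        using True by simp
    next
      case False
      have "boundary_integral K' (\<lambda>n t. q' t * ((inner_trace K' v t - 0 t) \<bullet> n)) = boundary_integral K' (\<lambda>n t. 0)"
        unfolding boundary_integral_def
      proof (intro sum.cong refl facet_integral_cong)
        fix F x assume "F \<in> {F. F facet_of K'}" "x \<in> F"
        then have "x \<in> closure (interior K')"
          using facet_sub[OF K'] elem(3)[OF K'] by auto
        then show "q' x * ((inner_trace K' v x - 0 x) \<bullet> outward_normal K' F) = 0"
          using op0(3)[OF _ K' False] by simp
      qed
      then show ?thesis
        using False by (simp add: boundary_integral_def facet_integral_def)
    qed
  qed simp
  then have s2: "(\<Sum>K'\<in>T. boundary_integral K' (\<lambda>n t. q' t * ((inner_trace K' v t - 0 t) \<bullet> n)))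
      = boundary_integral K (\<lambda>n x. q' x * (w x \<bullet> n))"
    using K finite_T by simp
  show "b_form T (q, q') (v, 0) = - cell_integral (interior K) (\<lambda>x. q x * divergence w x)
      + boundary_integral K (\<lambda>n x. q' x * (w x \<bullet> n))"
    unfolding b_form_eq fst_conv snd_conv s1 s2 ..
qed

text \<open>\<open>T'\<close> allows the pressure to be given on a larger mesh, as the total
  pressure is on the union. On each element the condition \<open>b\<close> reduces to polynomial
  tests on that element alone.\<close>

lemma pressure_elementwise_constant:
  assumes k: "k \<ge> 1" and q: "q \<in> Q_space k T'" "T \<subseteq> T'" "q' \<in> Qbar_space k T \<Gamma>"
    and b: "\<And>v. v \<in> V_space k T \<Longrightarrow> b_form T (q, q') (v, 0) = 0" and K: "K \<in> T"
  shows "\<exists>r. (\<forall>x\<in>interior K. q x = r) \<and> (\<forall>F. F facet_of K \<longrightarrow> (\<forall>x\<in>rel_interior F. q' x = r))"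
proof -
  obtain C where C: "full_simplex C K"
    using K by (rule simplexE)
  obtain p where p: "p \<in> polys (k - 1)" "\<forall>x\<in>rel_interior K. q x = p x"
    using q K unfolding Q_space_def piecewise_def by blast
  have qp: "q x = p x" if "x \<in> interior K" for x
    using p(2) that elem(5)[OF K] by simp
  have "\<exists>r. (\<forall>x\<in>K. p x = r) \<and> (\<forall>F. F facet_of K \<longrightarrow> (\<forall>x\<in>rel_interior F. q' x = r))"
  proof (rule pressure_pairing_constant[OF C k p(1)])
    fix F assume F: "F facet_of K"
    show "bmeas F q'"
      using facet_bmeasD[OF Qbar_space_facet_bmeas[OF q(3)] K F] .
    show "\<exists>m'\<in>polys k. \<forall>x\<in>rel_interior F. q' x = m' x"
      using q(3) facet_sub[OF K F] unfolding Qbar_space_def piecewise_def by blast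
  next
    fix w :: "real^'d \<Rightarrow> real^'d" assume w: "w \<in> vec_polys k"
    have "cell_integral (interior K) (\<lambda>x. q x * divergence w x) = boundary_integral K (\<lambda>n x. q' x * (w x \<bullet> n))"
      using element_test_field(2)[OF K w, of q q'] b[OF element_test_field(1)[OF K w]] by simp
    moreover have "cell_integral (interior K) (\<lambda>x. q x * divergence w x) = cell_integral (interior K) (\<lambda>x. p x * divergence w x)"
      using qp by (intro cell_integral_cong) simp
    ultimately show "cell_integral (interior K) (\<lambda>x. p x * divergence w x) = boundary_integral K (\<lambda>n x. q' x * (w x \<bullet> n))"
      by simp
  qed
  then show ?thesis
    using qp interior_subset[of K] by (metis subsetD)
qed

text \<open>A shared facet carries a single value of \<open>q'\<close>, equal to the constants of
  both neighbours; a zero at one facet point therefore spreads over the connected mesh.\<close>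

lemma pressure_zero:
  assumes \<Omega>: "open \<Omega>" "connected \<Omega>" "interior (closure \<Omega>) = \<Omega>" "\<Union>T = closure \<Omega>"
    and const: "\<And>K. K \<in> T \<Longrightarrow>
      \<exists>r. (\<forall>x\<in>interior K. q x = r) \<and> (\<forall>F. F facet_of K \<longrightarrow> (\<forall>x\<in>rel_interior F. q' x = r))"
    and F0: "F0 \<in> facets T" "x0 \<in> rel_interior F0" "q' x0 = (0::real)"
    and q': "q' \<in> Qbar_space k T \<Gamma>"
  shows "q' = 0" "\<And>K x. K \<in> T \<Longrightarrow> x \<in> interior K \<Longrightarrow> q x = (0::real)"
proof -
  define Z where "Z K \<longleftrightarrow> (\<forall>x\<in>interior K. q x = 0) \<and> (\<forall>F. F facet_of K \<longrightarrow> (\<forall>x\<in>rel_interior F. q' x = 0))" for K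
  have start: "Z K" if K: "K \<in> T" "F facet_of K" "x \<in> rel_interior F" "q' x = 0" for K F x
  proof -
    obtain r where r: "\<forall>x\<in>interior K. q x = r" "\<forall>F. F facet_of K \<longrightarrow> (\<forall>x\<in>rel_interior F. q' x = r)"
      using const[OF K(1)] by blast
    then have "r = 0"
      using K by metis
    then show ?thesis
      using r unfolding Z_def by blast
  qed
  obtain K0 where K0: "K0 \<in> T" "F0 facet_of K0"
    using F0(1) unfolding facets_def by blast
  have Z: "Z K" if "K \<in> T" for K
  proof (rule facet_connected[OF \<Omega>, where Z = Z, OF K0(1) start[OF K0 F0(2,3)] _ that])
    fix K K' F assume K: "K \<in> T" "K' \<in> T" "F facet_of K" "F facet_of K'" "Z K"
    obtain x where x: "x \<in> rel_interior F"
      using ri_subset[OF K(3,1)] by blast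
    show "Z K'"
      using start[OF K(2,4) x] K(3,5) x unfolding Z_def by blast
  qed
  show "q x = 0" if "K \<in> T" "x \<in> interior K" for K x
    using Z[OF that(1)] that(2) unfolding Z_def by blast
  show "q' = 0"
  proof
    fix x
    show "q' x = 0 x"
    proof (cases "\<exists>F\<in>facets T. x \<in> rel_interior F")
      case True
      then obtain K F where "K \<in> T" "F facet_of K" "x \<in> rel_interior F"
        unfolding facets_def by blast
      then show ?thesis
        using Z[of K] unfolding Z_def by auto
    next
      case False
      then have "x \<notin> \<Union>(rel_interior ` facets T)"
        by auto
      then show ?thesis
        using q' by (simp add: Qbar_space_def piecewise_def)
    qed
  qed
qed

text \<open>The test function is the normal on \<open>F\<close> and zero on all other facets.\<close>

lemma neumann_facet_pressure_zero:
  assumes F: "F \<in> facets T" "\<exists>!K. K \<in> T \<and> F facet_of K" "rel_interior F \<inter> \<Gamma> = {}"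
    and const: "\<And>K. K \<in> T \<Longrightarrow>
      \<exists>r. (\<forall>x\<in>interior K. q x = r) \<and> (\<forall>F. F facet_of K \<longrightarrow> (\<forall>x\<in>rel_interior F. q' x = r))"
    and q': "q' \<in> Qbar_space k T \<Gamma>'"
    and b: "\<And>v'. v' \<in> Vbar_space k T \<Gamma> \<Longrightarrow> b_form T (q, q') (0, v') = 0"
    and x: "x \<in> rel_interior F"
  shows "q' x = (0::real)"
proof -
  obtain K where K: "K \<in> T" "F facet_of K" and uniq: "\<And>K'. K' \<in> T \<Longrightarrow> F facet_of K' \<Longrightarrow> K' = K"
    using F(2) by blast
  note FK = facet_sub[OF K]
  obtain r where r: "\<And>F x. F facet_of K \<Longrightarrow> x \<in> rel_interior F \<Longrightarrow> q' x = r"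
    using const[OF K(1)] by blast
  obtain C where "full_simplex C K"
    using K(1) by (rule simplexE)
  then interpret S: full_simplex C K .
  obtain c where c: "c \<in> C" "F = S.fac c"
    using K(2) S.facet_of_K by blast
  define n where "n = outward_normal K F"
  have n1: "n \<bullet> n = 1"
    using S.norm_nrm[OF c(1)] S.outward_normal_fac[OF c(1)] c(2) by (simp add: n_def norm_eq_1)
  define v' where "v' = (\<lambda>x. if x \<in> rel_interior F then n else 0)"
  have "(\<lambda>_. n) \<in> vec_polys k"
    by (simp add: vec_polys_def polys_const)
  then have "(\<lambda>x. if x \<in> \<Union>(rel_interior ` {F}) then n else 0) \<in> piecewise (vec_polys k) (facets T)"
    using F(1) subspace_0[OF subspace_vec_polys] by (intro piecewise_glue ri_disjoint_facets) auto
  then have v': "v' \<in> Vbar_space k T \<Gamma>"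
    using F(3) by (auto simp: v'_def Vbar_space_def)
  have q'F: "bmeas F q'"
    using Qbar_space_facet_bmeas[OF q'] F(1) by (simp add: facet_bmeas_def)
  have tr0: "inner_trace K' (0 :: real^'d \<Rightarrow> real^'d) x = 0" if "K' \<in> T" "x \<in> K'" for K' x
    using smooth_on_cell_operators(3)[where u = "0 :: real^'d \<Rightarrow> real^'d", OF C1_0, of K' x] elem(3)[OF that(1)] that(2)
    by simp
  have other: "facet_integral F' (\<lambda>t. q' t * ((inner_trace K' 0 t - v' t) \<bullet> m)) = 0"
    if F': "K' \<in> T" "F' facet_of K'" "F' \<noteq> F" for K' F' m
  proof -
    have "facet_integral F' (\<lambda>t. q' t * ((inner_trace K' 0 t - v' t) \<bullet> m)) = facet_integral F' (\<lambda>t. 0)"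
    proof (rule facet_integral_cong)
      fix t assume t: "t \<in> F'"
      then have "t \<notin> rel_interior F"
        using facet_disjoint[OF F(1)] facet_sub[OF F'(1,2)] F'(3) by blast
      then show "q' t * ((inner_trace K' 0 t - v' t) \<bullet> m) = 0"
        using tr0[OF F'(1)] t facet_sub[OF F'(1,2)] by (auto simp: v'_def)
    qed
    then show ?thesis
      by (simp add: facet_integral_def)
  qed
  \<comment> \<open>Since \<open>F\<close> belongs to one element only, no second contribution with
    the opposite normal can cancel this one.\<close>
  have "boundary_integral K' (\<lambda>n t. q' t * ((inner_trace K' 0 t - v' t) \<bullet> n))
      = (if K' = K then facet_integral F (\<lambda>t. q' t * ((inner_trace K 0 t - v' t) \<bullet> n)) else 0)" if K': "K' \<in> T" for K'
  proof (cases "K' = K")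
    case True
    have "boundary_integral K (\<lambda>n t. q' t * ((inner_trace K 0 t - v' t) \<bullet> n))
        = (\<Sum>F'\<in>{F'. F' facet_of K}. if F' = F then facet_integral F (\<lambda>t. q' t * ((inner_trace K 0 t - v' t) \<bullet> n)) else 0)"
      unfolding boundary_integral_def
    proof (rule sum.cong)
      fix F' assume "F' \<in> {F'. F' facet_of K}"
      then show "facet_integral F' (\<lambda>t. q' t * ((inner_trace K 0 t - v' t) \<bullet> outward_normal K F'))
          = (if F' = F then facet_integral F (\<lambda>t. q' t * ((inner_trace K 0 t - v' t) \<bullet> n)) else 0)"
        using other[OF K(1)] by (auto simp: n_def)
    qed simp
    also have "\<dots> = facet_integral F (\<lambda>t. q' t * ((inner_trace K 0 t - v' t) \<bullet> n))"
      using K(2) elem(8)[OF K(1)] by simp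
    finally show ?thesis
      using True by simp
  next
    case False
    then have "F' \<noteq> F" if "F' facet_of K'" for F'
      using uniq[OF K'] that by blast
    then show ?thesis
      using False other[OF K'] unfolding boundary_integral_def by (auto intro!: sum.neutral)
  qed
  then have "(\<Sum>K'\<in>T. boundary_integral K' (\<lambda>n t. q' t * ((inner_trace K' 0 t - v' t) \<bullet> n)))
      = (\<Sum>K'\<in>T. if K' = K then facet_integral F (\<lambda>t. q' t * ((inner_trace K 0 t - v' t) \<bullet> n)) else 0)"
    by (intro sum.cong) auto
  also have "\<dots> = facet_integral F (\<lambda>t. q' t * ((inner_trace K 0 t - v' t) \<bullet> n))"
    using K(1) finite_T by simp
  finally have "facet_integral F (\<lambda>t. q' t * ((inner_trace K 0 t - v' t) \<bullet> n)) = 0"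
    using b[OF v'] unfolding b_form_eq by (simp add: divergence_0)
  \<comment> \<open>On the relative interior of \<open>F\<close> the pressure is \<open>r\<close>
    and the jump is \<open>- n\<close>, so the integral is \<open>- r\<close> times the positive
    area of \<open>F\<close>.\<close>
  moreover have "facet_integral F (\<lambda>t. q' t * ((inner_trace K 0 t - v' t) \<bullet> n)) = facet_integral F (\<lambda>t. (- r) * 1)"
  proof (rule facet_integral_cong_rel_interior)
    show "good_facet F"
      using FK by blast
    have "(0 :: real^'d \<Rightarrow> real^'d) \<in> cell_smooth T"
      by (rule subspace_0[OF subspace_cell_smooth])
    then have "(0, v') \<in> cell_smooth T \<times> facet_bmeas T"
      using Vbar_space_facet_bmeas[OF v'] by simp
    from jump_bmeas[OF K this] have "bmeas F (\<lambda>t. inner_trace K (0 :: real^'d \<Rightarrow> real^'d) t - v' t)"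
      unfolding fst_conv snd_conv .
    then show "bmeas F (\<lambda>t. q' t * ((inner_trace K 0 t - v' t) \<bullet> n))"
      by (intro bmeas_mult q'F bmeas_inner bmeas_const)
    show "q' t * ((inner_trace K 0 t - v' t) \<bullet> n) = (- r) * 1" if "t \<in> rel_interior F" for t
      using that r[OF K(2) that] tr0[OF K(1), of t] ri_subset[OF K(2,1)] n1 by (auto simp: v'_def)
  qed (rule bmeas_const)
  moreover have "facet_integral F (\<lambda>t. (- r) * 1) = (- r) * facet_integral F (\<lambda>t. 1)"
    using FK by (intro facet_integral_scale bmeas_const) auto
  ultimately have "r = 0"
    using facet_integral_one_pos[of F] FK by auto
  then show ?thesis
    using r[OF K(2) x] by simp
qed

end

section \<open>The coupled system\<close>

text \<open>On a bounded set, a bounded test against a square integrable source is integrable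
  because a norm is at most its square plus 1. The bounded Borel fields contain the discrete
  spaces.\<close>

lemma L2_inner_lin_on:
  fixes f :: "'a::euclidean_space \<Rightarrow> 'b::euclidean_space"
  assumes S: "open S" "bounded S" and f: "f square_integrable_on S"
  shows "lin_on {v. bmeas UNIV v} (\<lambda>v. L2_inner S f v)"
proof -
  have int: "integrable (lebesgue_on S) (\<lambda>x. f x \<bullet> v x)" if v: "bmeas UNIV v" for v
  proof -
    obtain B where B: "\<forall>x. norm (v x) \<le> B"
      using v unfolding bmeas_def by auto
    then have "B \<ge> 0"
      using norm_ge_zero order_trans by blast
    have S': "S \<in> lmeasurable"
      using S by (simp add: lmeasurable_open)
    then interpret finite_measure "lebesgue_on S"
      by (rule finite_measure_lebesgue_on)
    have bound: "integrable (lebesgue_on S) (\<lambda>x. B * ((norm (f x))\<^sup>2 + 1))"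
      using f unfolding square_integrable_on_def by simp
    have m: "v \<in> borel_measurable (lebesgue_on S)"
    proof (rule borel_measurable_subalgebra)
      show "v \<in> borel_measurable (restrict_space borel S)"
        using bmeas_subset[OF v subset_UNIV, of S] by (simp add: bmeas_def)
      show "sets (restrict_space borel S) \<subseteq> sets (lebesgue_on S)"
        by (auto simp: sets_restrict_space)
    qed (simp add: space_restrict_space)
    then have meas: "(\<lambda>x. f x \<bullet> v x) \<in> borel_measurable (lebesgue_on S)"
      using f unfolding square_integrable_on_def by (intro borel_measurable_inner) auto
    have "norm (f x \<bullet> v x) \<le> norm (B * ((norm (f x))\<^sup>2 + 1))" for x
    proof -
      have "norm (f x) \<le> (norm (f x))\<^sup>2 + 1"
        using sum_power2_ge_zero[of "norm (f x) - 1/2" 0] by (simp add: power2_eq_square algebra_simps)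
      then have "norm (f x) * norm (v x) \<le> ((norm (f x))\<^sup>2 + 1) * B"
        using B by (intro mult_mono) auto
      then have "\<bar>f x \<bullet> v x\<bar> \<le> B * ((norm (f x))\<^sup>2 + 1)"
        using Cauchy_Schwarz_ineq2[of "f x" "v x"] by (simp add: mult.commute)
      then show ?thesis
        by simp
    qed
    then show ?thesis
      by (intro Bochner_Integration.integrable_bound[OF bound meas] AE_I2)
  qed
  show ?thesis
    unfolding lin_on_def L2_inner_def using int by (simp add: inner_add_right)
qed

lemma polytopal_domain_bounded: "polytopal_domain \<Omega> \<Longrightarrow> bounded \<Omega>"
proof -
  assume "polytopal_domain \<Omega>"
  then obtain P where P: "finite P" "\<forall>p\<in>P. polytope p" "closure \<Omega> = \<Union>P"
    unfolding polytopal_domain_def by blast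
  then have "bounded (\<Union>P)"
    by (intro bounded_Union) (auto simp: polytope_imp_bounded)
  then show ?thesis
    using P(3) bounded_subset[OF _ closure_subset] by metis
qed

lemma lin_on_compI:
  "lin_on Y f \<Longrightarrow> linear h \<Longrightarrow> (\<And>x. x \<in> X \<Longrightarrow> h x \<in> Y) \<Longrightarrow> lin_on X (\<lambda>x. f (h x))"
  by (rule lin_on_comp) auto

section \<open>Dependence of the forms on values inside the elements, and definiteness\<close>

context vec_mesh
begin

text \<open>Allows a field on the whole domain to be exchanged, inside the forms of one subdomain,
  for its restriction or for a scaled copy.\<close>

lemma cell_cong:
  assumes u: "u \<in> cell_smooth T" and K: "K \<in> T" and eq: "\<And>x. x \<in> interior K \<Longrightarrow> v x = u x"
  shows "x \<in> interior K \<Longrightarrow> sym_grad v x = sym_grad u x"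
    and "x \<in> interior K \<Longrightarrow> divergence v x = divergence u x"
    and "x \<in> K \<Longrightarrow> inner_trace K v x = inner_trace K u x"
    and "x \<in> K \<Longrightarrow> inner_trace K (sym_grad v) x = inner_trace K (sym_grad u) x"
proof -
  obtain p where p: "C1 p" "\<And>x. x \<in> interior K \<Longrightarrow> u x = p x"
    using u K unfolding cell_smooth_def smooth_on_cell_def by blast
  have vp: "\<And>x. x \<in> interior K \<Longrightarrow> v x = p x"
    using p eq by simp
  note U = smooth_on_cell_operators[where K = K and u = u and p = p, OF p]
  note V = smooth_on_cell_operators[where K = K and u = v and p = p, OF p(1) vp]
  show "sym_grad v x = sym_grad u x" if "x \<in> interior K"
    using U(1)[OF _ that] V(1)[OF _ that] by simp
  show "divergence v x = divergence u x" if "x \<in> interior K"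
    using U(2)[OF _ that] V(2)[OF _ that] by simp
  show "inner_trace K v x = inner_trace K u x" if "x \<in> K"
    using U(3)[of x] V(3)[of x] that elem(3)[OF K] by simp
  show "inner_trace K (sym_grad v) x = inner_trace K (sym_grad u) x" if "x \<in> K"
    using U(4)[of x] V(4)[of x] that elem(3)[OF K] by simp
qed

lemma a_form_cong:
  assumes u: "u \<in> cell_smooth T" and eq: "\<And>K x. K \<in> T \<Longrightarrow> x \<in> interior K \<Longrightarrow> v x = u x"
  shows "a_form \<mu> \<beta> T y (v, v') = a_form \<mu> \<beta> T y (u, v')"
proof (cases y)
  case (Pair y1 y2)
  have on_facet: "x \<in> K" if "K \<in> T" "F facet_of K" "x \<in> F" for K F x
    using facet_sub[OF that(1,2)] that(3) by blast
  note c = cell_cong[OF u _ eq]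
  show ?thesis
    unfolding Pair a_form_def mesh_inner_def L2_inner_def boundary_integral_def prod.case
    using c on_facet
    by (intro arg_cong2[of _ _ _ _ "(+)"] arg_cong2[of _ _ _ _ "(-)"] sum.cong refl cell_integral_cong facet_integral_cong) auto
qed

lemma b_form_cong:
  assumes u: "u \<in> cell_smooth T" and eq: "\<And>K x. K \<in> T \<Longrightarrow> x \<in> interior K \<Longrightarrow> v x = u x"
    and q: "\<And>K x. K \<in> T \<Longrightarrow> x \<in> interior K \<Longrightarrow> q x = r x"
  shows "b_form T (q, q') (v, v') = b_form T (r, q') (u, v')"
proof -
  have on_facet: "x \<in> K" if "K \<in> T" "F facet_of K" "x \<in> F" for K F x
    using facet_sub[OF that(1,2)] that(3) by blast
  note c = cell_cong[OF u _ eq]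
  show ?thesis
    unfolding b_form_eq fst_conv snd_conv boundary_integral_def
    using c on_facet q
    by (intro arg_cong2[of _ _ _ _ "(+)"] arg_cong[of _ _ uminus] sum.cong refl cell_integral_cong facet_integral_cong) auto
qed

lemma mesh_inner_cong:
  assumes "\<And>K x. K \<in> T \<Longrightarrow> x \<in> interior K \<Longrightarrow> f x = f' x" "\<And>K x. K \<in> T \<Longrightarrow> x \<in> interior K \<Longrightarrow> g x = g' x"
  shows "mesh_inner T f g = mesh_inner T f' g'"
  unfolding mesh_inner_def L2_inner_def using assms by (intro sum.cong refl cell_integral_cong) auto

lemma mesh_inner_nonneg: "mesh_inner T f f \<ge> 0"
  unfolding mesh_inner_def L2_inner_def by (intro sum_nonneg cell_integral_nonneg) auto

lemma mesh_inner_zero: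
  assumes f: "f \<in> cell_bmeas T" and c: "\<And>K. K \<in> T \<Longrightarrow> continuous_on (interior K) f"
    and 0: "mesh_inner T f f = 0" and K: "K \<in> T" "x \<in> interior K"
  shows "f x = 0"
proof -
  have nn: "L2_inner (interior K) f f \<ge> 0" for K
    unfolding L2_inner_def by (intro cell_integral_nonneg) auto
  have "cell_integral (interior K) (\<lambda>x. f x \<bullet> f x) = 0"
    using 0 nn K(1) finite_T unfolding mesh_inner_def
    by (subst (asm) sum_nonneg_eq_0_iff) (auto simp: L2_inner_def)
  then have "f x \<bullet> f x = 0"
    using int_elem[OF K(1)] bmeas_inner[OF cell_bmeasD[OF f K(1)] cell_bmeasD[OF f K(1)]] K(2)
      continuous_on_inner[OF c[OF K(1)] c[OF K(1)]]
    by (intro cell_integral_eq_0_imp[of "interior K" "\<lambda>x. f x \<bullet> f x" x]) auto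
  then show ?thesis
    by simp
qed

lemma Q_space_continuous:
  assumes "q \<in> Q_space k T'" "T \<subseteq> T'" "K \<in> T"
  shows "continuous_on (interior K) q"
proof -
  obtain p where p: "p \<in> polys (k - 1)" "\<forall>x\<in>rel_interior K. q x = p x"
    using assms unfolding Q_space_def piecewise_def by blast
  have "continuous_on (interior K) p"
    by (rule polys_continuous[OF p(1)])
  then show ?thesis
    using p(2) elem(5)[OF assms(3)] by (simp cong: continuous_on_cong)
qed

lemma V_space_continuous:
  assumes "v \<in> V_space k T'" "T \<subseteq> T'" "K \<in> T"
  shows "continuous_on (interior K) v"
proof -
  obtain p where p: "p \<in> vec_polys k" "\<forall>x\<in>rel_interior K. v x = p x"
    using assms unfolding V_space_def piecewise_def by blast
  have "continuous_on (interior K) p"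
    by (rule C1_continuous[OF vec_polys_C1[OF p(1)]])
  then show ?thesis
    using p(2) elem(5)[OF assms(3)] by (simp cong: continuous_on_cong)
qed

lemma piecewise_zero:
  assumes "v \<in> piecewise P T" "\<And>K x. K \<in> T \<Longrightarrow> x \<in> interior K \<Longrightarrow> v x = 0"
  shows "v = 0"
proof
  fix x
  show "v x = 0 x"
  proof (cases "\<exists>K\<in>T. x \<in> interior K")
    case False
    then have "x \<notin> \<Union>(rel_interior ` T)"
      using elem(5) by auto
    then show ?thesis
      using assms(1) by (simp add: piecewise_def)
  qed (use assms(2) in auto)
qed

lemma aI_form_nonneg:
  assumes "\<gamma> > 0" "\<mu> > 0" "\<kappa> > 0"
  shows "aI_form \<gamma> \<mu> \<kappa> T \<Gamma> x x \<ge> 0"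
proof (cases x)
  case (Pair us ub)
  show ?thesis
    unfolding Pair aI_form_def prod.case using assms
    by (intro sum_nonneg facet_integral_nonneg) simp
qed

end

section \<open>Unknowns and bilinear forms of one time step\<close>

type_synonym 'd state =
  "((real^'d \<Rightarrow> real^'d) \<times> (real^'d \<Rightarrow> real^'d) \<times> (real^'d \<Rightarrow> real^'d)) \<times>
   ((real^'d \<Rightarrow> real) \<times> (real^'d \<Rightarrow> real) \<times> (real^'d \<Rightarrow> real)) \<times>
   (real^'d \<Rightarrow> real^'d) \<times> ((real^'d \<Rightarrow> real) \<times> (real^'d \<Rightarrow> real))"

text \<open>Displacement with its two traces (\<open>dsp\<close>), total pressure with its two
  traces (\<open>prs\<close>), Darcy velocity (\<open>vel\<close>), pore pressure with its trace
  (\<open>por\<close>, \<open>por_b\<close>).\<close>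

abbreviation dsp :: "'d::finite state \<Rightarrow> real^'d \<Rightarrow> real^'d" where "dsp x \<equiv> fst (fst x)"
abbreviation dsp_s :: "'d::finite state \<Rightarrow> real^'d \<Rightarrow> real^'d" where "dsp_s x \<equiv> fst (snd (fst x))"
abbreviation dsp_b :: "'d::finite state \<Rightarrow> real^'d \<Rightarrow> real^'d" where "dsp_b x \<equiv> snd (snd (fst x))"
abbreviation prs :: "'d::finite state \<Rightarrow> real^'d \<Rightarrow> real" where "prs x \<equiv> fst (fst (snd x))"
abbreviation prs_s :: "'d::finite state \<Rightarrow> real^'d \<Rightarrow> real" where "prs_s x \<equiv> fst (snd (fst (snd x)))"
abbreviation prs_b :: "'d::finite state \<Rightarrow> real^'d \<Rightarrow> real" where "prs_b x \<equiv> snd (snd (fst (snd x)))"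
abbreviation vel :: "'d::finite state \<Rightarrow> real^'d \<Rightarrow> real^'d" where "vel x \<equiv> fst (snd (snd x))"
abbreviation por :: "'d::finite state \<Rightarrow> real^'d \<Rightarrow> real" where "por x \<equiv> fst (snd (snd (snd x)))"
abbreviation por_b :: "'d::finite state \<Rightarrow> real^'d \<Rightarrow> real" where "por_b x \<equiv> snd (snd (snd (snd x)))"

lemma subspace_Times: "subspace A \<Longrightarrow> subspace B \<Longrightarrow> subspace (A \<times> B)"
  by (auto simp: subspace_def zero_prod_def)

lemma diff_quotient_eq: "diff_quotient \<tau> g h = inverse \<tau> *\<^sub>R g - inverse \<tau> *\<^sub>R h"
  by (simp add: fun_eq_iff diff_quotient_def scaleR_diff_right)

text \<open>Forms and facet unknowns belong to the subdomain meshes, displacement and total pressure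
  to their union. \<open>\<tau>\<close> is the time step; the old time level does not occur, since
  it will only enter the right-hand side.\<close>

locale hdg_step = Ms: vec_mesh Ts + Mb: vec_mesh Tb + M: vec_mesh "Ts \<union> Tb"
  for Ts Tb :: "(real^'d) set set" +
  fixes \<Omega> \<Omega>s \<Omega>b \<Gamma>I \<Gamma>Ds \<Gamma>Ns \<Gamma>Db \<Gamma>P :: "(real^'d) set"
    and k :: nat and C \<mu>s \<mu>b lam \<kappa> \<gamma> \<alpha> c0 \<beta>s \<beta>b \<tau> :: real
  assumes \<Omega>: "open \<Omega>" "interior (closure \<Omega>) = \<Omega>" "\<Union>(Ts \<union> Tb) = closure \<Omega>"
    and \<Omega>s: "open \<Omega>s" "connected \<Omega>s" "interior (closure \<Omega>s) = \<Omega>s" "\<Union>Ts = closure \<Omega>s"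
    and \<Omega>b: "open \<Omega>b" "connected \<Omega>b" "interior (closure \<Omega>b) = \<Omega>b" "\<Union>Tb = closure \<Omega>b"
    and disjoint: "\<Omega>s \<inter> \<Omega>b = {}"
    and partition: "boundary_partition Ts (frontier \<Omega> \<inter> frontier \<Omega>s) \<Gamma>Ds \<Gamma>Ns"
    and area: "surface_area Tb \<Gamma>P > 0" "surface_area Tb \<Gamma>Db > 0" "surface_area Ts \<Gamma>Ds > 0" "surface_area Ts \<Gamma>Ns > 0"
    and k: "k \<ge> 1"
    and constants: "\<mu>s > 0" "\<mu>b > 0" "lam > 0" "\<kappa> > 0" "\<gamma> > 0" "c0 \<ge> 0" "\<tau> > 0"
    and coercive: "C > 0" "a_coercive C k \<mu>s \<beta>s Ts \<Gamma>Ds" "a_coercive C k \<mu>b \<beta>b Tb \<Gamma>Db"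
begin

abbreviation X :: "'d state set" where "X \<equiv> X_space k Ts Tb \<Gamma>Ds \<Gamma>Db \<Gamma>P"

lemma subspace_X: "subspace X"
  unfolding X_space_def
  by (intro subspace_Times Ms.subspace_spaces Mb.subspace_spaces M.subspace_spaces)

lemma fin_dim_X: "fin_dim X"
  unfolding X_space_def
  by (intro fin_dim_Times Ms.fin_dim_spaces Mb.fin_dim_spaces M.fin_dim_spaces)

lemma mem_X: "x \<in> X \<longleftrightarrow> dsp x \<in> V_space k (Ts \<union> Tb) \<and> dsp_s x \<in> Vbar_space k Ts \<Gamma>Ds \<and> dsp_b x \<in> Vbar_space k Tb \<Gamma>Db \<and>
    prs x \<in> Q_space k (Ts \<union> Tb) \<and> prs_s x \<in> Qbar_space k Ts {} \<and> prs_b x \<in> Qbar_space k Tb {} \<and>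
    vel x \<in> V_space k Tb \<and> por x \<in> Q_space k Tb \<and> por_b x \<in> Qbar_space k Tb \<Gamma>P"
  by (cases x) (auto simp: X_space_def)

lemma X_D:
  assumes "x \<in> X"
  shows "dsp x \<in> cell_smooth Ts" "dsp x \<in> cell_smooth Tb" "dsp_s x \<in> facet_bmeas T" "dsp_b x \<in> facet_bmeas T" "prs x \<in> cell_bmeas T"
    "prs_s x \<in> facet_bmeas T" "prs_b x \<in> facet_bmeas T" "vel x \<in> cell_smooth Tb" "vel x \<in> cell_bmeas T" "por x \<in> cell_bmeas T" "por_b x \<in> facet_bmeas T"
    "bmeas UNIV (dsp x)" "bmeas UNIV (por x)"
proof -
  note x = assms[unfolded mem_X]
  show "dsp x \<in> cell_smooth Ts" "dsp x \<in> cell_smooth Tb" "vel x \<in> cell_smooth Tb"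
    using x Ms.V_space_cell_smooth[of "dsp x"] Mb.V_space_cell_smooth[of "dsp x"] Mb.V_space_cell_smooth[of "vel x" k Tb] by auto
  show "bmeas UNIV (dsp x)" "bmeas UNIV (por x)"
    using x M.spaces_bmeas(1) Mb.spaces_bmeas(2) by blast+
  then show "dsp_s x \<in> facet_bmeas T" "dsp_b x \<in> facet_bmeas T" "prs_s x \<in> facet_bmeas T" "prs_b x \<in> facet_bmeas T" "por_b x \<in> facet_bmeas T"
    using x Ms.Vbar_space_facet_bmeas Mb.Vbar_space_facet_bmeas Ms.Qbar_space_facet_bmeas Mb.Qbar_space_facet_bmeas by blast+
  show "prs x \<in> cell_bmeas T" "por x \<in> cell_bmeas T" "vel x \<in> cell_bmeas T"
    using x M.spaces_bmeas(2) Mb.spaces_bmeas(2) Mb.spaces_bmeas(1) bmeas_UNIV_cell_bmeas by blast+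
qed

lemma facet_bmeas_scale: "f \<in> facet_bmeas T \<Longrightarrow> c *\<^sub>R f \<in> facet_bmeas T" and cell_bmeas_scale: "g \<in> cell_bmeas T \<Longrightarrow> c *\<^sub>R g \<in> cell_bmeas T"
  by (rule subspace_scale[OF subspace_facet_bmeas] subspace_scale[OF subspace_cell_bmeas], assumption)+

lemma zero_mem: "0 \<in> facet_bmeas T" "0 \<in> cell_bmeas T" "0 \<in> cell_smooth T"
  by (rule subspace_0 subspace_facet_bmeas subspace_cell_bmeas subspace_cell_smooth)+

abbreviation \<iota> :: real where "\<iota> \<equiv> inverse \<tau>"

text \<open>Here and in the three definitions below: the left-hand side of one equation, with every
  difference quotient replaced by \<open>\<iota>\<close> times the new unknown.\<close>

definition momentum_form :: "'d state \<Rightarrow> 'd state \<Rightarrow> real" where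
  "momentum_form x y = a_form \<mu>s \<beta>s Ts (dsp x, dsp_s x) (dsp y, dsp_s y) + a_form \<mu>b \<beta>b Tb (dsp x, dsp_b x) (dsp y, dsp_b y)
    + aI_form \<gamma> \<mu>s \<kappa> Ts \<Gamma>I (dsp_s x, \<iota> *\<^sub>R dsp_b x) (dsp_s y, dsp_b y)
    + (b_form Ts (prs x, prs_s x) (dsp y, dsp_s y) + b_form Tb (prs x, prs_b x) (dsp y, dsp_b y))
    + bI_form Ts \<Gamma>I (por_b x) (dsp_s y, dsp_b y)"

definition constraint_form :: "'d state \<Rightarrow> 'd state \<Rightarrow> real" where
  "constraint_form x y = (b_form Ts (prs y, prs_s y) (dsp x, dsp_s x) + b_form Tb (prs y, prs_b y) (dsp x, dsp_b x))
    + c_form lam \<alpha> Tb (por x, prs x) (prs y)"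

definition storage_form :: "'d state \<Rightarrow> 'd state \<Rightarrow> real" where
  "storage_form x y = mesh_inner Tb (c0 *\<^sub>R \<iota> *\<^sub>R por x) (por y)
    + c_form lam \<alpha> Tb (\<iota> *\<^sub>R por x, \<iota> *\<^sub>R prs x) (\<alpha> *\<^sub>R por y)
    - b_form Tb (por y, por_b y) (vel x, 0)
    - bI_form Ts \<Gamma>I (por_b y) (dsp_s x, \<iota> *\<^sub>R dsp_b x)"

definition darcy_form :: "'d state \<Rightarrow> 'd state \<Rightarrow> real" where
  "darcy_form x y = mesh_inner Tb (inverse \<kappa> *\<^sub>R vel x) (vel y) + b_form Tb (por x, por_b x) (vel y, 0)"

lemma momentum_form_lin1: "y \<in> X \<Longrightarrow> lin_on X (\<lambda>x. momentum_form x y)"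
  unfolding momentum_form_def
proof (intro lin_on_add)
  assume y: "y \<in> X"
  note Y = X_D[OF y]
  show "lin_on X (\<lambda>x. a_form \<mu>s \<beta>s Ts (dsp x, dsp_s x) (dsp y, dsp_s y))"
    by (rule lin_on_compI[where h = "\<lambda>x. (dsp x, dsp_s x)", OF Ms.a_form_lin]; (rule linearI)?;
        simp add: X_D Y facet_bmeas_scale cell_bmeas_scale zero_mem prod_eq_iff mem_Times_iff algebra_simps)
  show "lin_on X (\<lambda>x. a_form \<mu>b \<beta>b Tb (dsp x, dsp_b x) (dsp y, dsp_b y))"
    by (rule lin_on_compI[where h = "\<lambda>x. (dsp x, dsp_b x)", OF Mb.a_form_lin]; (rule linearI)?;
        simp add: X_D Y facet_bmeas_scale cell_bmeas_scale zero_mem prod_eq_iff mem_Times_iff algebra_simps)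
  show "lin_on X (\<lambda>x. aI_form \<gamma> \<mu>s \<kappa> Ts \<Gamma>I (dsp_s x, \<iota> *\<^sub>R dsp_b x) (dsp_s y, dsp_b y))"
    by (rule lin_on_compI[where h = "\<lambda>x. (dsp_s x, \<iota> *\<^sub>R dsp_b x)", OF Ms.aI_form_lin]; (rule linearI)?;
        simp add: X_D Y facet_bmeas_scale cell_bmeas_scale zero_mem prod_eq_iff mem_Times_iff algebra_simps)
  show "lin_on X (\<lambda>x. b_form Ts (prs x, prs_s x) (dsp y, dsp_s y))"
    by (rule lin_on_compI[where h = "\<lambda>x. (prs x, prs_s x)", OF Ms.b_form_lin1]; (rule linearI)?;
        simp add: X_D Y facet_bmeas_scale cell_bmeas_scale zero_mem prod_eq_iff mem_Times_iff algebra_simps)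
  show "lin_on X (\<lambda>x. b_form Tb (prs x, prs_b x) (dsp y, dsp_b y))"
    by (rule lin_on_compI[where h = "\<lambda>x. (prs x, prs_b x)", OF Mb.b_form_lin1]; (rule linearI)?;
        simp add: X_D Y facet_bmeas_scale cell_bmeas_scale zero_mem prod_eq_iff mem_Times_iff algebra_simps)
  show "lin_on X (\<lambda>x. bI_form Ts \<Gamma>I (por_b x) (dsp_s y, dsp_b y))"
    by (rule lin_on_compI[where h = "\<lambda>x. por_b x", OF Ms.bI_form_lin1]; (rule linearI)?;
        simp add: X_D Y facet_bmeas_scale cell_bmeas_scale zero_mem prod_eq_iff mem_Times_iff algebra_simps)
qed

lemma momentum_form_lin2: "x \<in> X \<Longrightarrow> lin_on X (momentum_form x)"
  unfolding momentum_form_def[abs_def]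
proof (intro lin_on_add)
  assume x: "x \<in> X"
  note D = X_D[OF x]
  show "lin_on X (\<lambda>y. a_form \<mu>s \<beta>s Ts (dsp x, dsp_s x) (dsp y, dsp_s y))"
    by (rule lin_on_compI[where h = "\<lambda>y. (dsp y, dsp_s y)", OF Ms.a_form_lin2]; (rule linearI)?;
        simp add: X_D D facet_bmeas_scale cell_bmeas_scale zero_mem prod_eq_iff mem_Times_iff algebra_simps)
  show "lin_on X (\<lambda>y. a_form \<mu>b \<beta>b Tb (dsp x, dsp_b x) (dsp y, dsp_b y))"
    by (rule lin_on_compI[where h = "\<lambda>y. (dsp y, dsp_b y)", OF Mb.a_form_lin2]; (rule linearI)?;
        simp add: X_D D facet_bmeas_scale cell_bmeas_scale zero_mem prod_eq_iff mem_Times_iff algebra_simps)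
  show "lin_on X (\<lambda>y. aI_form \<gamma> \<mu>s \<kappa> Ts \<Gamma>I (dsp_s x, \<iota> *\<^sub>R dsp_b x) (dsp_s y, dsp_b y))"
    by (rule lin_on_compI[where h = "\<lambda>y. (dsp_s y, dsp_b y)", OF Ms.aI_form_lin2]; (rule linearI)?;
        simp add: X_D D facet_bmeas_scale cell_bmeas_scale zero_mem prod_eq_iff mem_Times_iff algebra_simps)
  show "lin_on X (\<lambda>y. b_form Ts (prs x, prs_s x) (dsp y, dsp_s y))"
    by (rule lin_on_compI[where h = "\<lambda>y. (dsp y, dsp_s y)", OF Ms.b_form_lin2]; (rule linearI)?;
        simp add: X_D D facet_bmeas_scale cell_bmeas_scale zero_mem prod_eq_iff mem_Times_iff algebra_simps)
  show "lin_on X (\<lambda>y. b_form Tb (prs x, prs_b x) (dsp y, dsp_b y))"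
    by (rule lin_on_compI[where h = "\<lambda>y. (dsp y, dsp_b y)", OF Mb.b_form_lin2]; (rule linearI)?;
        simp add: X_D D facet_bmeas_scale cell_bmeas_scale zero_mem prod_eq_iff mem_Times_iff algebra_simps)
  show "lin_on X (\<lambda>y. bI_form Ts \<Gamma>I (por_b x) (dsp_s y, dsp_b y))"
    by (rule lin_on_compI[where h = "\<lambda>y. (dsp_s y, dsp_b y)", OF Ms.bI_form_lin2]; (rule linearI)?;
        simp add: X_D D facet_bmeas_scale cell_bmeas_scale zero_mem prod_eq_iff mem_Times_iff algebra_simps)
qed

lemma constraint_form_lin1: "y \<in> X \<Longrightarrow> lin_on X (\<lambda>x. constraint_form x y)"
  unfolding constraint_form_def
proof (intro lin_on_add)
  assume y: "y \<in> X"
  note Y = X_D[OF y]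
  show "lin_on X (\<lambda>x. b_form Ts (prs y, prs_s y) (dsp x, dsp_s x))"
    by (rule lin_on_compI[where h = "\<lambda>x. (dsp x, dsp_s x)", OF Ms.b_form_lin2]; (rule linearI)?;
        simp add: X_D Y facet_bmeas_scale cell_bmeas_scale zero_mem prod_eq_iff mem_Times_iff algebra_simps)
  show "lin_on X (\<lambda>x. b_form Tb (prs y, prs_b y) (dsp x, dsp_b x))"
    by (rule lin_on_compI[where h = "\<lambda>x. (dsp x, dsp_b x)", OF Mb.b_form_lin2]; (rule linearI)?;
        simp add: X_D Y facet_bmeas_scale cell_bmeas_scale zero_mem prod_eq_iff mem_Times_iff algebra_simps)
  show "lin_on X (\<lambda>x. c_form lam \<alpha> Tb (por x, prs x) (prs y))"
    by (rule lin_on_compI[where h = "\<lambda>x. (por x, prs x)", OF Mb.c_form_lin1]; (rule linearI)?;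
        simp add: X_D Y facet_bmeas_scale cell_bmeas_scale zero_mem prod_eq_iff mem_Times_iff algebra_simps)
qed

lemma constraint_form_lin2: "x \<in> X \<Longrightarrow> lin_on X (constraint_form x)"
  unfolding constraint_form_def[abs_def]
proof (intro lin_on_add)
  assume x: "x \<in> X"
  note D = X_D[OF x]
  show "lin_on X (\<lambda>y. b_form Ts (prs y, prs_s y) (dsp x, dsp_s x))"
    by (rule lin_on_compI[where h = "\<lambda>y. (prs y, prs_s y)", OF Ms.b_form_lin1]; (rule linearI)?;
        simp add: X_D D facet_bmeas_scale cell_bmeas_scale zero_mem prod_eq_iff mem_Times_iff algebra_simps)
  show "lin_on X (\<lambda>y. b_form Tb (prs y, prs_b y) (dsp x, dsp_b x))"
    by (rule lin_on_compI[where h = "\<lambda>y. (prs y, prs_b y)", OF Mb.b_form_lin1]; (rule linearI)?;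
        simp add: X_D D facet_bmeas_scale cell_bmeas_scale zero_mem prod_eq_iff mem_Times_iff algebra_simps)
  show "lin_on X (\<lambda>y. c_form lam \<alpha> Tb (por x, prs x) (prs y))"
    by (rule lin_on_compI[where h = "\<lambda>y. prs y", OF Mb.c_form_lin2]; (rule linearI)?;
        simp add: X_D D facet_bmeas_scale cell_bmeas_scale zero_mem prod_eq_iff mem_Times_iff algebra_simps)
qed

lemma storage_form_lin1: "y \<in> X \<Longrightarrow> lin_on X (\<lambda>x. storage_form x y)"
  unfolding storage_form_def
proof (intro lin_on_add lin_on_sub)
  assume y: "y \<in> X"
  note Y = X_D[OF y]
  show "lin_on X (\<lambda>x. mesh_inner Tb (c0 *\<^sub>R \<iota> *\<^sub>R por x) (por y))"
    by (rule lin_on_compI[where h = "\<lambda>x. c0 *\<^sub>R \<iota> *\<^sub>R por x", OF Mb.mesh_inner_lin1]; (rule linearI)?;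
        simp add: X_D Y facet_bmeas_scale cell_bmeas_scale zero_mem prod_eq_iff mem_Times_iff algebra_simps)
  show "lin_on X (\<lambda>x. c_form lam \<alpha> Tb (\<iota> *\<^sub>R por x, \<iota> *\<^sub>R prs x) (\<alpha> *\<^sub>R por y))"
    by (rule lin_on_compI[where h = "\<lambda>x. (\<iota> *\<^sub>R por x, \<iota> *\<^sub>R prs x)", OF Mb.c_form_lin1]; (rule linearI)?;
        simp add: X_D Y facet_bmeas_scale cell_bmeas_scale zero_mem prod_eq_iff mem_Times_iff algebra_simps)
  show "lin_on X (\<lambda>x. b_form Tb (por y, por_b y) (vel x, 0))"
    by (rule lin_on_compI[where h = "\<lambda>x. (vel x, 0)", OF Mb.b_form_lin2]; (rule linearI)?;
        simp add: X_D Y facet_bmeas_scale cell_bmeas_scale zero_mem prod_eq_iff mem_Times_iff algebra_simps)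
  show "lin_on X (\<lambda>x. bI_form Ts \<Gamma>I (por_b y) (dsp_s x, \<iota> *\<^sub>R dsp_b x))"
    by (rule lin_on_compI[where h = "\<lambda>x. (dsp_s x, \<iota> *\<^sub>R dsp_b x)", OF Ms.bI_form_lin2]; (rule linearI)?;
        simp add: X_D Y facet_bmeas_scale cell_bmeas_scale zero_mem prod_eq_iff mem_Times_iff algebra_simps)
qed

lemma storage_form_lin2: "x \<in> X \<Longrightarrow> lin_on X (storage_form x)"
  unfolding storage_form_def[abs_def]
proof (intro lin_on_add lin_on_sub)
  assume x: "x \<in> X"
  note D = X_D[OF x]
  show "lin_on X (\<lambda>y. mesh_inner Tb (c0 *\<^sub>R \<iota> *\<^sub>R por x) (por y))"
    by (rule lin_on_compI[where h = "\<lambda>y. por y", OF Mb.mesh_inner_lin2]; (rule linearI)?;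
        simp add: X_D D facet_bmeas_scale cell_bmeas_scale zero_mem prod_eq_iff mem_Times_iff algebra_simps)
  show "lin_on X (\<lambda>y. c_form lam \<alpha> Tb (\<iota> *\<^sub>R por x, \<iota> *\<^sub>R prs x) (\<alpha> *\<^sub>R por y))"
    by (rule lin_on_compI[where h = "\<lambda>y. \<alpha> *\<^sub>R por y", OF Mb.c_form_lin2]; (rule linearI)?;
        simp add: X_D D facet_bmeas_scale cell_bmeas_scale zero_mem prod_eq_iff mem_Times_iff algebra_simps)
  show "lin_on X (\<lambda>y. b_form Tb (por y, por_b y) (vel x, 0))"
    by (rule lin_on_compI[where h = "\<lambda>y. (por y, por_b y)", OF Mb.b_form_lin1]; (rule linearI)?;
        simp add: X_D D facet_bmeas_scale cell_bmeas_scale zero_mem prod_eq_iff mem_Times_iff algebra_simps)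
  show "lin_on X (\<lambda>y. bI_form Ts \<Gamma>I (por_b y) (dsp_s x, \<iota> *\<^sub>R dsp_b x))"
    by (rule lin_on_compI[where h = "\<lambda>y. por_b y", OF Ms.bI_form_lin1]; (rule linearI)?;
        simp add: X_D D facet_bmeas_scale cell_bmeas_scale zero_mem prod_eq_iff mem_Times_iff algebra_simps)
qed

lemma darcy_form_lin1: "y \<in> X \<Longrightarrow> lin_on X (\<lambda>x. darcy_form x y)"
  unfolding darcy_form_def
proof (intro lin_on_add)
  assume y: "y \<in> X"
  note Y = X_D[OF y]
  show "lin_on X (\<lambda>x. mesh_inner Tb (inverse \<kappa> *\<^sub>R vel x) (vel y))"
    by (rule lin_on_compI[where h = "\<lambda>x. inverse \<kappa> *\<^sub>R vel x", OF Mb.mesh_inner_lin1]; (rule linearI)?;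
        simp add: X_D Y facet_bmeas_scale cell_bmeas_scale zero_mem prod_eq_iff mem_Times_iff algebra_simps)
  show "lin_on X (\<lambda>x. b_form Tb (por x, por_b x) (vel y, 0))"
    by (rule lin_on_compI[where h = "\<lambda>x. (por x, por_b x)", OF Mb.b_form_lin1]; (rule linearI)?;
        simp add: X_D Y facet_bmeas_scale cell_bmeas_scale zero_mem prod_eq_iff mem_Times_iff algebra_simps)
qed

lemma darcy_form_lin2: "x \<in> X \<Longrightarrow> lin_on X (darcy_form x)"
  unfolding darcy_form_def[abs_def]
proof (intro lin_on_add)
  assume x: "x \<in> X"
  note D = X_D[OF x]
  show "lin_on X (\<lambda>y. mesh_inner Tb (inverse \<kappa> *\<^sub>R vel x) (vel y))"
    by (rule lin_on_compI[where h = "\<lambda>y. vel y", OF Mb.mesh_inner_lin2]; (rule linearI)?;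
        simp add: X_D D facet_bmeas_scale cell_bmeas_scale zero_mem prod_eq_iff mem_Times_iff algebra_simps)
  show "lin_on X (\<lambda>y. b_form Tb (por x, por_b x) (vel y, 0))"
    by (rule lin_on_compI[where h = "\<lambda>y. (vel y, 0)", OF Mb.b_form_lin2]; (rule linearI)?;
        simp add: X_D D facet_bmeas_scale cell_bmeas_scale zero_mem prod_eq_iff mem_Times_iff algebra_simps)
qed

end

text \<open>Splits a field on the union into its parts on the subdomains while keeping the
  representative that is zero off the relative interiors.\<close>

definition restr :: "'a::euclidean_space set set \<Rightarrow> ('a \<Rightarrow> 'b::zero) \<Rightarrow> 'a \<Rightarrow> 'b" where
  "restr D v = (\<lambda>x. if x \<in> \<Union>(rel_interior ` D) then v x else 0)"

lemma restr_piecewise: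
  assumes "v \<in> piecewise P \<C>" "D \<subseteq> \<C>" "D \<subseteq> \<C>'" "ri_disjoint \<C>'" "0 \<in> P"
  shows "restr D v \<in> piecewise P \<C>'"
  unfolding restr_def using assms by (intro piecewise_glue) (auto simp: piecewise_def)

lemma piecewise_extend:
  assumes "v \<in> piecewise P D" "D \<subseteq> \<C>" "ri_disjoint \<C>" "0 \<in> P"
  shows "v \<in> piecewise P \<C>"
proof -
  have "restr D v = v"
    using assms(1) by (auto simp: restr_def piecewise_def fun_eq_iff)
  then show ?thesis
    using restr_piecewise[OF assms(1) subset_refl assms(2-4)] by simp
qed

section \<open>Decoupling the equations and the energy identity\<close>

context hdg_step
begin

lemma parts_X:
  assumes "y \<in> X"
  shows "(fst y, 0) \<in> X" "(0, fst (snd y), 0) \<in> X" "(0, 0, 0, snd (snd (snd y))) \<in> X" "(0, 0, vel y, 0) \<in> X"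
  using assms subspace_0[OF Ms.subspace_spaces(3)] subspace_0[OF Mb.subspace_spaces(3)]
    subspace_0[OF Ms.subspace_spaces(4)] subspace_0[OF Mb.subspace_spaces(4)]
    subspace_0[OF M.subspace_spaces(1)] subspace_0[OF M.subspace_spaces(2)]
    subspace_0[OF Mb.subspace_spaces(1)] subspace_0[OF Mb.subspace_spaces(2)]
  by (simp_all add: mem_X)

lemma zero_tests:
  assumes "x \<in> X"
  shows "momentum_form x (0, a) = 0" "constraint_form x (b, 0, c) = 0" "storage_form x (d, e, f, 0) = 0" "darcy_form x (g, h, 0, j) = 0"
proof -
  have z: "momentum_form x 0 = 0" "constraint_form x 0 = 0" "storage_form x 0 = 0" "darcy_form x 0 = 0"
    using lin_on_zero[OF momentum_form_lin2[OF assms] subspace_0[OF subspace_X]]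
      lin_on_zero[OF constraint_form_lin2[OF assms] subspace_0[OF subspace_X]]
      lin_on_zero[OF storage_form_lin2[OF assms] subspace_0[OF subspace_X]]
      lin_on_zero[OF darcy_form_lin2[OF assms] subspace_0[OF subspace_X]] .
  show "momentum_form x (0, a) = 0" "constraint_form x (b, 0, c) = 0" "storage_form x (d, e, f, 0) = 0" "darcy_form x (g, h, 0, j) = 0"
    using z by (simp_all add: momentum_form_def constraint_form_def storage_form_def darcy_form_def)
qed

text \<open>The four equations are tested by different blocks of \<open>y\<close>, and each form
  vanishes on tests whose own block is zero. Hence one bilinear form, the sum of the four, can
  represent the whole system.\<close>

lemma split_system:
  assumes x: "x \<in> X"
    and L1: "\<And>y. L1 (fst y, 0) = L1 y" "\<And>z. L1 (0, z) = 0"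
    and L3: "\<And>y. L3 (0, 0, 0, snd (snd (snd y))) = L3 y" "\<And>a b c. L3 (a, b, c, 0) = 0"
    and eq: "\<And>y. y \<in> X \<Longrightarrow> momentum_form x y + constraint_form x y + storage_form x y + darcy_form x y = L1 y + L3 y"
    and y: "y \<in> X"
  shows "momentum_form x y = L1 y" "constraint_form x y = 0" "storage_form x y = L3 y" "darcy_form x y = 0"
proof -
  note z = zero_tests[OF x]
  have L1z: "L1 0 = 0" and L3z: "L3 0 = 0"
    using L1(2)[of 0] L3(2)[of 0 0 0] by (simp_all add: zero_prod_def)
  have "L3 (fst y, 0) = 0" "L3 (0, fst (snd y), 0) = 0" "L3 (0, 0, vel y, 0) = 0"
    using L3(2)[of "fst y" 0 0] L3(2)[of 0 "fst (snd y)" 0] L3(2)[of 0 0 "vel y"] by (simp_all add: zero_prod_def)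
  moreover have "momentum_form x (fst y, 0) = momentum_form x y" "constraint_form x (fst y, 0) = 0" "storage_form x (fst y, 0) = 0" "darcy_form x (fst y, 0) = 0"
    using z(2)[of "fst y" 0] z(3)[of "fst y" 0 0] z(4)[of "fst y" 0 0] by (simp_all add: momentum_form_def zero_prod_def)
  moreover have "constraint_form x (0, fst (snd y), 0) = constraint_form x y" "storage_form x (0, fst (snd y), 0) = 0" "darcy_form x (0, fst (snd y), 0) = 0"
    using z(3)[of 0 "fst (snd y)" 0] z(4)[of 0 "fst (snd y)" 0] by (simp_all add: constraint_form_def zero_prod_def)
  moreover have "storage_form x (0, 0, 0, snd (snd (snd y))) = storage_form x y" "constraint_form x (0, 0, 0, snd (snd (snd y))) = 0"
    "darcy_form x (0, 0, 0, snd (snd (snd y))) = 0"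
    using z(2)[of 0 "(0, snd (snd (snd y)))"] z(4)[of 0 0 "snd (snd (snd y))"] by (simp_all add: storage_form_def)
  moreover have "darcy_form x (0, 0, vel y, 0) = darcy_form x y" "constraint_form x (0, 0, vel y, 0) = 0" "storage_form x (0, 0, vel y, 0) = 0"
    using z(2)[of 0 "(vel y, 0)"] z(3)[of 0 0 "vel y"] by (simp_all add: darcy_form_def)
  ultimately show "momentum_form x y = L1 y" "constraint_form x y = 0" "storage_form x y = L3 y" "darcy_form x y = 0"
    using eq[OF parts_X(1)[OF y]] eq[OF parts_X(2)[OF y]] eq[OF parts_X(3)[OF y]] eq[OF parts_X(4)[OF y]]
      z(1) L1 L3(1) by simp_all
qed

lemma interior_s: "K \<in> Ts \<Longrightarrow> interior K \<subseteq> \<Omega>s"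
  using interior_mono[of K "closure \<Omega>s"] Union_upper[of K Ts] \<Omega>s(3,4) by simp

lemma interior_b: "K \<in> Tb \<Longrightarrow> interior K \<subseteq> \<Omega>b"
  using interior_mono[of K "closure \<Omega>b"] Union_upper[of K Tb] \<Omega>b(3,4) by simp

lemma on_s: "K \<in> Ts \<Longrightarrow> t \<in> interior K \<Longrightarrow> t \<in> \<Union>(rel_interior ` Ts) \<and> t \<notin> \<Union>(rel_interior ` Tb)"
  using Ms.elem(5) Mb.elem(5) interior_s interior_b disjoint by blast

lemma on_b: "K \<in> Tb \<Longrightarrow> t \<in> interior K \<Longrightarrow> t \<in> \<Union>(rel_interior ` Tb) \<and> t \<notin> \<Union>(rel_interior ` Ts)"
  using Ms.elem(5) Mb.elem(5) interior_s interior_b disjoint by blast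

lemma restr_on:
  "K \<in> Ts \<Longrightarrow> t \<in> interior K \<Longrightarrow> restr Ts v t = v t" "K \<in> Ts \<Longrightarrow> t \<in> interior K \<Longrightarrow> restr Tb v t = 0"
  "K \<in> Tb \<Longrightarrow> t \<in> interior K \<Longrightarrow> restr Tb v t = v t" "K \<in> Tb \<Longrightarrow> t \<in> interior K \<Longrightarrow> restr Ts v t = 0"
  using on_s[of K t] on_b[of K t] by (simp_all add: restr_def)

text \<open>Energy argument: since the interface terms couple \<open>dsp_s\<close> with \<open>dsp_b / \<tau>\<close>, the displacement
  and total pressure tests on the poroelastic side are scaled by \<open>1 / \<tau>\<close>.\<close>

lemma energy:
  assumes x: "x \<in> X"
    and momentum_form: "\<And>y. y \<in> X \<Longrightarrow> momentum_form x y = 0" and constraint_form: "\<And>y. y \<in> X \<Longrightarrow> constraint_form x y = 0"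
    and storage_form: "\<And>y. y \<in> X \<Longrightarrow> storage_form x y = 0" and darcy_form: "\<And>y. y \<in> X \<Longrightarrow> darcy_form x y = 0"
  shows "dsp x = 0" "dsp_s x = 0" "dsp_b x = 0" "vel x = 0"
    and "\<And>K t. K \<in> Tb \<Longrightarrow> t \<in> interior K \<Longrightarrow> prs x t = \<alpha> * por x t"
proof -
  note xm = x[unfolded mem_X] and D = X_D[OF x]
  have \<iota>: "\<iota> > 0"
    using constants by simp
  have vp0: "0 \<in> vec_polys k" and p0: "0 \<in> polys (k - 1)"
    using subspace_0[OF subspace_vec_polys] subspace_0[OF subspace_polys] by blast+
  have u_pw: "dsp x \<in> piecewise (vec_polys k) (Ts \<union> Tb)" and p_pw: "prs x \<in> piecewise (polys (k - 1)) (Ts \<union> Tb)"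
    using xm by (simp_all add: V_space_def Q_space_def)
  define us ub where "us = restr Ts (dsp x)" and "ub = restr Tb (dsp x)"
  have us: "us \<in> V_space k Ts" "us \<in> V_space k (Ts \<union> Tb)" and ub: "ub \<in> V_space k Tb" "ub \<in> V_space k (Ts \<union> Tb)"
    unfolding us_def ub_def V_space_def
    by (rule restr_piecewise[OF u_pw _ _ _ vp0]; auto intro: Ms.ri_disjoint_T Mb.ri_disjoint_T M.ri_disjoint_T)+
  \<comment> \<open>The test equals \<open>dsp x\<close> on the structure side and
    \<open>\<iota>\<close> times \<open>dsp x\<close> on the poroelastic side; the jump in scale is
    admissible since the space imposes no continuity across elements.\<close>
  define v where "v = us + \<iota> *\<^sub>R ub"
  have v: "v \<in> V_space k (Ts \<union> Tb)"
    unfolding v_def using us ub M.subspace_spaces(1) by (intro subspace_add subspace_scale)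
  define q where "q = restr Ts (prs x) + \<iota> *\<^sub>R restr Tb (prs x)"
  have q: "q \<in> Q_space k (Ts \<union> Tb)"
  proof -
    have "restr Ts (prs x) \<in> Q_space k (Ts \<union> Tb)" "restr Tb (prs x) \<in> Q_space k (Ts \<union> Tb)"
      unfolding Q_space_def
      by (rule restr_piecewise[OF p_pw _ _ _ p0]; auto intro: M.ri_disjoint_T)+
    then show ?thesis
      unfolding q_def using M.subspace_spaces(2) by (intro subspace_add subspace_scale)
  qed
  define y1 :: "'d state" where "y1 = ((v, dsp_s x, \<iota> *\<^sub>R dsp_b x), 0)"
  define y2 :: "'d state" where "y2 = (0, (q, prs_s x, \<iota> *\<^sub>R prs_b x), 0)"
  have y1: "y1 \<in> X" and y2: "y2 \<in> X"
  proof -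
    have "((v, dsp_s x, \<iota> *\<^sub>R dsp_b x), snd x) \<in> X" "(fst x, (q, prs_s x, \<iota> *\<^sub>R prs_b x), snd (snd x)) \<in> X"
      using xm v q subspace_scale[OF Mb.subspace_spaces(3)] subspace_scale[OF Mb.subspace_spaces(4)]
      by (simp_all add: mem_X)
    from parts_X(1)[OF this(1)] parts_X(2)[OF this(2)] show "y1 \<in> X" "y2 \<in> X"
      by (simp_all add: y1_def y2_def)
  qed
  have v_s: "v t = dsp x t" "q t = prs x t" if "K \<in> Ts" "t \<in> interior K" for K t
    by (simp_all add: v_def q_def us_def ub_def restr_on(1,2)[OF that])
  have v_b: "v t = (\<iota> *\<^sub>R dsp x) t" "q t = (\<iota> *\<^sub>R prs x) t" if "K \<in> Tb" "t \<in> interior K" for K t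
    by (simp_all add: v_def q_def us_def ub_def restr_on(3,4)[OF that])
  have cell_smooth_s: "us \<in> cell_smooth Ts" and cell_smooth_b: "ub \<in> cell_smooth Tb" "\<iota> *\<^sub>R dsp x \<in> cell_smooth Tb"
    using Ms.V_space_cell_smooth[OF us(1)] Mb.V_space_cell_smooth[OF ub(1)] subspace_scale[OF subspace_cell_smooth D(2)] by auto
  have us_eq: "us t = dsp x t" if "K \<in> Ts" "t \<in> interior K" for K t
    by (simp add: us_def restr_on(1)[OF that])
  have ub_eq: "ub t = dsp x t" if "K \<in> Tb" "t \<in> interior K" for K t
    by (simp add: ub_def restr_on(3)[OF that])
  define Es where "Es = a_form \<mu>s \<beta>s Ts (us, dsp_s x) (us, dsp_s x)"
  define Eb where "Eb = a_form \<mu>b \<beta>b Tb (ub, dsp_b x) (ub, dsp_b x)"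
  define EI where "EI = aI_form \<gamma> \<mu>s \<kappa> Ts \<Gamma>I (dsp_s x, \<iota> *\<^sub>R dsp_b x) (dsp_s x, \<iota> *\<^sub>R dsp_b x)"
  have a_s: "a_form \<mu>s \<beta>s Ts (dsp x, dsp_s x) (v, dsp_s x) = Es"
  proof -
    have "a_form \<mu>s \<beta>s Ts (dsp x, dsp_s x) (v, dsp_s x) = a_form \<mu>s \<beta>s Ts (dsp x, dsp_s x) (us, dsp_s x)"
      using v_s us_eq by (intro Ms.a_form_cong cell_smooth_s) simp
    also have "\<dots> = a_form \<mu>s \<beta>s Ts (us, dsp_s x) (dsp x, dsp_s x)"
      by (rule a_form_sym)
    also have "\<dots> = Es"
      unfolding Es_def using us_eq by (intro Ms.a_form_cong cell_smooth_s) simp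
    finally show ?thesis .
  qed
  have a_b: "a_form \<mu>b \<beta>b Tb (dsp x, dsp_b x) (v, \<iota> *\<^sub>R dsp_b x) = \<iota> * Eb"
  proof -
    have "a_form \<mu>b \<beta>b Tb (dsp x, dsp_b x) (v, \<iota> *\<^sub>R dsp_b x) = a_form \<mu>b \<beta>b Tb (dsp x, dsp_b x) (\<iota> *\<^sub>R dsp x, \<iota> *\<^sub>R dsp_b x)"
      using v_b by (intro Mb.a_form_cong cell_smooth_b) simp
    also have "\<dots> = a_form \<mu>b \<beta>b Tb (dsp x, dsp_b x) (\<iota> *\<^sub>R (dsp x, dsp_b x))"
      by simp
    also have "\<dots> = \<iota> * a_form \<mu>b \<beta>b Tb (dsp x, dsp_b x) (dsp x, dsp_b x)"
      using lin_on_scaleR[OF Mb.a_form_lin2, of "(dsp x, dsp_b x)" "(dsp x, dsp_b x)" \<mu>b \<beta>b \<iota>] D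
      by (simp add: zero_mem zero_prod_def)
    also have "a_form \<mu>b \<beta>b Tb (dsp x, dsp_b x) (dsp x, dsp_b x) = a_form \<mu>b \<beta>b Tb (dsp x, dsp_b x) (ub, dsp_b x)"
      using ub_eq by (intro Mb.a_form_cong cell_smooth_b(1)) simp
    also have "\<dots> = a_form \<mu>b \<beta>b Tb (ub, dsp_b x) (dsp x, dsp_b x)"
      by (rule a_form_sym)
    also have "\<dots> = Eb"
      unfolding Eb_def using ub_eq by (intro Mb.a_form_cong cell_smooth_b(1)) simp
    finally show ?thesis .
  qed
  define Bs where "Bs = b_form Ts (prs x, prs_s x) (dsp x, dsp_s x)"
  define Bb where "Bb = b_form Tb (prs x, prs_b x) (dsp x, dsp_b x)"
  have b1: "b_form Ts (prs x, prs_s x) (v, dsp_s x) = Bs" "b_form Ts (q, prs_s x) (dsp x, dsp_s x) = Bs"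
    unfolding Bs_def using v_s by (intro Ms.b_form_cong D; simp)+
  have b2: "b_form Tb (prs x, prs_b x) (v, \<iota> *\<^sub>R dsp_b x) = \<iota> * Bb"
  proof -
    have "b_form Tb (prs x, prs_b x) (v, \<iota> *\<^sub>R dsp_b x) = b_form Tb (prs x, prs_b x) (\<iota> *\<^sub>R (dsp x, dsp_b x))"
      using v_b cell_smooth_b(2) by (simp, intro Mb.b_form_cong) simp_all
    also have "\<dots> = \<iota> * Bb"
      unfolding Bb_def
      using lin_on_scaleR[OF Mb.b_form_lin2, of "(prs x, prs_b x)" "(dsp x, dsp_b x)" \<iota>] D
      by (simp add: zero_mem zero_prod_def)
    finally show ?thesis .
  qed
  have b3: "b_form Tb (q, \<iota> *\<^sub>R prs_b x) (dsp x, dsp_b x) = \<iota> * Bb"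
  proof -
    have "b_form Tb (q, \<iota> *\<^sub>R prs_b x) (dsp x, dsp_b x) = b_form Tb (\<iota> *\<^sub>R (prs x, prs_b x)) (dsp x, dsp_b x)"
      using v_b D(2) by (simp, intro Mb.b_form_cong) simp_all
    also have "\<dots> = \<iota> * Bb"
      unfolding Bb_def
      using lin_on_scaleR[OF Mb.b_form_lin1, of "(dsp x, dsp_b x)" "(prs x, prs_b x)" \<iota>] D
      by (simp add: zero_mem zero_prod_def)
    finally show ?thesis .
  qed
  have "y1 \<in> X \<Longrightarrow> momentum_form x y1 = Es + \<iota> * Eb + EI + (Bs + \<iota> * Bb) + bI_form Ts \<Gamma>I (por_b x) (dsp_s x, \<iota> *\<^sub>R dsp_b x)"
    by (simp add: momentum_form_def y1_def a_s a_b EI_def b1 b2)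
  then have e1: "Es + \<iota> * Eb + EI + (Bs + \<iota> * Bb) + bI_form Ts \<Gamma>I (por_b x) (dsp_s x, \<iota> *\<^sub>R dsp_b x) = 0"
    using momentum_form y1 by simp
  \<comment> \<open>In both pressure equations \<open>c_form\<close> is a pairing with
    \<open>g\<close>; subtracting the tests \<open>\<alpha> *\<^sub>R por x\<close> and
    \<open>prs x\<close> turns it into a multiple of the square of \<open>g\<close>.\<close>
  define g where "g = \<alpha> *\<^sub>R por x - prs x"
  have g: "g \<in> cell_bmeas Tb"
    unfolding g_def using D by (intro subspace_diff subspace_cell_bmeas cell_bmeas_scale)
  have c_eq: "c_form lam \<alpha> Tb (por x, prs x) r = mesh_inner Tb (inverse lam *\<^sub>R g) r" for r
    by (auto simp: c_form_def g_def intro!: arg_cong2[of _ _ _ _ "mesh_inner Tb"])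
  have c1: "c_form lam \<alpha> Tb (por x, prs x) q = \<iota> * mesh_inner Tb (inverse lam *\<^sub>R g) (prs x)"
  proof -
    have "c_form lam \<alpha> Tb (por x, prs x) q = mesh_inner Tb (inverse lam *\<^sub>R g) (\<iota> *\<^sub>R prs x)"
      unfolding c_eq using v_b by (intro Mb.mesh_inner_cong) auto
    also have "\<dots> = \<iota> * mesh_inner Tb (inverse lam *\<^sub>R g) (prs x)"
      using lin_on_scaleR[OF Mb.mesh_inner_lin2[OF cell_bmeas_scale[OF g, of "inverse lam"]] zero_mem(2), of "prs x" \<iota>] D by simp
    finally show ?thesis .
  qed
  have "constraint_form x y2 = (Bs + \<iota> * Bb) + \<iota> * mesh_inner Tb (inverse lam *\<^sub>R g) (prs x)"
    by (simp add: constraint_form_def y2_def b1 b3 c1)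
  then have e2: "Bs + \<iota> * Bb + \<iota> * mesh_inner Tb (inverse lam *\<^sub>R g) (prs x) = 0"
    using constraint_form y2 by simp
  define G where "G = mesh_inner Tb g g"
  define Pp where "Pp = mesh_inner Tb (por x) (por x)"
  define V where "V = mesh_inner Tb (vel x) (vel x)"
  have c2: "c_form lam \<alpha> Tb (\<iota> *\<^sub>R por x, \<iota> *\<^sub>R prs x) (\<alpha> *\<^sub>R por x) = \<iota> * mesh_inner Tb (inverse lam *\<^sub>R g) (\<alpha> *\<^sub>R por x)"
    using lin_on_scaleR[OF Mb.c_form_lin1[OF cell_bmeas_scale[of "por x" Tb \<alpha>]], of "(por x, prs x)" lam \<alpha> \<iota>] D c_eq[of "\<alpha> *\<^sub>R por x"]
    by (simp add: zero_mem zero_prod_def)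
  have diff: "mesh_inner Tb (inverse lam *\<^sub>R g) (\<alpha> *\<^sub>R por x) - mesh_inner Tb (inverse lam *\<^sub>R g) (prs x) = inverse lam * G"
  proof -
    have "mesh_inner Tb (inverse lam *\<^sub>R g) (\<alpha> *\<^sub>R por x) - mesh_inner Tb (inverse lam *\<^sub>R g) (prs x) = mesh_inner Tb (inverse lam *\<^sub>R g) g"
      using lin_on_diff[OF Mb.mesh_inner_lin2[OF cell_bmeas_scale[OF g, of "inverse lam"]] cell_bmeas_scale[OF D(10), of \<alpha>] D(5)]
      by (simp add: g_def)
    also have "\<dots> = inverse lam * G"
      unfolding G_def using lin_on_scaleR[OF Mb.mesh_inner_lin1[OF g] zero_mem(2) g, of "inverse lam"] by simp
    finally show ?thesis .
  qed
  have p_eq: "mesh_inner Tb ((c0 * \<iota>) *\<^sub>R por x) (por x) = c0 * \<iota> * Pp"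
    unfolding Pp_def using lin_on_scaleR[OF Mb.mesh_inner_lin1[OF D(10)] zero_mem(2) D(10), of "c0 * \<iota>"] by simp
  have v_eq: "mesh_inner Tb (inverse \<kappa> *\<^sub>R vel x) (vel x) = inverse \<kappa> * V"
    unfolding V_def using lin_on_scaleR[OF Mb.mesh_inner_lin1[OF D(9)] zero_mem(2) D(9), of "inverse \<kappa>"] by simp
  have e3: "c0 * \<iota> * Pp + \<iota> * mesh_inner Tb (inverse lam *\<^sub>R g) (\<alpha> *\<^sub>R por x)
      - b_form Tb (por x, por_b x) (vel x, 0) - bI_form Ts \<Gamma>I (por_b x) (dsp_s x, \<iota> *\<^sub>R dsp_b x) = 0"
    using storage_form[OF x] by (simp add: storage_form_def p_eq c2)
  have e4: "inverse \<kappa> * V + b_form Tb (por x, por_b x) (vel x, 0) = 0"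
    using darcy_form[OF x] by (simp add: darcy_form_def v_eq)
  have "\<iota> * (mesh_inner Tb (inverse lam *\<^sub>R g) (\<alpha> *\<^sub>R por x) - mesh_inner Tb (inverse lam *\<^sub>R g) (prs x)) = \<iota> * (inverse lam * G)"
    unfolding diff ..
  \<comment> \<open>The combination \<open>e1 - e2 + e3 + e4\<close>: the pairings \<open>Bs\<close>
    and \<open>Bb\<close>, the interface pairing with \<open>por_b x\<close> and the pairing with
    the velocity all cancel.\<close>
  then have total: "Es + \<iota> * Eb + EI + \<iota> * (inverse lam * G) + c0 * \<iota> * Pp + inverse \<kappa> * V = 0"
    using e1 e2 e3 e4 unfolding right_diff_distrib by linarith
  have nn: "Es \<ge> 0" "Eb \<ge> 0" "EI \<ge> 0" "G \<ge> 0" "Pp \<ge> 0" "V \<ge> 0"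
    unfolding Es_def Eb_def EI_def G_def Pp_def V_def
    using xm us ub coercive constants Ms.a_form_nonneg Mb.a_form_nonneg Ms.aI_form_nonneg Mb.mesh_inner_nonneg
    by blast+
  then have "\<iota> * Eb \<ge> 0" "\<iota> * (inverse lam * G) \<ge> 0" "c0 * \<iota> * Pp \<ge> 0" "inverse \<kappa> * V \<ge> 0"
    using \<iota> constants by simp_all
  then have "Es = 0" "\<iota> * Eb = 0" "\<iota> * (inverse lam * G) = 0" "inverse \<kappa> * V = 0"
    using total nn by linarith+
  then have zero: "Es = 0" "Eb = 0" "G = 0" "V = 0"
    using \<iota> constants by simp_all
  have disp_s: "us = 0 \<and> dsp_s x = 0"
    using xm us(1) zero(1) constants coercive area \<Omega>s unfolding Es_def
    by (intro conjI Ms.displacement_zero[OF \<Omega>s us(1), of "dsp_s x" \<Gamma>Ds] Ms.a_form_zero[of C k \<mu>s \<beta>s \<Gamma>Ds us "dsp_s x"]) auto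
  have disp_b: "ub = 0 \<and> dsp_b x = 0"
    using xm ub(1) zero(2) constants coercive area \<Omega>b unfolding Eb_def
    by (intro conjI Mb.displacement_zero[OF \<Omega>b ub(1), of "dsp_b x" \<Gamma>Db] Mb.a_form_zero[of C k \<mu>b \<beta>b \<Gamma>Db ub "dsp_b x"]) auto
  show "dsp_s x = 0" "dsp_b x = 0"
    using disp_s disp_b by blast+
  show "dsp x = 0"
  proof (rule M.piecewise_zero[OF u_pw])
    fix K t assume K: "K \<in> Ts \<union> Tb" "t \<in> interior K"
    then show "dsp x t = 0"
      using us_eq[of K t] ub_eq[of K t] disp_s disp_b by (metis UnE zero_fun_apply)
  qed
  have vel_pw: "vel x \<in> V_space k Tb"
    using xm by simp
  show "vel x = 0"
  proof (rule Mb.piecewise_zero)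
    show "vel x \<in> piecewise (vec_polys k) Tb"
      using vel_pw by (simp add: V_space_def)
    show "vel x t = 0" if "K \<in> Tb" "t \<in> interior K" for K t
      using zero(4) Mb.V_space_continuous[OF vel_pw] that unfolding V_def
      by (intro Mb.mesh_inner_zero[OF D(9)]) auto
  qed
  show "prs x t = \<alpha> * por x t" if K: "K \<in> Tb" "t \<in> interior K" for K t
  proof -
    have "continuous_on (interior K) g" if "K \<in> Tb" for K
    proof -
      have "continuous_on (interior K) (prs x)" "continuous_on (interior K) (por x)"
        using M.Q_space_continuous[of "prs x" k "Ts \<union> Tb" K] Mb.Q_space_continuous[of "por x" k Tb K] xm that by auto
      then show ?thesis
        unfolding g_def fun_diff_def scaleR_fun_def by (intro continuous_intros)
    qed
    then have "g t = 0"
      using zero(3) K unfolding G_def by (intro Mb.mesh_inner_zero[OF g]) auto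
    then show ?thesis
      by (simp add: g_def)
  qed
qed

end

section \<open>Uniqueness for the coupled system and solution of one step\<close>

context hdg_step
begin

lemma test_X:
  "w \<in> V_space k Tb \<Longrightarrow> (0, 0, w, 0) \<in> X"
  "v \<in> V_space k (Ts \<union> Tb) \<Longrightarrow> vs \<in> Vbar_space k Ts \<Gamma>Ds \<Longrightarrow> vb \<in> Vbar_space k Tb \<Gamma>Db \<Longrightarrow> ((v, vs, vb), 0) \<in> X"
  using subspace_0[OF Ms.subspace_spaces(3)] subspace_0[OF Mb.subspace_spaces(3)]
    subspace_0[OF Ms.subspace_spaces(4)] subspace_0[OF Mb.subspace_spaces(4)]
    subspace_0[OF M.subspace_spaces(1)] subspace_0[OF M.subspace_spaces(2)]
    subspace_0[OF Mb.subspace_spaces(1)] subspace_0[OF Mb.subspace_spaces(2)]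
  by (simp_all add: mem_X)

lemma ex_facet_point:
  assumes "aff_dim (A \<inter> rel_interior F) = int CARD('d) - 1"
  obtains x where "x \<in> A" "x \<in> rel_interior F"
proof -
  have "A \<inter> rel_interior F \<noteq> {}"
    using assms by (auto simp del: Int_iff)
  then show ?thesis
    using that by blast
qed

lemma momentum_form_pressure:
  assumes x: "x \<in> X" "dsp x = 0" "dsp_s x = 0" "dsp_b x = 0" "por_b x = 0" and y: "y \<in> X"
  shows "momentum_form x y = b_form Ts (prs x, prs_s x) (dsp y, dsp_s y) + b_form Tb (prs x, prs_b x) (dsp y, dsp_b y)"
proof -
  note Y = X_D[OF y]
  have "a_form \<mu>s \<beta>s Ts 0 (dsp y, dsp_s y) = 0"
    by (rule lin_on_zero[OF Ms.a_form_lin]) (use Y in \<open>simp_all add: zero_prod_def zero_mem\<close>)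
  moreover have "a_form \<mu>b \<beta>b Tb 0 (dsp y, dsp_b y) = 0"
    by (rule lin_on_zero[OF Mb.a_form_lin]) (use Y in \<open>simp_all add: zero_prod_def zero_mem\<close>)
  moreover have "aI_form \<gamma> \<mu>s \<kappa> Ts \<Gamma>I 0 (dsp_s y, dsp_b y) = 0"
    by (rule lin_on_zero[OF Ms.aI_form_lin]) (use Y in \<open>simp_all add: zero_prod_def zero_mem\<close>)
  moreover have "bI_form Ts \<Gamma>I 0 (dsp_s y, dsp_b y) = 0"
    by (rule lin_on_zero[OF Ms.bI_form_lin1]) (use Y in \<open>simp_all add: zero_mem\<close>)
  ultimately show ?thesis
    unfolding momentum_form_def by (simp add: x zero_prod_def)
qed

lemma homogeneous_zero:
  assumes x: "x \<in> X"
    and momentum_form: "\<And>y. y \<in> X \<Longrightarrow> momentum_form x y = 0" and constraint_form: "\<And>y. y \<in> X \<Longrightarrow> constraint_form x y = 0"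
    and storage_form: "\<And>y. y \<in> X \<Longrightarrow> storage_form x y = 0" and darcy_form: "\<And>y. y \<in> X \<Longrightarrow> darcy_form x y = 0"
  shows "x = 0"
proof -
  note xm = x[unfolded mem_X] and D = X_D[OF x]
  have E: "dsp x = 0" "dsp_s x = 0" "dsp_b x = 0" "vel x = 0"
    by (rule energy[OF x momentum_form constraint_form storage_form darcy_form]; assumption)+
  have E5: "prs x t = \<alpha> * por x t" if "K \<in> Tb" "t \<in> interior K" for K t
    by (rule energy(5)[OF x momentum_form constraint_form storage_form darcy_form that])
  have vp0: "0 \<in> vec_polys k"
    by (rule subspace_0[OF subspace_vec_polys])
  have mi0: "mesh_inner Tb (0 :: real^'d \<Rightarrow> real^'d) w = 0" for w
    by (simp add: mesh_inner_def L2_inner_def)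
  \<comment> \<open>Without velocity, Darcy's equation says that the pore pressure pairs to zero
    with every discrete field on the poroelastic mesh.\<close>
  have b4: "b_form Tb (por x, por_b x) (w, 0) = 0" if "w \<in> V_space k Tb" for w
    using darcy_form[OF test_X(1)[OF that]] E(4) mi0 by (simp add: darcy_form_def)
  have por_mem: "por x \<in> Q_space k Tb" "por_b x \<in> Qbar_space k Tb \<Gamma>P" "prs x \<in> Q_space k (Ts \<union> Tb)"
    "prs_s x \<in> Qbar_space k Ts {}" "prs_b x \<in> Qbar_space k Tb {}"
    using xm by blast+
  have const_p: "\<exists>r. (\<forall>x'\<in>interior K. por x x' = r) \<and> (\<forall>F. F facet_of K \<longrightarrow> (\<forall>x'\<in>rel_interior F. por_b x x' = r))"
    if "K \<in> Tb" for K
    by (rule Mb.pressure_elementwise_constant[OF k por_mem(1) subset_refl por_mem(2) b4 that])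
  obtain Fb where Fb: "Fb \<in> facets Tb" "aff_dim (\<Gamma>P \<inter> rel_interior Fb) = int CARD('d) - 1"
    by (rule Mb.positive_area_facet[OF area(1)])
  obtain xb where xb: "xb \<in> \<Gamma>P" "xb \<in> rel_interior Fb"
    by (rule ex_facet_point[OF Fb(2)])
  have por_b_xb: "por_b x xb = 0"
    using por_mem(2) xb(1) by (simp add: Qbar_space_def)
  have por_b0: "por_b x = 0"
    by (rule Mb.pressure_zero(1)[OF \<Omega>b const_p Fb(1) xb(2) por_b_xb por_mem(2)])
  have por0: "por x = 0"
  proof (rule Mb.piecewise_zero)
    show "por x \<in> piecewise (polys (k - 1)) Tb"
      using por_mem(1) by (simp add: Q_space_def)
    show "por x t = 0" if "K \<in> Tb" "t \<in> interior K" for K t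
      by (rule Mb.pressure_zero(2)[OF \<Omega>b const_p Fb(1) xb(2) por_b_xb por_mem(2) that])
  qed
  have prs0b: "prs x t = 0" if "K \<in> Tb" "t \<in> interior K" for K t
    using E5[OF that] por0 by simp
  have momentum_form': "b_form Ts (prs x, prs_s x) (v, vs) + b_form Tb (prs x, prs_b x) (v, vb) = 0"
    if "v \<in> V_space k (Ts \<union> Tb)" "vs \<in> Vbar_space k Ts \<Gamma>Ds" "vb \<in> Vbar_space k Tb \<Gamma>Db" for v vs vb
    using momentum_form_pressure[OF x E(1-3) por_b0 test_X(2)[OF that]] momentum_form[OF test_X(2)[OF that]] by simp
  have zs: "0 \<in> Vbar_space k Ts \<Gamma>Ds" "0 \<in> Vbar_space k Tb \<Gamma>Db" "0 \<in> V_space k (Ts \<union> Tb)"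
    using subspace_0 Ms.subspace_spaces(3) Mb.subspace_spaces(3) M.subspace_spaces(1) by blast+
  have bs0: "b_form Ts (prs x, prs_s x) 0 = 0" and bb0: "b_form Tb (prs x, prs_b x) 0 = 0"
    using lin_on_zero[OF Ms.b_form_lin2, of "(prs x, prs_s x)"] lin_on_zero[OF Mb.b_form_lin2, of "(prs x, prs_b x)"] D
    by (simp_all add: zero_prod_def zero_mem)
  \<comment> \<open>With zero facet unknowns, a field on the poroelastic mesh extended by zero is
    invisible to the structure side, so the momentum equation decouples.\<close>
  have bb: "b_form Tb (prs x, prs_b x) (v, 0) = 0" if v: "v \<in> V_space k Tb" for v
  proof -
    have v': "v \<in> V_space k (Ts \<union> Tb)"
      using v unfolding V_space_def by (rule piecewise_extend[OF _ _ M.ri_disjoint_T vp0]) simp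
    have "v t = 0" if "K \<in> Ts" "t \<in> interior K" for K t
      using v on_s[OF that] by (simp add: V_space_def piecewise_def)
    then have "b_form Ts (prs x, prs_s x) (v, 0) = b_form Ts (prs x, prs_s x) (0, 0)"
      by (intro Ms.b_form_cong zero_mem) auto
    then show ?thesis
      using momentum_form'[OF v' zs(1,2)] bs0 by (simp add: zero_prod_def)
  qed
  have const_b: "\<exists>r. (\<forall>x'\<in>interior K. prs x x' = r) \<and> (\<forall>F. F facet_of K \<longrightarrow> (\<forall>x'\<in>rel_interior F. prs_b x x' = r))"
    if "K \<in> Tb" for K
    by (rule Mb.pressure_elementwise_constant[OF k por_mem(3) Un_upper2 por_mem(5) bb that])
  \<comment> \<open>No boundary condition is imposed on \<open>prs_b x\<close>. Its constant on the
    element of \<open>Fb\<close> equals that of \<open>prs x\<close> inside, which is zero through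
    the relation to the pore pressure.\<close>
  have prs_b_xb: "prs_b x xb = 0"
  proof -
    obtain K where K: "K \<in> Tb" "Fb facet_of K"
      using Fb(1) unfolding facets_def by blast
    obtain t where t: "t \<in> interior K"
      using Mb.elem(4)[OF K(1)] by blast
    obtain r where r: "\<forall>x'\<in>interior K. prs x x' = r" "\<forall>F. F facet_of K \<longrightarrow> (\<forall>x'\<in>rel_interior F. prs_b x x' = r)"
      using const_b[OF K(1)] by blast
    then have "r = 0"
      using prs0b[OF K(1) t] t by simp
    then show ?thesis
      using r(2) K(2) xb(2) by blast
  qed
  have prs_b0: "prs_b x = 0"
    by (rule Mb.pressure_zero(1)[OF \<Omega>b const_b Fb(1) xb(2) prs_b_xb por_mem(5)])
  \<comment> \<open>The poroelastic pressure and its trace are gone, so the momentum equation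
    becomes one on the structure mesh alone, for all admissible facet tests.\<close>
  have bs: "b_form Ts (prs x, prs_s x) (v, vs) = 0"
    if v: "v \<in> V_space k (Ts \<union> Tb)" "vs \<in> Vbar_space k Ts \<Gamma>Ds" for v vs
  proof -
    have vE: "v \<in> cell_smooth Tb"
      by (rule Mb.V_space_cell_smooth[OF v(1)]) simp
    have "b_form Tb (prs x, prs_b x) (v, 0) = b_form Tb (0, prs_b x) (v, 0)"
      using prs0b by (intro Mb.b_form_cong vE) auto
    also have "\<dots> = b_form Tb 0 (v, 0)"
      by (simp add: prs_b0 zero_prod_def)
    also have "\<dots> = 0"
      using vE by (intro lin_on_zero[OF Mb.b_form_lin1]) (simp_all add: zero_prod_def zero_mem)
    finally show ?thesis
      using momentum_form'[OF v zs(2)] by simp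
  qed
  have bs1: "b_form Ts (prs x, prs_s x) (v, 0) = 0" if v: "v \<in> V_space k Ts" for v
  proof (rule bs[OF _ zs(1)])
    show "v \<in> V_space k (Ts \<union> Tb)"
      using v unfolding V_space_def by (rule piecewise_extend[OF _ _ M.ri_disjoint_T vp0]) simp
  qed
  have const_s: "\<exists>r. (\<forall>x'\<in>interior K. prs x x' = r) \<and> (\<forall>F. F facet_of K \<longrightarrow> (\<forall>x'\<in>rel_interior F. prs_s x x' = r))"
    if "K \<in> Ts" for K
    by (rule Ms.pressure_elementwise_constant[OF k por_mem(3) Un_upper1 por_mem(4) bs1 that])
  obtain Fs where Fs: "Fs \<in> facets Ts" "aff_dim (\<Gamma>Ns \<inter> rel_interior Fs) = int CARD('d) - 1"
    by (rule Ms.positive_area_facet[OF area(4)])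
  obtain xs where xs: "xs \<in> \<Gamma>Ns" "xs \<in> rel_interior Fs"
    by (rule ex_facet_point[OF Fs(2)])
  have fr: "xs \<in> frontier \<Omega>" "xs \<in> frontier \<Omega>s"
    using partition xs(1) unfolding boundary_partition_def by blast+
  \<comment> \<open>Used on both meshes: on the structure mesh, \<open>Fs\<close> belongs to a
    single element and lies in the frontier of \<open>\<Omega>s\<close>; on the union, it also lies
    in the frontier of \<Omega>. Only then does compatibility with the partition apply to
    \<open>Fs\<close>.\<close>
  note bf = Ms.boundary_facet[OF \<Omega>s(1,3,4) Fs(1) xs(2) fr(2)]
  have "Fs \<in> facets (Ts \<union> Tb)"
    using Fs(1) by (auto simp: facets_def)
  note bf' = M.boundary_facet(1)[OF \<Omega> this xs(2) fr(1)]
  have "Fs \<in> facets_in Ts (frontier \<Omega> \<inter> frontier \<Omega>s)"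
    using Fs(1) bf(1) bf' by (simp add: facets_in_def)
  then have "rel_interior Fs \<subseteq> \<Gamma>Ds \<or> rel_interior Fs \<subseteq> \<Gamma>Ns" "\<Gamma>Ds \<inter> \<Gamma>Ns = {}"
    using partition unfolding boundary_partition_def by blast+
  \<comment> \<open>A facet whose relative interior meets the Neumann part lies in it up to its
    relative boundary, so tests on \<open>Fs\<close> need not vanish.\<close>
  then have "rel_interior Fs \<inter> \<Gamma>Ds = {}"
    using xs by blast
  then have nz: "prs_s x xs = 0"
    by (rule Ms.neumann_facet_pressure_zero[OF Fs(1) bf(2) _ const_s por_mem(4) bs[OF zs(3)] xs(2)])
  have prs_s0: "prs_s x = 0"
    by (rule Ms.pressure_zero(1)[OF \<Omega>s const_s Fs(1) xs(2) nz por_mem(4)])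
  have prs0s: "prs x t = 0" if "K \<in> Ts" "t \<in> interior K" for K t
    by (rule Ms.pressure_zero(2)[OF \<Omega>s const_s Fs(1) xs(2) nz por_mem(4) that])
  have prs0: "prs x = 0"
  proof (rule M.piecewise_zero)
    show "prs x \<in> piecewise (polys (k - 1)) (Ts \<union> Tb)"
      using por_mem(3) by (simp add: Q_space_def)
    show "prs x t = 0" if "K \<in> Ts \<union> Tb" "t \<in> interior K" for K t
      using that prs0s[of K t] prs0b[of K t] by blast
  qed
  show ?thesis
    using E(1-4) por0 por_b0 prs_b0 prs_s0 prs0 by (simp add: prod_eq_iff)
qed

text \<open>By linearity the old time level moves to the right-hand side; the summed equations then
  form one square system on \<open>X\<close>, whose homogeneous version has only the zero
  solution.\<close>

lemma step_unique_solution: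
  assumes dom: "bounded \<Omega>" "bounded \<Omega>b" and f: "f square_integrable_on \<Omega>" and g: "g square_integrable_on \<Omega>b"
    and level_n: "((un, usn, ubn), (pn, psn, pbn), zn, (ppn, ppbn)) \<in> X"
  shows "\<exists>!sol. sol \<in> X \<and>
    (case sol of ((u, us, ub), (p, ps, pb), z, (pp, ppb)) \<Rightarrow>
      \<forall>v vs vb q qs qb w qp qpb.
        ((v, vs, vb), (q, qs, qb), w, (qp, qpb)) \<in> X \<longrightarrow>
        a_form \<mu>s \<beta>s Ts (u, us) (v, vs) + a_form \<mu>b \<beta>b Tb (u, ub) (v, vb)
          + aI_form \<gamma> \<mu>s \<kappa> Ts \<Gamma>I (us, diff_quotient \<tau> ub ubn) (vs, vb)
          + (b_form Ts (p, ps) (v, vs) + b_form Tb (p, pb) (v, vb))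
          + bI_form Ts \<Gamma>I ppb (vs, vb)
          = L2_inner \<Omega> f v \<and>
        (b_form Ts (q, qs) (u, us) + b_form Tb (q, qb) (u, ub))
          + c_form lam \<alpha> Tb (pp, p) q = 0 \<and>
        mesh_inner Tb (\<lambda>x. c0 * diff_quotient \<tau> pp ppn x) qp
          + c_form lam \<alpha> Tb (diff_quotient \<tau> pp ppn, diff_quotient \<tau> p pn) (\<lambda>x. \<alpha> * qp x)
          - b_form Tb (qp, qpb) (z, \<lambda>x. 0)
          - bI_form Ts \<Gamma>I qpb (us, diff_quotient \<tau> ub ubn)
          = L2_inner \<Omega>b g qp \<and>
        mesh_inner Tb (\<lambda>x. inverse \<kappa> *\<^sub>R z x) w + b_form Tb (pp, ppb) (w, \<lambda>x. 0) = 0)"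
proof -
  define xn :: "'d state" where "xn = ((un, usn, ubn), (pn, psn, pbn), zn, (ppn, ppbn))"
  have xn: "xn \<in> X"
    using level_n by (simp add: xn_def)
  note N = X_D[OF xn]
  have lin_f: "lin_on X (\<lambda>y. L2_inner \<Omega> f (dsp y))"
    by (rule lin_on_compI[where h = "\<lambda>y. dsp y", OF L2_inner_lin_on[OF \<Omega>(1) dom(1) f]]; (rule linearI)?;
        simp add: X_D)
  have lin_g: "lin_on X (\<lambda>y. L2_inner \<Omega>b g (por y))"
    by (rule lin_on_compI[where h = "\<lambda>y. por y", OF L2_inner_lin_on[OF \<Omega>b(1) dom(2) g]]; (rule linearI)?;
        simp add: X_D)
  define xI :: "'d state" where "xI = ((0, 0, dsp_b xn), 0)"
  have xI: "xI \<in> X"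
    unfolding xI_def using xn subspace_0[OF M.subspace_spaces(1)] subspace_0[OF Ms.subspace_spaces(3)]
    by (intro test_X) (simp_all add: mem_X)
  \<comment> \<open>The part of the old state that occurs in the difference quotients of the storage
    equation. Its \<open>dsp_s\<close> and \<open>vel\<close> are zero, so that
    \<open>storage_form (x - xP)\<close> keeps the structure trace and the velocity at the new
    level.\<close>
  define xP :: "'d state" where "xP = ((0, 0, dsp_b xn), (prs xn, 0, 0), 0, (por xn, 0))"
  have xP: "xP \<in> X"
    using xn subspace_0[OF M.subspace_spaces(1)] subspace_0[OF Ms.subspace_spaces(3)]
      subspace_0[OF Ms.subspace_spaces(4)] subspace_0[OF Mb.subspace_spaces(4)] subspace_0[OF Mb.subspace_spaces(1)]
    by (simp add: mem_X xP_def)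
  \<comment> \<open>In the momentum equation the old level occurs only in the interface
    term.\<close>
  define J1 where "J1 y = aI_form \<gamma> \<mu>s \<kappa> Ts \<Gamma>I (0, \<iota> *\<^sub>R dsp_b xn) (dsp_s y, dsp_b y)" for y :: "'d state"
  have J1: "lin_on X J1"
    unfolding J1_def[abs_def]
    by (rule lin_on_compI[where h = "\<lambda>y. (dsp_s y, dsp_b y)", OF Ms.aI_form_lin2]; (rule linearI)?;
        simp add: X_D N facet_bmeas_scale zero_mem prod_eq_iff mem_Times_iff)
  define L1 where "L1 y = L2_inner \<Omega> f (dsp y) + J1 y" for y
  define L3 where "L3 y = L2_inner \<Omega>b g (por y) + storage_form xP y" for y
  have L1: "lin_on X L1" and L3: "lin_on X L3"
    unfolding L1_def[abs_def] L3_def[abs_def] by (intro lin_on_add lin_f lin_g J1 storage_form_lin2 xP)+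
  have z: "L1 0 = 0" "L3 0 = 0"
    by (rule lin_on_zero[OF L1 subspace_0[OF subspace_X]] lin_on_zero[OF L3 subspace_0[OF subspace_X]])+
  have split: "L1 (fst y, 0) = L1 y" "L1 (0, c) = 0" "L3 (0, 0, 0, snd (snd (snd y))) = L3 y" "L3 (a, b, d, 0) = 0"
    for y c a b d
    using z by (simp_all add: L1_def L3_def J1_def storage_form_def)
  define \<Phi> where "\<Phi> x y = momentum_form x y + constraint_form x y + storage_form x y + darcy_form x y" for x y
  have ex1: "\<exists>!x. x \<in> X \<and> (\<forall>y\<in>X. \<Phi> x y = L1 y + L3 y)"
  proof (rule bilinear_unique_solution[OF subspace_X fin_dim_X])
    show "lin_on X (\<lambda>x. \<Phi> x y)" if "y \<in> X" for y
      unfolding \<Phi>_def using that by (intro lin_on_add momentum_form_lin1 constraint_form_lin1 storage_form_lin1 darcy_form_lin1)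
    show "lin_on X (\<Phi> x)" if "x \<in> X" for x
      unfolding \<Phi>_def[abs_def] using that by (intro lin_on_add momentum_form_lin2 constraint_form_lin2 storage_form_lin2 darcy_form_lin2)
    show "x = 0" if "x \<in> X" "\<And>y. y \<in> X \<Longrightarrow> \<Phi> x y = 0" for x
    proof (rule homogeneous_zero[OF that(1)])
      fix y assume y: "y \<in> X"
      have eq: "momentum_form x y + constraint_form x y + storage_form x y + darcy_form x y = (\<lambda>_. 0) y + (\<lambda>_. 0) y" if "y \<in> X" for y
        using \<open>\<And>y. y \<in> X \<Longrightarrow> \<Phi> x y = 0\<close>[OF that] by (simp add: \<Phi>_def)
      show "momentum_form x y = 0" "constraint_form x y = 0" "storage_form x y = 0" "darcy_form x y = 0"
        using split_system[OF that(1) _ _ _ _ eq y] by simp_all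
    qed
    show "lin_on X (\<lambda>y. L1 y + L3 y)"
      by (intro lin_on_add L1 L3)
  qed
  have sys: "(\<forall>y\<in>X. \<Phi> x y = L1 y + L3 y) \<longleftrightarrow> (\<forall>y\<in>X. momentum_form x y = L1 y \<and> constraint_form x y = 0 \<and> storage_form x y = L3 y \<and> darcy_form x y = 0)"
    if x: "x \<in> X" for x
  proof
    assume "\<forall>y\<in>X. \<Phi> x y = L1 y + L3 y"
    then have eq: "momentum_form x y + constraint_form x y + storage_form x y + darcy_form x y = L1 y + L3 y" if "y \<in> X" for y
      using that by (simp add: \<Phi>_def)
    show "\<forall>y\<in>X. momentum_form x y = L1 y \<and> constraint_form x y = 0 \<and> storage_form x y = L3 y \<and> darcy_form x y = 0"
      using split_system[OF x split eq] by blast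
  qed (simp add: \<Phi>_def)
  have 1: "a_form \<mu>s \<beta>s Ts (dsp x, dsp_s x) (dsp y, dsp_s y) + a_form \<mu>b \<beta>b Tb (dsp x, dsp_b x) (dsp y, dsp_b y)
          + aI_form \<gamma> \<mu>s \<kappa> Ts \<Gamma>I (dsp_s x, diff_quotient \<tau> (dsp_b x) ubn) (dsp_s y, dsp_b y)
          + (b_form Ts (prs x, prs_s x) (dsp y, dsp_s y) + b_form Tb (prs x, prs_b x) (dsp y, dsp_b y))
          + bI_form Ts \<Gamma>I (por_b x) (dsp_s y, dsp_b y) = L2_inner \<Omega> f (dsp y) \<longleftrightarrow> momentum_form x y = L1 y"
    if x: "x \<in> X" and y: "y \<in> X" for x y
  proof -
    have "aI_form \<gamma> \<mu>s \<kappa> Ts \<Gamma>I ((dsp_s x, \<iota> *\<^sub>R dsp_b x) - (0, \<iota> *\<^sub>R dsp_b xn)) (dsp_s y, dsp_b y)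
        = aI_form \<gamma> \<mu>s \<kappa> Ts \<Gamma>I (dsp_s x, \<iota> *\<^sub>R dsp_b x) (dsp_s y, dsp_b y) - J1 y"
      unfolding J1_def using X_D[OF x] X_D[OF y] N
      by (intro lin_on_diff[OF Ms.aI_form_lin]) (simp_all add: facet_bmeas_scale zero_mem)
    moreover have "(dsp_s x, diff_quotient \<tau> (dsp_b x) ubn) = (dsp_s x, \<iota> *\<^sub>R dsp_b x) - (0, \<iota> *\<^sub>R dsp_b xn)"
      by (simp add: diff_quotient_eq xn_def)
    ultimately show ?thesis
      unfolding momentum_form_def L1_def by (simp only:) linarith
  qed
  have 3: "mesh_inner Tb (\<lambda>t. c0 * diff_quotient \<tau> (por x) ppn t) (por y)
          + c_form lam \<alpha> Tb (diff_quotient \<tau> (por x) ppn, diff_quotient \<tau> (prs x) pn) (\<lambda>t. \<alpha> * por y t)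
          - b_form Tb (por y, por_b y) (vel x, \<lambda>t. 0)
          - bI_form Ts \<Gamma>I (por_b y) (dsp_s x, diff_quotient \<tau> (dsp_b x) ubn) = L2_inner \<Omega>b g (por y)
      \<longleftrightarrow> storage_form x y = L3 y"
    if x: "x \<in> X" and y: "y \<in> X" for x y
  proof -
    have "storage_form (x - xP) y = storage_form x y - storage_form xP y"
      by (rule lin_on_diff[OF storage_form_lin1[OF y] x xP])
    moreover have "(\<lambda>t. c0 * diff_quotient \<tau> (por x) ppn t) = c0 *\<^sub>R \<iota> *\<^sub>R por (x - xP)"
      "diff_quotient \<tau> (por x) ppn = \<iota> *\<^sub>R por (x - xP)" "diff_quotient \<tau> (prs x) pn = \<iota> *\<^sub>R prs (x - xP)"
      "diff_quotient \<tau> (dsp_b x) ubn = \<iota> *\<^sub>R dsp_b (x - xP)" "dsp_s x = dsp_s (x - xP)" "vel x = vel (x - xP)"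
      "(\<lambda>t. \<alpha> * por y t) = \<alpha> *\<^sub>R por y" "(\<lambda>t. 0) = (0 :: real^'d \<Rightarrow> real^'d)"
      by (auto simp: fun_eq_iff diff_quotient_eq xP_def xn_def scaleR_diff_right right_diff_distrib)
    ultimately show ?thesis
      unfolding L3_def storage_form_def[of "x - xP"] by (simp only:) linarith
  qed
  have 4: "mesh_inner Tb (\<lambda>t. inverse \<kappa> *\<^sub>R vel x t) (vel y) + b_form Tb (por x, por_b x) (vel y, \<lambda>t. 0) = darcy_form x y" for x y
    by (simp add: darcy_form_def zero_fun_def scaleR_fun_def)
  define Eq where "Eq x y \<longleftrightarrow> (a_form \<mu>s \<beta>s Ts (dsp x, dsp_s x) (dsp y, dsp_s y) + a_form \<mu>b \<beta>b Tb (dsp x, dsp_b x) (dsp y, dsp_b y)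
          + aI_form \<gamma> \<mu>s \<kappa> Ts \<Gamma>I (dsp_s x, diff_quotient \<tau> (dsp_b x) ubn) (dsp_s y, dsp_b y)
          + (b_form Ts (prs x, prs_s x) (dsp y, dsp_s y) + b_form Tb (prs x, prs_b x) (dsp y, dsp_b y))
          + bI_form Ts \<Gamma>I (por_b x) (dsp_s y, dsp_b y) = L2_inner \<Omega> f (dsp y) \<and>
        (b_form Ts (prs y, prs_s y) (dsp x, dsp_s x) + b_form Tb (prs y, prs_b y) (dsp x, dsp_b x))
          + c_form lam \<alpha> Tb (por x, prs x) (prs y) = 0 \<and>
        mesh_inner Tb (\<lambda>t. c0 * diff_quotient \<tau> (por x) ppn t) (por y)
          + c_form lam \<alpha> Tb (diff_quotient \<tau> (por x) ppn, diff_quotient \<tau> (prs x) pn) (\<lambda>t. \<alpha> * por y t)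
          - b_form Tb (por y, por_b y) (vel x, \<lambda>t. 0)
          - bI_form Ts \<Gamma>I (por_b y) (dsp_s x, diff_quotient \<tau> (dsp_b x) ubn) = L2_inner \<Omega>b g (por y) \<and>
        mesh_inner Tb (\<lambda>t. inverse \<kappa> *\<^sub>R vel x t) (vel y) + b_form Tb (por x, por_b x) (vel y, \<lambda>t. 0) = 0)" for x y
  have Eq: "Eq x y \<longleftrightarrow> momentum_form x y = L1 y \<and> constraint_form x y = 0 \<and> storage_form x y = L3 y \<and> darcy_form x y = 0" if "x \<in> X" "y \<in> X" for x y
    unfolding Eq_def 1[OF that] 3[OF that] 4 constraint_form_def ..
  have "\<exists>!x. x \<in> X \<and> (\<forall>y\<in>X. Eq x y)"
  proof -
    have iff: "(\<forall>y\<in>X. Eq x y) \<longleftrightarrow> (\<forall>y\<in>X. \<Phi> x y = L1 y + L3 y)" if "x \<in> X" for x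
      unfolding sys[OF that] using Eq[OF that] by blast
    have "(\<lambda>x. x \<in> X \<and> (\<forall>y\<in>X. Eq x y)) = (\<lambda>x. x \<in> X \<and> (\<forall>y\<in>X. \<Phi> x y = L1 y + L3 y))"
      by (rule ext, rule conj_cong[OF refl], rule iff)
    then show ?thesis
      using ex1 by simp
  qed
  then show ?thesis
    unfolding Eq_def case_prod_beta Ball_def split_paired_All fst_conv snd_conv .
qed

end

theorem lemma3:
  fixes \<Omega> \<Omega>s \<Omega>b \<Gamma>I \<Gamma>s \<Gamma>b \<Gamma>Ds \<Gamma>Ns \<Gamma>Db \<Gamma>Nb \<Gamma>P \<Gamma>F :: "(real^'d) set"
    and \<T>s \<T>b :: "(real^'d) set set"
    and k N n :: nat
    and \<sigma> C \<mu>s \<mu>b lam \<kappa> \<gamma> \<alpha> c0 \<beta>s \<beta>b \<tau> T :: real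
    and f :: "real \<Rightarrow> real^'d \<Rightarrow> real^'d"
    and g :: "real \<Rightarrow> real^'d \<Rightarrow> real"
    and un usn ubn zn :: "real^'d \<Rightarrow> real^'d"
    and pn psn pbn ppn ppbn :: "real^'d \<Rightarrow> real"
  assumes dim: "CARD('d) = 2 \<or> CARD('d) = 3"
    and domains: "polytopal_domain \<Omega>" "polytopal_domain \<Omega>s" "polytopal_domain \<Omega>b"
    and subdomains: "\<Omega>s \<union> \<Omega>b \<subseteq> \<Omega>" "\<Omega>s \<inter> \<Omega>b = {}" "closure \<Omega> = closure \<Omega>s \<union> closure \<Omega>b"
    and boundaries: "\<Gamma>I = frontier \<Omega>s \<inter> frontier \<Omega>b"
      "\<Gamma>s = frontier \<Omega> \<inter> frontier \<Omega>s" "\<Gamma>b = frontier \<Omega> \<inter> frontier \<Omega>b"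
    and meshes: "simplicial_mesh \<Omega>s \<T>s" "simplicial_mesh \<Omega>b \<T>b" "triangulation (\<T>s \<union> \<T>b)"
    and shape_regular: "shape_regular \<sigma> (\<T>s \<union> \<T>b)"
    and partitions: "boundary_partition \<T>b \<Gamma>b \<Gamma>P \<Gamma>F" "boundary_partition \<T>b \<Gamma>b \<Gamma>Db \<Gamma>Nb"
      "boundary_partition \<T>s \<Gamma>s \<Gamma>Ds \<Gamma>Ns"
    and positive_area: "surface_area \<T>b \<Gamma>P > 0" "surface_area \<T>b \<Gamma>Db > 0" "surface_area \<T>b \<Gamma>Nb > 0"
      "surface_area \<T>s \<Gamma>Ds > 0" "surface_area \<T>s \<Gamma>Ns > 0"
    and degree: "k \<ge> 1"
    and constants: "\<mu>s > 0" "\<mu>b > 0" "lam > 0" "\<kappa> > 0" "\<gamma> > 0" "0 < \<alpha>" "\<alpha> < 1" "c0 \<ge> 0"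
    and penalties: "\<beta>s > 0" "\<beta>b > 0"
    and coercivity: "C > 0" "a_coercive C k \<mu>s \<beta>s \<T>s \<Gamma>Ds" "a_coercive C k \<mu>b \<beta>b \<T>b \<Gamma>Db"
    and time_steps: "\<tau> > 0" "real N * \<tau> = T" "n < N"
    and sources: "\<And>t. t \<in> {0..T} \<Longrightarrow> f t square_integrable_on \<Omega>"
      "\<And>t. t \<in> {0..T} \<Longrightarrow> g t square_integrable_on \<Omega>b"
    and level_n: "((un, usn, ubn), (pn, psn, pbn), zn, (ppn, ppbn)) \<in> X_space k \<T>s \<T>b \<Gamma>Ds \<Gamma>Db \<Gamma>P"
  shows "\<exists>!sol. sol \<in> X_space k \<T>s \<T>b \<Gamma>Ds \<Gamma>Db \<Gamma>P \<and>
    (case sol of ((u, us, ub), (p, ps, pb), z, (pp, ppb)) \<Rightarrow>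
      \<forall>v vs vb q qs qb w qp qpb.
        ((v, vs, vb), (q, qs, qb), w, (qp, qpb)) \<in> X_space k \<T>s \<T>b \<Gamma>Ds \<Gamma>Db \<Gamma>P \<longrightarrow>
        a_form \<mu>s \<beta>s \<T>s (u, us) (v, vs) + a_form \<mu>b \<beta>b \<T>b (u, ub) (v, vb)
          + aI_form \<gamma> \<mu>s \<kappa> \<T>s \<Gamma>I (us, diff_quotient \<tau> ub ubn) (vs, vb)
          + (b_form \<T>s (p, ps) (v, vs) + b_form \<T>b (p, pb) (v, vb))
          + bI_form \<T>s \<Gamma>I ppb (vs, vb)
          = L2_inner \<Omega> (f (real (n + 1) * \<tau>)) v \<and>
        (b_form \<T>s (q, qs) (u, us) + b_form \<T>b (q, qb) (u, ub))
          + c_form lam \<alpha> \<T>b (pp, p) q = 0 \<and>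
        mesh_inner \<T>b (\<lambda>x. c0 * diff_quotient \<tau> pp ppn x) qp
          + c_form lam \<alpha> \<T>b (diff_quotient \<tau> pp ppn, diff_quotient \<tau> p pn) (\<lambda>x. \<alpha> * qp x)
          - b_form \<T>b (qp, qpb) (z, \<lambda>x. 0)
          - bI_form \<T>s \<Gamma>I qpb (us, diff_quotient \<tau> ub ubn)
          = L2_inner \<Omega>b (g (real (n + 1) * \<tau>)) qp \<and>
        mesh_inner \<T>b (\<lambda>x. inverse \<kappa> *\<^sub>R z x) w + b_form \<T>b (pp, ppb) (w, \<lambda>x. 0) = 0)"
proof -
  have mesh_s: "\<And>K. K \<in> \<T>s \<Longrightarrow> int DIM(real^'d) simplex K" and mesh_b: "\<And>K. K \<in> \<T>b \<Longrightarrow> int DIM(real^'d) simplex K"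
    using meshes(1,2) by (simp_all add: simplicial_mesh_def)
  interpret hdg_step \<T>s \<T>b \<Omega> \<Omega>s \<Omega>b \<Gamma>I \<Gamma>Ds \<Gamma>Ns \<Gamma>Db \<Gamma>P k C \<mu>s \<mu>b lam \<kappa> \<gamma> \<alpha> c0 \<beta>s \<beta>b \<tau>
  proof unfold_locales
    show "\<Union>(\<T>s \<union> \<T>b) = closure \<Omega>"
      using meshes(1,2) subdomains(3) by (auto simp: simplicial_mesh_def)
    show "boundary_partition \<T>s (frontier \<Omega> \<inter> frontier \<Omega>s) \<Gamma>Ds \<Gamma>Ns"
      using partitions(3) boundaries(2) by simp
  qed (use meshes mesh_s mesh_b domains subdomains degree constants coercivity time_steps positive_area
      in \<open>auto simp: simplicial_mesh_def polytopal_domain_def\<close>)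
  \<comment> \<open>From \<open>n < N\<close> the new time level is still at most \<open>T\<close>,
    where the sources are known to be square integrable.\<close>
  have "real (n + 1) * \<tau> \<le> real N * \<tau>"
    using time_steps by (intro mult_right_mono) auto
  then have t: "real (n + 1) * \<tau> \<in> {0..T}"
    using time_steps by auto
  show ?thesis
    by (rule step_unique_solution[OF polytopal_domain_bounded[OF domains(1)] polytopal_domain_bounded[OF domains(3)]
        sources(1)[OF t] sources(2)[OF t] level_n])
qed

end
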